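(* Let $(R,\mathbb{L})$ be a Geigle-Lenzing complete intersection of dimension $d+1$ with weights $p_1,\dots,p_n$ over a field $k$, and let $A^{\rm CM}$ be its CM-canonical algebra. Assume $p_i\ge 2$ for all $i$. (a) $A^{\rm CM}=0$ if and only if $n\le d+1$. (b) If $n\ge d+2$, then the global dimension of $A^{\rm CM}$ equals $2(n-d-2)+\#\{i\mid p_i\ge 3\}$.
   Context: Geigle-Lenzing (GL) complete intersection: let $k$ be an arbitrary field, $d\ge -1$ and $n\ge 0$ integers, $C=k[T_0,\dots,T_d]$ ($C=k$ if $d=-1$), $\ell_1,\dots,\ell_n\in C$ linear forms ($\ell_i=0$ if $d=-1$) such that any set of at most $d+1$ of the $\ell_i$ is linearly independent, and $p_1,\dots,p_n$ positive integers (weights). Put $$R=k[T_0,\dots,T_d,X_1,\dots,X_n]/(X_i^{p_i}-\ell_i\mid 1\le i\le n),\qquad \mathbb{L}=\langle \vec x_1,\dots,\vec x_n,\vec c\rangle/\langle p_i\vec x_i-\vec c\mid 1\le i\le n\rangle,$$ with $R$ $\mathbb{L}$-graded by $\deg T_j=\vec c$, $\deg X_i=\vec x_i$. $(R,\mathbb{L})$ is the GL complete intersection of dimension $d+1$ with weights $p_1,\dots,p_n$. Let $\vec\omega=(n-d-1)\vec c-\sum_{i=1}^n\vec x_i$ and $\vec\delta=d\vec c+2\vec\omega$. Let $\mathbb{L}_+$ be the submonoid of $\mathbb{L}$ generated by $\vec x_1,\dots,\vec x_n,\vec c$; $\vec x\ge\vec y$ means $\vec x-\vec y\in\mathbb{L}_+$;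 $[\vec x,\vec y]=\{\vec z\mid \vec x\le\vec z\le\vec y\}$. CM-canonical algebra: $A^{\rm CM}=(R_{\vec x-\vec y})_{\vec x,\vec y\in[0,\vec\delta]}$, the finite dimensional matrix algebra with multiplication $(r_{\vec x,\vec y})\cdot(r'_{\vec x,\vec y})=(\sum_{\vec z\in[0,\vec\delta]}r_{\vec x,\vec z}r'_{\vec z,\vec y})$. *)

theory Defs
  imports
    "HOL-Algebra.Free_Abelian_Groups"
    "HOL-Algebra.QuotRing"
    "HOL-Algebra.Module"
    "HOL-Library.Extended_Nat"
    "HOL-Library.Poly_Mapping"
begin

section \<open>Homological algebra over a ring that need not be commutative\<close>

text \<open>
  The library's \<^locale>\<open>module\<close> presupposes a commutative ring. The following is the same
  list of axioms over an arbitrary ring (the multiplicative part of the record of \<open>M\<close> is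
  irrelevant here, as it is in the library).
\<close>

locale left_module = R?: ring R + M?: abelian_group M
  for R (structure) and M :: "('a, 'm, 'd) module_scheme" (structure) +
  assumes smult_closed:
      "\<lbrakk>a \<in> carrier R; x \<in> carrier M\<rbrakk> \<Longrightarrow> a \<odot>\<^bsub>M\<^esub> x \<in> carrier M"
    and smult_l_distr:
      "\<lbrakk>a \<in> carrier R; b \<in> carrier R; x \<in> carrier M\<rbrakk> \<Longrightarrow>
        (a \<oplus>\<^bsub>R\<^esub> b) \<odot>\<^bsub>M\<^esub> x = (a \<odot>\<^bsub>M\<^esub> x) \<oplus>\<^bsub>M\<^esub> (b \<odot>\<^bsub>M\<^esub> x)"
    and smult_r_distr:
      "\<lbrakk>a \<in> carrier R; x \<in> carrier M; y \<in> carrier M\<rbrakk> \<Longrightarrow>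
        a \<odot>\<^bsub>M\<^esub> (x \<oplus>\<^bsub>M\<^esub> y) = (a \<odot>\<^bsub>M\<^esub> x) \<oplus>\<^bsub>M\<^esub> (a \<odot>\<^bsub>M\<^esub> y)"
    and smult_assoc:
      "\<lbrakk>a \<in> carrier R; b \<in> carrier R; x \<in> carrier M\<rbrakk> \<Longrightarrow>
        (a \<otimes>\<^bsub>R\<^esub> b) \<odot>\<^bsub>M\<^esub> x = a \<odot>\<^bsub>M\<^esub> (b \<odot>\<^bsub>M\<^esub> x)"
    and smult_one:
      "x \<in> carrier M \<Longrightarrow> \<one>\<^bsub>R\<^esub> \<odot>\<^bsub>M\<^esub> x = x"

definition left_module_hom ::
  "('a, 'r) ring_scheme \<Rightarrow> ('a, 'm) module \<Rightarrow> ('a, 'm) module \<Rightarrow> ('m \<Rightarrow> 'm) set" where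
  "left_module_hom R M N =
    {f \<in> carrier M \<rightarrow> carrier N.
      (\<forall>x\<in>carrier M. \<forall>y\<in>carrier M. f (x \<oplus>\<^bsub>M\<^esub> y) = f x \<oplus>\<^bsub>N\<^esub> f y) \<and>
      (\<forall>a\<in>carrier R. \<forall>x\<in>carrier M. f (a \<odot>\<^bsub>M\<^esub> x) = a \<odot>\<^bsub>N\<^esub> f x)}"

definition projective_module :: "('a, 'r) ring_scheme \<Rightarrow> ('a, 'm) module \<Rightarrow> bool" where
  "projective_module R P \<longleftrightarrow>
    left_module R P \<and>
    (\<forall>(M :: ('a, 'm) module) (N :: ('a, 'm) module) g f.
      left_module R M \<longrightarrow> left_module R N \<longrightarrow>
      g \<in> left_module_hom R M N \<longrightarrow> g ` carrier M = carrier N \<longrightarrow>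
      f \<in> left_module_hom R P N \<longrightarrow>
      (\<exists>h \<in> left_module_hom R P M. \<forall>x\<in>carrier P. g (h x) = f x))"

text \<open>
  A projective resolution
  \<open>0 \<rightarrow> P\<^sub>m \<rightarrow> \<dots> \<rightarrow> P\<^sub>0 \<rightarrow> M \<rightarrow> 0\<close>, encoded
  as one sequence with \<open>Q 0 = M\<close>, \<open>Q (i + 1) = P\<^sub>i\<close> and
  \<open>D i : Q (i + 1) \<rightarrow> Q i\<close>; entries of \<open>Q\<close> beyond \<open>m + 1\<close>
  and of \<open>D\<close> beyond \<open>m\<close> are ignored.
\<close>

definition projective_resolution ::
  "('a, 'r) ring_scheme \<Rightarrow> ('a, 'm) module \<Rightarrow> nat \<Rightarrow>
    (nat \<Rightarrow> ('a, 'm) module) \<Rightarrow> (nat \<Rightarrow> 'm \<Rightarrow> 'm) \<Rightarrow> bool" where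
  "projective_resolution R M m Q D \<longleftrightarrow>
    Q 0 = M \<and>
    (\<forall>i\<le>m. projective_module R (Q (Suc i))) \<and>
    (\<forall>i\<le>m. D i \<in> left_module_hom R (Q (Suc i)) (Q i)) \<and>
    D 0 ` carrier (Q 1) = carrier M \<and>
    (\<forall>i<m. D (Suc i) ` carrier (Q (Suc (Suc i))) =
            {u \<in> carrier (Q (Suc i)). D i u = \<zero>\<^bsub>Q i\<^esub>}) \<and>
    inj_on (D m) (carrier (Q (Suc m)))"

text \<open>The infimum of the empty set is \<open>\<infinity>\<close>; the zero module gets dimension 0.\<close>

definition projective_dimension :: "('a, 'r) ring_scheme \<Rightarrow> ('a, 'm) module \<Rightarrow> enat" where
  "projective_dimension R M = (INF m \<in> {m. \<exists>Q D. projective_resolution R M m Q D}. enat m)"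

text \<open>
  A definition in HOL cannot quantify over all types, so the modules (together with the test
  modules in the definition of projectivity and the terms of the resolutions) are those whose
  carrier is a set of elements of the type \<open>'m\<close>. The predicate \<open>module_universe\<close>
  says that \<open>'m\<close> is infinite and at least as large as \<open>R\<close>. Then every cyclic
  module has a copy in \<open>'m\<close>, and so has the free module on the
  carrier of any module in \<open>'m\<close>; hence projectivity and projective dimension
  relative to \<open>'m\<close> are the absolute notions. A statement about all types \<open>'m\<close> with
  \<open>module_universe\<close> covers modules of every cardinality.
\<close>

definition global_dimension :: "'m itself \<Rightarrow> ('a, 'r) ring_scheme \<Rightarrow> enat" where
  "global_dimension U R =
    (SUP M \<in> {M :: ('a, 'm) module. left_module R M}. projective_dimension R M)"

definition module_universe :: "'m itself \<Rightarrow> ('a, 'r) ring_scheme \<Rightarrow> bool" where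
  "module_universe U R \<longleftrightarrow>
    infinite (UNIV :: 'm set) \<and> (\<exists>\<iota> :: 'a \<Rightarrow> 'm. inj_on \<iota> (carrier R))"


section \<open>The grading group \<open>\<LL>\<close>\<close>

datatype gl_gen = GenX nat | GenC

type_synonym gl_deg = "(gl_gen \<Rightarrow>\<^sub>0 int) set"

text \<open>
  The groups are written multiplicatively, following HOL-Algebra; their elements are cosets
  in the free abelian group. Indices \<open>i\<close> run over \<open>{1..n}\<close>.
\<close>

definition gl_free_group :: "nat \<Rightarrow> (gl_gen \<Rightarrow>\<^sub>0 int) monoid" where
  "gl_free_group n = free_Abelian_group (insert GenC (GenX ` {1..n}))"

definition gl_relations :: "nat \<Rightarrow> (nat \<Rightarrow> nat) \<Rightarrow> (gl_gen \<Rightarrow>\<^sub>0 int) set" where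
  "gl_relations n p = generate (gl_free_group n)
    ((\<lambda>i. frag_cmul (int (p i)) (frag_of (GenX i)) - frag_of GenC) ` {1..n})"

definition gl_group :: "nat \<Rightarrow> (nat \<Rightarrow> nat) \<Rightarrow> gl_deg monoid" where
  "gl_group n p = gl_free_group n Mod gl_relations n p"

definition gl_x :: "nat \<Rightarrow> (nat \<Rightarrow> nat) \<Rightarrow> nat \<Rightarrow> gl_deg" where
  "gl_x n p i = gl_relations n p #>\<^bsub>gl_free_group n\<^esub> frag_of (GenX i)"

definition gl_c :: "nat \<Rightarrow> (nat \<Rightarrow> nat) \<Rightarrow> gl_deg" where
  "gl_c n p = gl_relations n p #>\<^bsub>gl_free_group n\<^esub> frag_of GenC"

definition gl_minus :: "nat \<Rightarrow> (nat \<Rightarrow> nat) \<Rightarrow> gl_deg \<Rightarrow> gl_deg \<Rightarrow> gl_deg" where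
  "gl_minus n p x y = x \<otimes>\<^bsub>gl_group n p\<^esub> inv\<^bsub>gl_group n p\<^esub> y"

inductive_set gl_pos :: "nat \<Rightarrow> (nat \<Rightarrow> nat) \<Rightarrow> gl_deg set"
  for n :: nat and p :: "nat \<Rightarrow> nat" where
  zero: "\<one>\<^bsub>gl_group n p\<^esub> \<in> gl_pos n p"
| gen_x: "i \<in> {1..n} \<Longrightarrow> gl_x n p i \<in> gl_pos n p"
| gen_c: "gl_c n p \<in> gl_pos n p"
| add: "\<lbrakk>x \<in> gl_pos n p; y \<in> gl_pos n p\<rbrakk> \<Longrightarrow> x \<otimes>\<^bsub>gl_group n p\<^esub> y \<in> gl_pos n p"

definition gl_le :: "nat \<Rightarrow> (nat \<Rightarrow> nat) \<Rightarrow> gl_deg \<Rightarrow> gl_deg \<Rightarrow> bool" where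
  "gl_le n p x y \<longleftrightarrow> gl_minus n p y x \<in> gl_pos n p"

definition gl_interval :: "nat \<Rightarrow> (nat \<Rightarrow> nat) \<Rightarrow> gl_deg \<Rightarrow> gl_deg \<Rightarrow> gl_deg set" where
  "gl_interval n p x y = {z \<in> carrier (gl_group n p). gl_le n p x z \<and> gl_le n p z y}"

definition gl_omega :: "int \<Rightarrow> nat \<Rightarrow> (nat \<Rightarrow> nat) \<Rightarrow> gl_deg" where
  "gl_omega d n p =
    gl_minus n p (gl_c n p [^]\<^bsub>gl_group n p\<^esub> (int n - d - 1))
      (\<Otimes>\<^bsub>gl_group n p\<^esub>i\<in>{1..n}. gl_x n p i)"

definition gl_delta :: "int \<Rightarrow> nat \<Rightarrow> (nat \<Rightarrow> nat) \<Rightarrow> gl_deg" where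
  "gl_delta d n p =
    (gl_c n p [^]\<^bsub>gl_group n p\<^esub> d) \<otimes>\<^bsub>gl_group n p\<^esub>
    (gl_omega d n p [^]\<^bsub>gl_group n p\<^esub> (2 :: int))"


section \<open>The ring \<open>R\<close>\<close>

datatype gl_var = VarT nat | VarX nat

type_synonym 'k gl_poly = "(gl_var \<Rightarrow>\<^sub>0 nat) \<Rightarrow>\<^sub>0 'k"

definition gl_monom_var :: "gl_var \<Rightarrow> 'k::field gl_poly" where
  "gl_monom_var v = Poly_Mapping.single (Poly_Mapping.single v 1) 1"

text \<open>The variables are \<open>T\<^sub>0, \<dots>, T\<^sub>d\<close> (none if \<open>d = -1\<close>) and \<open>X\<^sub>1, \<dots>, X\<^sub>n\<close>.\<close>

definition gl_vars :: "int \<Rightarrow> nat \<Rightarrow> gl_var set" where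
  "gl_vars d n = {VarT j | j. int j \<le> d} \<union> VarX ` {1..n}"

definition gl_poly_ring :: "int \<Rightarrow> nat \<Rightarrow> 'k::field gl_poly ring" where
  "gl_poly_ring d n =
    \<lparr>carrier = {f. \<forall>m\<in>Poly_Mapping.keys f. Poly_Mapping.keys m \<subseteq> gl_vars d n},
     monoid.mult = (*), one = 1, ring.zero = 0, add = (+)\<rparr>"

definition gl_ideal ::
  "int \<Rightarrow> nat \<Rightarrow> (nat \<Rightarrow> 'k::field gl_poly) \<Rightarrow> (nat \<Rightarrow> nat) \<Rightarrow> 'k gl_poly set" where
  "gl_ideal d n l p =
    genideal (gl_poly_ring d n) ((\<lambda>i. gl_monom_var (VarX i) ^ p i - l i) ` {1..n})"

definition gl_ring ::
  "int \<Rightarrow> nat \<Rightarrow> (nat \<Rightarrow> 'k::field gl_poly) \<Rightarrow> (nat \<Rightarrow> nat) \<Rightarrow> 'k gl_poly set ring" where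
  "gl_ring d n l p = gl_poly_ring d n Quot gl_ideal d n l p"

definition gl_linear_form :: "int \<Rightarrow> 'k::field gl_poly \<Rightarrow> bool" where
  "gl_linear_form d f \<longleftrightarrow>
    (\<forall>m\<in>Poly_Mapping.keys f. \<exists>j. int j \<le> d \<and> m = Poly_Mapping.single (VarT j) 1)"

text \<open>
  The data defining a Geigle-Lenzing complete intersection of dimension \<open>d + 1\<close>.
  Linear independence is that of the family \<open>(l\<^sub>i)\<close> indexed by \<open>J\<close>, so repetitions
  count as dependent; \<open>Poly_Mapping.single 0 a\<close> is the constant polynomial \<open>a\<close>.
\<close>

locale gl_complete_intersection =
  fixes d :: int and n :: nat and l :: "nat \<Rightarrow> 'k::field gl_poly" and p :: "nat \<Rightarrow> nat"
  assumes dim: "d \<ge> -1"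
    and linear: "\<And>i. i \<in> {1..n} \<Longrightarrow> gl_linear_form d (l i)"
    and general_position:
      "\<And>J a. \<lbrakk>J \<subseteq> {1..n}; int (card J) \<le> d + 1;
        (\<Sum>i\<in>J. Poly_Mapping.single 0 (a i) * l i) = 0\<rbrakk> \<Longrightarrow> \<forall>i\<in>J. a i = 0"
    and weights: "\<And>i. i \<in> {1..n} \<Longrightarrow> p i \<ge> 1"

primrec gl_var_degree :: "nat \<Rightarrow> (nat \<Rightarrow> nat) \<Rightarrow> gl_var \<Rightarrow> gl_deg" where
  "gl_var_degree n p (VarT j) = gl_c n p"
| "gl_var_degree n p (VarX i) = gl_x n p i"

definition gl_degree :: "nat \<Rightarrow> (nat \<Rightarrow> nat) \<Rightarrow> (gl_var \<Rightarrow>\<^sub>0 nat) \<Rightarrow> gl_deg" where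
  "gl_degree n p m =
    (\<Otimes>\<^bsub>gl_group n p\<^esub>v\<in>Poly_Mapping.keys m.
      gl_var_degree n p v [^]\<^bsub>gl_group n p\<^esub> Poly_Mapping.lookup m v)"

text \<open>The homogeneous component \<open>R\<^sub>x\<close>: classes of polynomials all of whose monomials have degree \<open>x\<close>.\<close>

definition gl_component ::
  "int \<Rightarrow> nat \<Rightarrow> (nat \<Rightarrow> 'k::field gl_poly) \<Rightarrow> (nat \<Rightarrow> nat) \<Rightarrow> gl_deg \<Rightarrow> 'k gl_poly set set" where
  "gl_component d n l p x =
    (\<lambda>f. gl_ideal d n l p +>\<^bsub>gl_poly_ring d n\<^esub> f) `
      {f \<in> carrier (gl_poly_ring d n). \<forall>m\<in>Poly_Mapping.keys f. gl_degree n p m = x}"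


section \<open>The CM-canonical algebra\<close>

text \<open>
  Matrices are functions of two indices that are \<open>undefined\<close> outside the index set
  \<open>[0, \<delta>]\<close>, so that equality of matrices is equality of their entries.
\<close>

definition cm_canonical_algebra ::
  "int \<Rightarrow> nat \<Rightarrow> (nat \<Rightarrow> 'k::field gl_poly) \<Rightarrow> (nat \<Rightarrow> nat) \<Rightarrow>
    (gl_deg \<Rightarrow> gl_deg \<Rightarrow> 'k gl_poly set) ring" where
  "cm_canonical_algebra d n l p =
    (let I = gl_interval n p \<one>\<^bsub>gl_group n p\<^esub> (gl_delta d n p); R = gl_ring d n l p in
     \<lparr>carrier = (\<Pi>\<^sub>E x\<in>I. \<Pi>\<^sub>E y\<in>I. gl_component d n l p (gl_minus n p x y)),
      monoid.mult = (\<lambda>r s. \<lambda>x\<in>I. \<lambda>y\<in>I. \<Oplus>\<^bsub>R\<^esub>z\<in>I. r x z \<otimes>\<^bsub>R\<^esub> s z y),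
      one = (\<lambda>x\<in>I. \<lambda>y\<in>I. if x = y then \<one>\<^bsub>R\<^esub> else \<zero>\<^bsub>R\<^esub>),
      ring.zero = (\<lambda>x\<in>I. \<lambda>y\<in>I. \<zero>\<^bsub>R\<^esub>),
      add = (\<lambda>r s. \<lambda>x\<in>I. \<lambda>y\<in>I. r x y \<oplus>\<^bsub>R\<^esub> s x y)\<rparr>)"

end

theory Submission
  imports Defs
begin

text \<open>
  Modules over \<open>A\<close> are graded \<open>R\<close>-modules supported on the interval \<open>[0, \<delta>]\<close>, where
  \<open>\<delta> = (n - d - 2) c + \<Sum> (p\<^sub>i - 2) x\<^sub>i\<close>, and the simple module at \<open>z\<close> is the twist by \<open>z\<close> of
  \<open>R / (X\<^sub>1, \<dots>, X\<^sub>n)\<close>. Put \<open>V\<^sub>i = R / (X\<^sub>1, \<dots>, X\<^sub>i)\<close>. For \<open>i \<le> d + 1\<close> the element \<open>X\<^sub>i\<close> is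
  regular on \<open>V\<^sub>i\<^sub>-\<^sub>1\<close>; for \<open>i > d + 1\<close> the kernel of \<open>X\<^sub>i\<close> on \<open>V\<^sub>i\<^sub>-\<^sub>1\<close> is generated by \<open>X\<^sub>i\<close> to the power
  \<open>p\<^sub>i - 1\<close> and is a twist of \<open>V\<^sub>i\<close>. Iterated mapping cones therefore give a projective
  resolution of the simple module at \<open>z\<close> whose term in degree \<open>h\<close> has its tops at the vertices
  \<open>z + j c + \<Sum>\<^sub>k\<^sub>\<in>\<^sub>B x\<^sub>k\<close> with \<open>2 j + |B| = h\<close>, and terms at vertices outside the interval vanish.
  The vertex \<open>j c + \<Sum>\<^sub>k\<^sub>\<in>\<^sub>B x\<^sub>k\<close> lies in the interval only if \<open>2 j + |B|\<close> is at most the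
  claimed dimension, which bounds the projective dimension of every simple module. A module is
  filtered by sums of copies of simple modules, since \<open>A\<close> is directed; this gives the upper bound. The bound is
  attained at \<open>j = n - d - 2\<close> and \<open>B = {i. p\<^sub>i \<ge> 3}\<close>; this vertex occurs in no other degree of the
  resolution of the simple module at \<open>0\<close>, so no shorter projective resolution exists.
\<close>

subsection \<open>Modules in different types\<close>

text \<open>The constant comes from a trade below \<delta>. In normal form \<delta> has
  \<open>c\<close>-coordinate \<open>n - d - 2\<close> and \<open>x i\<close>-coordinate
  \<open>p i - 2\<close>. A step by \<open>c\<close> costs one unit of the
  \<open>c\<close>-coordinate and buys two homological degrees, since going round the pair
  \<open>X i\<close>, \<open>X i ^ (p i - 1)\<close> takes two maps and has degree
  \<open>p i x i = c\<close>. A step by \<open>x i\<close> is free if \<open>p i >= 3\<close>; if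
  \<open>p i = 2\<close> it borrows one \<open>c\<close> and buys one degree only, so it never pays.
  Two obstacles shape the algebra. Twists leave the interval, where \<open>A\<close> has no column,
  so cones are formed for the columns of every nonnegative \<open>z\<close> of the free group, and
  those outside the interval turn out to be zero. Modules live in an arbitrary type
  \<open>'m\<close>, so the terms of a resolution have no canonical form; they are known only
  through predicates that are stable under direct sums, such as which simple modules occur in the
  top. Since modules may be infinite, inductions over composition series are replaced by inductions
  over the finite set of vertices.\<close>

text \<open>
  Unlike \<^const>\<open>left_module_hom\<close>, this allows the two modules to have elements of different types:
  the columns of \<open>A\<close> are modules of functions, while resolutions are formed in the universe \<open>'m\<close>.
\<close>

definition lhom ::
  "('a, 'r) ring_scheme \<Rightarrow> ('a, 'b) module \<Rightarrow> ('a, 'c) module \<Rightarrow> ('b \<Rightarrow> 'c) set" where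
  "lhom R M N =
    {f \<in> carrier M \<rightarrow> carrier N.
      (\<forall>x\<in>carrier M. \<forall>y\<in>carrier M. f (x \<oplus>\<^bsub>M\<^esub> y) = f x \<oplus>\<^bsub>N\<^esub> f y) \<and>
      (\<forall>a\<in>carrier R. \<forall>x\<in>carrier M. f (a \<odot>\<^bsub>M\<^esub> x) = a \<odot>\<^bsub>N\<^esub> f x)}"

lemma (in abelian_group) diff_eq_zero_iff:
  assumes "x \<in> carrier G" "y \<in> carrier G" shows "x \<ominus> y = \<zero> \<longleftrightarrow> x = y"
  using assms by (metis a_minus_def add.inv_closed minus_equality minus_minus r_neg)

lemma (in abelian_group) diff_zero:
  assumes "x \<in> carrier G" shows "x \<ominus> \<zero> = x"
  using assms by (simp add: a_minus_def)

lemma (in abelian_group) diff_add_cancel_r: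
  assumes "x \<in> carrier G" "y \<in> carrier G" shows "(x \<ominus> y) \<oplus> y = x"
  using assms by (simp add: a_minus_def a_assoc l_neg)

lemma left_module_hom_eq_lhom: "left_module_hom R M N = lhom R M N"
  by (simp add: left_module_hom_def lhom_def)

text \<open>Closure under negatives comes from the action of \<open>\<ominus> \<one>\<close>
  (\<open>lsub_neg\<close>).\<close>

definition lsub :: "('a, 'r) ring_scheme \<Rightarrow> ('a, 'b) module \<Rightarrow> 'b set \<Rightarrow> bool" where
  "lsub R M N \<longleftrightarrow> N \<subseteq> carrier M \<and> \<zero>\<^bsub>M\<^esub> \<in> N \<and>
    (\<forall>x\<in>N. \<forall>y\<in>N. x \<oplus>\<^bsub>M\<^esub> y \<in> N) \<and> (\<forall>a\<in>carrier R. \<forall>x\<in>N. a \<odot>\<^bsub>M\<^esub> x \<in> N)"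

definition lker :: "('a, 'b) module \<Rightarrow> ('a, 'c) module \<Rightarrow> ('b \<Rightarrow> 'c) \<Rightarrow> 'b set" where
  "lker M N f = {u \<in> carrier M. f u = \<zero>\<^bsub>N\<^esub>}"

lemma left_module_abelian_group: "left_module R M \<Longrightarrow> abelian_group M"
  by (simp add: left_module_def)

lemma left_module_ring: "left_module R M \<Longrightarrow> ring R"
  by (simp add: left_module_def)

lemma left_moduleI:
  assumes "ring R" "abelian_group M"
    "\<And>a x. \<lbrakk>a \<in> carrier R; x \<in> carrier M\<rbrakk> \<Longrightarrow> a \<odot>\<^bsub>M\<^esub> x \<in> carrier M"
    "\<And>a b x. \<lbrakk>a \<in> carrier R; b \<in> carrier R; x \<in> carrier M\<rbrakk> \<Longrightarrow>
        (a \<oplus>\<^bsub>R\<^esub> b) \<odot>\<^bsub>M\<^esub> x = (a \<odot>\<^bsub>M\<^esub> x) \<oplus>\<^bsub>M\<^esub> (b \<odot>\<^bsub>M\<^esub> x)"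
    "\<And>a x y. \<lbrakk>a \<in> carrier R; x \<in> carrier M; y \<in> carrier M\<rbrakk> \<Longrightarrow>
        a \<odot>\<^bsub>M\<^esub> (x \<oplus>\<^bsub>M\<^esub> y) = (a \<odot>\<^bsub>M\<^esub> x) \<oplus>\<^bsub>M\<^esub> (a \<odot>\<^bsub>M\<^esub> y)"
    "\<And>a b x. \<lbrakk>a \<in> carrier R; b \<in> carrier R; x \<in> carrier M\<rbrakk> \<Longrightarrow>
        (a \<otimes>\<^bsub>R\<^esub> b) \<odot>\<^bsub>M\<^esub> x = a \<odot>\<^bsub>M\<^esub> (b \<odot>\<^bsub>M\<^esub> x)"
    "\<And>x. x \<in> carrier M \<Longrightarrow> \<one>\<^bsub>R\<^esub> \<odot>\<^bsub>M\<^esub> x = x"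
  shows "left_module R M"
  using assms unfolding left_module_def left_module_axioms_def by blast

lemma lm_closed: "\<lbrakk>left_module R M; a \<in> carrier R; x \<in> carrier M\<rbrakk> \<Longrightarrow> a \<odot>\<^bsub>M\<^esub> x \<in> carrier M"
  by (rule left_module.smult_closed)

lemma lm_add_l: "\<lbrakk>left_module R M; a \<in> carrier R; b \<in> carrier R; x \<in> carrier M\<rbrakk> \<Longrightarrow>
        (a \<oplus>\<^bsub>R\<^esub> b) \<odot>\<^bsub>M\<^esub> x = (a \<odot>\<^bsub>M\<^esub> x) \<oplus>\<^bsub>M\<^esub> (b \<odot>\<^bsub>M\<^esub> x)"
  by (rule left_module.smult_l_distr)

lemma lm_add_r: "\<lbrakk>left_module R M; a \<in> carrier R; x \<in> carrier M; y \<in> carrier M\<rbrakk> \<Longrightarrow>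
        a \<odot>\<^bsub>M\<^esub> (x \<oplus>\<^bsub>M\<^esub> y) = (a \<odot>\<^bsub>M\<^esub> x) \<oplus>\<^bsub>M\<^esub> (a \<odot>\<^bsub>M\<^esub> y)"
  by (rule left_module.smult_r_distr)

lemma lm_assoc: "\<lbrakk>left_module R M; a \<in> carrier R; b \<in> carrier R; x \<in> carrier M\<rbrakk> \<Longrightarrow>
        (a \<otimes>\<^bsub>R\<^esub> b) \<odot>\<^bsub>M\<^esub> x = a \<odot>\<^bsub>M\<^esub> (b \<odot>\<^bsub>M\<^esub> x)"
  by (rule left_module.smult_assoc)

lemma lm_one: "\<lbrakk>left_module R M; x \<in> carrier M\<rbrakk> \<Longrightarrow> \<one>\<^bsub>R\<^esub> \<odot>\<^bsub>M\<^esub> x = x"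
  by (rule left_module.smult_one)

lemma lm_zero_r:
  assumes "left_module R M" "a \<in> carrier R" shows "a \<odot>\<^bsub>M\<^esub> \<zero>\<^bsub>M\<^esub> = \<zero>\<^bsub>M\<^esub>"
proof -
  interpret abelian_group M using assms(1) by (rule left_module_abelian_group)
  have c: "a \<odot>\<^bsub>M\<^esub> \<zero>\<^bsub>M\<^esub> \<in> carrier M" using assms by (simp add: lm_closed)
  have "a \<odot>\<^bsub>M\<^esub> \<zero>\<^bsub>M\<^esub> \<oplus>\<^bsub>M\<^esub> a \<odot>\<^bsub>M\<^esub> \<zero>\<^bsub>M\<^esub> = a \<odot>\<^bsub>M\<^esub> \<zero>\<^bsub>M\<^esub>"
    using lm_add_r[OF assms, of "\<zero>\<^bsub>M\<^esub>" "\<zero>\<^bsub>M\<^esub>"] by simp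
  then show ?thesis using c add.r_cancel_one by blast
qed

lemma lm_zero_l:
  assumes "left_module R M" "x \<in> carrier M" shows "\<zero>\<^bsub>R\<^esub> \<odot>\<^bsub>M\<^esub> x = \<zero>\<^bsub>M\<^esub>"
proof -
  interpret R: ring R using assms(1) by (rule left_module_ring)
  interpret abelian_group M using assms(1) by (rule left_module_abelian_group)
  have c: "\<zero>\<^bsub>R\<^esub> \<odot>\<^bsub>M\<^esub> x \<in> carrier M" using assms by (simp add: lm_closed)
  have "\<zero>\<^bsub>R\<^esub> \<odot>\<^bsub>M\<^esub> x \<oplus>\<^bsub>M\<^esub> \<zero>\<^bsub>R\<^esub> \<odot>\<^bsub>M\<^esub> x = \<zero>\<^bsub>R\<^esub> \<odot>\<^bsub>M\<^esub> x"
    using lm_add_l[OF assms(1), of "\<zero>\<^bsub>R\<^esub>" "\<zero>\<^bsub>R\<^esub>" x] assms(2) by simp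
  then show ?thesis using c add.r_cancel_one by blast
qed

lemma lm_neg:
  assumes "left_module R M" "x \<in> carrier M" shows "(\<ominus>\<^bsub>R\<^esub> \<one>\<^bsub>R\<^esub>) \<odot>\<^bsub>M\<^esub> x = \<ominus>\<^bsub>M\<^esub> x"
proof -
  interpret R: ring R using assms(1) by (rule left_module_ring)
  interpret abelian_group M using assms(1) by (rule left_module_abelian_group)
  have c: "(\<ominus>\<^bsub>R\<^esub> \<one>\<^bsub>R\<^esub>) \<odot>\<^bsub>M\<^esub> x \<in> carrier M" using assms by (simp add: lm_closed)
  have "(\<ominus>\<^bsub>R\<^esub> \<one>\<^bsub>R\<^esub>) \<odot>\<^bsub>M\<^esub> x \<oplus>\<^bsub>M\<^esub> x = \<zero>\<^bsub>M\<^esub>"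
    using lm_add_l[OF assms(1), of "\<ominus>\<^bsub>R\<^esub> \<one>\<^bsub>R\<^esub>" "\<one>\<^bsub>R\<^esub>" x] assms
    by (simp add: lm_one lm_zero_l R.l_neg)
  then show ?thesis using c assms(2) minus_equality by metis
qed

lemma lm_neg_r:
  assumes "left_module R N" "a \<in> carrier R" "y \<in> carrier N"
  shows "a \<odot>\<^bsub>N\<^esub> (\<ominus>\<^bsub>N\<^esub> y) = \<ominus>\<^bsub>N\<^esub> (a \<odot>\<^bsub>N\<^esub> y)"
proof -
  interpret R: ring R using assms(1) by (rule left_module_ring)
  have "a \<odot>\<^bsub>N\<^esub> ((\<ominus>\<^bsub>R\<^esub> \<one>\<^bsub>R\<^esub>) \<odot>\<^bsub>N\<^esub> y) = (\<ominus>\<^bsub>R\<^esub> \<one>\<^bsub>R\<^esub>) \<odot>\<^bsub>N\<^esub> (a \<odot>\<^bsub>N\<^esub> y)"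
    using assms by (simp flip: lm_assoc add: R.l_minus R.r_minus)
  then show ?thesis using assms by (simp add: lm_neg lm_closed)
qed

lemma lm_minus_r:
  assumes "left_module R N" "a \<in> carrier R" "x \<in> carrier N" "y \<in> carrier N"
  shows "a \<odot>\<^bsub>N\<^esub> (x \<ominus>\<^bsub>N\<^esub> y) = a \<odot>\<^bsub>N\<^esub> x \<ominus>\<^bsub>N\<^esub> a \<odot>\<^bsub>N\<^esub> y"
proof -
  interpret N: abelian_group N using assms(1) by (rule left_module_abelian_group)
  show ?thesis using assms by (simp add: a_minus_def lm_add_r lm_neg_r)
qed

lemma lhomI:
  assumes "\<And>x. x \<in> carrier M \<Longrightarrow> f x \<in> carrier N"
    "\<And>x y. \<lbrakk>x \<in> carrier M; y \<in> carrier M\<rbrakk> \<Longrightarrow> f (x \<oplus>\<^bsub>M\<^esub> y) = f x \<oplus>\<^bsub>N\<^esub> f y"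
    "\<And>a x. \<lbrakk>a \<in> carrier R; x \<in> carrier M\<rbrakk> \<Longrightarrow> f (a \<odot>\<^bsub>M\<^esub> x) = a \<odot>\<^bsub>N\<^esub> f x"
  shows "f \<in> lhom R M N"
  using assms by (auto simp: lhom_def)

lemma lhom_closed: "\<lbrakk>f \<in> lhom R M N; x \<in> carrier M\<rbrakk> \<Longrightarrow> f x \<in> carrier N"
  by (auto simp: lhom_def)
lemma lhom_add: "\<lbrakk>f \<in> lhom R M N; x \<in> carrier M; y \<in> carrier M\<rbrakk> \<Longrightarrow> f (x \<oplus>\<^bsub>M\<^esub> y) = f x \<oplus>\<^bsub>N\<^esub> f y"
  by (auto simp: lhom_def)
lemma lhom_smult: "\<lbrakk>f \<in> lhom R M N; a \<in> carrier R; x \<in> carrier M\<rbrakk> \<Longrightarrow> f (a \<odot>\<^bsub>M\<^esub> x) = a \<odot>\<^bsub>N\<^esub> f x"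
  by (auto simp: lhom_def)

lemma lhom_zero:
  assumes "left_module R M" "left_module R N" "f \<in> lhom R M N" shows "f \<zero>\<^bsub>M\<^esub> = \<zero>\<^bsub>N\<^esub>"
proof -
  interpret M: abelian_group M using assms(1) by (rule left_module_abelian_group)
  interpret R: ring R using assms(1) by (rule left_module_ring)
  have "f (\<zero>\<^bsub>R\<^esub> \<odot>\<^bsub>M\<^esub> \<zero>\<^bsub>M\<^esub>) = \<zero>\<^bsub>R\<^esub> \<odot>\<^bsub>N\<^esub> f \<zero>\<^bsub>M\<^esub>" using assms(3) by (simp add: lhom_smult)
  then show ?thesis using assms by (simp add: lm_zero_l lhom_closed)
qed

lemma lhom_neg:
  assumes "left_module R M" "left_module R N" "f \<in> lhom R M N" "x \<in> carrier M"
  shows "f (\<ominus>\<^bsub>M\<^esub> x) = \<ominus>\<^bsub>N\<^esub> f x"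
proof -
  interpret R: ring R using assms(1) by (rule left_module_ring)
  have "f ((\<ominus>\<^bsub>R\<^esub> \<one>\<^bsub>R\<^esub>) \<odot>\<^bsub>M\<^esub> x) = (\<ominus>\<^bsub>R\<^esub> \<one>\<^bsub>R\<^esub>) \<odot>\<^bsub>N\<^esub> f x" using assms(3,4) by (simp add: lhom_smult)
  then show ?thesis using assms by (simp add: lm_neg lhom_closed)
qed

lemma lhom_diff:
  assumes "left_module R M" "left_module R N" "f \<in> lhom R M N" "x \<in> carrier M" "y \<in> carrier M"
  shows "f (x \<ominus>\<^bsub>M\<^esub> y) = f x \<ominus>\<^bsub>N\<^esub> f y"
proof -
  interpret M: abelian_group M using assms(1) by (rule left_module_abelian_group)
  show ?thesis using assms by (simp add: a_minus_def lhom_add[OF assms(3)] lhom_neg[OF assms(1-3)])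
qed

lemma lhom_comp: "\<lbrakk>f \<in> lhom R M N; g \<in> lhom R N L\<rbrakk> \<Longrightarrow> (\<lambda>x. g (f x)) \<in> lhom R M L"
  by (rule lhomI) (auto simp: lhom_closed lhom_add lhom_smult)

lemma lhom_id: "(\<lambda>x. x) \<in> lhom R M M"
  by (rule lhomI) auto

lemma lhom_zero_map:
  assumes "left_module R N" shows "(\<lambda>x. \<zero>\<^bsub>N\<^esub>) \<in> lhom R M N"
proof -
  interpret N: abelian_group N using assms(1) by (rule left_module_abelian_group)
  show ?thesis by (rule lhomI) (simp_all add: lm_zero_r[OF assms])
qed

lemma lhom_plus:
  assumes "left_module R N" "f \<in> lhom R M N" "g \<in> lhom R M N"
  shows "(\<lambda>x. f x \<oplus>\<^bsub>N\<^esub> g x) \<in> lhom R M N"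
proof -
  interpret N: abelian_group N using assms(1) by (rule left_module_abelian_group)
  show ?thesis
    by (rule lhomI) (use assms in \<open>auto simp: lhom_closed lhom_add lhom_smult lm_add_r N.a_ac\<close>)
qed

lemma lhom_minus:
  assumes "left_module R N" "f \<in> lhom R M N" "g \<in> lhom R M N"
  shows "(\<lambda>x. f x \<ominus>\<^bsub>N\<^esub> g x) \<in> lhom R M N"
proof -
  interpret N: abelian_group N using assms(1) by (rule left_module_abelian_group)
  interpret R: ring R using assms(1) by (rule left_module_ring)
  show ?thesis
    by (rule lhomI)
      (use assms in \<open>auto simp: lhom_closed lhom_add lhom_smult lm_add_r lm_closed lm_neg_r a_minus_def N.minus_add N.a_ac\<close>)
qed

lemma lsub_carrier: "left_module R M \<Longrightarrow> lsub R M (carrier M)"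
  using left_module_abelian_group[of R M] lm_closed[of R M]
  by (auto simp: lsub_def abelian_group_def abelian_monoid.zero_closed abelian_monoid.a_closed)

lemma lsub_neg:
  assumes "left_module R M" "lsub R M N" "x \<in> N" shows "\<ominus>\<^bsub>M\<^esub> x \<in> N"
proof -
  interpret R: ring R using assms(1) by (rule left_module_ring)
  have "(\<ominus>\<^bsub>R\<^esub> \<one>\<^bsub>R\<^esub>) \<odot>\<^bsub>M\<^esub> x \<in> N" "x \<in> carrier M" using assms(2,3) by (auto simp: lsub_def)
  then show ?thesis by (simp add: lm_neg[OF assms(1)])
qed

lemma lsub_left_module:
  assumes "left_module R M" "lsub R M N"
  shows "left_module R (M\<lparr>carrier := N\<rparr>)"
proof (rule left_moduleI)
  interpret M: abelian_group M using assms(1) by (rule left_module_abelian_group)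
  show "ring R" using assms(1) by (rule left_module_ring)
  have sub: "N \<subseteq> carrier M" using assms(2) by (simp add: lsub_def)
  show "abelian_group (M\<lparr>carrier := N\<rparr>)"
  proof (rule abelian_groupI)
    fix x assume "x \<in> carrier (M\<lparr>carrier := N\<rparr>)"
    then show "\<exists>y\<in>carrier (M\<lparr>carrier := N\<rparr>). y \<oplus>\<^bsub>M\<lparr>carrier := N\<rparr>\<^esub> x = \<zero>\<^bsub>M\<lparr>carrier := N\<rparr>\<^esub>"
      using lsub_neg[OF assms] sub M.l_neg by auto
  qed (use assms sub in \<open>auto simp: lsub_def subset_iff M.a_ac\<close>)
qed (use assms in \<open>auto simp: lsub_def subset_iff lm_add_l lm_add_r lm_assoc lm_one\<close>)

lemma lsub_lker:
  assumes "left_module R M" "left_module R N" "f \<in> lhom R M N" shows "lsub R M (lker M N f)"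
proof -
  interpret M: abelian_group M using assms(1) by (rule left_module_abelian_group)
  interpret N: abelian_group N using assms(2) by (rule left_module_abelian_group)
  show ?thesis using assms
    by (auto simp: lsub_def lker_def lhom_zero lhom_add lhom_smult lm_closed lm_zero_r)
qed

lemma lsub_zero:
  assumes "left_module R M" shows "lsub R M {\<zero>\<^bsub>M\<^esub>}"
proof -
  interpret M: abelian_group M using assms(1) by (rule left_module_abelian_group)
  show ?thesis using assms by (auto simp: lsub_def lm_zero_r)
qed

lemma lsub_diff_iff:
  assumes "left_module R M" "lsub R M N" "x \<in> carrier M" "y \<in> carrier M" "x \<ominus>\<^bsub>M\<^esub> y \<in> N"
  shows "y \<ominus>\<^bsub>M\<^esub> x \<in> N"
proof -
  interpret M: abelian_group M using assms(1) by (rule left_module_abelian_group)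
  have "y \<ominus>\<^bsub>M\<^esub> x = \<ominus>\<^bsub>M\<^esub> (x \<ominus>\<^bsub>M\<^esub> y)" using assms by (simp add: a_minus_def M.minus_add M.a_comm)
  then show ?thesis using lsub_neg[OF assms(1,2,5)] by simp
qed

subsection \<open>Quotients\<close>

text \<open>\<open>Q\<close> is a copy of \<open>M / N\<close>, usually in another type, with projection \<open>\<kappa>\<close>.\<close>

definition coded where
  "coded R M N Q \<kappa> \<longleftrightarrow> left_module R M \<and> lsub R M N \<and> left_module R Q \<and> \<kappa> \<in> lhom R M Q \<and> \<kappa> ` carrier M = carrier Q \<and>
     (\<forall>u\<in>carrier M. \<kappa> u = \<zero>\<^bsub>Q\<^esub> \<longleftrightarrow> u \<in> N)"

text \<open>A coset is named by the code of one chosen representative, so any type that receives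
  \<open>carrier M\<close> injectively also holds the quotient. With \<open>N\<close> the zero
  submodule this copies \<open>M\<close> itself into \<open>'m\<close>.\<close>

lemma ex_coded:
  fixes M :: "('a, 'b) module" and \<iota> :: "'b \<Rightarrow> 'm"
  assumes M: "left_module R M" and N: "lsub R M N" and inj: "inj_on \<iota> (carrier M)"
  shows "\<exists>(Q :: ('a, 'm) module) \<kappa>. coded R M N Q \<kappa>"
proof -
  interpret M: abelian_group M using M by (rule left_module_abelian_group)
  interpret R: ring R using M by (rule left_module_ring)
  have sub: "N \<subseteq> carrier M" using N by (simp add: lsub_def)
  have N0: "\<zero>\<^bsub>M\<^esub> \<in> N" using N by (simp add: lsub_def)
  define rep where "rep u = (SOME v. v \<in> carrier M \<and> v \<ominus>\<^bsub>M\<^esub> u \<in> N)" for u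
  have rep: "rep u \<in> carrier M \<and> rep u \<ominus>\<^bsub>M\<^esub> u \<in> N" if "u \<in> carrier M" for u
    unfolding rep_def
    by (rule someI[of _ u]) (use that N0 M.r_neg in \<open>auto simp: a_minus_def\<close>)
  have tr: "x \<ominus>\<^bsub>M\<^esub> z \<in> N" if "x \<in> carrier M" "y \<in> carrier M" "z \<in> carrier M" "x \<ominus>\<^bsub>M\<^esub> y \<in> N" "y \<ominus>\<^bsub>M\<^esub> z \<in> N" for x y z
  proof -
    have "x \<ominus>\<^bsub>M\<^esub> z = (x \<ominus>\<^bsub>M\<^esub> y) \<oplus>\<^bsub>M\<^esub> (y \<ominus>\<^bsub>M\<^esub> z)"
      using that(1-3) by (simp add: a_minus_def M.a_assoc M.r_neg1)
    then show ?thesis using that N by (simp add: lsub_def)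
  qed
  have rep_eq: "rep u = rep v \<longleftrightarrow> u \<ominus>\<^bsub>M\<^esub> v \<in> N" if "u \<in> carrier M" "v \<in> carrier M" for u v
  proof
    assume "rep u = rep v"
    then have "rep u \<ominus>\<^bsub>M\<^esub> u \<in> N" "rep u \<ominus>\<^bsub>M\<^esub> v \<in> N" "rep u \<in> carrier M" using rep[OF that(1)] rep[OF that(2)] by auto
    then show "u \<ominus>\<^bsub>M\<^esub> v \<in> N" using tr lsub_diff_iff[OF M N] that by blast
  next
    assume *: "u \<ominus>\<^bsub>M\<^esub> v \<in> N"
    \<comment> \<open>Congruent \<open>u\<close> and \<open>v\<close> satisfy the same choice
      predicate, so \<open>SOME\<close> returns the same representative.\<close>
    have "w \<ominus>\<^bsub>M\<^esub> u \<in> N \<longleftrightarrow> w \<ominus>\<^bsub>M\<^esub> v \<in> N" if "w \<in> carrier M" for w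
      using tr * lsub_diff_iff[OF M N] \<open>u \<in> carrier M\<close> \<open>v \<in> carrier M\<close> that by blast
    then show "rep u = rep v" unfolding rep_def by meson
  qed
  define \<kappa> where "\<kappa> u = \<iota> (rep u)" for u
  have \<kappa>_eq: "\<kappa> u = \<kappa> v \<longleftrightarrow> u \<ominus>\<^bsub>M\<^esub> v \<in> N" if "u \<in> carrier M" "v \<in> carrier M" for u v
    using rep_eq[OF that] rep[OF that(1)] rep[OF that(2)] inj by (auto simp: \<kappa>_def inj_on_def)
  define lft where "lft = inv_into (carrier M) \<kappa>"
  have lft: "lft (\<kappa> u) \<in> carrier M" "\<kappa> (lft (\<kappa> u)) = \<kappa> u" "lft (\<kappa> u) \<ominus>\<^bsub>M\<^esub> u \<in> N" if "u \<in> carrier M" for u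
  proof -
    show 1: "lft (\<kappa> u) \<in> carrier M" unfolding lft_def by (rule inv_into_into) (use that in auto)
    show 2: "\<kappa> (lft (\<kappa> u)) = \<kappa> u" unfolding lft_def by (rule f_inv_into_f) (use that in auto)
    show "lft (\<kappa> u) \<ominus>\<^bsub>M\<^esub> u \<in> N" using \<kappa>_eq[OF 1 that] 2 by simp
  qed
  define Q :: "('a, 'm) module" where
    "Q = \<lparr>carrier = \<kappa> ` carrier M, monoid.mult = (\<lambda>x y. x), one = \<kappa> \<zero>\<^bsub>M\<^esub>, ring.zero = \<kappa> \<zero>\<^bsub>M\<^esub>,
       add = (\<lambda>x y. \<kappa> (lft x \<oplus>\<^bsub>M\<^esub> lft y)), smult = (\<lambda>a x. \<kappa> (a \<odot>\<^bsub>M\<^esub> lft x))\<rparr>"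
  have carr: "carrier Q = \<kappa> ` carrier M" by (simp add: Q_def)
  have zero: "\<zero>\<^bsub>Q\<^esub> = \<kappa> \<zero>\<^bsub>M\<^esub>" by (simp add: Q_def)
  have add: "\<kappa> u \<oplus>\<^bsub>Q\<^esub> \<kappa> v = \<kappa> (u \<oplus>\<^bsub>M\<^esub> v)" if "u \<in> carrier M" "v \<in> carrier M" for u v
  proof -
    have "(lft (\<kappa> u) \<oplus>\<^bsub>M\<^esub> lft (\<kappa> v)) \<ominus>\<^bsub>M\<^esub> (u \<oplus>\<^bsub>M\<^esub> v) = (lft (\<kappa> u) \<ominus>\<^bsub>M\<^esub> u) \<oplus>\<^bsub>M\<^esub> (lft (\<kappa> v) \<ominus>\<^bsub>M\<^esub> v)"
      using that lft by (simp add: a_minus_def M.minus_add M.a_ac)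
    then have "(lft (\<kappa> u) \<oplus>\<^bsub>M\<^esub> lft (\<kappa> v)) \<ominus>\<^bsub>M\<^esub> (u \<oplus>\<^bsub>M\<^esub> v) \<in> N"
      using lft that N by (simp add: lsub_def)
    then show ?thesis using that lft \<kappa>_eq by (simp add: Q_def)
  qed
  have smult: "a \<odot>\<^bsub>Q\<^esub> \<kappa> u = \<kappa> (a \<odot>\<^bsub>M\<^esub> u)" if "a \<in> carrier R" "u \<in> carrier M" for a u
  proof -
    have "a \<odot>\<^bsub>M\<^esub> lft (\<kappa> u) \<ominus>\<^bsub>M\<^esub> a \<odot>\<^bsub>M\<^esub> u = a \<odot>\<^bsub>M\<^esub> (lft (\<kappa> u) \<ominus>\<^bsub>M\<^esub> u)"
      using that lft M by (simp add: lm_minus_r)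
    then have "a \<odot>\<^bsub>M\<^esub> lft (\<kappa> u) \<ominus>\<^bsub>M\<^esub> a \<odot>\<^bsub>M\<^esub> u \<in> N"
      using lft that N by (simp add: lsub_def)
    then show ?thesis using that lft \<kappa>_eq M by (simp add: Q_def lm_closed)
  qed
  have ab: "abelian_group Q"
  proof (rule abelian_groupI)
    fix x assume "x \<in> carrier Q"
    then obtain u where u: "u \<in> carrier M" "x = \<kappa> u" by (auto simp: carr)
    show "\<exists>y\<in>carrier Q. y \<oplus>\<^bsub>Q\<^esub> x = \<zero>\<^bsub>Q\<^esub>"
      by (rule bexI[of _ "\<kappa> (\<ominus>\<^bsub>M\<^esub> u)"]) (use u in \<open>auto simp: carr zero add M.l_neg\<close>)
  qed (auto simp: carr zero add M.a_ac)
  have Q: "left_module R Q"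
    by (rule left_moduleI[OF R.ring_axioms ab])
      (use M in \<open>auto simp: carr add smult lm_closed lm_add_l lm_add_r lm_assoc lm_one\<close>)
  have hom: "\<kappa> \<in> lhom R M Q" by (rule lhomI) (auto simp: carr add smult)
  have "\<forall>u\<in>carrier M. \<kappa> u = \<zero>\<^bsub>Q\<^esub> \<longleftrightarrow> u \<in> N"
    using \<kappa>_eq[OF _ M.zero_closed] by (simp add: zero M.diff_zero)
  then show ?thesis using Q hom carr M N by (auto simp: coded_def intro!: exI[of _ Q] exI[of _ \<kappa>])
qed

lemma coded_eq_iff:
  assumes "coded R M N Q \<kappa>" "u \<in> carrier M" "v \<in> carrier M"
  shows "\<kappa> u = \<kappa> v \<longleftrightarrow> u \<ominus>\<^bsub>M\<^esub> v \<in> N"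
proof -
  have M: "left_module R M" and Q: "left_module R Q" and h: "\<kappa> \<in> lhom R M Q" using assms by (auto simp: coded_def)
  interpret M: abelian_group M using M by (rule left_module_abelian_group)
  interpret Q: abelian_group Q using Q by (rule left_module_abelian_group)
  have "u \<ominus>\<^bsub>M\<^esub> v \<in> N \<longleftrightarrow> \<kappa> u \<ominus>\<^bsub>Q\<^esub> \<kappa> v = \<zero>\<^bsub>Q\<^esub>"
    using assms lhom_diff[OF M Q h, of u v] unfolding coded_def by (metis M.minus_closed)
  then show ?thesis using assms(2,3) h by (simp add: lhom_closed Q.diff_eq_zero_iff)
qed

text \<open>The homomorphism theorem, with \<open>L\<close> in any type. Maps out of a copy are
  produced this way, since the elements of \<open>Q\<close> are known only through \<kappa>.\<close>

lemma coded_induced: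
  assumes c: "coded R M N Q \<kappa>" and L: "left_module R L" and f: "f \<in> lhom R M L" and z: "\<And>u. u \<in> N \<Longrightarrow> f u = \<zero>\<^bsub>L\<^esub>"
  shows "\<exists>f'\<in>lhom R Q L. \<forall>u\<in>carrier M. f' (\<kappa> u) = f u"
proof -
  have M: "left_module R M" and Q: "left_module R Q" and h: "\<kappa> \<in> lhom R M Q" and s: "\<kappa> ` carrier M = carrier Q"
    and N: "lsub R M N" using c by (auto simp: coded_def)
  interpret M: abelian_group M using M by (rule left_module_abelian_group)
  interpret L: abelian_group L using L by (rule left_module_abelian_group)
  define f' where "f' x = f (inv_into (carrier M) \<kappa> x)" for x
  have key: "f' (\<kappa> u) = f u" if u: "u \<in> carrier M" for u
  proof -
    let ?v = "inv_into (carrier M) \<kappa> (\<kappa> u)"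
    have v: "?v \<in> carrier M" "\<kappa> ?v = \<kappa> u" using u by (auto intro: inv_into_into f_inv_into_f)
    then have "f (?v \<ominus>\<^bsub>M\<^esub> u) = \<zero>\<^bsub>L\<^esub>" using coded_eq_iff[OF c v(1) u] z by blast
    then have "f ?v \<ominus>\<^bsub>L\<^esub> f u = \<zero>\<^bsub>L\<^esub>" using lhom_diff[OF M L f] v u by simp
      then show ?thesis unfolding f'_def using f u v by (simp add: lhom_closed L.diff_eq_zero_iff)
  qed
  have "f' \<in> lhom R Q L"
  proof (rule lhomI)
    fix x assume "x \<in> carrier Q"
    then obtain u where u: "u \<in> carrier M" "x = \<kappa> u" using s by blast
    then show "f' x \<in> carrier L" using key f lhom_closed by metis
  next
    fix x y assume "x \<in> carrier Q" "y \<in> carrier Q"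
    then obtain u v where u: "u \<in> carrier M" "x = \<kappa> u" "v \<in> carrier M" "y = \<kappa> v" using s by blast
    then show "f' (x \<oplus>\<^bsub>Q\<^esub> y) = f' x \<oplus>\<^bsub>L\<^esub> f' y"
      using key f h by (metis M.a_closed lhom_add)
  next
    fix a x assume a: "a \<in> carrier R" and "x \<in> carrier Q"
    then obtain u where u: "u \<in> carrier M" "x = \<kappa> u" using s by blast
    then show "f' (a \<odot>\<^bsub>Q\<^esub> x) = a \<odot>\<^bsub>L\<^esub> f' x"
      using key f h a M by (metis lm_closed lhom_smult)
  qed
  then show ?thesis using key by blast
qed

section \<open>Codings in an infinite type and projective modules\<close>

lemma infinite_list_code:
  assumes "infinite (UNIV :: 'm set)" shows "\<exists>enc :: 'm list \<Rightarrow> 'm. inj enc"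
  using lists_infinite_bij_betw_types[OF assms] by (auto simp: bij_betw_def)

lemma infinite_pair_code:
  assumes "infinite (UNIV :: 'm set)" shows "\<exists>enc :: 'm \<times> 'm \<Rightarrow> 'm. inj enc"
proof -
  obtain e :: "'m list \<Rightarrow> 'm" where "inj e" using infinite_list_code[OF assms] by blast
  then have "inj (\<lambda>(a, b). e [a, b])" by (auto simp: inj_def)
  then show ?thesis by blast
qed

lemma projective_left_module: "projective_module R P \<Longrightarrow> left_module R P"
  by (simp add: projective_module_def)

lemma projective_lift:
  fixes P M N :: "('a, 'm) module"
  assumes "projective_module R P" "left_module R M" "left_module R N" "g \<in> lhom R M N" "g ` carrier M = carrier N"
    "f \<in> lhom R P N"
  shows "\<exists>h\<in>lhom R P M. \<forall>x\<in>carrier P. g (h x) = f x"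
  using assms unfolding projective_module_def left_module_hom_eq_lhom by blast

lemma projectiveI:
  fixes P :: "('a, 'm) module"
  assumes "left_module R P"
    "\<And>(M :: ('a, 'm) module) (N :: ('a, 'm) module) g f. \<lbrakk>left_module R M; left_module R N; g \<in> lhom R M N;
      g ` carrier M = carrier N; f \<in> lhom R P N\<rbrakk> \<Longrightarrow> \<exists>h\<in>lhom R P M. \<forall>x\<in>carrier P. g (h x) = f x"
  shows "projective_module R P"
  using assms unfolding projective_module_def left_module_hom_eq_lhom by blast

lemma projective_zero_module:
  fixes P :: "('a, 'm) module"
  assumes "left_module R P" "carrier P = {\<zero>\<^bsub>P\<^esub>}"
  shows "projective_module R P"
proof (rule projectiveI[OF assms(1)])
  fix M N :: "('a, 'm) module" and g f
  assume M: "left_module R M" and N: "left_module R N" and g: "g \<in> lhom R M N" and f: "f \<in> lhom R P N"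
  have "g \<zero>\<^bsub>M\<^esub> = \<zero>\<^bsub>N\<^esub>" "f \<zero>\<^bsub>P\<^esub> = \<zero>\<^bsub>N\<^esub>" using lhom_zero M N assms(1) g f by auto
  then show "\<exists>h\<in>lhom R P M. \<forall>x\<in>carrier P. g (h x) = f x"
    using lhom_zero_map[OF M] assms(2) by (intro bexI[of _ "\<lambda>x. \<zero>\<^bsub>M\<^esub>"]) auto
qed

text \<open>An isomorphism is the quotient map by the zero submodule, so a lift found on
  \<open>P\<close> descends along \<phi> by \<open>coded_induced\<close>.\<close>

lemma projective_iso:
  fixes P Q :: "('a, 'm) module"
  assumes "projective_module R P" "left_module R Q" "\<phi> \<in> lhom R P Q" "\<phi> ` carrier P = carrier Q" "inj_on \<phi> (carrier P)"
  shows "projective_module R Q"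
proof (rule projectiveI[OF assms(2)])
  fix M N :: "('a, 'm) module" and g f
  assume M: "left_module R M" and N: "left_module R N" and g: "g \<in> lhom R M N" "g ` carrier M = carrier N"
    and f: "f \<in> lhom R Q N"
  have P: "left_module R P" using assms(1) by (rule projective_left_module)
  obtain h where h: "h \<in> lhom R P M" "\<forall>x\<in>carrier P. g (h x) = f (\<phi> x)"
    using projective_lift[OF assms(1) M N g lhom_comp[OF assms(3) f]] by blast
  interpret P: abelian_group P using P by (rule left_module_abelian_group)
  have "\<phi> u = \<zero>\<^bsub>Q\<^esub> \<longleftrightarrow> u \<in> {\<zero>\<^bsub>P\<^esub>}" if "u \<in> carrier P" for u
    using inj_onD[OF assms(5), of u "\<zero>\<^bsub>P\<^esub>"] lhom_zero[OF P assms(2,3)] that by auto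
  then have c: "coded R P {\<zero>\<^bsub>P\<^esub>} Q \<phi>"
    unfolding coded_def using P assms(2,3,4) lsub_zero[OF P] by blast
  have z: "h u = \<zero>\<^bsub>M\<^esub>" if "u \<in> {\<zero>\<^bsub>P\<^esub>}" for u using lhom_zero[OF P M h(1)] that by simp
  have "\<exists>h'\<in>lhom R Q M. \<forall>u\<in>carrier P. h' (\<phi> u) = h u"
    by (rule coded_induced[OF c M h(1) z])
  then obtain h' where h': "h' \<in> lhom R Q M" and h'2: "\<forall>u\<in>carrier P. h' (\<phi> u) = h u" ..
  have "g (h' x) = f x" if x: "x \<in> carrier Q" for x
  proof -
    have "x \<in> \<phi> ` carrier P" using x by (simp add: assms(4))
    then obtain u where "u \<in> carrier P" "x = \<phi> u" ..
    then show ?thesis using h'2 h(2) by simp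
  qed
  then show "\<exists>h\<in>lhom R Q M. \<forall>x\<in>carrier Q. g (h x) = f x"
    using h' by (intro bexI[of _ h'] ballI)
qed

subsection \<open>Biproducts\<close>

text \<open>A direct sum is given by its maps, since a pair of elements of \<open>'m\<close> has no
  canonical code in \<open>'m\<close>.\<close>

definition biprod where
  "biprod R S P P' i1 i2 p1 p2 \<longleftrightarrow> left_module R S \<and> left_module R P \<and> left_module R P' \<and>
     i1 \<in> lhom R P S \<and> i2 \<in> lhom R P' S \<and> p1 \<in> lhom R S P \<and> p2 \<in> lhom R S P' \<and>
     (\<forall>x\<in>carrier P. p1 (i1 x) = x \<and> p2 (i1 x) = \<zero>\<^bsub>P'\<^esub>) \<and>
     (\<forall>y\<in>carrier P'. p2 (i2 y) = y \<and> p1 (i2 y) = \<zero>\<^bsub>P\<^esub>) \<and>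
     (\<forall>s\<in>carrier S. i1 (p1 s) \<oplus>\<^bsub>S\<^esub> i2 (p2 s) = s)"

text \<open>The product of the carriers, copied into \<open>'m\<close> along a pairing of the
  infinite type.\<close>

lemma ex_biprod:
  fixes P P' :: "('a, 'm) module"
  assumes inf: "infinite (UNIV :: 'm set)" and P: "left_module R P" and P': "left_module R P'"
  shows "\<exists>(S :: ('a, 'm) module) i1 i2 p1 p2. biprod R S P P' i1 i2 p1 p2"
proof -
  interpret P: abelian_group P using P by (rule left_module_abelian_group)
  interpret P': abelian_group P' using P' by (rule left_module_abelian_group)
  define D :: "('a, 'm \<times> 'm) module" where
    "D = \<lparr>carrier = carrier P \<times> carrier P', monoid.mult = (\<lambda>x y. x), one = (\<zero>\<^bsub>P\<^esub>, \<zero>\<^bsub>P'\<^esub>), ring.zero = (\<zero>\<^bsub>P\<^esub>, \<zero>\<^bsub>P'\<^esub>),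
       add = (\<lambda>x y. (fst x \<oplus>\<^bsub>P\<^esub> fst y, snd x \<oplus>\<^bsub>P'\<^esub> snd y)), smult = (\<lambda>a x. (a \<odot>\<^bsub>P\<^esub> fst x, a \<odot>\<^bsub>P'\<^esub> snd x))\<rparr>"
  have ab: "abelian_group D"
  proof (rule abelian_groupI)
    fix x assume "x \<in> carrier D"
    then show "\<exists>y\<in>carrier D. y \<oplus>\<^bsub>D\<^esub> x = \<zero>\<^bsub>D\<^esub>"
      by (intro bexI[of _ "(\<ominus>\<^bsub>P\<^esub> fst x, \<ominus>\<^bsub>P'\<^esub> snd x)"]) (auto simp: D_def P.l_neg P'.l_neg)
  qed (auto simp: D_def P.a_ac P'.a_ac)
  have D: "left_module R D"
    by (rule left_moduleI[OF left_module_ring[OF P] ab])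
      (use P P' in \<open>auto simp: D_def lm_closed lm_add_l lm_add_r lm_assoc lm_one\<close>)
  obtain e :: "'m \<times> 'm \<Rightarrow> 'm" where "inj e" using infinite_pair_code[OF inf] by blast
  then obtain S :: "('a, 'm) module" and \<kappa> where c: "coded R D {\<zero>\<^bsub>D\<^esub>} S \<kappa>"
    using ex_coded[OF D lsub_zero[OF D], of e] by (metis inj_on_subset subset_UNIV)
  then have S: "left_module R S" and h: "\<kappa> \<in> lhom R D S" and s: "\<kappa> ` carrier D = carrier S" by (auto simp: coded_def)
  have f1: "fst \<in> lhom R D P" and f2: "snd \<in> lhom R D P'" by (auto intro!: lhomI simp: D_def)
  have j1: "(\<lambda>x. (x, \<zero>\<^bsub>P'\<^esub>)) \<in> lhom R P D" and j2: "(\<lambda>x. (\<zero>\<^bsub>P\<^esub>, x)) \<in> lhom R P' D"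
    using P P' by (auto intro!: lhomI simp: D_def lm_zero_r)
  obtain p1 where p1: "p1 \<in> lhom R S P" "\<forall>u\<in>carrier D. p1 (\<kappa> u) = fst u"
    using coded_induced[OF c P f1] by (auto simp: D_def)
  obtain p2 where p2: "p2 \<in> lhom R S P'" "\<forall>u\<in>carrier D. p2 (\<kappa> u) = snd u"
    using coded_induced[OF c P' f2] by (auto simp: D_def)
  have "biprod R S P P' (\<lambda>x. \<kappa> (x, \<zero>\<^bsub>P'\<^esub>)) (\<lambda>x. \<kappa> (\<zero>\<^bsub>P\<^esub>, x)) p1 p2"
    unfolding biprod_def
  proof (intro conjI ballI)
    fix x assume "x \<in> carrier S"
    then obtain u where u: "u \<in> carrier D" "x = \<kappa> u" using s by blast
    have "p1 x = fst u" "p2 x = snd u" using p1(2) p2(2) u by auto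
    moreover have "\<kappa> (fst u, \<zero>\<^bsub>P'\<^esub>) \<oplus>\<^bsub>S\<^esub> \<kappa> (\<zero>\<^bsub>P\<^esub>, snd u) = \<kappa> u"
      using u lhom_add[OF h, of "(fst u, \<zero>\<^bsub>P'\<^esub>)" "(\<zero>\<^bsub>P\<^esub>, snd u)"] by (auto simp: D_def)
    ultimately show "\<kappa> (p1 x, \<zero>\<^bsub>P'\<^esub>) \<oplus>\<^bsub>S\<^esub> \<kappa> (\<zero>\<^bsub>P\<^esub>, p2 x) = x" using u by simp
  next
    show "(\<lambda>x. \<kappa> (x, \<zero>\<^bsub>P'\<^esub>)) \<in> lhom R P S" by (rule lhom_comp[OF j1 h])
    show "(\<lambda>x. \<kappa> (\<zero>\<^bsub>P\<^esub>, x)) \<in> lhom R P' S" by (rule lhom_comp[OF j2 h])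
  qed (use P P' S p1 p2 in \<open>auto simp: D_def\<close>)
  then show ?thesis by blast
qed

lemma projective_biprod:
  fixes S P P' :: "('a, 'm) module"
  assumes "biprod R S P P' i1 i2 p1 p2" "projective_module R P" "projective_module R P'"
  shows "projective_module R S"
proof (rule projectiveI)
  show S: "left_module R S" using assms(1) by (simp add: biprod_def)
  fix M N :: "('a, 'm) module" and g f
  assume M: "left_module R M" and N: "left_module R N" and g: "g \<in> lhom R M N" "g ` carrier M = carrier N"
    and f: "f \<in> lhom R S N"
  have b: "i1 \<in> lhom R P S" "i2 \<in> lhom R P' S" "p1 \<in> lhom R S P" "p2 \<in> lhom R S P'"
    "\<forall>s\<in>carrier S. i1 (p1 s) \<oplus>\<^bsub>S\<^esub> i2 (p2 s) = s" using assms(1) by (auto simp: biprod_def)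
  obtain h1 where h1: "h1 \<in> lhom R P M" "\<forall>x\<in>carrier P. g (h1 x) = f (i1 x)"
    using projective_lift[OF assms(2) M N g lhom_comp[OF b(1) f]] by blast
  obtain h2 where h2: "h2 \<in> lhom R P' M" "\<forall>x\<in>carrier P'. g (h2 x) = f (i2 x)"
    using projective_lift[OF assms(3) M N g lhom_comp[OF b(2) f]] by blast
  have "(\<lambda>s. h1 (p1 s) \<oplus>\<^bsub>M\<^esub> h2 (p2 s)) \<in> lhom R S M"
    by (rule lhom_plus[OF M lhom_comp[OF b(3) h1(1)] lhom_comp[OF b(4) h2(1)]])
  moreover have "g (h1 (p1 s) \<oplus>\<^bsub>M\<^esub> h2 (p2 s)) = f s" if s: "s \<in> carrier S" for s
  proof -
    have c: "p1 s \<in> carrier P" "p2 s \<in> carrier P'" using lhom_closed b s by metis+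
    then have "g (h1 (p1 s) \<oplus>\<^bsub>M\<^esub> h2 (p2 s)) = f (i1 (p1 s)) \<oplus>\<^bsub>N\<^esub> f (i2 (p2 s))"
      using g h1 h2 by (simp add: lhom_add lhom_closed)
    also have "\<dots> = f s" using lhom_add[OF f, of "i1 (p1 s)" "i2 (p2 s)"] c b s by (simp add: lhom_closed)
    finally show ?thesis .
  qed
  ultimately show "\<exists>h\<in>lhom R S M. \<forall>x\<in>carrier S. g (h x) = f x"
    by (intro bexI[of _ "\<lambda>s. h1 (p1 s) \<oplus>\<^bsub>M\<^esub> h2 (p2 s)"] ballI)
qed

subsection \<open>Partial resolutions\<close>

text \<open>Only the carrier changes, so a syzygy keeps the zero and the operations of
  \<open>P\<close>, and iterated kernels stay in one type.\<close>

abbreviation kmod where "kmod P M g \<equiv> P\<lparr>carrier := lker P M g\<rparr>"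

text \<open>
  A projective resolution of \<open>M\<close> truncated after \<open>h\<close> terms, built from successive kernels, whose \<open>k\<close>-th term
  satisfies \<open>\<Phi> k\<close>. The predicate \<open>\<Phi>\<close> records the tops of the terms without naming the terms.
\<close>

primrec res :: "('a, 'r) ring_scheme \<Rightarrow> nat \<Rightarrow> (nat \<Rightarrow> ('a, 'm) module \<Rightarrow> bool) \<Rightarrow> ('a, 'm) module \<Rightarrow> bool" where
  "res R 0 \<Phi> M = left_module R M"
| "res R (Suc h) \<Phi> M = (left_module R M \<and> (\<exists>P g. projective_module R P \<and> \<Phi> 0 P \<and> g \<in> lhom R P M \<and>
     g ` carrier P = carrier M \<and> res R h (\<lambda>k. \<Phi> (Suc k)) (kmod P M g)))"

lemma res_left_module: "res R h \<Phi> M \<Longrightarrow> left_module R M"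
  by (cases h) auto

lemma res_mono:
  "res R h \<Phi> M \<Longrightarrow> (\<And>k P. k < h \<Longrightarrow> projective_module R P \<Longrightarrow> \<Phi> k P \<Longrightarrow> \<Phi>' k P) \<Longrightarrow> res R h \<Phi>' M"
proof (induction h arbitrary: \<Phi> \<Phi>' M)
  case (Suc h)
  from Suc.prems obtain P g where P: "left_module R M" "projective_module R P" "\<Phi> 0 P" "g \<in> lhom R P M"
     "g ` carrier P = carrier M" "res R h (\<lambda>k. \<Phi> (Suc k)) (kmod P M g)" by auto
  have "res R h (\<lambda>k. \<Phi>' (Suc k)) (kmod P M g)"
    by (rule Suc.IH[OF P(6)]) (use Suc.prems(2) in auto)
  moreover have "\<Phi>' 0 P" using Suc.prems(2)[of 0 P] P by simp
  ultimately show ?case using P(1,2,4,5) by auto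
qed simp

lemma kmod_left_module:
  assumes "left_module R P" "left_module R M" "g \<in> lhom R P M"
  shows "left_module R (kmod P M g)"
  by (rule lsub_left_module[OF assms(1) lsub_lker[OF assms]])

lemma lhom_kmod_dom: "f \<in> lhom R P N \<Longrightarrow> f \<in> lhom R (kmod P M g) N"
  by (auto simp: lhom_def lker_def)

lemma lhom_kmod_cod: "f \<in> lhom R N P \<Longrightarrow> (\<And>x. x \<in> carrier N \<Longrightarrow> g (f x) = \<zero>\<^bsub>M\<^esub>) \<Longrightarrow> f \<in> lhom R N (kmod P M g)"
  by (auto simp: lhom_def lker_def)

definition ses where
  "ses R K L A \<alpha> \<beta> \<longleftrightarrow> left_module R K \<and> left_module R L \<and> left_module R A \<and> \<alpha> \<in> lhom R K L \<and> \<beta> \<in> lhom R L A \<and>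
    (\<forall>x\<in>carrier K. \<alpha> x = \<zero>\<^bsub>L\<^esub> \<longrightarrow> x = \<zero>\<^bsub>K\<^esub>) \<and> \<beta> ` carrier L = carrier A \<and>
    (\<forall>y\<in>carrier L. \<beta> y = \<zero>\<^bsub>A\<^esub> \<longleftrightarrow> y \<in> \<alpha> ` carrier K)"

text \<open>Abstracts the one fact about terms that splicing of resolutions uses: how a property of
  a direct sum follows from properties of the summands. Instances are vanishing
  (\<open>comb_pdc\<close>) and the union of tops (\<open>comb_tops\<close>).\<close>

definition comb where
  "comb R \<Phi> \<Phi>' \<Phi>'' \<longleftrightarrow> (\<forall>P P' S i1 i2 p1 p2. \<Phi> P \<longrightarrow> \<Phi>' P' \<longrightarrow> biprod R S P P' i1 i2 p1 p2 \<longrightarrow> \<Phi>'' S)"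

text \<open>The horseshoe lemma: the cover of \<open>A\<close> lifts to \<open>L\<close> by
  projectivity, together with the cover of \<open>K\<close> it covers \<open>L\<close>, and the
  three kernels again form a short exact sequence, to which the induction applies.\<close>

lemma res_horseshoe:
  fixes K L A :: "('a, 'm) module"
  assumes inf: "infinite (UNIV :: 'm set)"
  shows "\<lbrakk>ses R K L A \<alpha> \<beta>; res R h \<Phi> K; res R h \<Phi>' A; \<And>k. comb R (\<Phi> k) (\<Phi>' k) (\<Phi>'' k)\<rbrakk> \<Longrightarrow> res R h \<Phi>'' L"
proof (induction h arbitrary: \<Phi> \<Phi>' \<Phi>'' K L A \<alpha> \<beta>)
  case 0
  then show ?case by (simp add: ses_def)
next
  case (Suc h)
  have lm: "left_module R K" "left_module R L" "left_module R A" and \<alpha>: "\<alpha> \<in> lhom R K L" and \<beta>: "\<beta> \<in> lhom R L A"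
    and inj: "\<forall>x\<in>carrier K. \<alpha> x = \<zero>\<^bsub>L\<^esub> \<longrightarrow> x = \<zero>\<^bsub>K\<^esub>" and surj: "\<beta> ` carrier L = carrier A"
    and ex: "\<forall>y\<in>carrier L. \<beta> y = \<zero>\<^bsub>A\<^esub> \<longleftrightarrow> y \<in> \<alpha> ` carrier K" using Suc.prems(1) by (auto simp: ses_def)
  from Suc.prems(2) obtain P g where P: "projective_module R P" "\<Phi> 0 P" and g: "g \<in> lhom R P K"
     "g ` carrier P = carrier K" and rP: "res R h (\<lambda>k. \<Phi> (Suc k)) (kmod P K g)" by auto
  from Suc.prems(3) obtain P' g' where P': "projective_module R P'" "\<Phi>' 0 P'" and g': "g' \<in> lhom R P' A"
     "g' ` carrier P' = carrier A" and rP': "res R h (\<lambda>k. \<Phi>' (Suc k)) (kmod P' A g')" by auto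
  obtain G where G: "G \<in> lhom R P' L" "\<forall>x\<in>carrier P'. \<beta> (G x) = g' x"
    using projective_lift[OF P'(1) lm(2,3) \<beta> surj g'(1)] by blast
  have lP: "left_module R P" "left_module R P'" using P P' projective_left_module by auto
  obtain S :: "('a, 'm) module" and i1 i2 p1 p2 where S: "biprod R S P P' i1 i2 p1 p2"
    using ex_biprod[OF inf lP] by blast
  then have lS: "left_module R S" and i: "i1 \<in> lhom R P S" "i2 \<in> lhom R P' S" "p1 \<in> lhom R S P" "p2 \<in> lhom R S P'"
    and b1: "\<And>x. x \<in> carrier P \<Longrightarrow> p1 (i1 x) = x \<and> p2 (i1 x) = \<zero>\<^bsub>P'\<^esub>"
    and b2: "\<And>y. y \<in> carrier P' \<Longrightarrow> p2 (i2 y) = y \<and> p1 (i2 y) = \<zero>\<^bsub>P\<^esub>"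
    and b3: "\<And>s. s \<in> carrier S \<Longrightarrow> i1 (p1 s) \<oplus>\<^bsub>S\<^esub> i2 (p2 s) = s"
    by (auto simp: biprod_def)
  interpret K: abelian_group K using lm(1) by (rule left_module_abelian_group)
  interpret L: abelian_group L using lm(2) by (rule left_module_abelian_group)
  interpret A: abelian_group A using lm(3) by (rule left_module_abelian_group)
  interpret P: abelian_group P using lP(1) by (rule left_module_abelian_group)
  interpret P': abelian_group P' using lP(2) by (rule left_module_abelian_group)
  interpret S: abelian_group S using lS by (rule left_module_abelian_group)
  define \<gamma> where "\<gamma> s = \<alpha> (g (p1 s)) \<oplus>\<^bsub>L\<^esub> G (p2 s)" for s
  have \<gamma>: "\<gamma> \<in> lhom R S L" unfolding \<gamma>_def
    by (rule lhom_plus[OF lm(2) lhom_comp[OF lhom_comp[OF i(3) g(1)] \<alpha>] lhom_comp[OF i(4) G(1)]])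
  have \<beta>\<alpha>: "\<beta> (\<alpha> x) = \<zero>\<^bsub>A\<^esub>" if "x \<in> carrier K" for x using ex \<alpha> that by (meson imageI lhom_closed)
  have \<gamma>1: "\<gamma> (i1 x) = \<alpha> (g x)" if "x \<in> carrier P" for x
    using that b1[OF that] lhom_zero[OF lP(2) lm(2) G(1)] g \<alpha> by (simp add: \<gamma>_def lhom_closed)
  have \<gamma>2: "\<gamma> (i2 y) = G y" if "y \<in> carrier P'" for y
    using that b2[OF that] lhom_zero[OF lP(1) lm(1) g(1)] lhom_zero[OF lm(1,2) \<alpha>] G by (simp add: \<gamma>_def lhom_closed)
  have \<beta>\<gamma>: "\<beta> (\<gamma> s) = g' (p2 s)" if "s \<in> carrier S" for s
    using that i g G \<beta>\<alpha> \<alpha> g' \<beta> by (simp add: \<gamma>_def lhom_add[OF \<beta>] lhom_closed)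
  have surj\<gamma>: "\<gamma> ` carrier S = carrier L"
  proof (intro equalityI subsetI)
    fix y assume y: "y \<in> carrier L"
    then have "\<beta> y \<in> g' ` carrier P'" using \<beta> g'(2) lhom_closed by metis
    then obtain q where q: "q \<in> carrier P'" "\<beta> y = g' q" by auto
    have Gq: "G q \<in> carrier L" using G q by (simp add: lhom_closed)
    \<comment> \<open>Subtracting the lift of a preimage of \<open>\<beta> y\<close> moves
      \<open>y\<close> into the kernel of \<beta>, which is the image of \<open>K\<close>.\<close>
    have "\<beta> (y \<ominus>\<^bsub>L\<^esub> G q) = \<zero>\<^bsub>A\<^esub>"
      using lhom_diff[OF lm(2,3) \<beta> y Gq] q G g' by (simp add: A.diff_eq_zero_iff lhom_closed)
    then obtain k where k: "k \<in> carrier K" "y \<ominus>\<^bsub>L\<^esub> G q = \<alpha> k" using ex y Gq by (auto simp: image_iff)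
    then obtain x where x: "x \<in> carrier P" "k = g x" using g by auto
    have "\<gamma> (i1 x \<oplus>\<^bsub>S\<^esub> i2 q) = \<alpha> (g x) \<oplus>\<^bsub>L\<^esub> G q"
      using x q i by (simp add: lhom_add[OF \<gamma>] lhom_closed \<gamma>1 \<gamma>2)
    also have "\<dots> = y" using k x y Gq L.diff_add_cancel_r[OF y Gq] by simp
    finally have "\<gamma> (i1 x \<oplus>\<^bsub>S\<^esub> i2 q) = y" .
    moreover have "i1 x \<oplus>\<^bsub>S\<^esub> i2 q \<in> carrier S" using x q i by (simp add: lhom_closed)
    ultimately show "y \<in> \<gamma> ` carrier S" by blast
  qed (use \<gamma> in \<open>auto simp: lhom_closed\<close>)
  have S2: "ses R (kmod P K g) (kmod S L \<gamma>) (kmod P' A g') i1 p2"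
    unfolding ses_def
  proof (intro conjI)
    show "left_module R (kmod P K g)" "left_module R (kmod S L \<gamma>)" "left_module R (kmod P' A g')"
      using lP lm lS g g' \<gamma> by (auto intro: kmod_left_module)
    show "i1 \<in> lhom R (kmod P K g) (kmod S L \<gamma>)"
      using i(1) \<gamma>1 lhom_zero[OF lm(1,2) \<alpha>] by (auto simp: lhom_def lker_def)
    show "p2 \<in> lhom R (kmod S L \<gamma>) (kmod P' A g')"
      using i(4) \<beta>\<gamma> lhom_zero[OF lm(2,3) \<beta>] by (fastforce simp: lhom_def lker_def)
    show "\<forall>x\<in>carrier (kmod P K g). i1 x = \<zero>\<^bsub>kmod S L \<gamma>\<^esub> \<longrightarrow> x = \<zero>\<^bsub>kmod P K g\<^esub>"
      using b1 lhom_zero[OF lS lP(1) i(3)] by (auto simp: lker_def) metis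
    show "p2 ` carrier (kmod S L \<gamma>) = carrier (kmod P' A g')"
    proof (intro equalityI subsetI)
      fix q assume "q \<in> carrier (kmod P' A g')"
      then have q: "q \<in> carrier P'" "g' q = \<zero>\<^bsub>A\<^esub>" by (auto simp: lker_def)
      then have "\<beta> (G q) = \<zero>\<^bsub>A\<^esub>" "G q \<in> carrier L" using G by (auto simp: lhom_closed)
      then obtain k where k: "k \<in> carrier K" "G q = \<alpha> k" using ex by auto
      then obtain x where x: "x \<in> carrier P" "k = g x" using g by auto
      \<comment> \<open>\<open>G q\<close> lies in the image of \<open>K\<close>; the preimage
        \<open>x\<close> cancels it without changing the component in \<open>P'\<close>.\<close>
      let ?s = "i2 q \<ominus>\<^bsub>S\<^esub> i1 x"
      have s: "?s \<in> carrier S" using x q i by (simp add: lhom_closed)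
      have c: "i2 q \<in> carrier S" "i1 x \<in> carrier S" using x q i by (auto simp: lhom_closed)
      have "\<gamma> ?s = \<zero>\<^bsub>L\<^esub>" using lhom_diff[OF lS lm(2) \<gamma> c] k x q G \<alpha> by (simp add: \<gamma>1 \<gamma>2 L.diff_eq_zero_iff lhom_closed)
      moreover have "p2 ?s = q" using lhom_diff[OF lS lP(2) i(4) c] x q b1 b2 by (simp add: P'.diff_zero)
      ultimately show "q \<in> p2 ` carrier (kmod S L \<gamma>)" using s by (force simp: lker_def)
    next
      fix q assume "q \<in> p2 ` carrier (kmod S L \<gamma>)"
      then show "q \<in> carrier (kmod P' A g')"
        using i(4) \<beta>\<gamma> lhom_zero[OF lm(2,3) \<beta>] by (fastforce simp: lhom_def lker_def)
    qed
    show "\<forall>y\<in>carrier (kmod S L \<gamma>). p2 y = \<zero>\<^bsub>kmod P' A g'\<^esub> \<longleftrightarrow> y \<in> i1 ` carrier (kmod P K g)"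
    proof
      fix y assume "y \<in> carrier (kmod S L \<gamma>)"
      then have y: "y \<in> carrier S" "\<gamma> y = \<zero>\<^bsub>L\<^esub>" by (auto simp: lker_def)
      have p1y: "p1 y \<in> carrier P" using y i by (simp add: lhom_closed)
      show "p2 y = \<zero>\<^bsub>kmod P' A g'\<^esub> \<longleftrightarrow> y \<in> i1 ` carrier (kmod P K g)"
      proof
        assume "p2 y = \<zero>\<^bsub>kmod P' A g'\<^esub>"
        then have z: "p2 y = \<zero>\<^bsub>P'\<^esub>" by simp
        have e: "y = i1 (p1 y)" using b3[OF y(1)] z lhom_zero[OF lP(2) lS i(2)] i p1y by (simp add: lhom_closed)
        then have "\<alpha> (g (p1 y)) = \<zero>\<^bsub>L\<^esub>" using y \<gamma>1[OF p1y] by simp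
        then have "g (p1 y) = \<zero>\<^bsub>K\<^esub>" using inj g p1y by (simp add: lhom_closed)
        then show "y \<in> i1 ` carrier (kmod P K g)" using e p1y by (auto simp: lker_def)
      qed (use b1 in \<open>auto simp: lker_def\<close>)
    qed
  qed
  have "res R h (\<lambda>k. \<Phi>'' (Suc k)) (kmod S L \<gamma>)"
    by (rule Suc.IH[OF S2 rP rP']) (rule Suc.prems(4))
  moreover have "\<Phi>'' 0 S" using Suc.prems(4)[of 0] P(2) P'(2) S unfolding comb_def by blast
  ultimately show ?case using lm(2) projective_biprod[OF S P(1) P'(1)] \<gamma> surj\<gamma> by auto
qed

text \<open>Composing the cover of \<open>B\<close> with \<beta> gives a cover of \<open>C\<close>
  whose kernel is an extension of \<open>A\<close> by the first syzygy of \<open>B\<close>. The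
  horseshoe lemma resolves this kernel; hence the terms of \<open>A\<close> enter one degree higher,
  and term 0 comes from \<open>B\<close> alone.\<close>

lemma res_cone:
  fixes A B C :: "('a, 'm) module"
  assumes inf: "infinite (UNIV :: 'm set)"
    and s: "ses R A B C \<alpha> \<beta>" and rA: "res R h \<Phi> A" and rB: "res R (Suc h) \<Phi>' B"
    and c: "\<And>k. comb R (\<Phi>' (Suc k)) (\<Phi> k) (\<Phi>'' (Suc k))" and 0: "\<And>P. \<Phi>' 0 P \<Longrightarrow> \<Phi>'' 0 P"
  shows "res R (Suc h) \<Phi>'' C"
proof -
  have lm: "left_module R A" "left_module R B" "left_module R C" and \<alpha>: "\<alpha> \<in> lhom R A B" and \<beta>: "\<beta> \<in> lhom R B C"
    and inj: "\<forall>x\<in>carrier A. \<alpha> x = \<zero>\<^bsub>B\<^esub> \<longrightarrow> x = \<zero>\<^bsub>A\<^esub>" and surj: "\<beta> ` carrier B = carrier C"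
    and ex: "\<forall>y\<in>carrier B. \<beta> y = \<zero>\<^bsub>C\<^esub> \<longleftrightarrow> y \<in> \<alpha> ` carrier A" using s by (auto simp: ses_def)
  interpret A: abelian_group A using lm(1) by (rule left_module_abelian_group)
  interpret B: abelian_group B using lm(2) by (rule left_module_abelian_group)
  from rB obtain P g where P: "projective_module R P" "\<Phi>' 0 P" and g: "g \<in> lhom R P B"
     "g ` carrier P = carrier B" and rP: "res R h (\<lambda>k. \<Phi>' (Suc k)) (kmod P B g)" by auto
  have lP: "left_module R P" using P projective_left_module by auto
  interpret P: abelian_group P using lP(1) by (rule left_module_abelian_group)
  define \<gamma> where "\<gamma> x = \<beta> (g x)" for x
  have \<gamma>: "\<gamma> \<in> lhom R P C" unfolding \<gamma>_def by (rule lhom_comp[OF g(1) \<beta>])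
  have surj\<gamma>: "\<gamma> ` carrier P = carrier C" using g(2) surj by (auto simp: \<gamma>_def simp flip: surj g(2))
  have \<alpha>inj: "inj_on \<alpha> (carrier A)"
  proof (rule inj_onI)
    fix x y assume xy: "x \<in> carrier A" "y \<in> carrier A" "\<alpha> x = \<alpha> y"
    have "\<alpha> (x \<ominus>\<^bsub>A\<^esub> y) = \<zero>\<^bsub>B\<^esub>" using lhom_diff[OF lm(1,2) \<alpha> xy(1,2)] xy \<alpha> by (simp add: B.diff_eq_zero_iff lhom_closed)
    then have "x \<ominus>\<^bsub>A\<^esub> y = \<zero>\<^bsub>A\<^esub>" using inj A.minus_closed[OF xy(1,2)] by blast
    then show "x = y" using xy by (simp add: A.diff_eq_zero_iff)
  qed
  \<comment> \<open>The map from the kernel of \<gamma> onto \<open>A\<close>: there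
    \<open>g x\<close> lies in the image of the injective map \<alpha>.\<close>
  define \<delta> where "\<delta> x = inv_into (carrier A) \<alpha> (g x)" for x
  have \<delta>: "\<delta> x \<in> carrier A" "\<alpha> (\<delta> x) = g x" if "x \<in> carrier P" "\<gamma> x = \<zero>\<^bsub>C\<^esub>" for x
  proof -
    have "g x \<in> \<alpha> ` carrier A" using ex that g by (simp add: \<gamma>_def lhom_closed)
    then show "\<delta> x \<in> carrier A" "\<alpha> (\<delta> x) = g x" by (auto simp: \<delta>_def inv_into_into f_inv_into_f)
  qed
  have \<delta>_eq: "\<delta> x = a" if "x \<in> carrier P" "a \<in> carrier A" "g x = \<alpha> a" for x a
    using that \<alpha>inj by (simp add: \<delta>_def)
  have kl: "left_module R (kmod P C \<gamma>)" by (rule kmod_left_module[OF lP lm(3) \<gamma>])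
  have S2: "ses R (kmod P B g) (kmod P C \<gamma>) A (\<lambda>x. x) \<delta>"
    unfolding ses_def
  proof (intro conjI)
    show "left_module R (kmod P B g)" "left_module R (kmod P C \<gamma>)" "left_module R A"
      using lP lm g \<gamma> by (auto intro: kmod_left_module)
    show "(\<lambda>x. x) \<in> lhom R (kmod P B g) (kmod P C \<gamma>)"
      using lhom_zero[OF lm(2,3) \<beta>] by (auto simp: lhom_def lker_def \<gamma>_def)
    show "\<delta> \<in> lhom R (kmod P C \<gamma>) A"
    proof (rule lhomI)
      fix x y assume "x \<in> carrier (kmod P C \<gamma>)" "y \<in> carrier (kmod P C \<gamma>)"
      then show "\<delta> (x \<oplus>\<^bsub>kmod P C \<gamma>\<^esub> y) = \<delta> x \<oplus>\<^bsub>A\<^esub> \<delta> y"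
        using \<delta> g \<alpha> by (auto intro!: \<delta>_eq simp: lker_def lhom_add)
    next
      fix a x assume "a \<in> carrier R" "x \<in> carrier (kmod P C \<gamma>)"
      then show "\<delta> (a \<odot>\<^bsub>kmod P C \<gamma>\<^esub> x) = a \<odot>\<^bsub>A\<^esub> \<delta> x"
        using \<delta> g \<alpha> lP lm by (auto intro!: \<delta>_eq simp: lker_def lhom_smult lm_closed)
    qed (use \<delta> in \<open>auto simp: lker_def\<close>)
    show "\<delta> ` carrier (kmod P C \<gamma>) = carrier A"
    proof (intro equalityI subsetI)
      fix a assume a: "a \<in> carrier A"
      then have "\<alpha> a \<in> carrier B" using \<alpha> by (simp add: lhom_closed)
      then obtain x where x: "x \<in> carrier P" "\<alpha> a = g x" using g(2) by (metis imageE)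
      moreover have "\<gamma> x = \<zero>\<^bsub>C\<^esub>" using ex a x \<open>\<alpha> a \<in> carrier B\<close> by (auto simp: \<gamma>_def simp flip: x(2))
      ultimately show "a \<in> \<delta> ` carrier (kmod P C \<gamma>)" using \<delta>_eq[OF x(1) a] by (force simp: lker_def)
    qed (use \<delta> in \<open>auto simp: lker_def\<close>)
    show "\<forall>y\<in>carrier (kmod P C \<gamma>). \<delta> y = \<zero>\<^bsub>A\<^esub> \<longleftrightarrow> y \<in> (\<lambda>x. x) ` carrier (kmod P B g)"
    proof
      fix y assume "y \<in> carrier (kmod P C \<gamma>)"
      then have y: "y \<in> carrier P" "\<gamma> y = \<zero>\<^bsub>C\<^esub>" by (auto simp: lker_def)
      have "\<delta> y = \<zero>\<^bsub>A\<^esub> \<longleftrightarrow> g y = \<zero>\<^bsub>B\<^esub>"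
        using \<delta>[OF y] \<delta>_eq[OF y(1) A.zero_closed] lhom_zero[OF lm(1,2) \<alpha>] by auto
      then show "\<delta> y = \<zero>\<^bsub>A\<^esub> \<longleftrightarrow> y \<in> (\<lambda>x. x) ` carrier (kmod P B g)" using y by (auto simp: lker_def)
    qed
  qed auto
  have "res R h (\<lambda>k. \<Phi>'' (Suc k)) (kmod P C \<gamma>)" by (rule res_horseshoe[OF inf S2 rP rA c])
  then show ?thesis using P 0 \<gamma> surj\<gamma> lm(3) by auto
qed

subsection \<open>Resolutions as sequences\<close>

lemma res_seq:
  "res R h \<Phi> M \<Longrightarrow> \<exists>P K g. K 0 = M \<and> (\<forall>k\<le>h. left_module R (K k)) \<and> (\<forall>k<h. projective_module R (P k) \<and> \<Phi> k (P k) \<and>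
     g k \<in> lhom R (P k) (K k) \<and> g k ` carrier (P k) = carrier (K k) \<and> K (Suc k) = kmod (P k) (K k) (g k))"
proof (induction h arbitrary: \<Phi> M)
  case 0
  then show ?case by (intro exI[of _ "\<lambda>_. M"]) auto
next
  case (Suc h)
  from Suc.prems obtain P g where P: "left_module R M" "projective_module R P" "\<Phi> 0 P" "g \<in> lhom R P M"
     "g ` carrier P = carrier M" "res R h (\<lambda>k. \<Phi> (Suc k)) (kmod P M g)" by auto
  from Suc.IH[OF P(6)] obtain P' K' g' where K': "K' 0 = kmod P M g" "\<forall>k\<le>h. left_module R (K' k)"
    "\<forall>k<h. projective_module R (P' k) \<and> \<Phi> (Suc k) (P' k) \<and>
     g' k \<in> lhom R (P' k) (K' k) \<and> g' k ` carrier (P' k) = carrier (K' k) \<and> K' (Suc k) = kmod (P' k) (K' k) (g' k)" by blast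
  show ?case
    by (rule exI[of _ "case_nat P P'"], rule exI[of _ "case_nat M K'"], rule exI[of _ "case_nat g g'"])
      (use P K' in \<open>auto split: nat.split\<close>)
qed

definition pdc where
  "pdc N k P \<longleftrightarrow> (k > (N::nat) \<longrightarrow> carrier P = {\<zero>\<^bsub>P\<^esub>})"

text \<open>Of the \<open>N + 2\<close> terms the last one, in degree \<open>N + 1\<close>,
  vanishes. It covers the kernel of \<open>g N\<close>, so \<open>g N\<close> is injective and the
  resolution can be cut off.\<close>

lemma res_pdc_projective_resolution:
  fixes M :: "('a, 'm) module"
  assumes "res R (N + 2) (pdc N) M"
  shows "\<exists>Q D. projective_resolution R M N Q D"
proof -
  obtain P K g where s0: "K 0 = M" "\<forall>k\<le>N + 2. left_module R (K k)"
    "\<forall>k<N + 2. projective_module R (P k) \<and> pdc N k (P k) \<and>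
     g k \<in> lhom R (P k) (K k) \<and> g k ` carrier (P k) = carrier (K k) \<and> K (Suc k) = kmod (P k) (K k) (g k)"
    using res_seq[OF assms] by (elim exE conjE) (rule that)
  note s = s0(1) s0(2)[rule_format] s0(3)[rule_format]
  define Q where "Q = case_nat M P"
  \<comment> \<open>\<open>K (Suc j)\<close> is \<open>P j\<close> with a smaller carrier and has
    the same zero; exactness in \<open>projective_resolution\<close> refers to the zero of
    \<open>Q k\<close>.\<close>
  have zero: "\<zero>\<^bsub>Q k\<^esub> = \<zero>\<^bsub>K k\<^esub>" if "k < N + 2" for k
    using s(1) s(3)[of "k - 1"] that by (cases k) (auto simp: Q_def)
  have "projective_resolution R M N Q g"
    unfolding projective_resolution_def left_module_hom_eq_lhom
  proof (intro conjI allI impI)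
    show "Q 0 = M" by (simp add: Q_def)
    show "projective_module R (Q (Suc i))" if "i \<le> N" for i using s(3)[of i] that by (simp add: Q_def)
    show "g i \<in> lhom R (Q (Suc i)) (Q i)" if "i \<le> N" for i
    proof (cases i)
      case 0
      then show ?thesis using s(1) s(3)[of 0] by (simp add: Q_def)
    next
      case (Suc j)
      then have "K i = kmod (P j) (K j) (g j)" "g i \<in> lhom R (P i) (K i)" using s(3)[of j] s(3)[of i] that by auto
      then show ?thesis using Suc by (auto simp: Q_def lhom_def lker_def)
    qed
    show "g 0 ` carrier (Q 1) = carrier M" using s(1) s(3)[of 0] by (simp add: Q_def)
    show "g (Suc i) ` carrier (Q (Suc (Suc i))) = {u \<in> carrier (Q (Suc i)). g i u = \<zero>\<^bsub>Q i\<^esub>}" if "i < N" for i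
      using s(3)[of i] s(3)[of "Suc i"] that zero[of i] by (simp add: Q_def lker_def)
    show "inj_on (g N) (carrier (Q (Suc N)))"
    proof (rule inj_onI)
      fix x y assume "x \<in> carrier (Q (Suc N))" "y \<in> carrier (Q (Suc N))" and eq: "g N x = g N y"
      then have xy: "x \<in> carrier (P N)" "y \<in> carrier (P N)" by (auto simp: Q_def)
      have P: "left_module R (P N)" and g: "g N \<in> lhom R (P N) (K N)" and K: "left_module R (K N)"
        using s(2)[of N] s(3)[of N] projective_left_module by auto
      interpret P: abelian_group "P N" using P by (rule left_module_abelian_group)
      interpret K: abelian_group "K N" using K by (rule left_module_abelian_group)
      have "g N (x \<ominus>\<^bsub>P N\<^esub> y) = \<zero>\<^bsub>K N\<^esub>"
        using lhom_diff[OF P K g xy] eq xy g by (simp add: K.diff_eq_zero_iff lhom_closed)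
      then have "x \<ominus>\<^bsub>P N\<^esub> y \<in> carrier (K (Suc N))" using s(3)[of N] xy by (simp add: lker_def)
      then have "x \<ominus>\<^bsub>P N\<^esub> y \<in> g (Suc N) ` carrier (P (Suc N))" using s(3)[of "Suc N"] by auto
      moreover have "carrier (P (Suc N)) = {\<zero>\<^bsub>P (Suc N)\<^esub>}" using s(3)[of "Suc N"] by (simp add: pdc_def)
      moreover have "g (Suc N) \<zero>\<^bsub>P (Suc N)\<^esub> = \<zero>\<^bsub>K (Suc N)\<^esub>"
        using lhom_zero s(2)[of "Suc N"] s(3)[of "Suc N"] projective_left_module by fastforce
      ultimately have "x \<ominus>\<^bsub>P N\<^esub> y = \<zero>\<^bsub>P N\<^esub>" using s(3)[of N] by simp
      then show "x = y" using xy by (simp add: P.diff_eq_zero_iff)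
    qed
  qed
  then show ?thesis by blast
qed

subsection \<open>Comparison of resolutions\<close>

text \<open>
  \<open>K\<close> is a direct summand of \<open>K' \<oplus> U\<close> for some projective \<open>U\<close>: the part of Schanuel's lemma that
  is needed to compare the syzygies of two resolutions, stated without forming the direct sum.
\<close>

definition hretr :: "('a, 'r) ring_scheme \<Rightarrow> ('a, 'm) module \<Rightarrow> ('a, 'm) module \<Rightarrow> bool" where
  "hretr R K K' \<longleftrightarrow> left_module R K \<and> left_module R K' \<and> (\<exists>f g \<alpha> \<beta> (U :: ('a, 'm) module). f \<in> lhom R K K' \<and>
      g \<in> lhom R K' K \<and> projective_module R U \<and>
     \<alpha> \<in> lhom R K U \<and> \<beta> \<in> lhom R U K \<and> (\<forall>x\<in>carrier K. g (f x) \<oplus>\<^bsub>K\<^esub> \<beta> (\<alpha> x) = x))"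

lemma hretr_refl:
  fixes K :: "('a, 'm) module"
  assumes K: "left_module R K" shows "hretr R K K"
proof -
  interpret K: abelian_group K using K by (rule left_module_abelian_group)
  let ?U = "K\<lparr>carrier := {\<zero>\<^bsub>K\<^esub>}\<rparr>"
  have U: "left_module R ?U" by (rule lsub_left_module[OF K lsub_zero[OF K]])
  have "projective_module R ?U" by (rule projective_zero_module[OF U]) simp
  moreover have "(\<lambda>_. \<zero>\<^bsub>K\<^esub>) \<in> lhom R K ?U" "(\<lambda>_. \<zero>\<^bsub>K\<^esub>) \<in> lhom R ?U K"
    by (auto intro!: lhomI simp: lm_zero_r[OF K])
  ultimately show ?thesis unfolding hretr_def
    using K lhom_id by (intro conjI exI[of _ "\<lambda>x. x"] exI[of _ "\<lambda>_. \<zero>\<^bsub>K\<^esub>"] exI[of _ ?U]) auto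
qed

text \<open>The maps \<open>f\<close>, \<open>g\<close> and \<beta> lift to the covers as
  \<open>F\<close>, \<open>G\<close> and \<open>B\<close>. The defect \<open>E\<close> of the lifted
  identity takes values in the kernel of \<open>p\<close>, so \<open>P\<close> itself serves as the
  projective module of the next stage.\<close>

lemma hretr_step:
  fixes K K' P Q :: "('a, 'm) module"
  assumes h: "hretr R K K'" and P: "projective_module R P" "p \<in> lhom R P K" "p ` carrier P = carrier K"
    and Q: "projective_module R Q" "q \<in> lhom R Q K'" "q ` carrier Q = carrier K'"
  shows "hretr R (kmod P K p) (kmod Q K' q)"
proof -
  from h obtain f g \<alpha> \<beta> and U :: "('a, 'm) module" where K: "left_module R K" "left_module R K'" and
    f: "f \<in> lhom R K K'" and g: "g \<in> lhom R K' K" and U: "projective_module R U" and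
     \<alpha>: "\<alpha> \<in> lhom R K U" and \<beta>: "\<beta> \<in> lhom R U K" and id: "\<And>x. x \<in> carrier K \<Longrightarrow> g (f x) \<oplus>\<^bsub>K\<^esub> \<beta> (\<alpha> x) = x"
    unfolding hretr_def by blast
  have lm: "left_module R P" "left_module R Q" "left_module R U" using P Q U projective_left_module by auto
  interpret K: abelian_group K using K(1) by (rule left_module_abelian_group)
  interpret P: abelian_group P using lm(1) by (rule left_module_abelian_group)
  obtain F where F: "F \<in> lhom R P Q" "\<And>x. x \<in> carrier P \<Longrightarrow> q (F x) = f (p x)"
    using projective_lift[OF P(1) lm(2) K(2) Q(2,3) lhom_comp[OF P(2) f]] by blast
  obtain G where G: "G \<in> lhom R Q P" "\<And>x. x \<in> carrier Q \<Longrightarrow> p (G x) = g (q x)"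
    using projective_lift[OF Q(1) lm(1) K(1) P(2,3) lhom_comp[OF Q(2) g]] by blast
  obtain B where B: "B \<in> lhom R U P" "\<And>x. x \<in> carrier U \<Longrightarrow> p (B x) = \<beta> x"
    using projective_lift[OF U lm(1) K(1) P(2,3) \<beta>] by blast
  define E where "E x = x \<ominus>\<^bsub>P\<^esub> (G (F x) \<oplus>\<^bsub>P\<^esub> B (\<alpha> (p x)))" for x
  have GB: "(\<lambda>x. G (F x) \<oplus>\<^bsub>P\<^esub> B (\<alpha> (p x))) \<in> lhom R P P"
    by (rule lhom_plus[OF lm(1) lhom_comp[OF F(1) G(1)] lhom_comp[OF lhom_comp[OF P(2) \<alpha>] B(1)]])
  have E: "E \<in> lhom R P P" unfolding E_def by (rule lhom_minus[OF lm(1) lhom_id GB])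
  have pE: "p (E x) = \<zero>\<^bsub>K\<^esub>" if x: "x \<in> carrier P" for x
  proof -
    have c: "G (F x) \<in> carrier P" "B (\<alpha> (p x)) \<in> carrier P" "p x \<in> carrier K" "F x \<in> carrier Q" "\<alpha> (p x) \<in> carrier U"
      using x F G B P \<alpha> by (auto simp: lhom_closed)
    have "p (G (F x) \<oplus>\<^bsub>P\<^esub> B (\<alpha> (p x))) = p x" using c x F G B id by (simp add: lhom_add[OF P(2)])
    then show ?thesis unfolding E_def using lhom_diff[OF lm(1) K(1) P(2) x, of "G (F x) \<oplus>\<^bsub>P\<^esub> B (\<alpha> (p x))"] c
      by (simp add: K.diff_eq_zero_iff)
  qed
  have "F \<in> lhom R (kmod P K p) (kmod Q K' q)"
    using F lhom_zero[OF K f] by (auto simp: lhom_def lker_def)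
  moreover have "G \<in> lhom R (kmod Q K' q) (kmod P K p)"
    using G lhom_zero[OF K(2,1) g] by (auto simp: lhom_def lker_def)
  moreover have "(\<lambda>x. x) \<in> lhom R (kmod P K p) P" by (auto simp: lhom_def lker_def)
  moreover have "E \<in> lhom R P (kmod P K p)" by (rule lhom_kmod_cod[OF E]) (rule pE)
  moreover have "G (F x) \<oplus>\<^bsub>P\<^esub> E x = x" if "x \<in> carrier (kmod P K p)" for x
  proof -
    have x: "x \<in> carrier P" "p x = \<zero>\<^bsub>K\<^esub>" using that by (auto simp: lker_def)
    \<comment> \<open>On the kernel of \<open>p\<close> the summand through \<open>U\<close>
      vanishes, so the identity there is the sum of \<open>G F\<close> and \<open>E\<close>.\<close>
    have "B (\<alpha> (p x)) = \<zero>\<^bsub>P\<^esub>" using x lhom_zero[OF K(1) lm(3) \<alpha>] lhom_zero[OF lm(3,1) B(1)] by simp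
    moreover have c: "G (F x) \<in> carrier P" using x F G by (simp add: lhom_closed)
    ultimately have "E x = x \<ominus>\<^bsub>P\<^esub> G (F x)" by (simp add: E_def)
    then show ?thesis using P.diff_add_cancel_r[OF x(1) c] c x by (simp add: P.a_comm)
  qed
  ultimately show ?thesis unfolding hretr_def
    using kmod_left_module[OF lm(1) K(1) P(2)] kmod_left_module[OF lm(2) K(2) Q(2)] P(1)
    by (intro conjI exI[of _ F] exI[of _ G] exI[of _ "\<lambda>x. x"] exI[of _ E] exI[of _ P]) auto
qed

definition splits where
  "splits R P K p \<longleftrightarrow> (\<exists>\<sigma>\<in>lhom R K P. \<forall>x\<in>carrier K. p (\<sigma> x) = x)"

text \<open>If \<open>K'\<close> is projective, the identity of \<open>K\<close> is a sum of two
  maps factoring through projective modules, and such maps lift through \<open>p\<close>.\<close>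

lemma hretr_projective_splits:
  fixes K K' P :: "('a, 'm) module"
  assumes h: "hretr R K K'" and K': "projective_module R K'" and P: "left_module R P" "p \<in> lhom R P K"
      "p ` carrier P = carrier K"
  shows "splits R P K p"
proof -
  from h obtain f g \<alpha> \<beta> and U :: "('a, 'm) module" where K: "left_module R K" "left_module R K'" and
    f: "f \<in> lhom R K K'" and g: "g \<in> lhom R K' K" and U: "projective_module R U" and
     \<alpha>: "\<alpha> \<in> lhom R K U" and \<beta>: "\<beta> \<in> lhom R U K" and id: "\<And>x. x \<in> carrier K \<Longrightarrow> g (f x) \<oplus>\<^bsub>K\<^esub> \<beta> (\<alpha> x) = x"
    unfolding hretr_def by blast
  obtain G where G: "G \<in> lhom R K' P" "\<And>x. x \<in> carrier K' \<Longrightarrow> p (G x) = g x"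
    using projective_lift[OF K' P(1) K(1) P(2,3) g] by blast
  obtain B where B: "B \<in> lhom R U P" "\<And>x. x \<in> carrier U \<Longrightarrow> p (B x) = \<beta> x"
    using projective_lift[OF U P(1) K(1) P(2,3) \<beta>] by blast
  have "(\<lambda>x. G (f x) \<oplus>\<^bsub>P\<^esub> B (\<alpha> x)) \<in> lhom R K P"
    by (rule lhom_plus[OF P(1) lhom_comp[OF f G(1)] lhom_comp[OF \<alpha> B(1)]])
  moreover have "p (G (f x) \<oplus>\<^bsub>P\<^esub> B (\<alpha> x)) = x" if x: "x \<in> carrier K" for x
    using x f \<alpha> G B P(2) id by (simp add: lhom_add[OF P(2)] lhom_closed)
  ultimately show ?thesis unfolding splits_def
    by (intro bexI[of _ "\<lambda>x. G (f x) \<oplus>\<^bsub>P\<^esub> B (\<alpha> x)"] ballI)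
qed

lemma splits_retraction:
  assumes P: "left_module R P" "left_module R K" "p \<in> lhom R P K" and s: "splits R P K p"
  shows "\<exists>r\<in>lhom R P (kmod P K p). \<forall>x\<in>carrier (kmod P K p). r x = x"
proof -
  interpret P: abelian_group P using P(1) by (rule left_module_abelian_group)
  interpret K: abelian_group K using P(2) by (rule left_module_abelian_group)
  obtain \<sigma> where \<sigma>: "\<sigma> \<in> lhom R K P" "\<And>x. x \<in> carrier K \<Longrightarrow> p (\<sigma> x) = x" using s unfolding splits_def by blast
  let ?r = "\<lambda>x. x \<ominus>\<^bsub>P\<^esub> \<sigma> (p x)"
  have "?r \<in> lhom R P P" by (rule lhom_minus[OF P(1) lhom_id lhom_comp[OF P(3) \<sigma>(1)]])
  moreover have "p (?r x) = \<zero>\<^bsub>K\<^esub>" if x: "x \<in> carrier P" for x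
    using lhom_diff[OF P x, of "\<sigma> (p x)"] x P(3) \<sigma> by (simp add: K.diff_eq_zero_iff lhom_closed)
  ultimately have "?r \<in> lhom R P (kmod P K p)" by (intro lhom_kmod_cod[where f = ?r])
  moreover have "?r x = x" if "x \<in> carrier (kmod P K p)" for x
    using that lhom_zero[OF P(2,1) \<sigma>(1)] by (auto simp: lker_def P.diff_zero)
  ultimately show ?thesis by (intro bexI[of _ ?r] ballI)
qed

text \<open>A split surjection makes its kernel a retract of the projective module \<open>P\<close>;
  hence the next cover splits too, and splitting persists in all higher degrees.\<close>

lemma splits_step:
  fixes K P P2 :: "('a, 'm) module"
  assumes P: "projective_module R P" "left_module R K" "p \<in> lhom R P K" and s: "splits R P K p"
    and P2: "left_module R P2" "p2 \<in> lhom R P2 (kmod P K p)" "p2 ` carrier P2 = carrier (kmod P K p)"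
  shows "splits R P2 (kmod P K p) p2"
proof -
  have lP: "left_module R P" using P(1) by (rule projective_left_module)
  obtain r where r: "r \<in> lhom R P (kmod P K p)" "\<forall>x\<in>carrier (kmod P K p). r x = x"
    using splits_retraction[OF lP P(2,3) s] by blast
  obtain h where h: "h \<in> lhom R P P2" "\<forall>x\<in>carrier P. p2 (h x) = r x"
    using projective_lift[OF P(1) P2(1) kmod_left_module[OF lP P(2,3)] P2(2,3) r(1)] by blast
  then have "h \<in> lhom R (kmod P K p) P2" by (intro lhom_kmod_dom)
  then show ?thesis unfolding splits_def using h r by (intro bexI[of _ h]) (auto simp: lker_def)
qed

text \<open>A resolution of length \<open>m\<close> has a projective syzygy in degree
  \<open>m\<close>. By comparison of syzygies every other resolution splits in degree
  \<open>m\<close>, and then in each degree from \<open>m\<close> on.\<close>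

lemma short_resolution_splits:
  fixes M :: "('a, 'm) module"
  assumes K: "K 0 = M" "\<And>k. k \<le> N \<Longrightarrow> left_module R (K k)"
    "\<And>k. k < N \<Longrightarrow> projective_module R (P k) \<and>
     g k \<in> lhom R (P k) (K k) \<and> g k ` carrier (P k) = carrier (K k) \<and> K (Suc k) = kmod (P k) (K k) (g k)"
    and Q: "projective_resolution R M m Q D" and m: "m \<le> k" "k < N"
  shows "splits R (P k) (K k) (g k)"
proof -
  \<comment> \<open>The syzygies of \<open>Q\<close> in the form that \<open>K\<close> has, so that
    both sequences go through \<open>hretr_step\<close> in parallel.\<close>
  define K' where "K' = (\<lambda>k. case k of 0 \<Rightarrow> M | Suc j \<Rightarrow> kmod (Q (Suc j)) (Q j) (D j))"
  have q: "Q 0 = M" "\<And>i. i \<le> m \<Longrightarrow> projective_module R (Q (Suc i))" "\<And>i. i \<le> m \<Longrightarrow> D i \<in> lhom R (Q (Suc i)) (Q i)"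
    "D 0 ` carrier (Q 1) = carrier M"
    "\<And>i. i < m \<Longrightarrow> D (Suc i) ` carrier (Q (Suc (Suc i))) = {u \<in> carrier (Q (Suc i)). D i u = \<zero>\<^bsub>Q i\<^esub>}"
    "inj_on (D m) (carrier (Q (Suc m)))"
    using Q unfolding projective_resolution_def left_module_hom_eq_lhom by auto
  have lQ: "left_module R (Q i)" if "i \<le> Suc m" for i
    using q(1) K(1) K(2)[of 0] q(2)[of "i - 1"] projective_left_module that by (cases i) auto
  have surj: "D i ` carrier (Q (Suc i)) = carrier (K' i)" if "i \<le> m" for i
    using q(4) q(5)[of "i - 1"] that by (cases i) (auto simp: K'_def lker_def)
  have hom: "D i \<in> lhom R (Q (Suc i)) (K' i)" if "i \<le> m" for i
  proof (cases i)
    case 0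
    then show ?thesis using q(1) q(3)[of 0] by (simp add: K'_def)
  next
    case (Suc j)
    then show ?thesis using q(3)[OF that] surj[OF that] by (auto simp: lhom_def K'_def)
  qed
  have ker: "K' (Suc i) = kmod (Q (Suc i)) (K' i) (D i)" for i
    by (cases i) (auto simp: K'_def lker_def q(1))
  have lK': "left_module R (K' i)" if "i \<le> m" for i
  proof (cases i)
    case 0
    then show ?thesis using lQ[of 0] q(1) by (simp add: K'_def)
  next
    case (Suc j)
    then show ?thesis using that lQ[of j] lQ[of "Suc j"] q(3)[of j] by (auto simp: K'_def intro!: kmod_left_module)
  qed
  have retr: "hretr R (K i) (K' i)" if "i \<le> m" for i
    using that
  proof (induction i)
    case 0
    then show ?case using hretr_refl[of R M] K(1) K(2)[of 0] by (simp add: K'_def)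
  next
    case (Suc i)
    then show ?case using hretr_step[of R "K i" "K' i" "P i" "g i" "Q (Suc i)"
        "D i"] K(3)[of i] m q(2)[of i] hom[of i] surj[of i] ker[of i]
      by simp
  qed
  \<comment> \<open>The last map is injective, so it identifies \<open>Q (Suc m)\<close> with the
    syzygy in degree \<open>m\<close>.\<close>
  have "projective_module R (K' m)"
    by (rule projective_iso[OF q(2)[of m] lK'[of m] hom[of m] surj[of m] q(6)]) auto
  then have 0: "splits R (P m) (K m) (g m)"
    using hretr_projective_splits[OF retr[of m]] K(3)[of m] m projective_left_module by auto
  have "k < N \<longrightarrow> splits R (P k) (K k) (g k)" using m(1)
  proof (induction rule: dec_induct)
    case base
    then show ?case using 0 by simp
  next
    case (step i)
    show ?case
    proof
      assume i: "Suc i < N"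
      have Ki: "K (Suc i) = kmod (P i) (K i) (g i)" using K(3)[of i] i by simp
      have "splits R (P (Suc i)) (kmod (P i) (K i) (g i)) (g (Suc i))"
        by (rule splits_step) (use step K(2)[of i] K(3)[of i] K(3)[of "Suc i"] i Ki projective_left_module in auto)
      then show "splits R (P (Suc i)) (K (Suc i)) (g (Suc i))" by (simp add: Ki)
    qed
  qed
  then show ?thesis using m by simp
qed

subsection \<open>Tops\<close>

text \<open>The finite sums of elements \<open>a x\<close> with \<open>a\<close> in
  \<open>B\<close>, in short \<open>B M\<close>, built by adding one summand at a time.\<close>

inductive_set rad :: "'a set \<Rightarrow> ('a, 'b) module \<Rightarrow> 'b set" for B and M where
  zero: "\<zero>\<^bsub>M\<^esub> \<in> rad B M"
| gen: "\<lbrakk>a \<in> B; x \<in> carrier M; y \<in> rad B M\<rbrakk> \<Longrightarrow> (a \<odot>\<^bsub>M\<^esub> x) \<oplus>\<^bsub>M\<^esub> y \<in> rad B M"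

text \<open>
  If \<open>e\<close> is a primitive idempotent and \<open>B\<close> is \<open>e\<close> times the radical of the ring, this says that
  the simple module at \<open>e\<close> does not occur in the top of \<open>M\<close>.
\<close>

definition notop where
  "notop e B M \<longleftrightarrow> (\<forall>x\<in>carrier M. e \<odot>\<^bsub>M\<^esub> x \<in> rad B M)"

lemma rad_carrier:
  assumes M: "left_module R M" and B: "B \<subseteq> carrier R" and x: "x \<in> rad B M" shows "x \<in> carrier M"
proof -
  interpret M: abelian_group M using M by (rule left_module_abelian_group)
  show ?thesis using x by induction (use M B lm_closed in \<open>fastforce+\<close>)
qed

lemma rad_hom:
  assumes M: "left_module R M" and N: "left_module R N" and B: "B \<subseteq> carrier R" and f: "f \<in> lhom R M N" and x: "x \<in> rad B M"
  shows "f x \<in> rad B N"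
  using x
proof induction
  case zero
  then show ?case using lhom_zero[OF M N f] by (simp add: rad.zero)
next
  case (gen a x y)
  have "f ((a \<odot>\<^bsub>M\<^esub> x) \<oplus>\<^bsub>M\<^esub> y) = (a \<odot>\<^bsub>N\<^esub> f x) \<oplus>\<^bsub>N\<^esub> f y"
    using gen B rad_carrier[OF M B] f M by (simp add: lhom_add lhom_smult lm_closed subset_iff)
  then show ?case using gen f by (simp add: rad.gen lhom_closed)
qed

lemma rad_add:
  assumes M: "left_module R M" and B: "B \<subseteq> carrier R" and x: "x \<in> rad B M" and y: "y \<in> rad B M"
  shows "x \<oplus>\<^bsub>M\<^esub> y \<in> rad B M"
proof -
  interpret M: abelian_group M using M by (rule left_module_abelian_group)
  show ?thesis using x
  proof induction
    case zero
    then show ?case using y rad_carrier[OF M B y] by simp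
  next
    case (gen a x z)
    have "(a \<odot>\<^bsub>M\<^esub> x) \<oplus>\<^bsub>M\<^esub> z \<oplus>\<^bsub>M\<^esub> y = (a \<odot>\<^bsub>M\<^esub> x) \<oplus>\<^bsub>M\<^esub> (z \<oplus>\<^bsub>M\<^esub> y)"
      using gen B rad_carrier[OF M B] y M by (simp add: M.a_assoc lm_closed subset_iff)
    then show ?case using gen by (simp add: rad.gen)
  qed
qed

lemma rad_smult:
  assumes M: "left_module R M" and B: "B \<subseteq> carrier R" and e: "e \<in> carrier R" "\<And>b. b \<in> B \<Longrightarrow> e \<otimes>\<^bsub>R\<^esub> b \<in> B" and x: "x \<in> rad B M"
  shows "e \<odot>\<^bsub>M\<^esub> x \<in> rad B M"
  using x
proof induction
  case zero
  then show ?case using lm_zero_r[OF M e(1)] by (simp add: rad.zero)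
next
  case (gen a x y)
  have "e \<odot>\<^bsub>M\<^esub> ((a \<odot>\<^bsub>M\<^esub> x) \<oplus>\<^bsub>M\<^esub> y) = ((e \<otimes>\<^bsub>R\<^esub> a) \<odot>\<^bsub>M\<^esub> x) \<oplus>\<^bsub>M\<^esub> (e \<odot>\<^bsub>M\<^esub> y)"
    using gen B rad_carrier[OF M B] e M by (simp add: lm_add_r lm_assoc lm_closed subset_iff)
  then show ?case using gen e by (simp add: rad.gen)
qed

lemma notop_surj:
  assumes M: "left_module R M" and N: "left_module R N" and B: "B \<subseteq> carrier R" "e \<in> carrier R" and f: "f \<in> lhom R M N"
    "f ` carrier M = carrier N" and n: "notop e B M"
  shows "notop e B N"
  unfolding notop_def
proof
  fix y assume "y \<in> carrier N"
  then obtain x where x: "x \<in> carrier M" "y = f x" using f(2) by auto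
  have "f (e \<odot>\<^bsub>M\<^esub> x) \<in> rad B N" using rad_hom[OF M N B(1) f(1)] n x by (simp add: notop_def)
  then show "e \<odot>\<^bsub>N\<^esub> y \<in> rad B N" using x B f by (simp add: lhom_smult)
qed

text \<open>The summands are images of the sum under the projections; conversely the injections
  carry the radicals of the summands into that of the sum.\<close>

lemma notop_biprod:
  assumes S: "biprod R S P P' i1 i2 p1 p2" and B: "B \<subseteq> carrier R" "e \<in> carrier R"
  shows "notop e B S \<longleftrightarrow> notop e B P \<and> notop e B P'"
proof -
  have lm: "left_module R S" "left_module R P" "left_module R P'" and i: "i1 \<in> lhom R P S" "i2 \<in> lhom R P' S"
      "p1 \<in> lhom R S P" "p2 \<in> lhom R S P'"
    and b1: "\<And>x. x \<in> carrier P \<Longrightarrow> p1 (i1 x) = x"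
    and b2: "\<And>y. y \<in> carrier P' \<Longrightarrow> p2 (i2 y) = y"
    and b3: "\<And>s. s \<in> carrier S \<Longrightarrow> i1 (p1 s) \<oplus>\<^bsub>S\<^esub> i2 (p2 s) = s"
    using S by (auto simp: biprod_def)
  have "p1 ` carrier S = carrier P"
    using b1 i by (auto simp: lhom_closed image_iff) (metis lhom_closed)
  moreover have "p2 ` carrier S = carrier P'"
    using b2 i by (auto simp: lhom_closed image_iff) (metis lhom_closed)
  moreover have "notop e B S" if n: "notop e B P" "notop e B P'"
    unfolding notop_def
  proof
    fix s assume s: "s \<in> carrier S"
    have c: "p1 s \<in> carrier P" "p2 s \<in> carrier P'" using s i by (auto simp: lhom_closed)
    have "i1 (e \<odot>\<^bsub>P\<^esub> p1 s) \<oplus>\<^bsub>S\<^esub> i2 (e \<odot>\<^bsub>P'\<^esub> p2 s) \<in> rad B S"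
      using n c by (intro rad_add[OF lm(1) B(1)] rad_hom[OF lm(2,1) B(1) i(1)] rad_hom[OF lm(3,1) B(1) i(2)]) (auto
          simp: notop_def)
    moreover have "i1 (e \<odot>\<^bsub>P\<^esub> p1 s) \<oplus>\<^bsub>S\<^esub> i2 (e \<odot>\<^bsub>P'\<^esub> p2 s) = e \<odot>\<^bsub>S\<^esub> s"
      using lm_add_r[OF lm(1) B(2), of "i1 (p1 s)" "i2 (p2 s)"] c i b3[OF s] B(2) by (simp add: lhom_smult lhom_closed)
    ultimately show "e \<odot>\<^bsub>S\<^esub> s \<in> rad B S" by simp
  qed
  ultimately show ?thesis using notop_surj[OF lm(1,2) B i(3)] notop_surj[OF lm(1,3) B i(4)] by blast
qed

text \<open>Right exactness of the top at \<open>e\<close>: the image of \<open>e x\<close> in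
  \<open>K\<close> is radical and lifts to a radical element \<open>w\<close> of \<open>P\<close>,
  and the difference of \<open>e x\<close> and \<open>w\<close> lies in the kernel, where it is
  controlled by the second hypothesis.\<close>

lemma notop_projective_cover:
  assumes P: "left_module R P" "left_module R K" "p \<in> lhom R P K" "p ` carrier P = carrier K"
    and B: "B \<subseteq> carrier R" "e \<in> carrier R" "e \<otimes>\<^bsub>R\<^esub> e = e" "\<And>b. b \<in> B \<Longrightarrow> e \<otimes>\<^bsub>R\<^esub> b \<in> B"
    and n: "notop e B K" "notop e B (kmod P K p)"
  shows "notop e B P"
  unfolding notop_def
proof
  fix x assume x: "x \<in> carrier P"
  interpret P: abelian_group P using P(1) by (rule left_module_abelian_group)
  interpret K: abelian_group K using P(2) by (rule left_module_abelian_group)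
  have lift: "\<exists>w\<in>rad B P. p w = v" if "v \<in> rad B K" for v
    using that
  proof induction
    case zero
    then show ?case using lhom_zero[OF P(1-3)] rad.zero by blast
  next
    case (gen a u v)
    then obtain w where w: "w \<in> rad B P" "p w = v" by blast
    obtain u' where u': "u' \<in> carrier P" "p u' = u" using P(4) gen(2) by (metis imageE)
    have "p ((a \<odot>\<^bsub>P\<^esub> u') \<oplus>\<^bsub>P\<^esub> w) = (a \<odot>\<^bsub>K\<^esub> u) \<oplus>\<^bsub>K\<^esub> v"
      using gen w u' B(1) rad_carrier[OF P(1) B(1) w(1)] P(1,3) by (auto simp: lhom_add lhom_smult lm_closed subset_iff)
    then show ?case using rad.gen[OF gen(1) u'(1) w(1)] by blast
  qed
  have "p (e \<odot>\<^bsub>P\<^esub> x) \<in> rad B K" using n(1) x P(3) B(2) by (simp add: notop_def lhom_smult lhom_closed)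
  then obtain w where w: "w \<in> rad B P" "p w = p (e \<odot>\<^bsub>P\<^esub> x)" using lift by blast
  have cw: "w \<in> carrier P" by (rule rad_carrier[OF P(1) B(1) w(1)])
  have ce: "e \<odot>\<^bsub>P\<^esub> x \<in> carrier P" using P(1) B(2) x by (rule lm_closed)
  let ?k = "e \<odot>\<^bsub>P\<^esub> x \<ominus>\<^bsub>P\<^esub> w"
  have "p ?k = \<zero>\<^bsub>K\<^esub>" using lhom_diff[OF P(1-3) ce cw] w ce P(3) by (simp add: K.diff_eq_zero_iff lhom_closed)
  then have k: "?k \<in> carrier (kmod P K p)" using ce cw by (simp add: lker_def)
  have "e \<odot>\<^bsub>P\<^esub> ?k \<in> rad B (kmod P K p)" using n(2) k by (simp add: notop_def)
  then have "e \<odot>\<^bsub>P\<^esub> ?k \<in> rad B P"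
    using rad_hom[OF kmod_left_module[OF P(1-3)] P(1) B(1) lhom_kmod_dom[OF lhom_id]] by blast
  moreover have "e \<odot>\<^bsub>P\<^esub> w \<in> rad B P" using rad_smult[OF P(1) B(1,2,4) w(1)] .
  ultimately have "e \<odot>\<^bsub>P\<^esub> ?k \<oplus>\<^bsub>P\<^esub> e \<odot>\<^bsub>P\<^esub> w \<in> rad B P" by (rule rad_add[OF P(1) B(1)])
  \<comment> \<open>Elements of the kernel become radical only after multiplication by
    \<open>e\<close>; idempotence then gives \<open>e x\<close> back.\<close>
  also have "e \<odot>\<^bsub>P\<^esub> ?k \<oplus>\<^bsub>P\<^esub> e \<odot>\<^bsub>P\<^esub> w = e \<odot>\<^bsub>P\<^esub> x"
    using lm_add_r[OF P(1) B(2), of ?k w] ce cw P.diff_add_cancel_r[OF ce cw] lm_assoc[OF P(1) B(2) B(2) x] B(3) by simp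
  finally show "e \<odot>\<^bsub>P\<^esub> x \<in> rad B P" .
qed

text \<open>If \<open>m < N\<close>, the cover in degree \<open>N - 1\<close> splits, so the syzygy
  in degree \<open>N\<close> is a retract of \<open>P (N - 1)\<close> and lacks the simple module at
  \<open>e\<close> in its top. The next syzygy lacks it as an image of \<open>P (N + 1)\<close>, and
  so \<open>P N\<close> would lack it. A vertex absent from both neighbouring degrees thus cannot be
  cancelled.\<close>

lemma resolution_length_ge:
  fixes M :: "('a, 'm) module"
  assumes r: "res R (N + 2) \<Phi> M" and Q: "projective_resolution R M m Q D"
    and B: "B \<subseteq> carrier R" "e \<in> carrier R" "e \<otimes>\<^bsub>R\<^esub> e = e" "\<And>b. b \<in> B \<Longrightarrow> e \<otimes>\<^bsub>R\<^esub> b \<in> B"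
    and N: "\<And>P. \<Phi> N P \<Longrightarrow> \<not> notop e B P" "\<And>P. N > 0 \<Longrightarrow> \<Phi> (N - 1) P \<Longrightarrow> notop e B P" "\<And>P. \<Phi> (Suc N) P \<Longrightarrow> notop e B P"
  shows "N \<le> m"
proof (rule ccontr)
  assume "\<not> N \<le> m"
  then have m: "m \<le> N - 1" "N - 1 < N + 2" "N > 0" by auto
  obtain P K g where s0: "K 0 = M" "\<forall>k\<le>N + 2. left_module R (K k)"
    "\<forall>k<N + 2. projective_module R (P k) \<and> \<Phi> k (P k) \<and>
     g k \<in> lhom R (P k) (K k) \<and> g k ` carrier (P k) = carrier (K k) \<and> K (Suc k) = kmod (P k) (K k) (g k)"
    using res_seq[OF r] by (elim exE conjE) (rule that)
  note s = s0(1) s0(2)[rule_format] s0(3)[rule_format]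
  have lP: "left_module R (P k)" if "k < N + 2" for k using s(3)[OF that] projective_left_module by blast
  have "splits R (P (N - 1)) (K (N - 1)) (g (N - 1))"
    by (rule short_resolution_splits[where K = K and N = "N + 2" and P = P and g =
        g, OF s(1,2) _ Q m(1,2)]) (use s(3) in auto)
  then obtain \<rho> where \<rho>: "\<rho> \<in> lhom R (P (N - 1)) (K N)" "\<And>x. x \<in> carrier (K N) \<Longrightarrow> \<rho> x = x"
    using splits_retraction[of R "P (N - 1)" "K (N - 1)"
        "g (N - 1)"] lP[of "N - 1"] s(2)[of "N - 1"] s(3)[of "N - 1"] m by auto
  have "K N = kmod (P (N - 1)) (K (N - 1)) (g (N - 1))" using s(3)[of "N - 1"] m by simp
  then have "carrier (K N) \<subseteq> carrier (P (N - 1))" by (auto simp: lker_def)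
  then have "\<rho> ` carrier (P (N - 1)) = carrier (K N)" using \<rho> by (force simp: lhom_closed image_iff)
  moreover have "notop e B (P (N - 1))" using N(2) m s(3)[of "N - 1"] by simp
  ultimately have n1: "notop e B (K N)"
    using notop_surj[OF lP s(2) B(1,2) \<rho>(1)] m by simp
  have "notop e B (K (Suc N))"
    using notop_surj[OF lP s(2) B(1,2), of "Suc N" "Suc N" "g (Suc N)"] N(3) s(3)[of "Suc N"] by simp
  then have "notop e B (kmod (P N) (K N) (g N))" using s(3)[of N] by simp
  then have "notop e B (P N)"
    using notop_projective_cover[OF lP s(2) _ _ B n1, of N "g N"] s(3)[of N] by simp
  then show False using N(1) s(3)[of N] by simp
qed

subsection \<open>Zero modules and projective dimension bounds\<close>

lemma lm_finsum_l:
  assumes M: "left_module R M" and x: "x \<in> carrier M" and "finite S" and "a \<in> S \<rightarrow> carrier R"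
  shows "(\<Oplus>\<^bsub>R\<^esub>j\<in>S. a j) \<odot>\<^bsub>M\<^esub> x = (\<Oplus>\<^bsub>M\<^esub>j\<in>S. a j \<odot>\<^bsub>M\<^esub> x)"
proof -
  interpret R: ring R using M by (rule left_module_ring)
  interpret M: abelian_group M using M by (rule left_module_abelian_group)
  show ?thesis using assms(3,4)
  proof induction
    case (insert j S)
    then have *: "a j \<in> carrier R" "(\<Oplus>\<^bsub>R\<^esub>j\<in>S. a j) \<in> carrier R" "(\<lambda>j. a j \<odot>\<^bsub>M\<^esub> x) \<in> S \<rightarrow> carrier M"
      using M x by (auto intro!: R.finsum_closed lm_closed)
    then show ?case using insert M x by (simp add: lm_add_l lm_closed)
  qed (use lm_zero_l[OF M x] in simp)
qed

lemma lm_finsum_r: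
  assumes M: "left_module R M" and a: "a \<in> carrier R" and "finite S" and "x \<in> S \<rightarrow> carrier M"
  shows "a \<odot>\<^bsub>M\<^esub> (\<Oplus>\<^bsub>M\<^esub>j\<in>S. x j) = (\<Oplus>\<^bsub>M\<^esub>j\<in>S. a \<odot>\<^bsub>M\<^esub> x j)"
proof -
  interpret M: abelian_group M using M by (rule left_module_abelian_group)
  show ?thesis using assms(3,4)
  proof induction
    case (insert j S)
    then have *: "x j \<in> carrier M" "(\<Oplus>\<^bsub>M\<^esub>j\<in>S. x j) \<in> carrier M" "(\<lambda>j. a \<odot>\<^bsub>M\<^esub> x j) \<in> S \<rightarrow> carrier M"
      using M a by (auto intro!: M.finsum_closed lm_closed)
    then show ?case using insert M a by (simp add: lm_add_r lm_closed)
  qed (use lm_zero_r[OF M a] in simp)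
qed

lemma res_zero_module:
  fixes M :: "('a, 'm) module"
  shows "\<lbrakk>left_module R M; carrier M = {\<zero>\<^bsub>M\<^esub>};
    \<And>k P. \<lbrakk>left_module R P; carrier P = {\<zero>\<^bsub>P\<^esub>}\<rbrakk> \<Longrightarrow> \<Phi> k P\<rbrakk> \<Longrightarrow> res R h \<Phi> M"
proof (induction h arbitrary: M \<Phi>)
  case (Suc h)
  have id: "(\<lambda>x. x) \<in> lhom R M M" by (rule lhom_id)
  have "res R h (\<lambda>k. \<Phi> (Suc k)) (kmod M M (\<lambda>x. x))"
    by (rule Suc.IH) (use Suc.prems kmod_left_module[OF Suc.prems(1,1) id] in \<open>auto simp: lker_def\<close>)
  then show ?case
    using Suc.prems id projective_zero_module[OF Suc.prems(1,2)] by (auto intro!: exI[of _ M] exI[of _ "\<lambda>x. x"])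
qed simp

lemma res_projective:
  fixes P :: "('a, 'm) module"
  assumes P: "projective_module R P" "\<Phi> 0 P"
    and z: "\<And>k Q. \<lbrakk>left_module R Q; carrier Q = {\<zero>\<^bsub>Q\<^esub>}\<rbrakk> \<Longrightarrow> \<Phi> (Suc k) Q"
  shows "res R h \<Phi> P"
proof (cases h)
  case 0
  then show ?thesis using projective_left_module[OF P(1)] by simp
next
  case (Suc h)
  have lP: "left_module R P" by (rule projective_left_module[OF P(1)])
  interpret P: abelian_group P using lP by (rule left_module_abelian_group)
  have id: "(\<lambda>x. x) \<in> lhom R P P" by (rule lhom_id)
  have "res R h (\<lambda>k. \<Phi> (Suc k)) (kmod P P (\<lambda>x. x))"
    by (rule res_zero_module) (use z kmod_left_module[OF lP lP id] in \<open>auto simp: lker_def\<close>)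
  then show ?thesis using Suc P lP id by (auto intro!: exI[of _ P] exI[of _ "\<lambda>x. x"])
qed

lemma comb_pdc: "comb R (pdc N k) (pdc N k) (pdc N k)"
  unfolding comb_def pdc_def
proof (intro allI impI)
  fix P P' S i1 i2 p1 p2
  assume P: "N < k \<longrightarrow> carrier P = {\<zero>\<^bsub>P\<^esub>}" "N < k \<longrightarrow> carrier P' = {\<zero>\<^bsub>P'\<^esub>}" and b: "biprod R S P P' i1 i2 p1 p2" and k: "N < k"
  have lm: "left_module R S" "left_module R P" "left_module R P'" and i: "i1 \<in> lhom R P S" "i2 \<in> lhom R P' S"
      "p1 \<in> lhom R S P" "p2 \<in> lhom R S P'"
    and b3: "\<And>s. s \<in> carrier S \<Longrightarrow> i1 (p1 s) \<oplus>\<^bsub>S\<^esub> i2 (p2 s) = s"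
    using b by (auto simp: biprod_def)
  interpret S: abelian_group S using lm(1) by (rule left_module_abelian_group)
  have "s = \<zero>\<^bsub>S\<^esub>" if s: "s \<in> carrier S" for s
  proof -
    have "p1 s = \<zero>\<^bsub>P\<^esub>" "p2 s = \<zero>\<^bsub>P'\<^esub>" using P k lhom_closed[OF i(3) s] lhom_closed[OF i(4) s] by auto
    then show ?thesis using b3[OF s] lhom_zero[OF lm(2,1) i(1)] lhom_zero[OF lm(3,1) i(2)] by simp
  qed
  then show "carrier S = {\<zero>\<^bsub>S\<^esub>}" by auto
qed

subsection \<open>Copowers\<close>

text \<open>A direct sum of copies of \<open>M\<close> indexed by \<open>B\<close>. Since modules of
  any size occur, a module concentrated at one vertex can be an infinite sum of simple ones.\<close>

definition cop :: "'i set \<Rightarrow> ('a, 'b) module \<Rightarrow> ('a, 'i \<Rightarrow> 'b) module" where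
  "cop B M = \<lparr>carrier = {\<phi>. (\<forall>b. \<phi> b \<in> carrier M) \<and> (\<forall>b. b \<notin> B \<longrightarrow> \<phi> b = \<zero>\<^bsub>M\<^esub>) \<and> finite {b. \<phi> b \<noteq> \<zero>\<^bsub>M\<^esub>}},
     monoid.mult = (\<lambda>x y. x), one = (\<lambda>_. \<zero>\<^bsub>M\<^esub>), ring.zero = (\<lambda>_. \<zero>\<^bsub>M\<^esub>),
     add = (\<lambda>x y b. x b \<oplus>\<^bsub>M\<^esub> y b), smult = (\<lambda>a x b. a \<odot>\<^bsub>M\<^esub> x b)\<rparr>"

lemma cop_simps:
  "\<phi> \<in> carrier (cop B M) \<longleftrightarrow> (\<forall>b. \<phi> b \<in> carrier M) \<and> (\<forall>b. b \<notin> B \<longrightarrow> \<phi> b = \<zero>\<^bsub>M\<^esub>) \<and> finite {b. \<phi> b \<noteq> \<zero>\<^bsub>M\<^esub>}"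
  "\<zero>\<^bsub>cop B M\<^esub> = (\<lambda>_. \<zero>\<^bsub>M\<^esub>)" "x \<oplus>\<^bsub>cop B M\<^esub> y = (\<lambda>b. x b \<oplus>\<^bsub>M\<^esub> y b)" "a \<odot>\<^bsub>cop B M\<^esub> x = (\<lambda>b. a \<odot>\<^bsub>M\<^esub> x b)"
  by (auto simp: cop_def)

lemma cop_left_module:
  assumes M: "left_module R M" shows "left_module R (cop B M)"
proof -
  interpret M: abelian_group M using M by (rule left_module_abelian_group)
  have fin: "finite {b. \<phi> b \<noteq> \<zero>\<^bsub>M\<^esub>} \<Longrightarrow> finite {b. \<psi> b \<noteq> \<zero>\<^bsub>M\<^esub>} \<Longrightarrow> finite {b. \<phi> b \<oplus>\<^bsub>M\<^esub> \<psi> b \<noteq> \<zero>\<^bsub>M\<^esub>}" for \<phi> \<psi>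
    by (rule finite_subset[of _ "{b. \<phi> b \<noteq> \<zero>\<^bsub>M\<^esub>} \<union> {b. \<psi> b \<noteq> \<zero>\<^bsub>M\<^esub>}"]) auto
  have fin2: "finite {b. \<phi> b \<noteq> \<zero>\<^bsub>M\<^esub>} \<Longrightarrow> a \<in> carrier R \<Longrightarrow> finite {b. a \<odot>\<^bsub>M\<^esub> \<phi> b \<noteq> \<zero>\<^bsub>M\<^esub>}" for \<phi> a
    by (rule finite_subset[of _ "{b. \<phi> b \<noteq> \<zero>\<^bsub>M\<^esub>}"]) (use lm_zero_r[OF M] in auto)
  have ab: "abelian_group (cop B M)"
  proof (rule abelian_groupI)
    fix x assume x: "x \<in> carrier (cop B M)"
    have "(\<lambda>b. \<ominus>\<^bsub>M\<^esub> x b) \<in> carrier (cop B M)"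
      using x by (auto simp: cop_simps elim!: finite_subset[rotated])
    then show "\<exists>y\<in>carrier (cop B M). y \<oplus>\<^bsub>cop B M\<^esub> x = \<zero>\<^bsub>cop B M\<^esub>"
      using x by (intro bexI[of _ "\<lambda>b. \<ominus>\<^bsub>M\<^esub> x b"]) (auto simp: cop_simps M.l_neg)
  qed (auto simp: cop_simps fin M.a_ac)
  show ?thesis
    by (rule left_moduleI[OF left_module_ring[OF M] ab])
      (use M in \<open>auto simp: cop_simps fin2 lm_closed lm_zero_r lm_add_l lm_add_r lm_assoc lm_one\<close>)
qed

text \<open>A finitely supported function is determined by its finite graph over the support, and a
  list of coded pairs enumerating that graph has a code in the infinite type
  \<open>'m\<close>.\<close>

lemma cop_code:
  fixes M :: "('a, 'm) module" and B :: "'m set"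
  assumes inf: "infinite (UNIV :: 'm set)"
  shows "\<exists>\<iota> :: ('m \<Rightarrow> 'm) \<Rightarrow> 'm. inj_on \<iota> (carrier (cop B M))"
proof -
  obtain pr :: "'m \<times> 'm \<Rightarrow> 'm" where pr: "inj pr" using infinite_pair_code[OF inf] by blast
  obtain en :: "'m list \<Rightarrow> 'm" where en: "inj en" using infinite_list_code[OF inf] by blast
  define gr where "gr \<phi> = (\<lambda>b. (b, \<phi> b)) ` {b. \<phi> b \<noteq> \<zero>\<^bsub>M\<^esub>}" for \<phi> :: "'m \<Rightarrow> 'm"
  define ls where "ls \<phi> = (SOME xs. set xs = gr \<phi>)" for \<phi>
  have ls: "set (ls \<phi>) = gr \<phi>" if "\<phi> \<in> carrier (cop B M)" for \<phi>
    unfolding ls_def by (rule someI_ex) (use that in \<open>auto simp: gr_def cop_simps intro!: finite_list\<close>)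
  have "inj_on (\<lambda>\<phi>. en (map pr (ls \<phi>))) (carrier (cop B M))"
  proof (rule inj_onI)
    fix \<phi> \<psi> assume *: "\<phi> \<in> carrier (cop B M)" "\<psi> \<in> carrier (cop B M)" "en (map pr (ls \<phi>)) = en (map pr (ls \<psi>))"
    then have "ls \<phi> = ls \<psi>" using pr en by (metis injD inj_map_eq_map)
    then have g: "gr \<phi> = gr \<psi>" using ls * by metis
    show "\<phi> = \<psi>"
    proof
      fix b
      have "(b, v) \<in> gr \<chi> \<longleftrightarrow> v = \<chi> b \<and> \<chi> b \<noteq> \<zero>\<^bsub>M\<^esub>" for v and \<chi> :: "'m \<Rightarrow> 'm" by (auto simp: gr_def)
      then show "\<phi> b = \<psi> b" using g by metis
    qed
  qed
  then show ?thesis by blast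
qed

definition sgl where "sgl M b x = (\<lambda>c. if c = b then x else \<zero>\<^bsub>M\<^esub>)"

lemma sgl_hom:
  assumes M: "left_module R M" and b: "b \<in> B" shows "sgl M b \<in> lhom R M (cop B M)"
proof -
  interpret M: abelian_group M using M by (rule left_module_abelian_group)
  show ?thesis
  proof (rule lhomI)
    fix x assume "x \<in> carrier M"
    moreover have "finite {c. sgl M b x c \<noteq> \<zero>\<^bsub>M\<^esub>}" by (rule finite_subset[of _ "{b}"]) (auto simp: sgl_def)
    ultimately show "sgl M b x \<in> carrier (cop B M)" using b by (auto simp: cop_simps sgl_def)
  qed (use lm_zero_r[OF M] in \<open>auto simp: cop_simps sgl_def fun_eq_iff\<close>)
qed

lemma cop_induct [consumes 2, case_names zero add]:
  assumes M: "left_module R M" and \<phi>: "\<phi> \<in> carrier (cop B M)"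
    and z: "Q (\<lambda>_. \<zero>\<^bsub>M\<^esub>)"
    and a: "\<And>b x \<psi>. \<lbrakk>b \<in> B; x \<in> carrier M; \<psi> \<in> carrier (cop B M); Q \<psi>\<rbrakk> \<Longrightarrow> Q (sgl M b x \<oplus>\<^bsub>cop B M\<^esub> \<psi>)"
  shows "Q \<phi>"
proof -
  interpret M: abelian_group M using M by (rule left_module_abelian_group)
  have "finite S \<Longrightarrow> \<phi> \<in> carrier (cop B M) \<Longrightarrow> {b. \<phi> b \<noteq> \<zero>\<^bsub>M\<^esub>} \<subseteq> S \<Longrightarrow> Q \<phi>" for S \<phi>
  proof (induction S arbitrary: \<phi> rule: finite_induct)
    case empty
    then have "\<phi> = (\<lambda>_. \<zero>\<^bsub>M\<^esub>)" by auto
    then show ?case using z by simp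
  next
    case (insert b S)
    show ?case
    proof (cases "\<phi> b = \<zero>\<^bsub>M\<^esub>")
      case True
      then show ?thesis using insert by blast
    next
      case False
      then have b: "b \<in> B" and x: "\<phi> b \<in> carrier M" using insert.prems(1) by (auto simp: cop_simps)
      let ?\<psi> = "\<phi>(b := \<zero>\<^bsub>M\<^esub>)"
      have \<psi>: "?\<psi> \<in> carrier (cop B M)" using insert.prems(1) by (auto simp: cop_simps elim!: finite_subset[rotated])
      moreover have "Q ?\<psi>" by (rule insert.IH[OF \<psi>]) (use insert.prems(2) in auto)
      moreover have "sgl M b (\<phi> b) \<oplus>\<^bsub>cop B M\<^esub> ?\<psi> = \<phi>"
        using insert.prems(1) by (auto simp: cop_simps sgl_def fun_eq_iff)
      ultimately show ?thesis using a[OF b x] by metis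
    qed
  qed
  then show ?thesis using \<phi> by (auto simp: cop_simps)
qed

text \<open>The universal property of a direct sum. The formula covers every finite set containing
  the support, so that two functions can be evaluated over a common set.\<close>

lemma cop_ext:
  assumes M: "left_module R M" and N: "left_module R N" and hB: "\<forall>b\<in>B. h b \<in> lhom R M N"
  shows "\<exists>H\<in>lhom R (cop B M) N. (\<forall>\<phi>\<in>carrier (cop B M). \<forall>S. finite S \<longrightarrow> S \<subseteq> B \<longrightarrow> {b. \<phi> b \<noteq> \<zero>\<^bsub>M\<^esub>} \<subseteq> S \<longrightarrow> H \<phi> =
      (\<Oplus>\<^bsub>N\<^esub>b\<in>S. h b (\<phi> b))) \<and>
    (\<forall>b\<in>B. \<forall>x\<in>carrier M. H (sgl M b x) = h b x)"
proof -
  interpret M: abelian_group M using M by (rule left_module_abelian_group)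
  interpret N: abelian_group N using N by (rule left_module_abelian_group)
  have h: "h b \<in> lhom R M N" if "b \<in> B" for b using hB that by blast
  define H where "H \<phi> = (\<Oplus>\<^bsub>N\<^esub>b\<in>{b. \<phi> b \<noteq> \<zero>\<^bsub>M\<^esub>}. h b (\<phi> b))" for \<phi>
  have H: "H \<phi> = (\<Oplus>\<^bsub>N\<^esub>b\<in>S. h b (\<phi> b))" if "\<phi> \<in> carrier (cop B M)" "finite S" "S \<subseteq> B" "{b. \<phi> b \<noteq> \<zero>\<^bsub>M\<^esub>} \<subseteq> S" for \<phi> S
    unfolding H_def
  proof (rule N.add.finprod_mono_neutral_cong_left)
    fix b assume "b \<in> S - {b. \<phi> b \<noteq> \<zero>\<^bsub>M\<^esub>}"
    then show "h b (\<phi> b) = \<zero>\<^bsub>N\<^esub>"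
      using that(3) lhom_zero[OF M N h] by auto
  next
    show "(\<lambda>b. h b (\<phi> b)) \<in> S \<rightarrow> carrier N" using that(1,3) lhom_closed[OF h] by (auto simp: cop_simps subset_iff)
  qed (use that in auto)
  have supp: "{b. \<phi> b \<noteq> \<zero>\<^bsub>M\<^esub>} \<subseteq> B" "finite {b. \<phi> b \<noteq> \<zero>\<^bsub>M\<^esub>}" if "\<phi> \<in> carrier (cop B M)" for \<phi>
    using that by (auto simp: cop_simps)
  have "H \<in> lhom R (cop B M) N"
  proof (rule lhomI)
    fix \<phi> assume \<phi>: "\<phi> \<in> carrier (cop B M)"
    then show "H \<phi> \<in> carrier N" unfolding H_def
      using supp[OF \<phi>] by (intro N.finsum_closed) (auto simp: cop_simps intro!: lhom_closed[OF h])
  next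
    fix \<phi> \<psi> assume \<phi>: "\<phi> \<in> carrier (cop B M)" and \<psi>: "\<psi> \<in> carrier (cop B M)"
    let ?S = "{b. \<phi> b \<noteq> \<zero>\<^bsub>M\<^esub>} \<union> {b. \<psi> b \<noteq> \<zero>\<^bsub>M\<^esub>}"
    have S: "finite ?S" "?S \<subseteq> B" using supp[OF \<phi>] supp[OF \<psi>] by auto
    have \<phi>\<psi>: "\<phi> \<oplus>\<^bsub>cop B M\<^esub> \<psi> \<in> carrier (cop B M)"
      using lsub_carrier[OF cop_left_module[OF M], of B] \<phi> \<psi> by (simp add: lsub_def)
    have "H (\<phi> \<oplus>\<^bsub>cop B M\<^esub> \<psi>) = (\<Oplus>\<^bsub>N\<^esub>b\<in>?S. h b ((\<phi> \<oplus>\<^bsub>cop B M\<^esub> \<psi>) b))"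
      by (rule H[OF \<phi>\<psi> S]) (auto simp: cop_simps)
    also have "\<dots> = (\<Oplus>\<^bsub>N\<^esub>b\<in>?S. h b (\<phi> b) \<oplus>\<^bsub>N\<^esub> h b (\<psi> b))"
      by (rule N.finsum_cong') (use \<phi> \<psi> h S in \<open>auto simp: cop_simps subset_iff intro!: lhom_add[OF h] N.a_closed
          lhom_closed[OF h]\<close>)
    also have "\<dots> = (\<Oplus>\<^bsub>N\<^esub>b\<in>?S. h b (\<phi> b)) \<oplus>\<^bsub>N\<^esub> (\<Oplus>\<^bsub>N\<^esub>b\<in>?S. h b (\<psi> b))"
      by (rule N.finsum_addf) (use \<phi> \<psi> S in \<open>auto simp: cop_simps subset_iff intro!: lhom_closed[OF h]\<close>)
    also have "\<dots> = H \<phi> \<oplus>\<^bsub>N\<^esub> H \<psi>" using H[OF \<phi> S] H[OF \<psi> S] by simp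
    finally show "H (\<phi> \<oplus>\<^bsub>cop B M\<^esub> \<psi>) = H \<phi> \<oplus>\<^bsub>N\<^esub> H \<psi>" .
  next
    fix a \<phi> assume a: "a \<in> carrier R" and \<phi>: "\<phi> \<in> carrier (cop B M)"
    let ?S = "{b. \<phi> b \<noteq> \<zero>\<^bsub>M\<^esub>}"
    have a\<phi>: "a \<odot>\<^bsub>cop B M\<^esub> \<phi> \<in> carrier (cop B M)" by (rule lm_closed[OF cop_left_module[OF M] a \<phi>])
    have "H (a \<odot>\<^bsub>cop B M\<^esub> \<phi>) = (\<Oplus>\<^bsub>N\<^esub>b\<in>?S. h b ((a \<odot>\<^bsub>cop B M\<^esub> \<phi>) b))"
      by (rule H[OF a\<phi> supp(2)[OF \<phi>] supp(1)[OF \<phi>]]) (use lm_zero_r[OF M a] in \<open>auto simp: cop_simps\<close>)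
    also have "\<dots> = (\<Oplus>\<^bsub>N\<^esub>b\<in>?S. a \<odot>\<^bsub>N\<^esub> h b (\<phi> b))"
      by (rule N.finsum_cong') (use a \<phi> N supp(1)[OF \<phi>] in \<open>auto simp: cop_simps subset_iff intro!: lhom_smult[OF
          h] lm_closed lhom_closed[OF h]\<close>)
    also have "\<dots> = a \<odot>\<^bsub>N\<^esub> H \<phi>" unfolding H_def
      by (rule lm_finsum_r[OF N a supp(2)[OF \<phi>], symmetric]) (use \<phi> supp(1)[OF \<phi>] in \<open>auto simp: cop_simps
          subset_iff intro!: lhom_closed[OF h]\<close>)
    finally show "H (a \<odot>\<^bsub>cop B M\<^esub> \<phi>) = a \<odot>\<^bsub>N\<^esub> H \<phi>" .
  qed
  moreover have "H (sgl M b x) = h b x" if b: "b \<in> B" and x: "x \<in> carrier M" for b x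
  proof -
    have "H (sgl M b x) = (\<Oplus>\<^bsub>N\<^esub>c\<in>{b}. h c (sgl M b x c))"
      by (rule H) (use b lhom_closed[OF sgl_hom[OF M b] x] in \<open>auto simp: sgl_def\<close>)
    also have "\<dots> = h b x" using lhom_closed[OF h[OF b] x] by (simp add: sgl_def)
    finally show ?thesis .
  qed
  ultimately show ?thesis using H by (intro bexI[of _ H]) auto
qed

lemma cop_hom_eq:
  assumes M: "left_module R M" and N: "left_module R N" and f: "f \<in> lhom R (cop B M) N" and g: "g \<in> lhom R (cop B M) N"
    and e: "\<And>b x. \<lbrakk>b \<in> B; x \<in> carrier M\<rbrakk> \<Longrightarrow> f (sgl M b x) = g (sgl M b x)" and \<phi>: "\<phi> \<in> carrier (cop B M)"
  shows "f \<phi> = g \<phi>"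
  using M \<phi>
proof (induction rule: cop_induct)
  case zero
  then show ?case using lhom_zero[OF cop_left_module[OF M] N f] lhom_zero[OF cop_left_module[OF M] N g]
      by (simp add: cop_simps)
next
  case (add b x \<psi>)
  then have "sgl M b x \<in> carrier (cop B M)" using lhom_closed[OF sgl_hom[OF M, of b B]] by blast
  then show ?case using add f g e by (simp add: lhom_add)
qed

lemma projective_cop:
  fixes P :: "('a, 'm) module" and P' :: "('a, 'm) module"
  assumes P: "projective_module R P" and c: "coded R (cop B P) {\<zero>\<^bsub>cop B P\<^esub>} P' \<psi>"
  shows "projective_module R P'"
proof (rule projectiveI)
  show P': "left_module R P'" using c by (simp add: coded_def)
  have lP: "left_module R P" by (rule projective_left_module[OF P])
  have \<psi>: "\<psi> \<in> lhom R (cop B P) P'" and \<psi>s: "\<psi> ` carrier (cop B P) = carrier P'" using c by (auto simp: coded_def)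
  fix M N :: "('a, 'm) module" and g f
  assume M: "left_module R M" and N: "left_module R N" and g: "g \<in> lhom R M N"
      "g ` carrier M = carrier N" and f: "f \<in> lhom R P' N"
  have "\<exists>h\<in>lhom R P M. \<forall>x\<in>carrier P. g (h x) = f (\<psi> (sgl P b x))" if "b \<in> B" for b
    by (rule projective_lift[OF P M N g lhom_comp[OF lhom_comp[OF sgl_hom[OF lP that] \<psi>] f]])
  then obtain h where h: "\<And>b. b \<in> B \<Longrightarrow> h b \<in> lhom R P M" "\<And>b x. b \<in> B \<Longrightarrow> x \<in> carrier P \<Longrightarrow> g (h b x) = f (\<psi> (sgl P b x))"
    by metis
  have "\<forall>b\<in>B. h b \<in> lhom R P M" using h(1) by blast
  from cop_ext[OF lP M this] obtain H where H: "H \<in> lhom R (cop B P) M" "\<forall>b\<in>B. \<forall>x\<in>carrier P. H (sgl P b x) = h b x"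
    by (elim bexE conjE) (rule that)
  have gH: "g (H \<phi>) = f (\<psi> \<phi>)" if "\<phi> \<in> carrier (cop B P)" for \<phi>
    by (rule cop_hom_eq[OF lP N lhom_comp[OF H(1) g(1)] lhom_comp[OF \<psi> f] _ that]) (use H h in auto)
  have "\<exists>H'\<in>lhom R P' M. \<forall>u\<in>carrier (cop B P). H' (\<psi> u) = H u"
    by (rule coded_induced[OF c M H(1)]) (use lhom_zero[OF cop_left_module[OF lP] M H(1)] in auto)
  then obtain H' where H': "H' \<in> lhom R P' M" and H'2: "\<forall>u\<in>carrier (cop B P). H' (\<psi> u) = H u" ..
  have "g (H' x) = f x" if x: "x \<in> carrier P'" for x
  proof -
    have "x \<in> \<psi> ` carrier (cop B P)" using x by (simp add: \<psi>s)
    then obtain u where "u \<in> carrier (cop B P)" "x = \<psi> u" by auto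
    then show ?thesis using H'2 gH by simp
  qed
  then show "\<exists>h\<in>lhom R P' M. \<forall>x\<in>carrier P'. g (h x) = f x" using H' by (intro bexI[of _ H'] ballI)
qed

text \<open>Direct sums are exact: the kernel of the map induced by \<open>g\<close> consists of
  copies of the kernel of \<open>g\<close>, so a resolution of \<open>M\<close> is copied degree by
  degree, each term being coded in \<open>'m\<close> again.\<close>

lemma res_cop:
  fixes M :: "('a, 'm) module" and B :: "'m set"
  assumes inf: "infinite (UNIV :: 'm set)"
  shows "\<lbrakk>res R h \<Phi> M; coded R (cop B M) {\<zero>\<^bsub>cop B M\<^esub>} C \<psi>;
    \<And>k P P' \<psi>. \<lbrakk>\<Phi> k P; coded R (cop B P) {\<zero>\<^bsub>cop B P\<^esub>} P' \<psi>\<rbrakk> \<Longrightarrow> \<Phi> k P'\<rbrakk> \<Longrightarrow> res R h \<Phi> C"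
proof (induction h arbitrary: M C \<psi> \<Phi>)
  case 0
  then show ?case by (simp add: coded_def)
next
  case (Suc h)
  from Suc.prems(1) obtain P g where M: "left_module R M" and P: "projective_module R P" "\<Phi> 0 P" "g \<in> lhom R P M"
     "g ` carrier P = carrier M" and r: "res R h (\<lambda>k. \<Phi> (Suc k)) (kmod P M g)" by auto
  have lP: "left_module R P" by (rule projective_left_module[OF P(1)])
  have lC: "left_module R C" and \<psi>: "\<psi> \<in> lhom R (cop B M) C" "\<psi> ` carrier (cop B M) = carrier C"
    and \<psi>0: "\<And>u. u \<in> carrier (cop B M) \<Longrightarrow> \<psi> u = \<zero>\<^bsub>C\<^esub> \<longleftrightarrow> u = \<zero>\<^bsub>cop B M\<^esub>" using Suc.prems(2) by (auto simp: coded_def)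
  obtain \<iota> :: "('m \<Rightarrow> 'm) \<Rightarrow> 'm" where "inj_on \<iota> (carrier (cop B P))" using cop_code[OF inf] by blast
  then obtain P' :: "('a, 'm) module" and \<psi>' where c': "coded R (cop B P) {\<zero>\<^bsub>cop B P\<^esub>} P' \<psi>'"
    using ex_coded[OF cop_left_module[OF lP] lsub_zero[OF cop_left_module[OF lP]]] by blast
  then have lP': "left_module R P'" and \<psi>': "\<psi>' \<in> lhom R (cop B P) P'" "\<psi>' ` carrier (cop B P) = carrier P'"
    and \<psi>'0: "\<And>u. u \<in> carrier (cop B P) \<Longrightarrow> \<psi>' u = \<zero>\<^bsub>P'\<^esub> \<longleftrightarrow> u = \<zero>\<^bsub>cop B P\<^esub>" by (auto simp: coded_def)
  have g0: "g \<zero>\<^bsub>P\<^esub> = \<zero>\<^bsub>M\<^esub>" by (rule lhom_zero[OF lP M P(3)])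
  define G where "G \<phi> = (\<lambda>b. g (\<phi> b))" for \<phi> :: "'m \<Rightarrow> 'm"
  have G: "G \<in> lhom R (cop B P) (cop B M)"
  proof (rule lhomI)
    fix \<phi> assume \<phi>: "\<phi> \<in> carrier (cop B P)"
    then have "finite {b. \<phi> b \<noteq> \<zero>\<^bsub>P\<^esub>}" by (simp add: cop_simps)
    then have "finite {b. G \<phi> b \<noteq> \<zero>\<^bsub>M\<^esub>}"
      by (rule finite_subset[rotated, of "{b. \<phi> b \<noteq> \<zero>\<^bsub>P\<^esub>}"]) (auto simp: cop_simps G_def g0)
    then show "G \<phi> \<in> carrier (cop B M)" using \<phi> P(3) by (auto simp: cop_simps G_def g0 lhom_closed)
  qed (use P(3) in \<open>auto simp: cop_simps G_def lhom_add lhom_smult\<close>)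
  have Gs: "G ` carrier (cop B P) = carrier (cop B M)"
  proof (intro equalityI subsetI)
    fix \<mu> assume \<mu>: "\<mu> \<in> carrier (cop B M)"
    \<comment> \<open>Zero is lifted to zero, so that the chosen preimage keeps finite
      support.\<close>
    have "\<exists>x\<in>carrier P. g x = \<mu> b \<and> (\<mu> b = \<zero>\<^bsub>M\<^esub> \<longrightarrow> x = \<zero>\<^bsub>P\<^esub>)" for b
    proof (cases "\<mu> b = \<zero>\<^bsub>M\<^esub>")
      case True
      then show ?thesis using g0 lP by (metis left_module_abelian_group abelian_group_def abelian_monoid.zero_closed)
    next
      case False
      have "\<mu> b \<in> g ` carrier P" using \<mu> P(4) by (auto simp: cop_simps)
      then show ?thesis using False by auto
    qed
    then obtain \<phi> where \<phi>: "\<And>b. \<phi> b \<in> carrier P" "\<And>b. g (\<phi> b) = \<mu> b" "\<And>b. \<mu> b = \<zero>\<^bsub>M\<^esub> \<Longrightarrow> \<phi> b = \<zero>\<^bsub>P\<^esub>" by metis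
    have "finite {b. \<phi> b \<noteq> \<zero>\<^bsub>P\<^esub>}" by (rule finite_subset[of _ "{b. \<mu> b \<noteq> \<zero>\<^bsub>M\<^esub>}"]) (use \<phi> \<mu> in \<open>auto simp: cop_simps\<close>)
    then have "\<phi> \<in> carrier (cop B P)" using \<phi> \<mu> by (auto simp: cop_simps)
    moreover have "\<mu> = G \<phi>" using \<phi> by (auto simp: G_def)
    ultimately show "\<mu> \<in> G ` carrier (cop B P)" by blast
  qed (use G in \<open>auto simp: lhom_closed\<close>)
  have \<psi>G: "(\<lambda>u. \<psi> (G u)) \<in> lhom R (cop B P) C" by (rule lhom_comp[OF G \<psi>(1)])
  have "\<exists>g'\<in>lhom R P' C. \<forall>u\<in>carrier (cop B P). g' (\<psi>' u) = \<psi> (G u)"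
    by (rule coded_induced[OF c' lC \<psi>G]) (use lhom_zero[OF cop_left_module[OF lP] lC \<psi>G] in auto)
  then obtain g' where g': "g' \<in> lhom R P' C" and g'2: "\<forall>u\<in>carrier (cop B P). g' (\<psi>' u) = \<psi> (G u)" ..
  have "g' ` carrier P' = (\<lambda>u. \<psi> (G u)) ` carrier (cop B P)"
    unfolding \<psi>'(2)[symmetric] image_image using g'2 by (intro image_cong) auto
  then have g's: "g' ` carrier P' = carrier C" using Gs \<psi>(2) by (metis image_image)
  let ?K = "kmod P M g" and ?K' = "kmod P' C g'"
  have lK: "left_module R ?K" by (rule kmod_left_module[OF lP M P(3)])
  have lK': "left_module R ?K'" by (rule kmod_left_module[OF lP' lC g'])
  have sub: "carrier (cop B ?K) \<subseteq> carrier (cop B P)" by (auto simp: cop_simps lker_def)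
  have iff: "\<phi> \<in> carrier (cop B ?K) \<longleftrightarrow> \<psi>' \<phi> \<in> carrier ?K'" if \<phi>: "\<phi> \<in> carrier (cop B P)" for \<phi>
  proof -
    have "\<psi>' \<phi> \<in> carrier ?K' \<longleftrightarrow> G \<phi> = \<zero>\<^bsub>cop B M\<^esub>"
      using \<phi> g'2 \<psi>0[of "G \<phi>"] lhom_closed[OF G \<phi>] lhom_closed[OF \<psi>'(1) \<phi>] by (simp add: lker_def)
    also have "\<dots> \<longleftrightarrow> \<phi> \<in> carrier (cop B ?K)" using \<phi> by (auto simp: cop_simps G_def lker_def fun_eq_iff)
    finally show ?thesis by simp
  qed
  have "coded R (cop B ?K) {\<zero>\<^bsub>cop B ?K\<^esub>} ?K' \<psi>'"
    unfolding coded_def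
  proof (intro conjI ballI)
    show "left_module R (cop B ?K)" by (rule cop_left_module[OF lK])
    then show "lsub R (cop B ?K) {\<zero>\<^bsub>cop B ?K\<^esub>}" by (rule lsub_zero)
    show "left_module R ?K'" by (rule lK')
    show "\<psi>' \<in> lhom R (cop B ?K) ?K'"
    proof (rule lhomI)
      fix x assume "x \<in> carrier (cop B ?K)"
      then show "\<psi>' x \<in> carrier ?K'" using iff sub by blast
    next
      fix x y assume "x \<in> carrier (cop B ?K)" "y \<in> carrier (cop B ?K)"
      then have "x \<in> carrier (cop B P)" "y \<in> carrier (cop B P)" using sub by auto
      from lhom_add[OF \<psi>'(1) this] show "\<psi>' (x \<oplus>\<^bsub>cop B ?K\<^esub> y) = \<psi>' x \<oplus>\<^bsub>?K'\<^esub> \<psi>' y"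
        by (simp add: cop_simps)
    next
      fix a x assume a: "a \<in> carrier R" and "x \<in> carrier (cop B ?K)"
      then have "x \<in> carrier (cop B P)" using sub by auto
      from lhom_smult[OF \<psi>'(1) a this] show "\<psi>' (a \<odot>\<^bsub>cop B ?K\<^esub> x) = a \<odot>\<^bsub>?K'\<^esub> \<psi>' x"
        by (simp add: cop_simps)
    qed
    show "\<psi>' ` carrier (cop B ?K) = carrier ?K'"
    proof (intro equalityI subsetI)
      fix y assume y: "y \<in> carrier ?K'"
      then have "y \<in> carrier P'" by (auto simp: lker_def)
      then have "y \<in> \<psi>' ` carrier (cop B P)" using \<psi>'(2) by simp
      then obtain \<phi> where "\<phi> \<in> carrier (cop B P)" "y = \<psi>' \<phi>" by auto
      then show "y \<in> \<psi>' ` carrier (cop B ?K)" using iff y by auto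
    qed (use iff sub in auto)
    fix u assume "u \<in> carrier (cop B ?K)"
    then show "\<psi>' u = \<zero>\<^bsub>?K'\<^esub> \<longleftrightarrow> u \<in> {\<zero>\<^bsub>cop B ?K\<^esub>}" using \<psi>'0[of u] sub by (auto simp: cop_simps(2))
  qed
  then have "res R h (\<lambda>k. \<Phi> (Suc k)) ?K'"
    by (rule Suc.IH[OF r]) (rule Suc.prems(3))
  moreover have "projective_module R P'" by (rule projective_cop[OF P(1) c'])
  moreover have "\<Phi> 0 P'" by (rule Suc.prems(3)[OF P(2) c'])
  ultimately show ?case using lC g' g's by auto
qed

lemma pdc_cop:
  assumes "pdc N k P" "coded R (cop B P) {\<zero>\<^bsub>cop B P\<^esub>} P' \<psi>" shows "pdc N k P'"
  unfolding pdc_def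
proof
  assume "N < k"
  then have P: "carrier P = {\<zero>\<^bsub>P\<^esub>}" using assms(1) by (simp add: pdc_def)
  have lm: "left_module R (cop B P)" "left_module R P'" "\<psi> \<in> lhom R (cop B P) P'" and \<psi>: "\<psi> ` carrier (cop B P) = carrier P'"
    using assms(2) by (auto simp: coded_def)
  have "carrier (cop B P) = {\<zero>\<^bsub>cop B P\<^esub>}" using P by (auto simp: cop_simps)
  then show "carrier P' = {\<zero>\<^bsub>P'\<^esub>}" using \<psi> lhom_zero[OF lm] by auto
qed

subsection \<open>Rings with directed idempotents\<close>

text \<open>The abstract shape of \<open>A\<close>: orthogonal idempotents for finitely many
  vertices, corner rings that are images of a field, and an action that leads from one vertex to
  another only if \<open>deg\<close> strictly increases. For \<open>A\<close> the function
  \<open>deg\<close> is the rational degree, hence real values.\<close>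

locale directed_ring = ring R for R :: "('a, 'r) ring_scheme" (structure) +
  fixes I :: "'i set" and e :: "'i \<Rightarrow> 'a" and deg :: "'i \<Rightarrow> real" and s :: "'i \<Rightarrow> 'k::field \<Rightarrow> 'a"
  assumes fin: "finite I"
    and e_closed: "i \<in> I \<Longrightarrow> e i \<in> carrier R"
    and e_idem: "i \<in> I \<Longrightarrow> e i \<otimes> e i = e i"
    and e_orth: "\<lbrakk>i \<in> I; j \<in> I; i \<noteq> j\<rbrakk> \<Longrightarrow> e i \<otimes> e j = \<zero>"
    and e_sum: "(\<Oplus>i\<in>I. e i) = \<one>"
    and directed: "\<lbrakk>i \<in> I; j \<in> I; i \<noteq> j; a \<in> carrier R; e i \<otimes> a \<otimes> e j \<noteq> \<zero>\<rbrakk> \<Longrightarrow> deg j < deg i"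
    and s_closed: "i \<in> I \<Longrightarrow> s i \<alpha> \<in> carrier R"
    and s_add: "i \<in> I \<Longrightarrow> s i (\<alpha> + \<beta>) = s i \<alpha> \<oplus> s i \<beta>"
    and s_mult: "i \<in> I \<Longrightarrow> s i (\<alpha> * \<beta>) = s i \<alpha> \<otimes> s i \<beta>"
    and s_one: "i \<in> I \<Longrightarrow> s i 1 = e i"
    and s_ex: "\<lbrakk>i \<in> I; a \<in> carrier R\<rbrakk> \<Longrightarrow> \<exists>\<alpha>. e i \<otimes> a \<otimes> e i = s i \<alpha>"
begin

text \<open>This is \<open>e i R (1 - e i)\<close>. The corner ring at \<open>i\<close> is the image
  of a field, so this set is \<open>e i\<close> times the radical.\<close>

definition B where "B i = {b \<in> carrier R. e i \<otimes> b = b \<and> b \<otimes> e i = \<zero>}"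

lemma B_sub: "B i \<subseteq> carrier R" by (auto simp: B_def)

lemma B_left: "i \<in> I \<Longrightarrow> b \<in> B i \<Longrightarrow> e i \<otimes> b \<in> B i" by (auto simp: B_def)

lemma e_sum_smult:
  assumes M: "left_module R M" and x: "x \<in> carrier M" shows "(\<Oplus>\<^bsub>M\<^esub>j\<in>I. e j \<odot>\<^bsub>M\<^esub> x) = x"
  using lm_finsum_l[OF M x fin, of e] e_closed e_sum lm_one[OF M x] by auto

lemma e_vanish:
  assumes M: "left_module R M" and x: "x \<in> carrier M" and i: "i \<in> I" and z: "\<And>j. j \<in> I \<Longrightarrow> j \<noteq> i \<Longrightarrow> e j \<odot>\<^bsub>M\<^esub> x = \<zero>\<^bsub>M\<^esub>"
  shows "e i \<odot>\<^bsub>M\<^esub> x = x"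
proof -
  interpret M: abelian_group M using M by (rule left_module_abelian_group)
  have cl: "e j \<odot>\<^bsub>M\<^esub> x \<in> carrier M" if "j \<in> I" for j by (rule lm_closed[OF M e_closed[OF that] x])
  have "(\<Oplus>\<^bsub>M\<^esub>j\<in>I. e j \<odot>\<^bsub>M\<^esub> x) = (\<Oplus>\<^bsub>M\<^esub>j\<in>I. if i = j then e j \<odot>\<^bsub>M\<^esub> x else \<zero>\<^bsub>M\<^esub>)"
    by (rule M.finsum_cong') (use z i cl in auto)
  also have "\<dots> = e i \<odot>\<^bsub>M\<^esub> x"
    by (rule M.add.finprod_singleton[OF i fin]) (use cl in auto)
  finally show ?thesis using e_sum_smult[OF M x] by simp
qed

lemma e_vanish_all:
  assumes M: "left_module R M" and x: "x \<in> carrier M" and z: "\<And>j. j \<in> I \<Longrightarrow> e j \<odot>\<^bsub>M\<^esub> x = \<zero>\<^bsub>M\<^esub>"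
  shows "x = \<zero>\<^bsub>M\<^esub>"
proof -
  interpret M: abelian_group M using M by (rule left_module_abelian_group)
  have "(\<Oplus>\<^bsub>M\<^esub>j\<in>I. e j \<odot>\<^bsub>M\<^esub> x) = (\<Oplus>\<^bsub>M\<^esub>j\<in>I. \<zero>\<^bsub>M\<^esub>)" by (rule M.finsum_cong') (use z in auto)
  then show ?thesis using e_sum_smult[OF M x] by simp
qed

lemma move:
  assumes M: "left_module R M" and a: "a \<in> carrier R" and x: "x \<in> carrier M" and i: "i \<in> I" "e i \<odot>\<^bsub>M\<^esub> x = x"
    and j: "j \<in> I" "j \<noteq> i" "\<not> deg i < deg j"
  shows "e j \<odot>\<^bsub>M\<^esub> (a \<odot>\<^bsub>M\<^esub> x) = \<zero>\<^bsub>M\<^esub>"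
proof -
  have "e j \<odot>\<^bsub>M\<^esub> (a \<odot>\<^bsub>M\<^esub> x) = (e j \<otimes> a \<otimes> e i) \<odot>\<^bsub>M\<^esub> x"
    using M a x i j e_closed by (simp add: lm_assoc lm_closed)
  also have "e j \<otimes> a \<otimes> e i = \<zero>" using directed[OF j(1) i(1) j(2) a] j(3) by blast
  finally show ?thesis using lm_zero_l[OF M x] by simp
qed

text \<open>Elements of \<open>B i\<close> see only the parts of \<open>M\<close> at vertices of
  smaller degree. These vanish by induction, hence so does \<open>B i M\<close>, which contains
  \<open>e i M\<close>. Directedness thus replaces finite generation of \<open>M\<close>.\<close>

lemma nakayama:
  assumes M: "left_module R M" and n: "\<And>i. i \<in> I \<Longrightarrow> notop (e i) (B i) M"
  shows "carrier M = {\<zero>\<^bsub>M\<^esub>}"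
proof -
  interpret M: abelian_group M using M by (rule left_module_abelian_group)
  have "i \<in> I \<Longrightarrow> \<forall>x\<in>carrier M. e i \<odot>\<^bsub>M\<^esub> x = \<zero>\<^bsub>M\<^esub>" for i
  \<comment> \<open>Degrees are real, so the induction runs over the number of vertices of smaller
    degree.\<close>
  proof (induction "card {j \<in> I. deg j < deg i}" arbitrary: i rule: less_induct)
    case less
    have IH: "e j \<odot>\<^bsub>M\<^esub> x = \<zero>\<^bsub>M\<^esub>" if "j \<in> I" "deg j < deg i" "x \<in> carrier M" for j x
    proof -
      have "{k \<in> I. deg k < deg j} \<subset> {j \<in> I. deg j < deg i}" using that by auto
      then have "card {k \<in> I. deg k < deg j} < card {j \<in> I. deg j < deg i}"
        using fin by (intro psubset_card_mono) auto
      then show ?thesis using less.hyps that by blast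
    qed
    have b: "b \<odot>\<^bsub>M\<^esub> x = \<zero>\<^bsub>M\<^esub>" if b: "b \<in> B i" and x: "x \<in> carrier M" for b x
    proof -
      have bc: "b \<in> carrier R" "e i \<otimes> b = b" "b \<otimes> e i = \<zero>" using b by (auto simp: B_def)
      have each: "b \<odot>\<^bsub>M\<^esub> (e j \<odot>\<^bsub>M\<^esub> x) = \<zero>\<^bsub>M\<^esub>" if j: "j \<in> I" for j
      proof (cases "b \<otimes> e j = \<zero>")
        case True
        then show ?thesis using lm_assoc[OF M bc(1) e_closed[OF j] x] lm_zero_l[OF M x] by simp
      next
        case False
        then have "deg j < deg i" using directed[OF less.prems j _ bc(1)] bc by auto
        then show ?thesis using IH[OF j _ x] lm_zero_r[OF M bc(1)] by simp
      qed
      have "b \<odot>\<^bsub>M\<^esub> x = b \<odot>\<^bsub>M\<^esub> (\<Oplus>\<^bsub>M\<^esub>j\<in>I. e j \<odot>\<^bsub>M\<^esub> x)" using e_sum_smult[OF M x] by simp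
      also have "\<dots> = (\<Oplus>\<^bsub>M\<^esub>j\<in>I. b \<odot>\<^bsub>M\<^esub> (e j \<odot>\<^bsub>M\<^esub> x))"
        by (rule lm_finsum_r[OF M bc(1) fin]) (use M x e_closed in \<open>auto intro: lm_closed\<close>)
      also have "\<dots> = (\<Oplus>\<^bsub>M\<^esub>j\<in>I. \<zero>\<^bsub>M\<^esub>)" by (rule M.finsum_cong') (use each in auto)
      finally show ?thesis by simp
    qed
    have "y \<in> rad (B i) M \<Longrightarrow> y = \<zero>\<^bsub>M\<^esub>" for y
      by (induction rule: rad.induct) (auto simp: b)
    then show ?case using n[OF less.prems] by (auto simp: notop_def)
  qed
  then show ?thesis using e_vanish_all[OF M] by auto
qed

definition conc where
  "conc i M \<longleftrightarrow> left_module R M \<and> (\<forall>x\<in>carrier M. e i \<odot>\<^bsub>M\<^esub> x = x)"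

text \<open>Ring elements move vectors only to vertices of larger degree, so at a vertex of maximal
  degree in the support of \<open>M\<close> the part \<open>e i M\<close> is a submodule. It is
  concentrated in that vertex and its quotient has smaller support; the horseshoe lemma joins the
  two.\<close>

lemma filtration:
  fixes M :: "('a, 'm) module"
  assumes inf: "infinite (UNIV :: 'm set)"
    and c: "\<And>i M. i \<in> I \<Longrightarrow> conc i (M :: ('a, 'm) module) \<Longrightarrow> res R (N + 2) (pdc N) M"
    and M: "left_module R M"
  shows "res R (N + 2) (pdc N) M"
  using M
proof (induction "card {i \<in> I. \<exists>x\<in>carrier M. e i \<odot>\<^bsub>M\<^esub> x \<noteq> \<zero>\<^bsub>M\<^esub>}" arbitrary: M rule: less_induct)
  case less
  note M = less.prems
  interpret M: abelian_group M using M by (rule left_module_abelian_group)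
  define S where "S = {i \<in> I. \<exists>x\<in>carrier M. e i \<odot>\<^bsub>M\<^esub> x \<noteq> \<zero>\<^bsub>M\<^esub>}"
  have finS: "finite S" using fin by (simp add: S_def)
  show ?case
  proof (cases "S = {}")
    case True
    then have "carrier M = {\<zero>\<^bsub>M\<^esub>}" using e_vanish_all[OF M] by (auto simp: S_def)
    then show ?thesis using M by (intro res_zero_module) (auto simp: pdc_def)
  next
    case False
    have "Max (deg ` S) \<in> deg ` S" using finS False by (intro Max_in) auto
    then obtain i where i1: "i \<in> S" "deg i = Max (deg ` S)" by auto
    have "\<not> deg i < deg j" if "j \<in> S" for j using Max_ge[OF finite_imageI[OF finS] imageI[OF that], of deg] i1(2) by simp
    note i = i1(1) this
    have iI: "i \<in> I" using i by (simp add: S_def)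
    define N0 where "N0 = {x \<in> carrier M. e i \<odot>\<^bsub>M\<^esub> x = x}"
    have ec: "e i \<in> carrier R" by (rule e_closed[OF iI])
    have sub: "lsub R M N0"
      unfolding lsub_def
    proof (intro conjI ballI)
      fix a x assume a: "a \<in> carrier R" and "x \<in> N0"
      then have x: "x \<in> carrier M" "e i \<odot>\<^bsub>M\<^esub> x = x" by (auto simp: N0_def)
      have ax: "a \<odot>\<^bsub>M\<^esub> x \<in> carrier M" by (rule lm_closed[OF M a x(1)])
      have "e j \<odot>\<^bsub>M\<^esub> (a \<odot>\<^bsub>M\<^esub> x) = \<zero>\<^bsub>M\<^esub>" if j: "j \<in> I" "j \<noteq> i" for j
      proof (cases "j \<in> S")
        case True
        then show ?thesis using move[OF M a x(1) iI x(2) j] i(2) by blast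
      next
        case False
        then show ?thesis using j ax by (auto simp: S_def)
      qed
      then show "a \<odot>\<^bsub>M\<^esub> x \<in> N0" using e_vanish[OF M ax iI] ax by (auto simp: N0_def)
    qed (auto simp: N0_def lm_add_r[OF M ec] lm_zero_r[OF M ec])
    have M0: "left_module R (M\<lparr>carrier := N0\<rparr>)" by (rule lsub_left_module[OF M sub])
    have r0: "res R (N + 2) (pdc N) (M\<lparr>carrier := N0\<rparr>)"
      by (rule c[OF iI]) (use M0 in \<open>auto simp: conc_def N0_def\<close>)
    have "inj_on (\<lambda>x. x) (carrier M)" by simp
    then obtain Q :: "('a, 'm) module" and \<kappa> where q: "coded R M N0 Q \<kappa>" using ex_coded[OF M sub] by blast
    then have Q: "left_module R Q" and \<kappa>: "\<kappa> \<in> lhom R M Q" "\<kappa> ` carrier M = carrier Q"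
      and \<kappa>0: "\<forall>u\<in>carrier M. \<kappa> u = \<zero>\<^bsub>Q\<^esub> \<longleftrightarrow> u \<in> N0" by (auto simp: coded_def)
    have eN: "e i \<odot>\<^bsub>M\<^esub> x \<in> N0" if "x \<in> carrier M" for x
      using lm_closed[OF M ec that] lm_assoc[OF M ec ec that] e_idem[OF iI] by (simp add: N0_def)
    have ei: "e i \<odot>\<^bsub>Q\<^esub> y = \<zero>\<^bsub>Q\<^esub>" if "y \<in> carrier Q" for y
    proof -
      have "y \<in> \<kappa> ` carrier M" using that \<kappa> by simp
      then obtain x where x: "x \<in> carrier M" "y = \<kappa> x" ..
      have "\<kappa> (e i \<odot>\<^bsub>M\<^esub> x) = \<zero>\<^bsub>Q\<^esub>" using \<kappa>0 eN[OF x(1)] lm_closed[OF M ec x(1)] by blast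
      then show ?thesis using x lhom_smult[OF \<kappa>(1) ec x(1)] by simp
    qed
    have ej: "e j \<odot>\<^bsub>Q\<^esub> y = \<zero>\<^bsub>Q\<^esub>" if "y \<in> carrier Q" "j \<in> I" "j \<notin> S" for j y
    proof -
      have "y \<in> \<kappa> ` carrier M" using that \<kappa> by simp
      then obtain x where "x \<in> carrier M" "y = \<kappa> x" ..
      moreover have "e j \<odot>\<^bsub>M\<^esub> x = \<zero>\<^bsub>M\<^esub>" using that calculation by (auto simp: S_def)
      ultimately show ?thesis using lhom_smult[OF \<kappa>(1) e_closed[OF that(2)], of x] lhom_zero[OF M Q \<kappa>(1)] by simp
    qed
    have "{j \<in> I. \<exists>x\<in>carrier Q. e j \<odot>\<^bsub>Q\<^esub> x \<noteq> \<zero>\<^bsub>Q\<^esub>} \<subseteq> S - {i}" using ei ej by auto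
    then have "card {j \<in> I. \<exists>x\<in>carrier Q. e j \<odot>\<^bsub>Q\<^esub> x \<noteq> \<zero>\<^bsub>Q\<^esub>} \<le> card (S - {i})" using finS by (intro card_mono) auto
    also have "\<dots> < card S" using finS i by (intro psubset_card_mono) auto
    finally have rQ: "res R (N + 2) (pdc N) Q" using less.hyps Q by (simp add: S_def)
    have "ses R (M\<lparr>carrier := N0\<rparr>) M Q (\<lambda>x. x) \<kappa>"
      unfolding ses_def using M M0 Q \<kappa> \<kappa>0 sub by (auto simp: lhom_def lsub_def)
    then show ?thesis by (rule res_horseshoe[OF inf _ r0 rQ comb_pdc])
  qed
qed

subsection \<open>Modules concentrated in one vertex\<close>

lemma s_zero: "i \<in> I \<Longrightarrow> s i 0 = \<zero>"
  using s_add[of i 0 0] s_closed[of i 0] by (metis add.r_cancel_one' add_0)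

definition indep where
  "indep i M T \<longleftrightarrow> T \<subseteq> carrier M \<and> (\<forall>U \<alpha>. finite U \<longrightarrow> U \<subseteq> T \<longrightarrow> (\<Oplus>\<^bsub>M\<^esub>b\<in>U. s i (\<alpha> b) \<odot>\<^bsub>M\<^esub> b) = \<zero>\<^bsub>M\<^esub> \<longrightarrow> (\<forall>b\<in>U. \<alpha> b = 0))"

text \<open>Zorn's lemma gives a maximal independent set; it spans, because a nontrivial relation
  with a further vector \<open>x\<close> can be solved for \<open>x\<close> over the field.\<close>

lemma ex_basis:
  assumes i: "i \<in> I" and c: "conc i M"
  shows "\<exists>T. indep i M T \<and> (\<forall>x\<in>carrier M. \<exists>U \<alpha>. finite U \<and> U \<subseteq> T \<and> x = (\<Oplus>\<^bsub>M\<^esub>b\<in>U. s i (\<alpha> b) \<odot>\<^bsub>M\<^esub> b))"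
proof -
  have M: "left_module R M" and ex: "\<And>x. x \<in> carrier M \<Longrightarrow> e i \<odot>\<^bsub>M\<^esub> x = x" using c by (auto simp: conc_def)
  interpret M: abelian_group M using M by (rule left_module_abelian_group)
  have "\<exists>T\<in>{T. indep i M T}. \<forall>X\<in>{T. indep i M T}. T \<subseteq> X \<longrightarrow> X = T"
  proof (rule subset_Zorn_nonempty)
    have "indep i M {}" by (auto simp: indep_def)
    then show "{T. indep i M T} \<noteq> {}" by blast
    fix C assume C: "C \<noteq> {}" "subset.chain {T. indep i M T} C"
    then have Ci: "\<And>T. T \<in> C \<Longrightarrow> indep i M T" by (auto simp: subset.chain_def)
    show "\<Union>C \<in> {T. indep i M T}"
      unfolding mem_Collect_eq indep_def
    proof (intro conjI allI impI)
      show "\<Union>C \<subseteq> carrier M" using Ci by (auto simp: indep_def)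
      fix U \<alpha> assume U: "finite U" "U \<subseteq> \<Union>C" "(\<Oplus>\<^bsub>M\<^esub>b\<in>U. s i (\<alpha> b) \<odot>\<^bsub>M\<^esub> b) = \<zero>\<^bsub>M\<^esub>"
      obtain T where "T \<in> C" "U \<subseteq> T" using finite_subset_Union_chain[OF U(1,2) C] by blast
      then show "\<forall>b\<in>U. \<alpha> b = 0" using Ci U by (auto simp: indep_def)
    qed
  qed
  then obtain T where T: "indep i M T" and max: "\<And>X. indep i M X \<Longrightarrow> T \<subseteq> X \<Longrightarrow> X = T" by blast
  have Tc: "T \<subseteq> carrier M" using T by (simp add: indep_def)
  have "\<exists>U \<alpha>. finite U \<and> U \<subseteq> T \<and> x = (\<Oplus>\<^bsub>M\<^esub>b\<in>U. s i (\<alpha> b) \<odot>\<^bsub>M\<^esub> b)" if x: "x \<in> carrier M" for x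
  proof (cases "x \<in> T")
    case True
    have "x = (\<Oplus>\<^bsub>M\<^esub>b\<in>{x}. s i 1 \<odot>\<^bsub>M\<^esub> b)" using x i by (simp add: s_one ex)
    then show ?thesis using True by (intro exI[of _ "{x}"] exI[of _ "\<lambda>_. 1"]) auto
  next
    case False
    then have "\<not> indep i M (insert x T)" using max by blast
    then obtain U \<alpha> where U: "finite U" "U \<subseteq> insert x T" "(\<Oplus>\<^bsub>M\<^esub>b\<in>U. s i (\<alpha> b) \<odot>\<^bsub>M\<^esub> b) = \<zero>\<^bsub>M\<^esub>" "\<exists>b\<in>U. \<alpha> b \<noteq> 0"
      using x Tc unfolding indep_def by blast
    have Uc: "b \<in> carrier M" if "b \<in> U" for b using U(2) x Tc that by blast
    have xU: "x \<in> U" using T U unfolding indep_def by blast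
    let ?V = "U - {x}"
    have V: "finite ?V" "?V \<subseteq> T" using U by auto
    have cl: "(\<lambda>b. s i (\<beta> b) \<odot>\<^bsub>M\<^esub> b) \<in> ?V \<rightarrow> carrier M" for \<beta> using Uc i M s_closed by (auto intro: lm_closed)
    let ?w = "\<Oplus>\<^bsub>M\<^esub>b\<in>?V. s i (\<alpha> b) \<odot>\<^bsub>M\<^esub> b"
    have w: "?w \<in> carrier M" by (rule M.finsum_closed[OF cl])
    have sx: "s i (\<alpha> x) \<odot>\<^bsub>M\<^esub> x \<in> carrier M" using x i M s_closed by (auto intro: lm_closed)
    have sum0: "s i (\<alpha> x) \<odot>\<^bsub>M\<^esub> x \<oplus>\<^bsub>M\<^esub> ?w = \<zero>\<^bsub>M\<^esub>"
      using U(3) M.finsum_insert[OF V(1), of x "\<lambda>b. s i (\<alpha> b) \<odot>\<^bsub>M\<^esub> b"] cl sx xU by (simp add: insert_absorb)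
    have ax: "\<alpha> x \<noteq> 0"
    proof
      assume a0: "\<alpha> x = 0"
      then have "?w = \<zero>\<^bsub>M\<^esub>" using sum0 w i x M by (simp add: s_zero lm_zero_l)
      then have "\<forall>b\<in>?V. \<alpha> b = 0" using T V unfolding indep_def by blast
      then show False using U(4) a0 by auto
    qed
    \<comment> \<open>Solving the relation for \<open>x\<close> divides by its coefficient, which is
      nonzero because \<open>T\<close> is independent.\<close>
    let ?\<beta> = "\<lambda>b. - inverse (\<alpha> x) * \<alpha> b"
    have "(\<Oplus>\<^bsub>M\<^esub>b\<in>?V. s i (?\<beta> b) \<odot>\<^bsub>M\<^esub> b) = (\<Oplus>\<^bsub>M\<^esub>b\<in>?V. s i (- inverse (\<alpha> x)) \<odot>\<^bsub>M\<^esub> (s i (\<alpha> b) \<odot>\<^bsub>M\<^esub> b))"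
      by (rule M.finsum_cong') (use Uc i M s_closed in \<open>auto simp del: mult_minus_left simp: s_mult lm_assoc
          intro!: lm_closed\<close>)
    also have "\<dots> = s i (- inverse (\<alpha> x)) \<odot>\<^bsub>M\<^esub> ?w"
      by (rule lm_finsum_r[OF M s_closed[OF i] V(1) cl, symmetric])
    also have "?w = \<ominus>\<^bsub>M\<^esub> (s i (\<alpha> x) \<odot>\<^bsub>M\<^esub> x)" using M.minus_equality[OF _ sx w] sum0 w sx by (simp add: M.a_comm)
    also have "\<dots> = s i (- \<alpha> x) \<odot>\<^bsub>M\<^esub> x"
    proof -
      have "s i (- \<alpha> x) \<odot>\<^bsub>M\<^esub> x \<oplus>\<^bsub>M\<^esub> s i (\<alpha> x) \<odot>\<^bsub>M\<^esub> x = (s i (- \<alpha> x) \<oplus> s i (\<alpha> x)) \<odot>\<^bsub>M\<^esub> x"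
        by (rule lm_add_l[OF M s_closed[OF i] s_closed[OF i] x, symmetric])
      also have "\<dots> = \<zero>\<^bsub>M\<^esub>" using s_add[OF i, of "- \<alpha> x" "\<alpha> x"] s_zero[OF i] lm_zero_l[OF M x] by simp
      finally show ?thesis using M.minus_equality[OF _ sx lm_closed[OF M s_closed[OF i] x]] by simp
    qed
    also have "s i (- inverse (\<alpha> x)) \<odot>\<^bsub>M\<^esub> (s i (- \<alpha> x) \<odot>\<^bsub>M\<^esub> x) = s i (- inverse (\<alpha> x) * - \<alpha> x) \<odot>\<^bsub>M\<^esub> x"
      using x i M s_closed by (simp only: s_mult lm_assoc)
    also have "\<dots> = x" using ax i x by (simp add: s_one ex)
    finally show ?thesis using V by (intro exI[of _ ?V] exI[of _ ?\<beta>] conjI) simp_all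
  qed
  then show ?thesis using T by blast
qed

text \<open>On a module concentrated at \<open>i\<close> all of \<open>R\<close> acts by scalars,
  and \<open>S\<close> is the one-dimensional case; a basis \<open>T\<close> of \<open>M\<close>
  therefore presents \<open>M\<close> as a sum of copies of \<open>S\<close>.\<close>

lemma conc_cop:
  assumes i: "i \<in> I" and S: "conc i S" and v0: "v0 \<in> carrier S" "v0 \<noteq> \<zero>\<^bsub>S\<^esub>" "\<forall>v\<in>carrier S. \<exists>\<alpha>. v = s i \<alpha> \<odot>\<^bsub>S\<^esub> v0"
    and c: "conc i M"
  shows "\<exists>T F. T \<subseteq> carrier M \<and> coded R (cop T S) {\<zero>\<^bsub>cop T S\<^esub>} M F"
proof -
  have M: "left_module R M" and ex: "\<And>x. x \<in> carrier M \<Longrightarrow> e i \<odot>\<^bsub>M\<^esub> x = x" using c by (auto simp: conc_def)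
  have lS: "left_module R S" and eS: "\<And>x. x \<in> carrier S \<Longrightarrow> e i \<odot>\<^bsub>S\<^esub> x = x" using S by (auto simp: conc_def)
  interpret M: abelian_group M using M by (rule left_module_abelian_group)
  interpret S: abelian_group S using lS by (rule left_module_abelian_group)
  obtain T where T: "indep i M T" and span: "\<And>x. x \<in> carrier M \<Longrightarrow> \<exists>U \<alpha>. finite U \<and> U \<subseteq> T \<and> x = (\<Oplus>\<^bsub>M\<^esub>b\<in>U. s i (\<alpha> b) \<odot>\<^bsub>M\<^esub> b)"
    using ex_basis[OF i c] by blast
  have Tc: "T \<subseteq> carrier M" using T by (simp add: indep_def)
  have z: "\<alpha> = 0" if "s i \<alpha> \<odot>\<^bsub>S\<^esub> v0 = \<zero>\<^bsub>S\<^esub>" for \<alpha>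
  proof (rule ccontr)
    assume a: "\<alpha> \<noteq> 0"
    have "s i (inverse \<alpha>) \<odot>\<^bsub>S\<^esub> (s i \<alpha> \<odot>\<^bsub>S\<^esub> v0) = s i (inverse \<alpha> * \<alpha>) \<odot>\<^bsub>S\<^esub> v0"
      using i lS v0 s_closed by (simp only: s_mult lm_assoc)
    also have "\<dots> = v0" using a i v0 by (simp add: s_one eS)
    finally show False using that v0 lm_zero_r[OF lS s_closed[OF i]] by simp
  qed
  define co where "co v = (SOME \<alpha>. v = s i \<alpha> \<odot>\<^bsub>S\<^esub> v0)" for v
  have co: "s i (co v) \<odot>\<^bsub>S\<^esub> v0 = v" if "v \<in> carrier S" for v
    using someI_ex[OF bspec[OF v0(3) that]] by (simp add: co_def)
  have co_eq: "co v = \<alpha>" if "v = s i \<alpha> \<odot>\<^bsub>S\<^esub> v0" for v \<alpha>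
  proof -
    have v: "v \<in> carrier S" using that lS v0 i s_closed by (simp add: lm_closed)
    have "s i \<beta> \<odot>\<^bsub>S\<^esub> v0 \<oplus>\<^bsub>S\<^esub> s i \<alpha> \<odot>\<^bsub>S\<^esub> v0 = s i (\<beta> + \<alpha>) \<odot>\<^bsub>S\<^esub> v0" for \<beta>
      using lm_add_l[OF lS s_closed[OF i] s_closed[OF i] v0(1)] s_add[OF i] by simp
    then have "s i (co v + - \<alpha>) \<odot>\<^bsub>S\<^esub> v0 \<oplus>\<^bsub>S\<^esub> v = s i (co v + - \<alpha> + \<alpha>) \<odot>\<^bsub>S\<^esub> v0"
      using that by metis
    also have "\<dots> = v" using co[OF v] by simp
    finally have "s i (co v + - \<alpha>) \<odot>\<^bsub>S\<^esub> v0 = \<zero>\<^bsub>S\<^esub>" using v lS v0 i s_closed by (simp add: lm_closed S.add.r_cancel_one)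
    then show ?thesis using z by fastforce
  qed
  have co_add: "co (v \<oplus>\<^bsub>S\<^esub> w) = co v + co w" if "v \<in> carrier S" "w \<in> carrier S" for v w
    by (rule co_eq) (use that co lm_add_l[OF lS s_closed[OF i] s_closed[OF i] v0(1)] s_add[OF i] in simp)
  \<comment> \<open>Only the corner \<open>e i a e i\<close> of \<open>a\<close> acts on a module
    concentrated at \<open>i\<close>, and this corner is a scalar.\<close>
  have act: "a \<odot>\<^bsub>N\<^esub> x = s i \<alpha> \<odot>\<^bsub>N\<^esub> x" if N: "conc i N" and a: "a \<in> carrier R" and al: "e i \<otimes> a \<otimes> e i =
      s i \<alpha>" and x: "x \<in> carrier N" for N :: "('a, 'z) module" and a \<alpha> x
  proof -
    have lN: "left_module R N" and eN: "\<And>x. x \<in> carrier N \<Longrightarrow> e i \<odot>\<^bsub>N\<^esub> x = x" using N by (auto simp: conc_def)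
    have "a \<odot>\<^bsub>N\<^esub> x = e i \<odot>\<^bsub>N\<^esub> (a \<odot>\<^bsub>N\<^esub> (e i \<odot>\<^bsub>N\<^esub> x))" using eN x lm_closed[OF lN a x] by simp
    also have "\<dots> = (e i \<otimes> a \<otimes> e i) \<odot>\<^bsub>N\<^esub> x" using lN a x i e_closed by (simp add: lm_assoc lm_closed)
    finally show ?thesis using al by simp
  qed
  \<comment> \<open>The linear map that takes \<open>v0\<close> to \<open>b\<close>;
    \<open>co v\<close> is the coordinate of \<open>v\<close> with respect to
    \<open>v0\<close>.\<close>
  define h where "h b v = s i (co v) \<odot>\<^bsub>M\<^esub> b" for b v
  have h: "h b \<in> lhom R S M" if b: "b \<in> T" for b
  proof (rule lhomI)
    have bc: "b \<in> carrier M" using b Tc by auto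
    show "h b v \<in> carrier M" if "v \<in> carrier S" for v using bc M i s_closed by (simp add: h_def lm_closed)
    show "h b (v \<oplus>\<^bsub>S\<^esub> w) = h b v \<oplus>\<^bsub>M\<^esub> h b w" if "v \<in> carrier S" "w \<in> carrier S" for v w
      using bc M i s_closed by (simp add: h_def co_add[OF that] s_add lm_add_l)
    show "h b (a \<odot>\<^bsub>S\<^esub> v) = a \<odot>\<^bsub>M\<^esub> h b v" if a: "a \<in> carrier R" and v: "v \<in> carrier S" for a v
    proof -
      obtain \<alpha> where \<alpha>: "e i \<otimes> a \<otimes> e i = s i \<alpha>" using s_ex[OF i a] by blast
      have "co (a \<odot>\<^bsub>S\<^esub> v) = \<alpha> * co v"
        by (rule co_eq) (use act[OF S a \<alpha> v] co[OF v] lm_assoc[OF lS s_closed[OF i] s_closed[OF i] v0(1)] s_mult[OF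
            i] in simp)
      then show ?thesis
        using act[OF c a \<alpha>, of "h b v"] bc M i s_closed lm_assoc[OF M s_closed[OF i] s_closed[OF i] bc]
        by (simp add: h_def s_mult lm_closed)
    qed
  qed
  have hT: "\<forall>b\<in>T. h b \<in> lhom R S M" using h by blast
  obtain F where F: "F \<in> lhom R (cop T S) M" and
    F2: "\<forall>\<phi>\<in>carrier (cop T S). \<forall>U. finite U \<longrightarrow> U \<subseteq> T \<longrightarrow> {b. \<phi> b \<noteq> \<zero>\<^bsub>S\<^esub>} \<subseteq> U \<longrightarrow> F \<phi> = (\<Oplus>\<^bsub>M\<^esub>b\<in>U. h b (\<phi> b))"
    using cop_ext[OF lS M hT] by (elim bexE conjE) (rule that)
  have "coded R (cop T S) {\<zero>\<^bsub>cop T S\<^esub>} M F"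
    unfolding coded_def
  proof (intro conjI ballI)
    show lc: "left_module R (cop T S)" by (rule cop_left_module[OF lS])
    show "lsub R (cop T S) {\<zero>\<^bsub>cop T S\<^esub>}" by (rule lsub_zero[OF lc])
    show "F ` carrier (cop T S) = carrier M"
    proof (intro equalityI subsetI)
      fix x assume "x \<in> carrier M"
      then obtain U \<alpha> where U: "finite U" "U \<subseteq> T" "x = (\<Oplus>\<^bsub>M\<^esub>b\<in>U. s i (\<alpha> b) \<odot>\<^bsub>M\<^esub> b)" using span by blast
      define \<phi> where "\<phi> b = (if b \<in> U then s i (\<alpha> b) \<odot>\<^bsub>S\<^esub> v0 else \<zero>\<^bsub>S\<^esub>)" for b
      have "{b. \<phi> b \<noteq> \<zero>\<^bsub>S\<^esub>} \<subseteq> U" by (auto simp: \<phi>_def)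
      moreover from this have "\<phi> \<in> carrier (cop T S)"
        using U finite_subset[of "{b. \<phi> b \<noteq> \<zero>\<^bsub>S\<^esub>}" U] lS i v0 s_closed by (auto simp: cop_simps \<phi>_def lm_closed)
      moreover have "(\<Oplus>\<^bsub>M\<^esub>b\<in>U. h b (\<phi> b)) = x" unfolding U(3)
        by (rule M.finsum_cong') (use U Tc i M s_closed co_eq in \<open>auto simp: h_def \<phi>_def intro!: lm_closed\<close>)
      ultimately have "\<phi> \<in> carrier (cop T S)" "F \<phi> = x" using F2 U(1,2) by auto
      then show "x \<in> F ` carrier (cop T S)" by blast
    qed (use F in \<open>auto simp: lhom_closed\<close>)
    fix \<phi> assume \<phi>: "\<phi> \<in> carrier (cop T S)"
    have key: "\<forall>b\<in>U. \<alpha> b = 0" if "finite U" "U \<subseteq> T" "(\<Oplus>\<^bsub>M\<^esub>b\<in>U. s i (\<alpha> b) \<odot>\<^bsub>M\<^esub> b) = \<zero>\<^bsub>M\<^esub>" for U \<alpha>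
      using T that by (simp add: indep_def)
    let ?U = "{b. \<phi> b \<noteq> \<zero>\<^bsub>S\<^esub>}"
    have U: "finite ?U" "?U \<subseteq> T" using \<phi> by (auto simp: cop_simps)
    show "F \<phi> = \<zero>\<^bsub>M\<^esub> \<longleftrightarrow> \<phi> \<in> {\<zero>\<^bsub>cop T S\<^esub>}"
    proof
      assume "F \<phi> = \<zero>\<^bsub>M\<^esub>"
      then have "(\<Oplus>\<^bsub>M\<^esub>b\<in>?U. s i (co (\<phi> b)) \<odot>\<^bsub>M\<^esub> b) = \<zero>\<^bsub>M\<^esub>" using F2 \<phi> U by (simp add: h_def)
      then have "\<forall>b\<in>?U. co (\<phi> b) = 0" by (rule key[OF U])
      then have "\<phi> b = \<zero>\<^bsub>S\<^esub>" for b
        using co[of "\<phi> b"] \<phi> i lS v0 by (cases "\<phi> b = \<zero>\<^bsub>S\<^esub>") (auto simp: cop_simps s_zero lm_zero_l)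
      then show "\<phi> \<in> {\<zero>\<^bsub>cop T S\<^esub>}" by (auto simp: cop_simps)
    qed (use lhom_zero[OF lc M F] in auto)
  qed (use M F in auto)
  then show ?thesis using Tc by blast
qed

lemma conc_res:
  fixes S M :: "('a, 'm) module"
  assumes inf: "infinite (UNIV :: 'm set)" and i: "i \<in> I" and S: "conc i S" and v0: "v0 \<in> carrier S" "v0 \<noteq> \<zero>\<^bsub>S\<^esub>"
      "\<forall>v\<in>carrier S. \<exists>\<alpha>. v = s i \<alpha> \<odot>\<^bsub>S\<^esub> v0"
    and r: "res R h (pdc N) S" and c: "conc i M"
  shows "res R h (pdc N) M"
proof -
  obtain T F where "T \<subseteq> carrier M" and F: "coded R (cop T S) {\<zero>\<^bsub>cop T S\<^esub>} M F"
    using conc_cop[OF i S v0 c] by (elim exE conjE) (rule that)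
  from F show ?thesis by (rule res_cop[OF inf r]) (rule pdc_cop)
qed

end

subsection \<open>Matrix algebras of graded pieces\<close>

lemma (in abelian_monoid) finsum_swap:
  assumes "finite A" "finite B" "\<And>i j. i \<in> A \<Longrightarrow> j \<in> B \<Longrightarrow> f i j \<in> carrier G"
  shows "(\<Oplus>i\<in>A. \<Oplus>j\<in>B. f i j) = (\<Oplus>j\<in>B. \<Oplus>i\<in>A. f i j)"
  using assms(1,3)
proof induction
  case (insert i A)
  have "(\<Oplus>j\<in>B. \<Oplus>i\<in>insert i A. f i j) = (\<Oplus>j\<in>B. f i j \<oplus> (\<Oplus>i\<in>A. f i j))"
    by (rule finsum_cong') (use insert in \<open>auto intro!: finsum_closed finsum_insert\<close>)
  also have "\<dots> = (\<Oplus>j\<in>B. f i j) \<oplus> (\<Oplus>j\<in>B. \<Oplus>i\<in>A. f i j)"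
    by (rule finsum_addf) (use insert in \<open>auto intro!: finsum_closed\<close>)
  also have "\<dots> = (\<Oplus>j\<in>B. f i j) \<oplus> (\<Oplus>i\<in>A. \<Oplus>j\<in>B. f i j)" using insert by simp
  also have "\<dots> = (\<Oplus>i\<in>insert i A. \<Oplus>j\<in>B. f i j)"
    using insert by (intro finsum_insert[symmetric]) (auto intro!: finsum_closed)
  finally show ?case ..
qed simp

text \<open>Isolates what the matrix algebra needs from the grading: the entries on the diagonal
  form the field, and nonzero entries off the diagonal strictly raise \<open>deg\<close>.\<close>

locale graded_matrix = cring R for R :: "('r, 'x) ring_scheme" (structure) +
  fixes I :: "'i set" and H :: "'i \<Rightarrow> 'i \<Rightarrow> 'r set" and deg :: "'i \<Rightarrow> real" and c :: "'k::field \<Rightarrow> 'r"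
  assumes finI: "finite I"
    and H_sub: "\<lbrakk>x \<in> I; y \<in> I\<rbrakk> \<Longrightarrow> H x y \<subseteq> carrier R"
    and H_zero: "\<lbrakk>x \<in> I; y \<in> I\<rbrakk> \<Longrightarrow> \<zero> \<in> H x y"
    and H_add: "\<lbrakk>x \<in> I; y \<in> I; a \<in> H x y; b \<in> H x y\<rbrakk> \<Longrightarrow> a \<oplus> b \<in> H x y"
    and H_neg: "\<lbrakk>x \<in> I; y \<in> I; a \<in> H x y\<rbrakk> \<Longrightarrow> \<ominus> a \<in> H x y"
    and H_mult: "\<lbrakk>x \<in> I; y \<in> I; z \<in> I; a \<in> H x y; b \<in> H y z\<rbrakk> \<Longrightarrow> a \<otimes> b \<in> H x z"
    and H_dir: "\<lbrakk>x \<in> I; y \<in> I; x \<noteq> y; a \<in> H x y; a \<noteq> \<zero>\<rbrakk> \<Longrightarrow> deg y < deg x"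
    and H_diag: "x \<in> I \<Longrightarrow> H x x = range c"
    and c_add: "c (\<alpha> + \<beta>) = c \<alpha> \<oplus> c \<beta>"
    and c_mult: "c (\<alpha> * \<beta>) = c \<alpha> \<otimes> c \<beta>"
    and c_one: "c 1 = \<one>"
    and nontrivial: "\<one> \<noteq> \<zero>"
begin

text \<open>Matrix times column vector. A product of matrices is this operation on each column, so
  the ring axioms of \<open>A\<close> and the module axioms of columns rest on the same
  lemmas.\<close>

definition mv where "mv a u = (\<lambda>x\<in>I. \<Oplus>z\<in>I. a x z \<otimes> u z)"

definition A :: "('i \<Rightarrow> 'i \<Rightarrow> 'r) ring" where
  "A = \<lparr>carrier = (\<Pi>\<^sub>E x\<in>I. \<Pi>\<^sub>E y\<in>I. H x y),
      monoid.mult = (\<lambda>r s. \<lambda>x\<in>I. \<lambda>y\<in>I. \<Oplus>z\<in>I. r x z \<otimes> s z y),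
      one = (\<lambda>x\<in>I. \<lambda>y\<in>I. if x = y then \<one> else \<zero>),
      ring.zero = (\<lambda>x\<in>I. \<lambda>y\<in>I. \<zero>),
      add = (\<lambda>r s. \<lambda>x\<in>I. \<lambda>y\<in>I. r x y \<oplus> s x y)\<rparr>"

lemma H_one: "x \<in> I \<Longrightarrow> \<one> \<in> H x x" using H_diag c_one by (metis rangeI)

lemma A_carrier: "a \<in> carrier A \<longleftrightarrow> a \<in> (\<Pi>\<^sub>E x\<in>I. \<Pi>\<^sub>E y\<in>I. H x y)" by (simp add: A_def)

lemma A_entry: "\<lbrakk>a \<in> carrier A; x \<in> I; y \<in> I\<rbrakk> \<Longrightarrow> a x y \<in> H x y"
  by (auto simp: A_carrier PiE_def Pi_def)

lemma A_entry_R: "\<lbrakk>a \<in> carrier A; x \<in> I; y \<in> I\<rbrakk> \<Longrightarrow> a x y \<in> carrier R"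
  using A_entry H_sub by blast

lemma A_eqI: "\<lbrakk>a \<in> carrier A; b \<in> carrier A; \<And>x y. \<lbrakk>x \<in> I; y \<in> I\<rbrakk> \<Longrightarrow> a x y = b x y\<rbrakk> \<Longrightarrow> a = b"
  unfolding A_carrier by (rule PiE_ext, assumption, assumption, rule PiE_ext) (auto simp: PiE_def Pi_def)

lemma A_simps [simp]:
  "x \<in> I \<Longrightarrow> y \<in> I \<Longrightarrow> (a \<otimes>\<^bsub>A\<^esub> b) x y = (\<Oplus>z\<in>I. a x z \<otimes> b z y)"
  "x \<in> I \<Longrightarrow> y \<in> I \<Longrightarrow> \<one>\<^bsub>A\<^esub> x y = (if x = y then \<one> else \<zero>)"
  "x \<in> I \<Longrightarrow> y \<in> I \<Longrightarrow> \<zero>\<^bsub>A\<^esub> x y = \<zero>"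
  "x \<in> I \<Longrightarrow> y \<in> I \<Longrightarrow> (a \<oplus>\<^bsub>A\<^esub> b) x y = a x y \<oplus> b x y"
  by (auto simp: A_def)

lemma mv_add_l:
  assumes a: "a \<in> carrier A" and b: "b \<in> carrier A" and u: "u \<in> I \<rightarrow> carrier R" and x: "x \<in> I"
  shows "mv (a \<oplus>\<^bsub>A\<^esub> b) u x = mv a u x \<oplus> mv b u x"
proof -
  have uc: "z \<in> I \<Longrightarrow> u z \<in> carrier R" for z using u by auto
  note e = A_entry_R[OF a x] A_entry_R[OF b x]
  have "(\<Oplus>z\<in>I. (a \<oplus>\<^bsub>A\<^esub> b) x z \<otimes> u z) = (\<Oplus>z\<in>I. a x z \<otimes> u z \<oplus> b x z \<otimes> u z)"
    by (rule finsum_cong') (use x e uc in \<open>auto simp: l_distr\<close>)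
  also have "\<dots> = (\<Oplus>z\<in>I. a x z \<otimes> u z) \<oplus> (\<Oplus>z\<in>I. b x z \<otimes> u z)"
    by (rule finsum_addf) (use e uc in auto)
  finally show ?thesis using x by (simp add: mv_def)
qed

lemma mv_add_r:
  assumes a: "a \<in> carrier A" and u: "u \<in> I \<rightarrow> carrier R" and v: "v \<in> I \<rightarrow> carrier R" and x: "x \<in> I"
  shows "mv a (\<lambda>x\<in>I. u x \<oplus> v x) x = mv a u x \<oplus> mv a v x"
proof -
  have uc: "z \<in> I \<Longrightarrow> u z \<in> carrier R" "z \<in> I \<Longrightarrow> v z \<in> carrier R" for z using u v by auto
  note e = A_entry_R[OF a x]
  have "(\<Oplus>z\<in>I. a x z \<otimes> (\<lambda>x\<in>I. u x \<oplus> v x) z) = (\<Oplus>z\<in>I. a x z \<otimes> u z \<oplus> a x z \<otimes> v z)"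
    by (rule finsum_cong') (use x e uc in \<open>auto simp: r_distr\<close>)
  also have "\<dots> = (\<Oplus>z\<in>I. a x z \<otimes> u z) \<oplus> (\<Oplus>z\<in>I. a x z \<otimes> v z)"
    by (rule finsum_addf) (use e uc in auto)
  finally show ?thesis using x by (simp add: mv_def)
qed

lemma mv_assoc:
  assumes a: "a \<in> carrier A" and b: "b \<in> carrier A" and u: "u \<in> I \<rightarrow> carrier R" and x: "x \<in> I"
  shows "mv (a \<otimes>\<^bsub>A\<^esub> b) u x = mv a (mv b u) x"
proof -
  note e = A_entry_R[OF a] A_entry_R[OF b]
  have uc: "z \<in> I \<Longrightarrow> u z \<in> carrier R" for z using u by auto
  have "mv (a \<otimes>\<^bsub>A\<^esub> b) u x = (\<Oplus>z\<in>I. (\<Oplus>w\<in>I. a x w \<otimes> b w z) \<otimes> u z)"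
    unfolding mv_def using x e uc by (simp cong: finsum_cong)
  also have "\<dots> = (\<Oplus>z\<in>I. \<Oplus>w\<in>I. a x w \<otimes> b w z \<otimes> u z)"
    by (rule finsum_cong') (use x e uc finI in \<open>auto simp: Pi_def intro!: finsum_ldistr finsum_closed\<close>)
  also have "\<dots> = (\<Oplus>w\<in>I. \<Oplus>z\<in>I. a x w \<otimes> b w z \<otimes> u z)"
    by (rule finsum_swap[OF finI finI]) (use x e uc in auto)
  also have "\<dots> = (\<Oplus>w\<in>I. a x w \<otimes> (\<Oplus>z\<in>I. b w z \<otimes> u z))"
  proof (rule finsum_cong')
    fix w assume w: "w \<in> I"
    have "(\<Oplus>z\<in>I. a x w \<otimes> b w z \<otimes> u z) = (\<Oplus>z\<in>I. a x w \<otimes> (b w z \<otimes> u z))"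
      by (rule finsum_cong') (use x e uc w in \<open>auto simp: m_assoc\<close>)
    also have "\<dots> = a x w \<otimes> (\<Oplus>z\<in>I. b w z \<otimes> u z)"
      by (rule finsum_rdistr[symmetric]) (use x e uc w finI in auto)
    finally show "(\<Oplus>z\<in>I. a x w \<otimes> b w z \<otimes> u z) = a x w \<otimes> (\<Oplus>z\<in>I. b w z \<otimes> u z)" .
  qed (use x e uc in \<open>auto intro!: finsum_closed\<close>)
  also have "\<dots> = mv a (mv b u) x" unfolding mv_def using x e uc by (auto simp: Pi_def intro!: finsum_cong' finsum_closed)
  finally show ?thesis .
qed

lemma sum_delta_l: "\<lbrakk>x \<in> I; u \<in> I \<rightarrow> carrier R\<rbrakk> \<Longrightarrow> (\<Oplus>z\<in>I. (if x = z then u z else \<zero>)) = u x"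
  by (rule add.finprod_singleton) (auto simp: finI)

lemma mv_one: "\<lbrakk>u \<in> I \<rightarrow> carrier R; x \<in> I\<rbrakk> \<Longrightarrow> mv \<one>\<^bsub>A\<^esub> u x = u x"
proof -
  assume u: "u \<in> I \<rightarrow> carrier R" and x: "x \<in> I"
  have "mv \<one>\<^bsub>A\<^esub> u x = (\<Oplus>z\<in>I. (if x = z then u z else \<zero>))"
    unfolding mv_def using x u by (auto simp: Pi_def intro!: finsum_cong')
  then show ?thesis using sum_delta_l[OF x u] by simp
qed

lemma H_finsum: "\<lbrakk>x \<in> I; y \<in> I; finite S; f \<in> S \<rightarrow> H x y\<rbrakk> \<Longrightarrow> (\<Oplus>z\<in>S. f z) \<in> H x y"
proof -
  assume x: "x \<in> I" "y \<in> I"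
  show "finite S \<Longrightarrow> f \<in> S \<rightarrow> H x y \<Longrightarrow> (\<Oplus>z\<in>S. f z) \<in> H x y"
  proof (induction S rule: finite_induct)
    case (insert z S)
    have "f \<in> S \<rightarrow> carrier R" "f z \<in> carrier R" using insert.prems H_sub[OF x] by auto
    then show ?case using insert H_add[OF x] by simp
  qed (use H_zero[OF x] in simp)
qed

lemma A_ring: "ring A"
proof (rule ringI)
  have z: "\<zero>\<^bsub>A\<^esub> \<in> carrier A" using H_zero by (auto simp: A_def)
  have o: "\<one>\<^bsub>A\<^esub> \<in> carrier A" using H_zero H_one by (auto simp: A_def)
  have p: "a \<oplus>\<^bsub>A\<^esub> b \<in> carrier A" if "a \<in> carrier A" "b \<in> carrier A" for a b
    using that H_add A_entry by (auto simp: A_def)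
  have t: "a \<otimes>\<^bsub>A\<^esub> b \<in> carrier A" if "a \<in> carrier A" "b \<in> carrier A" for a b
    using A_entry[OF that(1)] A_entry[OF that(2)] H_mult by (auto simp: A_def intro!: H_finsum[OF _ _ finI])
  have col: "(\<lambda>z. b z y) \<in> I \<rightarrow> carrier R" if "b \<in> carrier A" "y \<in> I" for b y using A_entry_R[OF that(1)] that(2) by auto
  have mm: "(a \<otimes>\<^bsub>A\<^esub> b) x y = mv a (\<lambda>z. b z y) x" if "x \<in> I" "y \<in> I" for a b x y using that by (simp add: mv_def)
  show "abelian_group A"
  proof (rule abelian_groupI)
    fix a assume a: "a \<in> carrier A"
    have "(\<lambda>x\<in>I. \<lambda>y\<in>I. \<ominus> a x y) \<in> carrier A" using A_entry[OF a] H_neg by (auto simp: A_def)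
    then show "\<exists>b\<in>carrier A. b \<oplus>\<^bsub>A\<^esub> a = \<zero>\<^bsub>A\<^esub>"
      using a z p A_entry_R[OF a] by (intro bexI[of _ "\<lambda>x\<in>I. \<lambda>y\<in>I. \<ominus> a x y"] A_eqI) (auto simp: l_neg)
  qed (use z p in \<open>auto intro!: A_eqI simp: A_entry_R a_ac\<close>)
  show "Group.monoid A"
  proof (rule monoidI)
    fix a b d assume a: "a \<in> carrier A" and b: "b \<in> carrier A" and d: "d \<in> carrier A"
    show "a \<otimes>\<^bsub>A\<^esub> b \<otimes>\<^bsub>A\<^esub> d = a \<otimes>\<^bsub>A\<^esub> (b \<otimes>\<^bsub>A\<^esub> d)"
    proof (rule A_eqI)
      fix x y assume x: "x \<in> I" and y: "y \<in> I"
      have "mv a (mv b (\<lambda>z. d z y)) x = mv a (\<lambda>z. (b \<otimes>\<^bsub>A\<^esub> d) z y) x"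
        unfolding mv_def using x y A_entry_R[OF a] A_entry_R[OF t[OF b d]] by (auto intro!: finsum_cong')
      then show "(a \<otimes>\<^bsub>A\<^esub> b \<otimes>\<^bsub>A\<^esub> d) x y = (a \<otimes>\<^bsub>A\<^esub> (b \<otimes>\<^bsub>A\<^esub> d)) x y"
        using mv_assoc[OF a b col[OF d y] x] mm[OF x y] by simp
    qed (use a b d t in auto)
  next
    fix a assume a: "a \<in> carrier A"
    show "\<one>\<^bsub>A\<^esub> \<otimes>\<^bsub>A\<^esub> a = a"
    proof (rule A_eqI)
      fix x y assume "x \<in> I" "y \<in> I"
      then show "(\<one>\<^bsub>A\<^esub> \<otimes>\<^bsub>A\<^esub> a) x y = a x y" using mm mv_one col[OF a] by simp
    qed (use a o t in auto)
    show "a \<otimes>\<^bsub>A\<^esub> \<one>\<^bsub>A\<^esub> = a"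
    proof (rule A_eqI)
      fix x y assume x: "x \<in> I" and y: "y \<in> I"
      have "(a \<otimes>\<^bsub>A\<^esub> \<one>\<^bsub>A\<^esub>) x y = (\<Oplus>z\<in>I. (if y = z then a x z else \<zero>))"
        using x y A_entry_R[OF a] by (auto intro!: finsum_cong')
      then show "(a \<otimes>\<^bsub>A\<^esub> \<one>\<^bsub>A\<^esub>) x y = a x y"
        using x A_entry_R[OF a] sum_delta_l[OF y, of "a x"] by auto
    qed (use a o t in auto)
  qed (use o t in auto)
  fix a b d assume a: "a \<in> carrier A" and b: "b \<in> carrier A" and d: "d \<in> carrier A"
  show "(a \<oplus>\<^bsub>A\<^esub> b) \<otimes>\<^bsub>A\<^esub> d = a \<otimes>\<^bsub>A\<^esub> d \<oplus>\<^bsub>A\<^esub> b \<otimes>\<^bsub>A\<^esub> d"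
  proof (rule A_eqI)
    fix x y assume x: "x \<in> I" and y: "y \<in> I"
    show "((a \<oplus>\<^bsub>A\<^esub> b) \<otimes>\<^bsub>A\<^esub> d) x y = (a \<otimes>\<^bsub>A\<^esub> d \<oplus>\<^bsub>A\<^esub> b \<otimes>\<^bsub>A\<^esub> d) x y"
      using mv_add_l[OF a b col[OF d y] x] mm[OF x y] A_simps(4)[OF x y] by metis
  qed (use a b d p t in auto)
  show "d \<otimes>\<^bsub>A\<^esub> (a \<oplus>\<^bsub>A\<^esub> b) = d \<otimes>\<^bsub>A\<^esub> a \<oplus>\<^bsub>A\<^esub> d \<otimes>\<^bsub>A\<^esub> b"
  proof (rule A_eqI)
    fix x y assume x: "x \<in> I" and y: "y \<in> I"
    have "mv d (\<lambda>x\<in>I. a x y \<oplus> b x y) x = mv d (\<lambda>z. (a \<oplus>\<^bsub>A\<^esub> b) z y) x"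
      unfolding mv_def using x y A_entry_R[OF d] A_entry_R[OF p[OF a b]] by (auto intro!: finsum_cong')
    then show "(d \<otimes>\<^bsub>A\<^esub> (a \<oplus>\<^bsub>A\<^esub> b)) x y = (d \<otimes>\<^bsub>A\<^esub> a \<oplus>\<^bsub>A\<^esub> d \<otimes>\<^bsub>A\<^esub> b) x y"
      using mv_add_r[OF d col[OF a y] col[OF b y] x] mm[OF x y] A_simps(4)[OF x y] by metis
  qed (use a b d p t in auto)
qed

subsection \<open>Column modules\<close>

definition col :: "('i \<Rightarrow> 'r set) \<Rightarrow> ('i \<Rightarrow> 'i \<Rightarrow> 'r, 'i \<Rightarrow> 'r) module" where
  "col C = \<lparr>carrier = (\<Pi>\<^sub>E x\<in>I. C x), monoid.mult = (\<lambda>x y. x), one = (\<lambda>x\<in>I. \<zero>), ring.zero = (\<lambda>x\<in>I. \<zero>),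
     add = (\<lambda>u v. \<lambda>x\<in>I. u x \<oplus> v x), smult = mv\<rparr>"

definition colC where
  "colC C \<longleftrightarrow> (\<forall>x\<in>I. C x \<subseteq> carrier R \<and> \<zero> \<in> C x \<and> (\<forall>a\<in>C x. \<forall>b\<in>C x. a \<oplus> b \<in> C x) \<and> (\<forall>a\<in>C x. \<ominus> a \<in> C x) \<and>
     (\<forall>w\<in>I. \<forall>h\<in>H x w. \<forall>a\<in>C w. h \<otimes> a \<in> C x))"

lemma col_simps:
  "u \<in> carrier (col C) \<longleftrightarrow> u \<in> (\<Pi>\<^sub>E x\<in>I. C x)" "\<zero>\<^bsub>col C\<^esub> = (\<lambda>x\<in>I. \<zero>)" "u \<oplus>\<^bsub>col C\<^esub> v = (\<lambda>x\<in>I. u x \<oplus> v x)"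
      "a \<odot>\<^bsub>col C\<^esub> u = mv a u"
  by (auto simp: col_def)

lemma colC_R: "\<lbrakk>colC C; x \<in> I; a \<in> C x\<rbrakk> \<Longrightarrow> a \<in> carrier R"
  unfolding colC_def by blast

lemma col_R: "\<lbrakk>colC C; u \<in> carrier (col C)\<rbrakk> \<Longrightarrow> u \<in> I \<rightarrow> carrier R"
  using colC_R by (auto simp: col_simps PiE_def Pi_def)

lemma col_eqI: "\<lbrakk>u \<in> carrier (col C); v \<in> carrier (col C); \<And>x. x \<in> I \<Longrightarrow> u x = v x\<rbrakk> \<Longrightarrow> u = v"
  unfolding col_simps by (rule PiE_ext)

lemma mv_ext: "x \<notin> I \<Longrightarrow> mv a u x = undefined" by (simp add: mv_def)

lemma C_finsum: "\<lbrakk>colC C; x \<in> I; finite S; f \<in> S \<rightarrow> C x\<rbrakk> \<Longrightarrow> (\<Oplus>z\<in>S. f z) \<in> C x"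
proof -
  assume C: "colC C" and x: "x \<in> I"
  show "finite S \<Longrightarrow> f \<in> S \<rightarrow> C x \<Longrightarrow> (\<Oplus>z\<in>S. f z) \<in> C x"
  proof (induction S rule: finite_induct)
    case (insert z S)
    have "f \<in> S \<rightarrow> carrier R" "f z \<in> carrier R" using insert.prems colC_R[OF C x] by auto
    then show ?case using insert C x by (simp add: colC_def)
  qed (use C x in \<open>simp add: colC_def\<close>)
qed

lemma mv_col:
  assumes C: "colC C" and a: "a \<in> carrier A" and u: "u \<in> carrier (col C)" shows "mv a u \<in> carrier (col C)"
  using A_entry[OF a] u C by (auto simp: col_simps mv_def intro!: C_finsum[OF C _ finI]) (auto simp: colC_def PiE_def Pi_def)

lemma col_left_module:
  assumes C: "colC C" shows "left_module A (col C)"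
proof -
  have p: "u \<oplus>\<^bsub>col C\<^esub> v \<in> carrier (col C)" if "u \<in> carrier (col C)" "v \<in> carrier (col C)" for u v
    using that C by (auto simp: col_simps colC_def PiE_def Pi_def)
  have z: "\<zero>\<^bsub>col C\<^esub> \<in> carrier (col C)" using C by (auto simp: col_simps colC_def)
  have e: "u x \<in> carrier R" if "u \<in> carrier (col C)" "x \<in> I" for u x using col_R[OF C that(1)] that(2) by auto
  have ab: "abelian_group (col C)"
  proof (rule abelian_groupI)
    fix u assume u: "u \<in> carrier (col C)"
    have "(\<lambda>x\<in>I. \<ominus> u x) \<in> carrier (col C)" using u C by (auto simp: col_simps colC_def PiE_def Pi_def)
    then show "\<exists>v\<in>carrier (col C). v \<oplus>\<^bsub>col C\<^esub> u = \<zero>\<^bsub>col C\<^esub>"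
      using e[OF u] by (intro bexI[of _ "\<lambda>x\<in>I. \<ominus> u x"]) (auto simp: col_simps l_neg)
  next
    fix u v w assume "u \<in> carrier (col C)" "v \<in> carrier (col C)" "w \<in> carrier (col C)"
    then show "u \<oplus>\<^bsub>col C\<^esub> v \<oplus>\<^bsub>col C\<^esub> w = u \<oplus>\<^bsub>col C\<^esub> (v \<oplus>\<^bsub>col C\<^esub> w)"
      using e by (intro col_eqI[where C = C] p) (auto simp: col_simps a_assoc)
  next
    fix u v assume "u \<in> carrier (col C)" "v \<in> carrier (col C)"
    then show "u \<oplus>\<^bsub>col C\<^esub> v = v \<oplus>\<^bsub>col C\<^esub> u"
      using e by (intro col_eqI[where C = C] p) (auto simp: col_simps a_comm)
  next
    fix u assume u: "u \<in> carrier (col C)"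
    then show "\<zero>\<^bsub>col C\<^esub> \<oplus>\<^bsub>col C\<^esub> u = u"
      using e z by (intro col_eqI[where C = C] p) (auto simp: col_simps)
  qed (use p z in auto)
  note cR = col_R[OF C]
  interpret A: ring A by (rule A_ring)
  show ?thesis
  proof (rule left_moduleI[OF A_ring ab])
    fix a u assume "a \<in> carrier A" "u \<in> carrier (col C)"
    then show "a \<odot>\<^bsub>col C\<^esub> u \<in> carrier (col C)" using mv_col[OF C] by (simp add: col_simps(4))
  next
    fix a b u assume h: "a \<in> carrier A" "b \<in> carrier A" "u \<in> carrier (col C)"
    show "(a \<oplus>\<^bsub>A\<^esub> b) \<odot>\<^bsub>col C\<^esub> u = a \<odot>\<^bsub>col C\<^esub> u \<oplus>\<^bsub>col C\<^esub> b \<odot>\<^bsub>col C\<^esub> u"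
      by (rule ext) (use h mv_add_l[OF h(1,2) cR[OF h(3)]] mv_ext in \<open>auto simp: col_simps\<close>)
    show "(a \<otimes>\<^bsub>A\<^esub> b) \<odot>\<^bsub>col C\<^esub> u = a \<odot>\<^bsub>col C\<^esub> (b \<odot>\<^bsub>col C\<^esub> u)"
      by (rule ext, case_tac "x \<in> I") (use mv_assoc[OF h(1,2) cR[OF h(3)]] mv_ext in \<open>auto simp: col_simps\<close>)
  next
    fix a u v assume h: "a \<in> carrier A" "u \<in> carrier (col C)" "v \<in> carrier (col C)"
    show "a \<odot>\<^bsub>col C\<^esub> (u \<oplus>\<^bsub>col C\<^esub> v) = a \<odot>\<^bsub>col C\<^esub> u \<oplus>\<^bsub>col C\<^esub> a \<odot>\<^bsub>col C\<^esub> v"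
      by (rule ext) (use h mv_add_r[OF h(1) cR[OF h(2)] cR[OF h(3)]] mv_ext in \<open>auto simp: col_simps\<close>)
  next
    fix u assume h: "u \<in> carrier (col C)"
    have "mv \<one>\<^bsub>A\<^esub> u = u" by (rule col_eqI[OF mv_col[OF C _ h] h]) (use mv_one[OF cR[OF h]] in auto)
    then show "\<one>\<^bsub>A\<^esub> \<odot>\<^bsub>col C\<^esub> u = u" by (simp add: col_simps)
  qed
qed

subsection \<open>Matrix units\<close>

definition E where "E r i j = (\<lambda>x\<in>I. \<lambda>y\<in>I. if x = i \<and> y = j then r else \<zero>)"

lemma E_closed: "\<lbrakk>i \<in> I; j \<in> I; r \<in> H i j\<rbrakk> \<Longrightarrow> E r i j \<in> carrier A"
  using H_zero by (auto simp: A_def E_def)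

lemma E_mv: "\<lbrakk>i \<in> I; j \<in> I; r \<in> carrier R; u \<in> I \<rightarrow> carrier R\<rbrakk> \<Longrightarrow> mv (E r i j) u = (\<lambda>x\<in>I. if x = i then r \<otimes> u j else \<zero>)"
proof (rule ext)
  fix x assume h: "i \<in> I" "j \<in> I" "r \<in> carrier R" "u \<in> I \<rightarrow> carrier R"
  show "mv (E r i j) u x = (\<lambda>x\<in>I. if x = i then r \<otimes> u j else \<zero>) x"
  proof (cases "x \<in> I")
    case True
    then have "mv (E r i j) u x = (\<Oplus>z\<in>I. if j = z then (if x = i then r \<otimes> u z else \<zero>) else \<zero>)"
      unfolding mv_def using h by (auto simp: E_def Pi_def intro!: finsum_cong')
    also have "\<dots> = (if x = i then r \<otimes> u j else \<zero>)" using h by (intro sum_delta_l) (auto simp: Pi_def)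
    finally show ?thesis using True by simp
  qed (simp add: mv_def)
qed

lemma E_mult_l: "\<lbrakk>i \<in> I; j \<in> I; r \<in> carrier R; a \<in> carrier A; x \<in> I; y \<in> I\<rbrakk> \<Longrightarrow>
    (E r i j \<otimes>\<^bsub>A\<^esub> a) x y = (if x = i then r \<otimes> a j y else \<zero>)"
  using E_mv[of i j r "\<lambda>z. a z y"] A_entry_R[of a] by (auto simp: mv_def fun_eq_iff Pi_def restrict_def split: if_splits)

lemma E_mult_r: "\<lbrakk>i \<in> I; j \<in> I; r \<in> carrier R; a \<in> carrier A; x \<in> I; y \<in> I\<rbrakk> \<Longrightarrow>
    (a \<otimes>\<^bsub>A\<^esub> E r i j) x y = (if y = j then a x i \<otimes> r else \<zero>)"
proof -
  assume h: "i \<in> I" "j \<in> I" "r \<in> carrier R" "a \<in> carrier A" "x \<in> I" "y \<in> I"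
  have "(a \<otimes>\<^bsub>A\<^esub> E r i j) x y = (\<Oplus>z\<in>I. if i = z then (if y = j then a x z \<otimes> r else \<zero>) else \<zero>)"
    using h A_entry_R[OF h(4,5)] by (auto simp: E_def intro!: finsum_cong')
  also have "\<dots> = (if y = j then a x i \<otimes> r else \<zero>)" using h A_entry_R[OF h(4,5)] by (intro sum_delta_l) auto
  finally show ?thesis .
qed

definition e where "e i = E \<one> i i"
definition s where "s i \<alpha> = E (c \<alpha>) i i"

lemma c_closed: "i \<in> I \<Longrightarrow> c \<alpha> \<in> H i i" using H_diag by auto

lemma finsum_A: "\<lbrakk>finite S; f \<in> S \<rightarrow> carrier A; x \<in> I; y \<in> I\<rbrakk> \<Longrightarrow> (\<Oplus>\<^bsub>A\<^esub>i\<in>S. f i) x y = (\<Oplus>i\<in>S. f i x y)"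
proof -
  assume x: "x \<in> I" "y \<in> I"
  interpret A: ring A by (rule A_ring)
  show "finite S \<Longrightarrow> f \<in> S \<rightarrow> carrier A \<Longrightarrow> (\<Oplus>\<^bsub>A\<^esub>i\<in>S. f i) x y = (\<Oplus>i\<in>S. f i x y)"
  proof (induction S rule: finite_induct)
    case (insert i S)
    then have "f \<in> S \<rightarrow> carrier A" "f i \<in> carrier A" by auto
    moreover from this have "(\<lambda>i. f i x y) \<in> S \<rightarrow> carrier R" "f i x y \<in> carrier R" using A_entry_R x by auto
    ultimately show ?case using insert x by simp
  qed (use x in simp)
qed

sublocale D: directed_ring A I e deg s
proof (intro directed_ring.intro A_ring directed_ring_axioms.intro)
  interpret A: ring A by (rule A_ring)
  have EA: "E r i j \<in> carrier A" if "i \<in> I" "j \<in> I" "r \<in> H i j" for r i j using E_closed that by blast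
  have HR: "r \<in> carrier R" if "i \<in> I" "j \<in> I" "r \<in> H i j" for r i j using H_sub that by blast
  have cR: "c \<alpha> \<in> carrier R" if "i \<in> I" for i \<alpha> using HR[OF that that c_closed[OF that]] .
  show "finite I" by (rule finI)
  show ec: "e i \<in> carrier A" if "i \<in> I" for i unfolding e_def using EA H_one that by blast
  show "e i \<otimes>\<^bsub>A\<^esub> e i = e i" if "i \<in> I" for i
    by (rule A_eqI) (use that ec in \<open>auto simp del: A_simps(1) simp: E_mult_l e_def\<close>, auto simp: E_def)
  show "e i \<otimes>\<^bsub>A\<^esub> e j = \<zero>\<^bsub>A\<^esub>" if "i \<in> I" "j \<in> I" "i \<noteq> j" for i j
    by (rule A_eqI) (use that ec in \<open>auto simp del: A_simps(1) simp: E_mult_l e_def\<close>, auto simp: E_def)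
  show "(\<Oplus>\<^bsub>A\<^esub>i\<in>I. e i) = \<one>\<^bsub>A\<^esub>"
  proof (rule A_eqI)
    fix x y assume x: "x \<in> I" and y: "y \<in> I"
    have "(\<Oplus>\<^bsub>A\<^esub>i\<in>I. e i) x y = (\<Oplus>i\<in>I. e i x y)" by (rule finsum_A) (use x y ec finI in auto)
    also have "\<dots> = (\<Oplus>i\<in>I. if x = i then (if x = y then \<one> else \<zero>) else \<zero>)"
      using x y by (intro finsum_cong') (auto simp: e_def E_def)
    also have "\<dots> = \<one>\<^bsub>A\<^esub> x y" using x y by (subst sum_delta_l) auto
    finally show "(\<Oplus>\<^bsub>A\<^esub>i\<in>I. e i) x y = \<one>\<^bsub>A\<^esub> x y" .
  qed (use ec in \<open>auto intro!: A.finsum_closed\<close>)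
  \<comment> \<open>The Peirce component of \<open>a\<close> at \<open>i\<close>, \<open>j\<close>
    is a matrix unit with entry \<open>a i j\<close>; directedness and the shape of the corner rings
    are read off from it.\<close>
  have eae: "e i \<otimes>\<^bsub>A\<^esub> a \<otimes>\<^bsub>A\<^esub> e j = E (a i j) i j" if "i \<in> I" "j \<in> I" "a \<in> carrier A" for i j a
  proof (rule A_eqI)
    fix x y assume x: "x \<in> I" and y: "y \<in> I"
    have "(e i \<otimes>\<^bsub>A\<^esub> a \<otimes>\<^bsub>A\<^esub> e j) x y = (if y = j then (e i \<otimes>\<^bsub>A\<^esub> a) x j \<otimes> \<one> else \<zero>)"
      using E_mult_r[of j j \<one> "e i \<otimes>\<^bsub>A\<^esub> a" x y] that ec x y by (simp add: e_def[of j])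
    also have "(e i \<otimes>\<^bsub>A\<^esub> a) x j = (if x = i then \<one> \<otimes> a i j else \<zero>)"
      using E_mult_l[of i i \<one> a x j] that x by (simp add: e_def del: A_simps(1))
    finally show "(e i \<otimes>\<^bsub>A\<^esub> a \<otimes>\<^bsub>A\<^esub> e j) x y = E (a i j) i j x y"
      using x y that A_entry_R[OF that(3,1,2)] by (simp add: E_def del: A_simps(1))
  qed (use that ec EA A_entry in auto)
  show "deg j < deg i" if "i \<in> I" "j \<in> I" "i \<noteq> j" "a \<in> carrier A" "e i \<otimes>\<^bsub>A\<^esub> a \<otimes>\<^bsub>A\<^esub> e j \<noteq> \<zero>\<^bsub>A\<^esub>" for i j a
  proof (rule H_dir[OF that(1,2,3) A_entry[OF that(4,1,2)]])
    show "a i j \<noteq> \<zero>"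
    proof
      assume "a i j = \<zero>"
      then have "E (a i j) i j = \<zero>\<^bsub>A\<^esub>" by (auto simp: E_def A_def)
      then show False using eae[OF that(1,2,4)] that(5) by simp
    qed
  qed
  show sc: "s i \<alpha> \<in> carrier A" if "i \<in> I" for i \<alpha> unfolding s_def using EA c_closed that by blast
  show "s i (\<alpha> + \<beta>) = s i \<alpha> \<oplus>\<^bsub>A\<^esub> s i \<beta>" if "i \<in> I" for i \<alpha> \<beta>
  proof (rule A_eqI)
    fix x y assume "x \<in> I" "y \<in> I"
    then show "s i (\<alpha> + \<beta>) x y = (s i \<alpha> \<oplus>\<^bsub>A\<^esub> s i \<beta>) x y" by (simp add: s_def E_def c_add)
  qed (use that sc in auto)
  show "s i (\<alpha> * \<beta>) = s i \<alpha> \<otimes>\<^bsub>A\<^esub> s i \<beta>" if "i \<in> I" for i \<alpha> \<beta>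
  proof (rule A_eqI)
    fix x y assume "x \<in> I" "y \<in> I"
    then show "s i (\<alpha> * \<beta>) x y = (s i \<alpha> \<otimes>\<^bsub>A\<^esub> s i \<beta>) x y"
      using E_mult_l[of i i "c \<alpha>" "s i \<beta>" x y] that sc cR[OF that] by (simp add: s_def E_def c_mult del: A_simps(1))
  qed (use that sc in auto)
  show "s i 1 = e i" for i by (simp add: s_def e_def c_one)
  show "\<exists>\<alpha>. e i \<otimes>\<^bsub>A\<^esub> a \<otimes>\<^bsub>A\<^esub> e i = s i \<alpha>" if "i \<in> I" "a \<in> carrier A" for i a
    using eae[OF that(1,1,2)] A_entry[OF that(2,1,1)] H_diag[OF that(1)] by (auto simp: s_def)
qed

end

lemma notop_zero_module:
  assumes "left_module R M" "carrier M = {\<zero>\<^bsub>M\<^esub>}" "e \<in> carrier R" shows "notop e B M"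
  using assms lm_zero_r[OF assms(1,3)] by (auto simp: notop_def intro: rad.zero)

section \<open>Column modules modulo ideals, mapping cones and tops\<close>

context graded_matrix
begin

definition idl where
  "idl J \<longleftrightarrow> J \<subseteq> carrier R \<and> \<zero> \<in> J \<and> (\<forall>a\<in>J. \<forall>b\<in>J. a \<oplus> b \<in> J) \<and> (\<forall>r\<in>carrier R. \<forall>a\<in>J. r \<otimes> a \<in> J)"

text \<open>\<open>J\<close> is an ideal of the whole ring, intersected here with each entry; its
  homogeneity enters only through the hypothesis \<open>j3\<close> of
  \<open>col_cone\<close>.\<close>

definition colsub where "colsub C J = {u \<in> carrier (col C). \<forall>x\<in>I. u x \<in> J}"

lemma idl_finsum: "\<lbrakk>idl J; finite S; f \<in> S \<rightarrow> J\<rbrakk> \<Longrightarrow> (\<Oplus>z\<in>S. f z) \<in> J"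
proof -
  assume J: "idl J"
  show "finite S \<Longrightarrow> f \<in> S \<rightarrow> J \<Longrightarrow> (\<Oplus>z\<in>S. f z) \<in> J"
  proof (induction S rule: finite_induct)
    case (insert z S)
    have "f \<in> S \<rightarrow> carrier R" "f z \<in> carrier R" using insert.prems J by (auto simp: idl_def)
    then show ?case using insert J by (simp add: idl_def)
  qed (use J in \<open>simp add: idl_def\<close>)
qed

lemma colsub_lsub:
  assumes C: "colC C" and J: "idl J" shows "lsub A (col C) (colsub C J)"
  unfolding lsub_def
proof (intro conjI ballI)
  interpret M: abelian_group "col C" using col_left_module[OF C] by (rule left_module_abelian_group)
  show "\<zero>\<^bsub>col C\<^esub> \<in> colsub C J" using M.zero_closed J by (auto simp: colsub_def col_simps(2) idl_def)
  show "u \<oplus>\<^bsub>col C\<^esub> v \<in> colsub C J" if "u \<in> colsub C J" "v \<in> colsub C J" for u v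
    using that J M.a_closed[of u v] by (auto simp: colsub_def col_simps(3) idl_def)
  show "a \<odot>\<^bsub>col C\<^esub> u \<in> colsub C J" if a: "a \<in> carrier A" and u: "u \<in> colsub C J" for a u
    using mv_col[OF C a, of u] u J A_entry_R[OF a] finI
    by (auto simp: colsub_def col_simps(4) mv_def idl_def intro!: idl_finsum[OF J finI])
qed (simp add: colsub_def)

lemma col_minus:
  assumes C: "colC C" and u: "u \<in> carrier (col C)" and v: "v \<in> carrier (col C)" and x: "x \<in> I"
  shows "(u \<ominus>\<^bsub>col C\<^esub> v) x = u x \<ominus> v x"
proof -
  interpret M: abelian_group "col C" using col_left_module[OF C] by (rule left_module_abelian_group)
  have vx: "\<And>x. x \<in> I \<Longrightarrow> v x \<in> carrier R" and ux: "u x \<in> carrier R" using col_R[OF C u] col_R[OF C v] x by auto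
  have n: "(\<lambda>x\<in>I. \<ominus> v x) \<in> carrier (col C)" using v C by (auto simp: col_simps colC_def PiE_def Pi_def)
  have "\<ominus>\<^bsub>col C\<^esub> v = (\<lambda>x\<in>I. \<ominus> v x)"
    by (rule M.minus_equality[OF _ v n]) (use vx in \<open>auto simp: col_simps l_neg fun_eq_iff restrict_def\<close>)
  then show ?thesis using x by (simp add: M.minus_eq col_simps minus_eq)
qed

definition cmul where "cmul r u = (\<lambda>x\<in>I. r \<otimes> u x)"

lemma cmul_app: "x \<in> I \<Longrightarrow> cmul r u x = r \<otimes> u x"
  by (simp add: cmul_def)

lemma cmul_ext: "x \<notin> I \<Longrightarrow> cmul r u x = undefined"
  by (simp add: cmul_def)

text \<open>Commutativity of \<open>R\<close> is linearity over \<open>A\<close>; the two families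
  \<open>C1\<close> and \<open>C2\<close> absorb the degree of \<open>r\<close>.\<close>

lemma cmul_hom:
  assumes C: "colC C1" "colC C2" and r: "r \<in> carrier R" and m: "\<And>x a. \<lbrakk>x \<in> I; a \<in> C1 x\<rbrakk> \<Longrightarrow> r \<otimes> a \<in> C2 x"
  shows "cmul r \<in> lhom A (col C1) (col C2)"
proof (rule lhomI)
  fix u assume u: "u \<in> carrier (col C1)"
  then show "cmul r u \<in> carrier (col C2)" using m by (auto simp: col_simps cmul_def)
next
  fix u v assume u: "u \<in> carrier (col C1)" and v: "v \<in> carrier (col C1)"
  show "cmul r (u \<oplus>\<^bsub>col C1\<^esub> v) = cmul r u \<oplus>\<^bsub>col C2\<^esub> cmul r v"
    using col_R[OF C(1) u] col_R[OF C(1) v] r by (auto simp: cmul_def col_simps r_distr fun_eq_iff restrict_def Pi_def)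
next
  fix a u assume a: "a \<in> carrier A" and u: "u \<in> carrier (col C1)"
  have uR: "\<And>x. x \<in> I \<Longrightarrow> u x \<in> carrier R" using col_R[OF C(1) u] by auto
  have "r \<otimes> (\<Oplus>z\<in>I. a x z \<otimes> u z) = (\<Oplus>z\<in>I. a x z \<otimes> (cmul r u) z)" if x: "x \<in> I" for x
  proof -
    note ax = A_entry_R[OF a x]
    have "r \<otimes> (\<Oplus>z\<in>I. a x z \<otimes> u z) = (\<Oplus>z\<in>I. r \<otimes> (a x z \<otimes> u z))"
      by (rule finsum_rdistr[OF finI r]) (use ax uR in auto)
    also have "\<dots> = (\<Oplus>z\<in>I. a x z \<otimes> (cmul r u) z)"
      by (rule finsum_cong') (use ax uR r in \<open>auto simp: cmul_def m_lcomm\<close>)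
    finally show ?thesis .
  qed
  then have "cmul r (mv a u) x = mv a (cmul r u) x" for x
    by (cases "x \<in> I") (simp_all add: mv_def cmul_app cmul_ext)
  then show "cmul r (a \<odot>\<^bsub>col C1\<^esub> u) = a \<odot>\<^bsub>col C2\<^esub> cmul r u"
    by (simp add: col_simps(4) fun_eq_iff)
qed

text \<open>No copy of the quotient is canonical, so all copies in \<open>'m\<close> are covered at
  once.\<close>

definition rs :: "nat \<Rightarrow> (nat \<Rightarrow> ('i \<Rightarrow> 'i \<Rightarrow> 'r, 'm) module \<Rightarrow> bool) \<Rightarrow> ('i \<Rightarrow> 'r set) \<Rightarrow> 'r set \<Rightarrow> bool" where
  "rs h \<Phi> C J \<longleftrightarrow> (\<forall>Q \<kappa>. coded A (col C) (colsub C J) Q \<kappa> \<longrightarrow> res A h \<Phi> Q)"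

text \<open>
  The mapping cone of multiplication by \<open>r\<close>, for an exact sequence
  \<open>0 \<rightarrow> C1 / J1 \<rightarrow> C2 / J2 \<rightarrow> C2 / J3 \<rightarrow> 0\<close> of column modules.
\<close>

lemma col_cone:
  fixes \<Phi> \<Phi>' \<Phi>'' :: "nat \<Rightarrow> ('i \<Rightarrow> 'i \<Rightarrow> 'r, 'm) module \<Rightarrow> bool"
  assumes inf: "infinite (UNIV :: 'm set)" and em: "inj_on (\<iota>1 :: _ \<Rightarrow> 'm) (carrier (col C1))"
      "inj_on (\<iota>2 :: _ \<Rightarrow> 'm) (carrier (col C2))"
    and C: "colC C1" "colC C2" and J: "idl J1" "idl J2" "idl J3"
    and r: "r \<in> carrier R" and m: "\<And>x a. \<lbrakk>x \<in> I; a \<in> C1 x\<rbrakk> \<Longrightarrow> r \<otimes> a \<in> C2 x"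
    and j1: "\<And>x a. \<lbrakk>x \<in> I; a \<in> C1 x\<rbrakk> \<Longrightarrow> r \<otimes> a \<in> J2 \<longleftrightarrow> a \<in> J1"
    and j3: "\<And>x v. \<lbrakk>x \<in> I; v \<in> C2 x\<rbrakk> \<Longrightarrow> v \<in> J3 \<longleftrightarrow> (\<exists>a\<in>C1 x. v \<ominus> r \<otimes> a \<in> J2)"
    and r1: "rs h \<Phi> C1 J1" and r2: "rs (Suc h) \<Phi>' C2 J2"
    and cb: "\<And>k. comb A (\<Phi>' (Suc k)) (\<Phi> k) (\<Phi>'' (Suc k))" and 0: "\<And>P. \<Phi>' 0 P \<Longrightarrow> \<Phi>'' 0 P"
  shows "rs (Suc h) \<Phi>'' C2 J3"
  unfolding rs_def
proof (intro allI impI)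
  fix Q :: "('i \<Rightarrow> 'i \<Rightarrow> 'r, 'm) module" and \<kappa> assume c3: "coded A (col C2) (colsub C2 J3) Q \<kappa>"
  note M = col_left_module[OF C(1)] col_left_module[OF C(2)]
  obtain Q1 :: "('i \<Rightarrow> 'i \<Rightarrow> 'r, 'm) module" and \<kappa>1 where c1: "coded A (col C1) (colsub C1 J1) Q1 \<kappa>1"
    using ex_coded[OF M(1) colsub_lsub[OF C(1) J(1)] em(1)] by blast
  obtain Q2 :: "('i \<Rightarrow> 'i \<Rightarrow> 'r, 'm) module" and \<kappa>2 where c2: "coded A (col C2) (colsub C2 J2) Q2 \<kappa>2"
    using ex_coded[OF M(2) colsub_lsub[OF C(2) J(2)] em(2)] by blast
  have q1: "left_module A Q1" "\<kappa>1 \<in> lhom A (col C1) Q1" "\<kappa>1 ` carrier (col C1) = carrier Q1"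
     "\<And>u. u \<in> carrier (col C1) \<Longrightarrow> \<kappa>1 u = \<zero>\<^bsub>Q1\<^esub> \<longleftrightarrow> u \<in> colsub C1 J1" using c1 by (auto simp: coded_def)
  have q2: "left_module A Q2" "\<kappa>2 \<in> lhom A (col C2) Q2" "\<kappa>2 ` carrier (col C2) = carrier Q2"
     "\<And>u. u \<in> carrier (col C2) \<Longrightarrow> \<kappa>2 u = \<zero>\<^bsub>Q2\<^esub> \<longleftrightarrow> u \<in> colsub C2 J2" using c2 by (auto simp: coded_def)
  have q3: "left_module A Q" "\<kappa> \<in> lhom A (col C2) Q" "\<kappa> ` carrier (col C2) = carrier Q"
     "\<And>u. u \<in> carrier (col C2) \<Longrightarrow> \<kappa> u = \<zero>\<^bsub>Q\<^esub> \<longleftrightarrow> u \<in> colsub C2 J3" using c3 by (auto simp: coded_def)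
  let ?f = "cmul r"
  have f: "?f \<in> lhom A (col C1) (col C2)" by (rule cmul_hom[OF C r m])
  have fsub: "?f u \<in> colsub C2 J2 \<longleftrightarrow> u \<in> colsub C1 J1" if u: "u \<in> carrier (col C1)" for u
  proof -
    have "u x \<in> C1 x" if "x \<in> I" for x using u that by (auto simp: col_simps)
    then show ?thesis using u lhom_closed[OF f u] j1 by (auto simp: colsub_def cmul_def)
  qed
  \<comment> \<open>This is \<open>j3\<close> with the witness zero.\<close>
  have J23: "colsub C2 J2 \<subseteq> colsub C2 J3"
  proof
    fix v assume v: "v \<in> colsub C2 J2"
    have "v x \<in> J3" if x: "x \<in> I" for x
    proof -
      have vx: "v x \<in> C2 x" "v x \<in> J2" using v x by (auto simp: colsub_def col_simps)
      have "\<zero> \<in> C1 x" using C(1) x by (simp add: colC_def)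
      moreover have "v x \<ominus> r \<otimes> \<zero> = v x" using r colC_R[OF C(2) x vx(1)] by (simp add: minus_eq)
      ultimately show ?thesis using j3[OF x vx(1)] vx(2) by metis
    qed
    then show "v \<in> colsub C2 J3" using v by (auto simp: colsub_def)
  qed
  have "\<exists>\<alpha>\<in>lhom A Q1 Q2. \<forall>u\<in>carrier (col C1). \<alpha> (\<kappa>1 u) = \<kappa>2 (?f u)"
  proof (rule coded_induced[OF c1 q2(1) lhom_comp[OF f q2(2)]])
    fix u assume u: "u \<in> colsub C1 J1"
    then have "u \<in> carrier (col C1)" by (simp add: colsub_def)
    then show "\<kappa>2 (?f u) = \<zero>\<^bsub>Q2\<^esub>" using u fsub q2(4) lhom_closed[OF f] by blast
  qed
  then obtain \<alpha> where \<alpha>: "\<alpha> \<in> lhom A Q1 Q2" and \<alpha>2: "\<forall>u\<in>carrier (col C1). \<alpha> (\<kappa>1 u) = \<kappa>2 (?f u)" ..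
  have "\<exists>\<beta>\<in>lhom A Q2 Q. \<forall>v\<in>carrier (col C2). \<beta> (\<kappa>2 v) = \<kappa> v"
  proof (rule coded_induced[OF c2 q3(1,2)])
    fix v assume "v \<in> colsub C2 J2"
    then have "v \<in> carrier (col C2)" "v \<in> colsub C2 J3" using J23 by (auto simp: colsub_def)
    then show "\<kappa> v = \<zero>\<^bsub>Q\<^esub>" using q3(4) by blast
  qed
  then obtain \<beta> where \<beta>: "\<beta> \<in> lhom A Q2 Q" and \<beta>2: "\<forall>v\<in>carrier (col C2). \<beta> (\<kappa>2 v) = \<kappa> v" ..
  have "ses A Q1 Q2 Q \<alpha> \<beta>"
    unfolding ses_def
  proof (intro conjI ballI impI)
    fix x assume "x \<in> carrier Q1" and x0: "\<alpha> x = \<zero>\<^bsub>Q2\<^esub>"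
    then have "x \<in> \<kappa>1 ` carrier (col C1)" using q1(3) by simp
    then obtain u where u: "u \<in> carrier (col C1)" "x = \<kappa>1 u" ..
    have "\<kappa>2 (?f u) = \<zero>\<^bsub>Q2\<^esub>" using u x0 \<alpha>2 by simp
    then have "u \<in> colsub C1 J1" using fsub[OF u(1)] q2(4)[OF lhom_closed[OF f u(1)]] by blast
    then show "x = \<zero>\<^bsub>Q1\<^esub>" using q1(4) u by blast
  next
    show "\<beta> ` carrier Q2 = carrier Q"
      unfolding q2(3)[symmetric] q3(3)[symmetric] image_image using \<beta>2 by (intro image_cong) auto
  next
    fix y assume "y \<in> carrier Q2"
    then have "y \<in> \<kappa>2 ` carrier (col C2)" using q2(3) by simp
    then obtain v where v: "v \<in> carrier (col C2)" "y = \<kappa>2 v" ..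
    have vC: "\<And>x. x \<in> I \<Longrightarrow> v x \<in> C2 x" using v by (auto simp: col_simps)
    have "\<beta> y = \<zero>\<^bsub>Q\<^esub> \<longleftrightarrow> v \<in> colsub C2 J3" using \<beta>2 v q3(4) by simp
    \<comment> \<open>Exactness in the middle is an entrywise statement: the witnesses of
      \<open>j3\<close> at the single indices are chosen and collected into one column.\<close>
    also have "\<dots> \<longleftrightarrow> (\<exists>u\<in>carrier (col C1). v \<ominus>\<^bsub>col C2\<^esub> ?f u \<in> colsub C2 J2)"
    proof
      assume "v \<in> colsub C2 J3"
      then have "\<forall>x\<in>I. \<exists>a\<in>C1 x. v x \<ominus> r \<otimes> a \<in> J2" using j3 vC by (auto simp: colsub_def)
      then obtain a where a: "\<And>x. x \<in> I \<Longrightarrow> a x \<in> C1 x" "\<And>x. x \<in> I \<Longrightarrow> v x \<ominus> r \<otimes> a x \<in> J2" by metis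
      let ?u = "\<lambda>x\<in>I. a x"
      have u: "?u \<in> carrier (col C1)" using a(1) by (auto simp: col_simps)
      interpret M2: abelian_group "col C2" using M(2) by (rule left_module_abelian_group)
      have "v \<ominus>\<^bsub>col C2\<^esub> ?f ?u \<in> colsub C2 J2"
        using a(2) col_minus[OF C(2) v(1) lhom_closed[OF f u]] M2.minus_closed[OF v(1) lhom_closed[OF f u]]
        by (auto simp: colsub_def cmul_def)
      then show "\<exists>u\<in>carrier (col C1). v \<ominus>\<^bsub>col C2\<^esub> ?f u \<in> colsub C2 J2" using u by blast
    next
      assume "\<exists>u\<in>carrier (col C1). v \<ominus>\<^bsub>col C2\<^esub> ?f u \<in> colsub C2 J2"
      then obtain u where u: "u \<in> carrier (col C1)" "v \<ominus>\<^bsub>col C2\<^esub> ?f u \<in> colsub C2 J2" ..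
      have "v x \<in> J3" if x: "x \<in> I" for x
      proof -
        have "v x \<ominus> r \<otimes> u x \<in> J2"
          using u(2) x col_minus[OF C(2) v(1) lhom_closed[OF f u(1)] x] by (auto simp: colsub_def cmul_def)
        moreover have "u x \<in> C1 x" using u(1) x by (auto simp: col_simps)
        ultimately show ?thesis using j3[OF x vC[OF x]] by blast
      qed
      then show "v \<in> colsub C2 J3" using v by (simp add: colsub_def)
    qed
    also have "\<dots> \<longleftrightarrow> (\<exists>u\<in>carrier (col C1). \<kappa>2 v = \<kappa>2 (?f u))"
      using coded_eq_iff[OF c2 v(1) lhom_closed[OF f]] by blast
    also have "\<dots> \<longleftrightarrow> (\<exists>u\<in>carrier (col C1). y = \<alpha> (\<kappa>1 u))" using \<alpha>2 v by auto
    also have "\<dots> \<longleftrightarrow> y \<in> \<alpha> ` carrier Q1" unfolding q1(3)[symmetric] by auto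
    finally show "\<beta> y = \<zero>\<^bsub>Q\<^esub> \<longleftrightarrow> y \<in> \<alpha> ` carrier Q1" .
  qed (use q1 q2 q3 \<alpha> \<beta> in auto)
  moreover have "res A h \<Phi> Q1" using r1 c1 unfolding rs_def by blast
  moreover have "res A (Suc h) \<Phi>' Q2" using r2 c2 unfolding rs_def by blast
  ultimately show "res A (Suc h) \<Phi>'' Q" by (rule res_cone[OF inf _ _ _ cb 0])
qed

text \<open>\<open>U\<close> may contain degrees outside \<open>I\<close>; they impose nothing,
  which is how the vertices outside the interval drop out of a resolution. Multiplicities are not
  recorded.\<close>

definition topsP where
  "topsP U P \<longleftrightarrow> (\<forall>i\<in>I. notop (e i) (D.B i) P \<longleftrightarrow> i \<notin> U)"

lemma comb_tops: "comb A (topsP U) (topsP U') (topsP (U \<union> U'))"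
  unfolding comb_def topsP_def by (auto simp: notop_biprod[OF _ D.B_sub D.e_closed])

lemma topsP_zero:
  assumes "left_module A P" "carrier P = {\<zero>\<^bsub>P\<^esub>}" "U \<inter> I = {}" shows "topsP U P"
  using assms notop_zero_module[OF assms(1,2)] D.e_closed by (auto simp: topsP_def)

lemma topsP_empty:
  assumes "left_module A P" "topsP U P" "U \<inter> I = {}" shows "carrier P = {\<zero>\<^bsub>P\<^esub>}"
  using assms by (intro D.nakayama) (auto simp: topsP_def)

lemma colC_H: "w \<in> I \<Longrightarrow> colC (\<lambda>x. H x w)"
  unfolding colC_def using H_sub H_zero H_add H_neg H_mult by simp

text \<open>The generator of \<open>A e w\<close>; \<open>mat w u\<close> is an element of
  \<open>A\<close> that takes it to \<open>u\<close>.\<close>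

definition g0 where "g0 w = (\<lambda>x\<in>I. if x = w then \<one> else \<zero>)"
definition mat where "mat w u = (\<lambda>x\<in>I. \<lambda>y\<in>I. if y = w then u x else \<zero>)"

lemma g0_col: "w \<in> I \<Longrightarrow> g0 w \<in> carrier (col (\<lambda>x. H x w))"
  using H_one H_zero by (auto simp: g0_def col_simps)

lemma mat_A: "\<lbrakk>w \<in> I; u \<in> carrier (col (\<lambda>x. H x w))\<rbrakk> \<Longrightarrow> mat w u \<in> carrier A"
  using H_zero by (auto simp: mat_def A_def col_simps)

lemma mat_g0:
  assumes w: "w \<in> I" and u: "u \<in> carrier (col (\<lambda>x. H x w))" shows "mv (mat w u) (g0 w) = u"
proof (rule col_eqI[where C = "\<lambda>x. H x w"])
  show "mv (mat w u) (g0 w) \<in> carrier (col (\<lambda>x. H x w))" by (rule mv_col[OF colC_H[OF w] mat_A[OF w u] g0_col[OF w]])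
  fix x assume x: "x \<in> I"
  have uR: "u \<in> I \<rightarrow> carrier R" by (rule col_R[OF colC_H[OF w] u])
  have "mv (mat w u) (g0 w) x = (\<Oplus>z\<in>I. if w = z then u x else \<zero>)"
    unfolding mv_def using x uR by (auto simp: mat_def g0_def Pi_def intro!: finsum_cong')
  also have "\<dots> = u x" using sum_delta_l[OF w, of "\<lambda>_. u x"] uR x by auto
  finally show "mv (mat w u) (g0 w) x = u x" .
qed (rule u)

text \<open>A lift is prescribed by a preimage \<open>y\<close> of the image of the generator and
  extended by letting \<open>mat w u\<close> act on \<open>y\<close>. Away from \<open>w\<close>
  every vector is a radical multiple of the generator, while at \<open>w\<close> directedness leaves
  no radical part.\<close>

lemma col_unit:
  fixes Q :: "('i \<Rightarrow> 'i \<Rightarrow> 'r, 'm) module"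
  assumes w: "w \<in> I" and c: "coded A (col (\<lambda>x. H x w)) (colsub (\<lambda>x. H x w) {\<zero>}) Q \<kappa>"
  shows "projective_module A Q \<and> topsP {w} Q"
proof -
  let ?C = "\<lambda>x. H x w"
  have C: "colC ?C" by (rule colC_H[OF w])
  have M: "left_module A (col ?C)" by (rule col_left_module[OF C])
  have Q: "left_module A Q" and \<kappa>: "\<kappa> \<in> lhom A (col ?C) Q" "\<kappa> ` carrier (col ?C) = carrier Q"
    and \<kappa>0: "\<And>u. u \<in> carrier (col ?C) \<Longrightarrow> \<kappa> u = \<zero>\<^bsub>Q\<^esub> \<longleftrightarrow> u \<in> colsub ?C {\<zero>}" using c by (auto simp: coded_def)
  interpret A: ring A by (rule A_ring)
  have g: "g0 w \<in> carrier (col ?C)" by (rule g0_col[OF w])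
  have sub0: "u \<in> colsub ?C {\<zero>} \<longleftrightarrow> u = \<zero>\<^bsub>col ?C\<^esub>" if "u \<in> carrier (col ?C)" for u
    using that by (auto simp: colsub_def col_simps PiE_def extensional_def fun_eq_iff)
  have "projective_module A Q"
  proof (rule projectiveI[OF Q])
    fix M' N :: "('i \<Rightarrow> 'i \<Rightarrow> 'r, 'm) module" and gg f
    assume M': "left_module A M'" and N: "left_module A N" and gg: "gg \<in> lhom A M' N" "gg ` carrier M' = carrier N"
      and f: "f \<in> lhom A Q N"
    interpret M': abelian_group M' using M' by (rule left_module_abelian_group)
    have "f (\<kappa> (g0 w)) \<in> gg ` carrier M'" using gg(2) f \<kappa>(1) g by (simp add: lhom_closed)
    then obtain y where y: "y \<in> carrier M'" "gg y = f (\<kappa> (g0 w))" by auto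
    define h where "h u = mat w u \<odot>\<^bsub>M'\<^esub> y" for u
    have hh: "h \<in> lhom A (col ?C) M'"
    proof (rule lhomI)
      fix u assume "u \<in> carrier (col ?C)"
      then show "h u \<in> carrier M'" using M' mat_A[OF w] y by (simp add: h_def lm_closed)
    next
      fix u v assume u: "u \<in> carrier (col ?C)" and v: "v \<in> carrier (col ?C)"
      have "mat w (u \<oplus>\<^bsub>col ?C\<^esub> v) = mat w u \<oplus>\<^bsub>A\<^esub> mat w v"
        using mat_A[OF w u] mat_A[OF w v] by (auto simp: mat_def A_def col_simps fun_eq_iff restrict_def)
      then show "h (u \<oplus>\<^bsub>col ?C\<^esub> v) = h u \<oplus>\<^bsub>M'\<^esub> h v"
        using lm_add_l[OF M' mat_A[OF w u] mat_A[OF w v] y(1)] by (simp add: h_def)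
    next
      fix a u assume a: "a \<in> carrier A" and u: "u \<in> carrier (col ?C)"
      have "mat w (mv a u) = a \<otimes>\<^bsub>A\<^esub> mat w u"
      proof (rule A_eqI)
        show "mat w (mv a u) \<in> carrier A" by (rule mat_A[OF w mv_col[OF C a u]])
        show "a \<otimes>\<^bsub>A\<^esub> mat w u \<in> carrier A" using a mat_A[OF w u] by simp
        fix x y assume x: "x \<in> I" and y: "y \<in> I"
        show "mat w (mv a u) x y = (a \<otimes>\<^bsub>A\<^esub> mat w u) x y"
        proof (cases "y = w")
          case True
          have "(\<Oplus>z\<in>I. a x z \<otimes> mat w u z w) = (\<Oplus>z\<in>I. a x z \<otimes> u z)"
            using A_entry_R[OF a x] col_R[OF C u] w by (intro finsum_cong') (auto simp: mat_def)
          moreover have "mat w (mv a u) x w = mv a u x" using x w by (simp add: mat_def)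
          ultimately show ?thesis using True x y by (simp add: mv_def)
        next
          case False
          have "(\<Oplus>z\<in>I. a x z \<otimes> mat w u z y) = (\<Oplus>z\<in>I. \<zero>)"
            using A_entry_R[OF a x] y False by (intro finsum_cong') (auto simp: mat_def)
          then show ?thesis using False x y by (simp add: mat_def[of w "mv a u"])
        qed
      qed
      then show "h (a \<odot>\<^bsub>col ?C\<^esub> u) = a \<odot>\<^bsub>M'\<^esub> h u"
        using lm_assoc[OF M' a mat_A[OF w u] y(1)] by (simp add: h_def col_simps(4))
    qed
    have gh: "gg (h u) = f (\<kappa> u)" if u: "u \<in> carrier (col ?C)" for u
    proof -
      have mA: "mat w u \<in> carrier A" by (rule mat_A[OF w u])
      have "gg (h u) = mat w u \<odot>\<^bsub>N\<^esub> f (\<kappa> (g0 w))" using lhom_smult[OF gg(1) mA y(1)] y by (simp add: h_def)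
      also have "\<dots> = f (\<kappa> (mat w u \<odot>\<^bsub>col ?C\<^esub> g0 w))"
        using lhom_smult[OF lhom_comp[OF \<kappa>(1) f] mA g] by simp
      finally show ?thesis using mat_g0[OF w u] by (simp add: col_simps)
    qed
    have "\<exists>h'\<in>lhom A Q M'. \<forall>u\<in>carrier (col ?C). h' (\<kappa> u) = h u"
      by (rule coded_induced[OF c M' hh]) (use sub0 lhom_zero[OF M M' hh] in \<open>auto simp: colsub_def\<close>)
    then obtain h' where h': "h' \<in> lhom A Q M'" and h'2: "\<forall>u\<in>carrier (col ?C). h' (\<kappa> u) = h u" ..
    have "gg (h' x) = f x" if x: "x \<in> carrier Q" for x
    proof -
      have "x \<in> \<kappa> ` carrier (col ?C)" using x \<kappa>(2) by simp
      then obtain u where "u \<in> carrier (col ?C)" "x = \<kappa> u" ..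
      then show ?thesis using h'2 gh by simp
    qed
    then show "\<exists>h\<in>lhom A Q M'. \<forall>x\<in>carrier Q. gg (h x) = f x" using h' by (intro bexI[of _ h'] ballI)
  qed
  moreover have "notop (e i) (D.B i) Q" if i: "i \<in> I" "i \<noteq> w" for i
    unfolding notop_def
  proof
    fix x assume "x \<in> carrier Q"
    then have "x \<in> \<kappa> ` carrier (col ?C)" using \<kappa>(2) by simp
    then obtain u where u: "u \<in> carrier (col ?C)" "x = \<kappa> u" ..
    have uR: "u \<in> I \<rightarrow> carrier R" by (rule col_R[OF C u(1)])
    have ui: "u i \<in> H i w" using u i by (auto simp: col_simps)
    have uiR: "u i \<in> carrier R" using uR i by auto
    \<comment> \<open>The matrix unit with entry \<open>u i\<close> takes the generator to the part
      of \<open>u\<close> at \<open>i\<close>, and lies in \<open>B i\<close> because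
      \<open>i\<close> differs from \<open>w\<close>.\<close>
    let ?b = "E (u i) i w"
    have bA: "?b \<in> carrier A" using E_closed[OF i(1) w ui] .
    have "e i \<otimes>\<^bsub>A\<^esub> ?b = ?b"
    proof (rule A_eqI)
      fix x y assume "x \<in> I" "y \<in> I"
      then show "(e i \<otimes>\<^bsub>A\<^esub> ?b) x y = ?b x y"
        using E_mult_l[OF i(1,1) one_closed bA] i w uiR by (auto simp: e_def E_def simp del: A_simps(1))
    qed (use bA D.e_closed[OF i(1)] in auto)
    moreover have "?b \<otimes>\<^bsub>A\<^esub> e i = \<zero>\<^bsub>A\<^esub>"
    proof (rule A_eqI)
      fix x y assume "x \<in> I" "y \<in> I"
      then show "(?b \<otimes>\<^bsub>A\<^esub> e i) x y = \<zero>\<^bsub>A\<^esub> x y"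
        using E_mult_r[OF i(1,1) one_closed bA] i w uiR by (auto simp: e_def E_def simp del: A_simps(1))
    qed (use bA D.e_closed[OF i(1)] in auto)
    ultimately have b: "?b \<in> D.B i" using bA by (simp add: D.B_def)
    have "mv (e i) u = mv ?b (g0 w)"
      using E_mv[OF i(1,1) one_closed uR] E_mv[OF i(1) w, of "u i" "g0 w"] col_R[OF C g] uR i w
      by (auto simp: e_def g0_def fun_eq_iff Pi_def)
    then have "e i \<odot>\<^bsub>Q\<^esub> x = ?b \<odot>\<^bsub>Q\<^esub> \<kappa> (g0 w)"
      using lhom_smult[OF \<kappa>(1) D.e_closed[OF i(1)] u(1)] lhom_smult[OF \<kappa>(1) bA g] u(2) by (simp add: col_simps)
    moreover interpret Q: abelian_group Q using Q by (rule left_module_abelian_group)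
    have "(?b \<odot>\<^bsub>Q\<^esub> \<kappa> (g0 w)) \<oplus>\<^bsub>Q\<^esub> \<zero>\<^bsub>Q\<^esub> \<in> rad (D.B i) Q"
      by (rule rad.gen[OF b lhom_closed[OF \<kappa>(1) g] rad.zero])
    ultimately show "e i \<odot>\<^bsub>Q\<^esub> x \<in> rad (D.B i) Q" using lm_closed[OF Q bA lhom_closed[OF \<kappa>(1) g]] by simp
  qed
  moreover have "\<not> notop (e w) (D.B w) Q"
  proof
    assume n: "notop (e w) (D.B w) Q"
    interpret Q: abelian_group Q using Q by (rule left_module_abelian_group)
    have z: "b \<odot>\<^bsub>Q\<^esub> x = \<zero>\<^bsub>Q\<^esub>" if b: "b \<in> D.B w" and x: "x \<in> carrier Q" for b x
    proof -
      have "x \<in> \<kappa> ` carrier (col ?C)" using x \<kappa>(2) by simp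
      then obtain u where u: "u \<in> carrier (col ?C)" "x = \<kappa> u" ..
      have uH: "\<And>z. z \<in> I \<Longrightarrow> u z \<in> H z w" using u by (auto simp: col_simps)
      have bA: "b \<in> carrier A" and eb: "e w \<otimes>\<^bsub>A\<^esub> b = b" and be: "b \<otimes>\<^bsub>A\<^esub> e w = \<zero>\<^bsub>A\<^esub>" using b by (auto simp: D.B_def)
      have b1: "b x z = \<zero>" if "x \<in> I" "x \<noteq> w" "z \<in> I" for x z
        using E_mult_l[OF w w one_closed bA that(1,3)] eb that(2) by (simp add: e_def del: A_simps(1))
      have b2: "b w w = \<zero>"
        using E_mult_r[OF w w one_closed bA w w] be w A_entry_R[OF bA w w] by (simp add: e_def del: A_simps(1))
      \<comment> \<open>A nonzero product would need \<open>deg z < deg w\<close> from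
        \<open>b\<close> and \<open>deg w < deg z\<close> from \<open>u\<close>.\<close>
      have bu: "b x z \<otimes> u z = \<zero>" if x: "x \<in> I" and zI: "z \<in> I" for x z
      proof (cases "x = w \<and> z \<noteq> w")
        case True
        have "b w z = \<zero> \<or> u z = \<zero>"
          using H_dir[OF w zI _ A_entry[OF bA w zI]] H_dir[OF zI w _ uH[OF zI]] True by force
        then show ?thesis using True A_entry_R[OF bA w zI] uH[OF zI] H_sub[OF zI w] by auto
      next
        case False
        then have "b x z = \<zero>" using b1[OF x _ zI] b2 by auto
        then show ?thesis using uH[OF zI] H_sub[OF zI w] by auto
      qed
      have "mv b u = \<zero>\<^bsub>col ?C\<^esub>"
      proof (rule ext)
        fix x show "mv b u x = \<zero>\<^bsub>col ?C\<^esub> x"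
        proof (cases "x \<in> I")
          case True
          have "(\<Oplus>z\<in>I. b x z \<otimes> u z) = (\<Oplus>z\<in>I. \<zero>)" by (rule finsum_cong') (use bu[OF True] in auto)
          then show ?thesis using True by (simp add: mv_def col_simps)
        qed (simp add: mv_def col_simps)
      qed
      then show ?thesis using lhom_smult[OF \<kappa>(1) bA u(1)] u(2) lhom_zero[OF M Q \<kappa>(1)] by (simp add: col_simps(4))
    qed
    have "y \<in> rad (D.B w) Q \<Longrightarrow> y = \<zero>\<^bsub>Q\<^esub>" for y
      by (induction rule: rad.induct) (auto simp: z)
    then have "e w \<odot>\<^bsub>Q\<^esub> \<kappa> (g0 w) = \<zero>\<^bsub>Q\<^esub>" using n lhom_closed[OF \<kappa>(1) g] by (auto simp: notop_def)
    then have "\<kappa> (mv (e w) (g0 w)) = \<zero>\<^bsub>Q\<^esub>" using lhom_smult[OF \<kappa>(1) D.e_closed[OF w] g] by (simp add: col_simps)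
    then have "mv (e w) (g0 w) \<in> colsub ?C {\<zero>}" using \<kappa>0[OF mv_col[OF C D.e_closed[OF w] g]] by simp
    then have "mv (e w) (g0 w) w = \<zero>" using w by (auto simp: colsub_def)
    then show False using E_mv[OF w w one_closed col_R[OF C g]] w nontrivial by (simp add: e_def g0_def)
  qed
  ultimately show ?thesis by (auto simp: topsP_def)
qed

lemma col_zero:
  assumes C: "colC C" "\<And>x. x \<in> I \<Longrightarrow> C x = {\<zero>}" and c: "coded A (col C) N Q \<kappa>"
  shows "left_module A Q \<and> carrier Q = {\<zero>\<^bsub>Q\<^esub>}"
proof -
  have Q: "left_module A Q" and \<kappa>: "\<kappa> \<in> lhom A (col C) Q" "\<kappa> ` carrier (col C) = carrier Q" using c by (auto simp: coded_def)
  have "u = \<zero>\<^bsub>col C\<^esub>" if "u \<in> carrier (col C)" for u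
    using that C(2) by (auto simp: col_simps PiE_def extensional_def fun_eq_iff Pi_def)
  moreover interpret M: abelian_group "col C" using col_left_module[OF C(1)] by (rule left_module_abelian_group)
  have "\<zero>\<^bsub>col C\<^esub> \<in> carrier (col C)" by simp
  ultimately have "carrier (col C) = {\<zero>\<^bsub>col C\<^esub>}" by blast
  then show ?thesis using Q \<kappa> lhom_zero[OF col_left_module[OF C(1)] Q \<kappa>(1)] by auto
qed

text \<open>Modulo \<open>J\<close> only the entry at \<open>w\<close> survives, and it ranges over
  the field.\<close>

lemma col_simple:
  assumes w: "w \<in> I" and J: "idl J" and J1: "\<And>x. \<lbrakk>x \<in> I; x \<noteq> w\<rbrakk> \<Longrightarrow> H x w \<subseteq> J" and J2: "\<And>a. \<lbrakk>a \<in> H w w; a \<in> J\<rbrakk> \<Longrightarrow> a = \<zero>"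
    and c: "coded A (col (\<lambda>x. H x w)) (colsub (\<lambda>x. H x w) J) Q \<kappa>"
  shows "D.conc w Q \<and> (\<exists>v0\<in>carrier Q. v0 \<noteq> \<zero>\<^bsub>Q\<^esub> \<and> (\<forall>v\<in>carrier Q. \<exists>\<alpha>. v = s w \<alpha> \<odot>\<^bsub>Q\<^esub> v0))"
proof -
  let ?C = "\<lambda>x. H x w"
  have C: "colC ?C" by (rule colC_H[OF w])
  have M: "left_module A (col ?C)" by (rule col_left_module[OF C])
  have Q: "left_module A Q" and \<kappa>: "\<kappa> \<in> lhom A (col ?C) Q" "\<kappa> ` carrier (col ?C) = carrier Q"
    and \<kappa>0: "\<And>u. u \<in> carrier (col ?C) \<Longrightarrow> \<kappa> u = \<zero>\<^bsub>Q\<^esub> \<longleftrightarrow> u \<in> colsub ?C J" using c by (auto simp: coded_def)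
  have g: "g0 w \<in> carrier (col ?C)" by (rule g0_col[OF w])
  interpret col: abelian_group "col ?C" using M by (rule left_module_abelian_group)
  have eq: "\<kappa> u = \<kappa> v" if u: "u \<in> carrier (col ?C)" and v: "v \<in> carrier (col ?C)" and uv: "u w = v w" for u v
  proof -
    have "(u \<ominus>\<^bsub>col ?C\<^esub> v) x \<in> J" if x: "x \<in> I" for x
    proof (cases "x = w")
      case True
      have "v w \<in> carrier R" using col_R[OF C v] w by auto
      then show ?thesis using col_minus[OF C u v x] uv True J by (simp add: idl_def minus_eq r_neg)
    next
      case False
      have "u \<ominus>\<^bsub>col ?C\<^esub> v \<in> carrier (col ?C)" using u v by simp
      then have "(u \<ominus>\<^bsub>col ?C\<^esub> v) x \<in> H x w" using x by (auto simp: col_simps)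
      then show ?thesis using J1[OF x False] by blast
    qed
    then have "u \<ominus>\<^bsub>col ?C\<^esub> v \<in> colsub ?C J" using u v by (simp add: colsub_def)
    then show ?thesis using coded_eq_iff[OF c u v] by blast
  qed
  have "e w \<odot>\<^bsub>Q\<^esub> x = x" if "x \<in> carrier Q" for x
  proof -
    have "x \<in> \<kappa> ` carrier (col ?C)" using that \<kappa>(2) by simp
    then obtain u where u: "u \<in> carrier (col ?C)" "x = \<kappa> u" ..
    have "u w \<in> carrier R" using col_R[OF C u(1)] w by auto
    then have "mv (e w) u w = u w" using E_mv[OF w w one_closed col_R[OF C u(1)]] w by (simp add: e_def)
    then have "\<kappa> (mv (e w) u) = \<kappa> u" by (intro eq mv_col[OF C D.e_closed[OF w]] u(1))
    then show ?thesis using lhom_smult[OF \<kappa>(1) D.e_closed[OF w] u(1)] u(2) by (simp add: col_simps)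
  qed
  moreover have "\<kappa> (g0 w) \<noteq> \<zero>\<^bsub>Q\<^esub>"
  proof
    assume "\<kappa> (g0 w) = \<zero>\<^bsub>Q\<^esub>"
    then have "\<one> \<in> J" using \<kappa>0[OF g] w by (auto simp: colsub_def g0_def)
    then show False using J2[OF H_one[OF w]] nontrivial by simp
  qed
  moreover have "\<exists>\<alpha>. v = s w \<alpha> \<odot>\<^bsub>Q\<^esub> \<kappa> (g0 w)" if "v \<in> carrier Q" for v
  proof -
    have "v \<in> \<kappa> ` carrier (col ?C)" using that \<kappa>(2) by simp
    then obtain u where u: "u \<in> carrier (col ?C)" "v = \<kappa> u" ..
    have "u w \<in> H w w" using u w by (auto simp: col_simps)
    then obtain \<alpha> where \<alpha>: "u w = c \<alpha>" using H_diag[OF w] by auto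
    have cR: "c \<alpha> \<in> carrier R" using c_closed[OF w] H_sub[OF w w] by blast
    have "mv (s w \<alpha>) (g0 w) w = u w" using E_mv[OF w w cR col_R[OF C g]] w \<alpha> cR by (simp add: s_def g0_def)
    then have "\<kappa> (mv (s w \<alpha>) (g0 w)) = \<kappa> u" by (intro eq mv_col[OF C D.s_closed[OF w]] u(1) g)
    then have "v = s w \<alpha> \<odot>\<^bsub>Q\<^esub> \<kappa> (g0 w)" using lhom_smult[OF \<kappa>(1) D.s_closed[OF w] g] u(2) by (simp add: col_simps)
    then show ?thesis ..
  qed
  ultimately show ?thesis using Q lhom_closed[OF \<kappa>(1) g] by (auto simp: D.conc_def intro!: bexI[of _ "\<kappa> (g0 w)"])
qed

end

subsection \<open>Normal forms in the grading group\<close>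

declare One_nat_def [simp del]

locale gl_grading =
  fixes n :: nat and p :: "nat \<Rightarrow> nat"
  assumes p1: "i \<in> {1..n} \<Longrightarrow> p i \<ge> 1"
begin

lemma p0: "i \<in> {1..n} \<Longrightarrow> int (p i) > 0" using p1[of i] by simp

abbreviation S where "S \<equiv> insert GenC (GenX ` {1..n})"
abbreviation G where "G \<equiv> gl_free_group n"
abbreviation K where "K \<equiv> gl_relations n p"
abbreviation L where "L \<equiv> gl_group n p"
abbreviation lk where "lk \<equiv> Poly_Mapping.lookup"
abbreviation ks where "ks \<equiv> Poly_Mapping.keys"

definition cls :: "(gl_gen \<Rightarrow>\<^sub>0 int) \<Rightarrow> gl_deg" where "cls f = K #>\<^bsub>G\<^esub> f"

definition kS :: "(gl_gen \<Rightarrow>\<^sub>0 int) \<Rightarrow> bool" where "kS f \<longleftrightarrow> ks f \<subseteq> S"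

lemma G_simps [simp]: "f \<in> carrier G \<longleftrightarrow> kS f" "\<one>\<^bsub>G\<^esub> = 0" "f \<otimes>\<^bsub>G\<^esub> g = f + g"
  by (auto simp: gl_free_group_def kS_def)

lemma G_inv: "kS f \<Longrightarrow> inv\<^bsub>G\<^esub> f = - f"
  by (simp add: gl_free_group_def kS_def)

lemma G_comm: "comm_group G" by (simp add: gl_free_group_def abelian_free_Abelian_group)

lemma kS_simps [simp]:
  "kS 0" "kS (frag_of GenC)" "i \<in> {1..n} \<Longrightarrow> kS (frag_of (GenX i))" "kS f \<Longrightarrow> kS (- f)"
  by (auto simp: kS_def)

lemma kS_add [simp]: "\<lbrakk>kS f; kS g\<rbrakk> \<Longrightarrow> kS (f + g)"
  using Poly_Mapping.keys_add[of f g] by (auto simp: kS_def)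

lemma kS_diff [simp]: "\<lbrakk>kS f; kS g\<rbrakk> \<Longrightarrow> kS (f - g)"
  using keys_diff[of f g] by (auto simp: kS_def)

lemma kS_cmul [simp]: "kS f \<Longrightarrow> kS (frag_cmul c f)"
  using keys_cmul[of c f] by (auto simp: kS_def)

lemma kS_sum [simp]: "(\<And>i. i \<in> A \<Longrightarrow> kS (f i)) \<Longrightarrow> kS (sum f A)"
  using keys_sum[of f A] unfolding kS_def by (meson UN_least order_trans)

definition rel where "rel i = frag_cmul (int (p i)) (frag_of (GenX i)) - frag_of GenC"

lemma K_eq: "K = generate G (rel ` {1..n})"
  by (simp add: gl_relations_def rel_def)

lemma kS_rel [simp]: "i \<in> {1..n} \<Longrightarrow> kS (rel i)" by (simp add: rel_def)

lemma K_subgroup: "subgroup K G"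
proof -
  interpret G: comm_group G by (rule G_comm)
  show ?thesis unfolding K_eq by (rule G.generate_is_subgroup) auto
qed

lemma K_normal: "K \<lhd> G"
proof -
  interpret G: comm_group G by (rule G_comm)
  show ?thesis using K_subgroup by (simp add: G.normal_iff_subgroup)
qed

text \<open>A combination of the relations with coefficients \<open>b i\<close> has
  \<open>x i\<close>-coefficient \<open>b i * p i\<close> and \<open>c\<close>-coefficient minus the
  sum of the \<open>b i\<close>; the two conditions say that \<open>f\<close> has this form.\<close>

definition inK :: "(gl_gen \<Rightarrow>\<^sub>0 int) \<Rightarrow> bool" where
  "inK f \<longleftrightarrow> kS f \<and> (\<forall>i\<in>{1..n}. int (p i) dvd lk f (GenX i)) \<and> lk f GenC + (\<Sum>i\<in>{1..n}. lk f (GenX i) div int (p i)) = 0"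

lemma inK_rel: "i \<in> {1..n} \<Longrightarrow> inK (rel i)"
proof -
  assume i: "i \<in> {1..n}"
  have l: "lk (rel i) (GenX j) = (if j = i then int (p i) else 0)" for j by (auto simp: rel_def lookup_minus)
  have c: "lk (rel i) GenC = - 1" by (simp add: rel_def lookup_minus)
  have "(\<Sum>j\<in>{1..n}. lk (rel i) (GenX j) div int (p j)) = (\<Sum>j\<in>{1..n}. if j = i then 1 else 0)"
    using p0 by (intro sum.cong) (auto simp: l)
  also have "\<dots> = 1" using i by simp
  finally show ?thesis using i by (auto simp: inK_def l c)
qed

lemma inK_add: "\<lbrakk>inK f; inK g\<rbrakk> \<Longrightarrow> inK (f + g)"
proof -
  assume f: "inK f" and g: "inK g"
  have "(\<Sum>i\<in>{1..n}. lk (f + g) (GenX i) div int (p i)) =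
      (\<Sum>i\<in>{1..n}. lk f (GenX i) div int (p i)) + (\<Sum>i\<in>{1..n}. lk g (GenX i) div int (p i))"
    unfolding sum.distrib[symmetric] using f by (intro sum.cong) (auto simp: lookup_add inK_def
        div_plus_div_distrib_dvd_left)
  then show ?thesis using f g by (auto simp: inK_def lookup_add)
qed

lemma inK_uminus: "inK f \<Longrightarrow> inK (- f)"
proof -
  assume f: "inK f"
  have "(\<Sum>i\<in>{1..n}. lk (- f) (GenX i) div int (p i)) = - (\<Sum>i\<in>{1..n}. lk f (GenX i) div int (p i))"
    unfolding sum_negf[symmetric] using f by (intro sum.cong) (auto simp: inK_def dvd_neg_div)
  then show ?thesis using f by (auto simp: inK_def)
qed

lemma K_iff: "f \<in> K \<longleftrightarrow> inK f"
proof
  interpret G: comm_group G by (rule G_comm)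
  show "f \<in> K \<Longrightarrow> inK f"
    unfolding K_eq
  proof (induction rule: generate.induct)
    case one
    then show ?case by (simp add: inK_def)
  next
    case (incl h)
    then show ?case using inK_rel by auto
  next
    case (inv h)
    then show ?case using inK_rel inK_uminus G_inv by (auto simp: inK_def)
  next
    case (eng h1 h2)
    then show ?case using inK_add by simp
  qed
  assume f: "inK f"
  have cm: "frag_cmul (int k) g \<in> K" if "g \<in> K" for k :: nat and g
    using that subgroup.one_closed[OF K_subgroup] subgroup.m_closed[OF K_subgroup]
    by (induction k) (auto simp: frag_cmul_distrib algebra_simps)
  have cmi: "frag_cmul k g \<in> K" if "g \<in> K" for k :: int and g
  proof (cases "k \<ge> 0")
    case True
    then show ?thesis using cm[OF that, of "nat k"] by simp
  next
    case False
    have "kS g" using that subgroup.subset[OF K_subgroup] by auto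
    then have "- frag_cmul (int (nat (- k))) g \<in> K"
      using cm[OF that, of "nat (- k)"] subgroup.m_inv_closed[OF K_subgroup] G_inv kS_cmul by metis
    then show ?thesis using False by simp
  qed
  define b where "b i = lk f (GenX i) div int (p i)" for i
  have sm: "finite A \<Longrightarrow> A \<subseteq> {1..n} \<Longrightarrow> (\<Sum>i\<in>A. frag_cmul (b i) (rel i)) \<in> K" for A
  proof (induction A rule: finite_induct)
    case empty
    then show ?case using subgroup.one_closed[OF K_subgroup] by simp
  next
    case (insert i A)
    have "rel i \<in> K" unfolding K_eq using insert by (intro generate.incl) auto
    then show ?case using insert cmi subgroup.m_closed[OF K_subgroup] by simp
  qed
  have "f = (\<Sum>i\<in>{1..n}. frag_cmul (b i) (rel i))"
  proof (rule poly_mapping_eqI)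
    fix s
    consider i where "s = GenX i" "i \<in> {1..n}" | "s = GenC" | i where "s = GenX i" "i \<notin> {1..n}" by (cases s) auto
    then show "lk f s = lk (\<Sum>i\<in>{1..n}. frag_cmul (b i) (rel i)) s"
    proof cases
      case 1
      have "(\<Sum>j\<in>{1..n}. b j * lk (rel j) (GenX i)) = (\<Sum>j\<in>{1..n}. if j = i then b i * int (p i) else 0)"
        by (intro sum.cong) (auto simp: rel_def lookup_minus)
      then show ?thesis using 1 f by (simp add: lookup_sum b_def inK_def)
    next
      case 2
      then show ?thesis using f by (simp add: lookup_sum b_def inK_def rel_def lookup_minus sum_negf)
    next
      case 3
      have "s \<notin> ks f" using f 3 by (auto simp: inK_def kS_def)
      then show ?thesis using 3 by (auto simp: lookup_sum rel_def lookup_minus in_keys_iff intro!: sum.neutral)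
    qed
  qed
  then show "f \<in> K" using sm[of "{1..n}"] by simp
qed

text \<open>
  Every degree is uniquely \<open>\<Sum> a\<^sub>i x\<^sub>i + a c\<close> with \<open>0 \<le> a\<^sub>i < p\<^sub>i\<close>; these are the coordinates \<open>a\<^sub>i\<close> and \<open>a\<close>.
\<close>

definition nfx :: "(gl_gen \<Rightarrow>\<^sub>0 int) \<Rightarrow> nat \<Rightarrow> int" where "nfx f i = lk f (GenX i) mod int (p i)"
definition nfc :: "(gl_gen \<Rightarrow>\<^sub>0 int) \<Rightarrow> int" where "nfc f = lk f GenC + (\<Sum>i\<in>{1..n}. lk f (GenX i) div int (p i))"

lemma cls_eq_K: "\<lbrakk>kS f; kS g\<rbrakk> \<Longrightarrow> cls f = cls g \<longleftrightarrow> f - g \<in> K"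
proof -
  interpret G: comm_group G by (rule G_comm)
  interpret N: normal K G by (rule K_normal)
  assume f: "kS f" and g: "kS g"
  show ?thesis
  proof
    assume "cls f = cls g"
    then have "f \<in> K #>\<^bsub>G\<^esub> g" using G.rcos_self[of f K] f K_subgroup by (simp add: cls_def)
    then obtain h where "h \<in> K" "f = h + g" by (auto simp: r_coset_def)
    then show "f - g \<in> K" by simp
  next
    assume "f - g \<in> K"
    then have "f \<in> K #>\<^bsub>G\<^esub> g" by (auto simp: r_coset_def intro!: bexI[of _ "f - g"])
    then show "cls f = cls g" unfolding cls_def
      using G.repr_independence[of f K g] f g K_subgroup by simp
  qed
qed

text \<open>Equal residues make the differences of coefficients divisible by \<open>p i\<close>, so
  the integer quotients subtract exactly, and the remaining condition for lying in the relations is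
  equality of the \<open>c\<close>-coordinates.\<close>

lemma cls_eq: "\<lbrakk>kS f; kS g\<rbrakk> \<Longrightarrow> cls f = cls g \<longleftrightarrow> (\<forall>i\<in>{1..n}. nfx f i = nfx g i) \<and> nfc f = nfc g"
proof -
  assume f: "kS f" and g: "kS g"
  have d: "(\<forall>i\<in>{1..n}. int (p i) dvd lk (f - g) (GenX i)) \<longleftrightarrow> (\<forall>i\<in>{1..n}. nfx f i = nfx g i)"
    by (simp add: nfx_def lookup_minus mod_eq_dvd_iff)
  have "nfc f - nfc g = lk (f - g) GenC + (\<Sum>i\<in>{1..n}. lk (f - g) (GenX i) div int (p i))"
    if "\<forall>i\<in>{1..n}. nfx f i = nfx g i"
  proof -
    have "(lk f (GenX i) - lk g (GenX i)) div int (p i) =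
        lk f (GenX i) div int (p i) - lk g (GenX i) div int (p i)" if i: "i \<in> {1..n}" for i
    proof -
      have m: "lk f (GenX i) mod int (p i) = lk g (GenX i) mod int (p i)" using \<open>\<forall>i\<in>_. _\<close> i by (simp add: nfx_def)
      have "lk f (GenX i) - lk g (GenX i) = int (p i) * (lk f (GenX i) div int (p i) - lk g (GenX i) div int (p i))"
        using mult_div_mod_eq[of "int (p i)" "lk f (GenX i)"] mult_div_mod_eq[of "int (p i)" "lk g (GenX i)"] m
            unfolding right_diff_distrib by linarith
      then show ?thesis using p0[OF i] by simp
    qed
    then show ?thesis by (simp add: nfc_def lookup_minus sum_subtractf)
  qed
  then show ?thesis using f g d by (auto simp: cls_eq_K K_iff inK_def)
qed

lemma L_carrier: "carrier L = cls ` {f. kS f}"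
  by (auto simp: gl_group_def carrier_FactGroup cls_def)

lemma cls_carrier [simp]: "kS f \<Longrightarrow> cls f \<in> carrier L" by (auto simp: L_carrier)

lemma L_obtain: "x \<in> carrier L \<Longrightarrow> \<exists>f. kS f \<and> x = cls f" by (auto simp: L_carrier)

lemma cls_mult: "\<lbrakk>kS f; kS g\<rbrakk> \<Longrightarrow> cls f \<otimes>\<^bsub>L\<^esub> cls g = cls (f + g)"
  using normal.rcos_sum[OF K_normal, of f g] by (simp add: gl_group_def cls_def)

lemma cls_one: "\<one>\<^bsub>L\<^esub> = cls 0"
proof -
  interpret G: comm_group G by (rule G_comm)
  show ?thesis using G.coset_mult_one[of K] subgroup.subset[OF K_subgroup] by (simp add: gl_group_def cls_def)
qed

lemma cls_inv: "kS f \<Longrightarrow> inv\<^bsub>L\<^esub> cls f = cls (- f)"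
proof -
  interpret G: comm_group G by (rule G_comm)
  interpret N: normal K G by (rule K_normal)
  assume f: "kS f"
  then show ?thesis using N.inv_FactGroup[of "K #>\<^bsub>G\<^esub> f"] N.rcos_inv[of f] G_inv[OF f]
    by (simp add: gl_group_def cls_def carrier_FactGroup)
qed

lemma L_comm: "comm_group L"
proof -
  interpret G: comm_group G by (rule G_comm)
  show ?thesis unfolding gl_group_def by (rule G.abelian_FactGroup[OF K_subgroup])
qed

lemma gl_minus_cls: "\<lbrakk>kS f; kS g\<rbrakk> \<Longrightarrow> gl_minus n p (cls f) (cls g) = cls (f - g)"
  by (simp add: gl_minus_def cls_inv cls_mult)

lemma cls_nat_pow: "kS f \<Longrightarrow> cls f [^]\<^bsub>L\<^esub> (k :: nat) = cls (frag_cmul (int k) f)"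
proof -
  interpret L: comm_group L by (rule L_comm)
  assume f: "kS f"
  show ?thesis by (induction k) (use f in \<open>auto simp: cls_one cls_mult frag_cmul_distrib add.commute\<close>)
qed

lemma cls_int_pow: "kS f \<Longrightarrow> cls f [^]\<^bsub>L\<^esub> (k :: int) = cls (frag_cmul k f)"
proof -
  interpret L: comm_group L by (rule L_comm)
  assume f: "kS f"
  show ?thesis
  proof (cases "k \<ge> 0")
    case True
    then obtain m where "k = int m" using nonneg_int_cases by blast
    then show ?thesis by (simp add: int_pow_int cls_nat_pow[OF f])
  next
    case False
    then obtain m where "k = - int m" by (metis int_cases2 of_nat_0_le_iff)
    then show ?thesis using cls_inv[of "frag_cmul (int m) f"] f by (simp add: L.int_pow_neg_int cls_nat_pow)
  qed
qed

lemma cls_finprod: "\<lbrakk>finite A; \<And>i. i \<in> A \<Longrightarrow> kS (f i)\<rbrakk> \<Longrightarrow> (\<Otimes>\<^bsub>L\<^esub>i\<in>A. cls (f i)) = cls (sum f A)"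
proof -
  interpret L: comm_group L by (rule L_comm)
  show "\<lbrakk>finite A; \<And>i. i \<in> A \<Longrightarrow> kS (f i)\<rbrakk> \<Longrightarrow> ?thesis"
  proof (induction A rule: finite_induct)
    case (insert i A)
    then show ?case by (simp add: L.finprod_insert Pi_def cls_mult)
  qed (simp add: cls_one)
qed

subsection \<open>The order on the grading group\<close>

definition nonneg :: "(gl_gen \<Rightarrow>\<^sub>0 int) \<Rightarrow> bool" where "nonneg f \<longleftrightarrow> kS f \<and> (\<forall>s. lk f s \<ge> 0)"

lemma nonneg_kS [simp]: "nonneg f \<Longrightarrow> kS f" by (simp add: nonneg_def)

lemma nonneg_add: "\<lbrakk>nonneg f; nonneg g\<rbrakk> \<Longrightarrow> nonneg (f + g)"
  by (simp add: nonneg_def lookup_add)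

lemma nonneg_nfc: "nonneg f \<Longrightarrow> nfc f \<ge> 0"
  using p0 by (auto simp: nonneg_def nfc_def intro!: add_nonneg_nonneg sum_nonneg simp: pos_imp_zdiv_nonneg_iff)

lemma gl_x_cls: "gl_x n p i = cls (frag_of (GenX i))" by (simp add: gl_x_def cls_def)
lemma gl_c_cls: "gl_c n p = cls (frag_of GenC)" by (simp add: gl_c_def cls_def)

lemma pos_nonneg: "x \<in> gl_pos n p \<Longrightarrow> \<exists>f. nonneg f \<and> x = cls f"
proof (induction rule: gl_pos.induct)
  case zero
  then show ?case by (auto simp: cls_one nonneg_def intro!: exI[of _ 0])
next
  case (gen_x i)
  then show ?case by (auto simp: gl_x_cls nonneg_def intro!: exI[of _ "frag_of (GenX i)"])
next
  case gen_c
  then show ?case by (auto simp: gl_c_cls nonneg_def intro!: exI[of _ "frag_of GenC"])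
next
  case (add x y)
  then obtain f g where "nonneg f" "nonneg g" "x = cls f" "y = cls g" by blast
  then show ?case using nonneg_add by (auto simp: cls_mult intro!: exI[of _ "f + g"])
qed

lemma nonneg_pos: "nonneg f \<Longrightarrow> cls f \<in> gl_pos n p"
proof -
  assume f: "nonneg f"
  have g: "cls (frag_of s) \<in> gl_pos n p" if "s \<in> S" for s
    using that gl_pos.gen_x[of _ n p] gl_pos.gen_c[of n p] by (auto simp: gl_x_cls gl_c_cls)
  have z: "cls 0 \<in> gl_pos n p" using gl_pos.zero[of n p] by (simp add: cls_one)
  have a: "cls (u + v) \<in> gl_pos n p" if "kS u" "kS v" "cls u \<in> gl_pos n p" "cls v \<in> gl_pos n p" for u v
    using gl_pos.add[OF that(3,4)] that by (simp add: cls_mult)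
  have ks1: "kS (frag_of s)" if "s \<in> S" for s using that by (auto simp: kS_def)
  have c: "cls (frag_cmul (int k) (frag_of s)) \<in> gl_pos n p" if "s \<in> S" for k s
    using that ks1[OF that] by (induction k) (auto simp: z frag_cmul_distrib intro!: a g)
  have sm: "finite A \<Longrightarrow> A \<subseteq> S \<Longrightarrow> cls (\<Sum>s\<in>A. frag_cmul (int (nat (lk f s))) (frag_of s)) \<in> gl_pos n p" for A
  proof (induction A rule: finite_induct)
    case (insert s A)
    let ?t = "\<lambda>s. frag_cmul (int (nat (lk f s))) (frag_of s)"
    have k: "kS (?t s)" "kS (\<Sum>s\<in>A. ?t s)" using insert.prems ks1 by (auto intro!: kS_sum kS_cmul)
    have "cls (?t s) \<in> gl_pos n p" by (rule c) (use insert.prems in auto)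
    moreover have "cls (\<Sum>s\<in>A. ?t s) \<in> gl_pos n p" by (rule insert.IH) (use insert.prems in auto)
    ultimately have "cls (?t s + (\<Sum>s\<in>A. ?t s)) \<in> gl_pos n p" by (rule a[OF k])
    then show ?case using insert.hyps by simp
  qed (simp add: z)
  have "f = (\<Sum>s\<in>S. frag_cmul (int (nat (lk f s))) (frag_of s))"
  proof (rule poly_mapping_eqI)
    fix t
    have "lk (\<Sum>s\<in>S. frag_cmul (int (nat (lk f s))) (frag_of s)) t = (\<Sum>s\<in>S. if s = t then lk f t else 0)"
      unfolding lookup_sum by (rule sum.cong) (use f in \<open>auto simp: nonneg_def\<close>)
    also have "\<dots> = lk f t" using f by (cases "t \<in> S") (auto simp: nonneg_def kS_def in_keys_iff subset_iff
        sum.delta simp del: sum.insert)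
    finally show "lk f t = lk (\<Sum>s\<in>S. frag_cmul (int (nat (lk f s))) (frag_of s)) t" ..
  qed
  then show ?thesis using sm[of S] by simp
qed

definition nff where "nff f = frag_cmul (nfc f) (frag_of GenC) + (\<Sum>i\<in>{1..n}. frag_cmul (nfx f i) (frag_of (GenX i)))"

lemma lk_nff: "lk (nff f) GenC = nfc f" "i \<in> {1..n} \<Longrightarrow> lk (nff f) (GenX i) = nfx f i"
  by (auto simp: nff_def lookup_add lookup_sum if_distrib cong: if_cong)

lemma kS_nff [simp]: "kS (nff f)" unfolding nff_def by (intro kS_add kS_cmul kS_sum kS_simps)

lemma cls_nff: "kS f \<Longrightarrow> cls (nff f) = cls f"
proof -
  assume f: "kS f"
  have "nfx (nff f) i = nfx f i" if "i \<in> {1..n}" for i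
      using that by (simp add: nfx_def[of "nff f"] lk_nff) (simp add: nfx_def)
  moreover have "nfx f i div int (p i) = 0" if "i \<in> {1..n}" for i using p1[OF that] by (simp add: nfx_def)
  then have "nfc (nff f) = nfc f" by (simp add: nfc_def[of "nff f"] lk_nff)
  ultimately show ?thesis using f by (simp add: cls_eq)
qed

text \<open>The \<open>x\<close>-coordinates of a normal form are never negative, so the
  \<open>c\<close>-coordinate alone decides. In the other direction, a nonnegative combination
  carries only nonnegative quotients into that coordinate.\<close>

lemma pos_iff: "kS f \<Longrightarrow> cls f \<in> gl_pos n p \<longleftrightarrow> nfc f \<ge> 0"
proof
  assume f: "kS f" and "cls f \<in> gl_pos n p"
  then obtain g where "nonneg g" "cls f = cls g" using pos_nonneg by blast
  then show "nfc f \<ge> 0" using nonneg_nfc[of g] f by (simp add: cls_eq)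
next
  assume f: "kS f" and c: "nfc f \<ge> 0"
  have "lk (nff f) s \<ge> 0" for s
  proof (cases "s \<in> S")
    case True
    then show ?thesis using c p0 by (auto simp: lk_nff nfx_def)
  next
    case False
    then have "s \<notin> ks (nff f)" using kS_nff[of f] unfolding kS_def by blast
    then show ?thesis by (simp add: in_keys_iff)
  qed
  then have "nonneg (nff f)" by (simp add: nonneg_def)
  then show "cls f \<in> gl_pos n p" using nonneg_pos[of "nff f"] cls_nff[OF f] by simp
qed

text \<open>The homomorphism that takes \<open>c\<close> to 1 and \<open>x i\<close> to
  \<open>1 / p i\<close>, hence kills the relations. It is positive on nonzero nonnegative
  combinations, which makes the algebra \<open>A\<close> directed.\<close>

definition degq :: "(gl_gen \<Rightarrow>\<^sub>0 int) \<Rightarrow> real" where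
  "degq f = real_of_int (lk f GenC) + (\<Sum>i\<in>{1..n}. real_of_int (lk f (GenX i)) / real (p i))"

lemma degq_nf: "degq f = real_of_int (nfc f) + (\<Sum>i\<in>{1..n}. real_of_int (nfx f i) / real (p i))"
proof -
  have "real_of_int (lk f (GenX i)) / real (p i) =
      real_of_int (lk f (GenX i) div int (p i)) + real_of_int (nfx f i) / real (p i)" if "i \<in> {1..n}" for i
  proof -
    have "real_of_int (lk f (GenX i)) = real (p i) * real_of_int (lk f (GenX i) div int (p i)) + real_of_int (nfx f i)"
      unfolding nfx_def by (metis mult_div_mod_eq of_int_add of_int_mult of_int_of_nat_eq)
    then show ?thesis using p1[OF that] by (simp add: field_simps)
  qed
  then show ?thesis by (simp add: degq_def nfc_def sum.distrib)
qed

text \<open>Independent of the representative because \<open>degq_nf\<close> expresses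
  \<open>degq\<close> by the coordinates of the class.\<close>

definition ldeg where "ldeg x = degq (SOME f. kS f \<and> x = cls f)"

lemma ldeg_cls: "kS f \<Longrightarrow> ldeg (cls f) = degq f"
proof -
  assume f: "kS f"
  have "kS (SOME g. kS g \<and> cls f = cls g) \<and> cls f = cls (SOME g. kS g \<and> cls f = cls g)"
    by (rule someI[of _ f]) (use f in auto)
  then have "(\<forall>i\<in>{1..n}. nfx (SOME g. kS g \<and> cls f = cls g) i = nfx f i) \<and> nfc (SOME g. kS g \<and> cls f = cls g) = nfc f"
    using cls_eq[of "SOME g. kS g \<and> cls f = cls g" f] f by metis
  then show ?thesis unfolding ldeg_def degq_nf by simp
qed

lemma degq_add: "degq (f + g) = degq f + degq g"
  by (simp add: degq_def lookup_add add_divide_distrib sum.distrib)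

lemma degq_pos: "nonneg f \<Longrightarrow> f \<noteq> 0 \<Longrightarrow> degq f > 0"
proof -
  assume f: "nonneg f" and "f \<noteq> 0"
  then obtain s where s: "s \<in> S" "lk f s \<noteq> 0" by (metis kS_def nonneg_def in_keys_iff lookup_zero poly_mapping_eqI subsetD)
  then have s': "lk f s > 0" using f by (metis nonneg_def order_le_less)
  have nn: "\<And>i. i \<in> {1..n} \<Longrightarrow> real_of_int (lk f (GenX i)) / real (p i) \<ge> 0" using f by (simp add: nonneg_def)
  show ?thesis
  proof (cases "s = GenC")
    case True
    then show ?thesis unfolding degq_def using s' nn sum_nonneg[of "{1..n}"
        "\<lambda>i. real_of_int (lk f (GenX i)) / real (p i)"] by force
  next
    case False
    then obtain i where i: "i \<in> {1..n}" "s = GenX i" using s by auto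
    have "0 < real_of_int (lk f (GenX i)) / real (p i)" using s' i p1[OF i(1)] by simp
    then have "0 < (\<Sum>i\<in>{1..n}. real_of_int (lk f (GenX i)) / real (p i))"
      using nn i(1) by (intro sum_pos2[of "{1..n}" i]) auto
    moreover have "lk f GenC \<ge> 0" using f by (simp add: nonneg_def)
    ultimately show ?thesis unfolding degq_def by simp
  qed
qed

end

section \<open>Degrees of monomials and the vertices of the resolution\<close>

context gl_grading
begin

primrec vfrag :: "gl_var \<Rightarrow> gl_gen \<Rightarrow>\<^sub>0 int" where
  "vfrag (VarT j) = frag_of GenC"
| "vfrag (VarX i) = frag_of (GenX i)"

text \<open>Degrees are kept in the free abelian group: there only the monomial 1 has degree zero
  (\<open>fd_eq_zero\<close>), and twists are added without choosing representatives.\<close>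

definition fd :: "(gl_var \<Rightarrow>\<^sub>0 nat) \<Rightarrow> gl_gen \<Rightarrow>\<^sub>0 int" where
  "fd m = (\<Sum>v\<in>ks m. frag_cmul (int (lk m v)) (vfrag v))"

lemma fd_superset: "\<lbrakk>finite A; ks m \<subseteq> A\<rbrakk> \<Longrightarrow> fd m = (\<Sum>v\<in>A. frag_cmul (int (lk m v)) (vfrag v))"
  unfolding fd_def by (rule sum.mono_neutral_left) (auto simp: in_keys_iff)

lemma fd_add: "fd (m + m') = fd m + fd m'"
proof -
  let ?A = "ks m \<union> ks m'"
  have "fd (m + m') = (\<Sum>v\<in>?A. frag_cmul (int (lk (m + m') v)) (vfrag v))"
    using Poly_Mapping.keys_add[of m m'] by (intro fd_superset) auto
  also have "\<dots> = fd m + fd m'"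
    using fd_superset[of ?A m] fd_superset[of ?A m'] by (simp add: lookup_add frag_cmul_distrib sum.distrib)
  finally show ?thesis .
qed

lemma fd_zero [simp]: "fd 0 = 0" by (simp add: fd_def)

lemma fd_single: "fd (Poly_Mapping.single v k) = frag_cmul (int k) (vfrag v)"
  by (cases "k = 0") (auto simp: fd_def)

lemma kS_vfrag: "v \<in> gl_vars d n \<Longrightarrow> kS (vfrag v)"
  by (auto simp: gl_vars_def)

lemma kS_fd: "ks m \<subseteq> gl_vars d n \<Longrightarrow> kS (fd m)"
  unfolding fd_def using kS_vfrag by (intro kS_sum kS_cmul) blast

lemma lk_vfrag: "lk (vfrag v) s \<ge> 0" by (cases v) (auto simp: lookup_single when_def)

lemma nonneg_fd: "ks m \<subseteq> gl_vars d n \<Longrightarrow> nonneg (fd m)"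
proof -
  assume m: "ks m \<subseteq> gl_vars d n"
  have "lk (fd m) s \<ge> 0" for s using lk_vfrag by (simp add: fd_def lookup_sum sum_nonneg)
  then show ?thesis using kS_fd[OF m] by (simp add: nonneg_def)
qed

lemma fd_eq_zero: "fd m = 0 \<Longrightarrow> m = 0"
proof (rule ccontr)
  assume f: "fd m = 0" and "m \<noteq> 0"
  then obtain v where v: "v \<in> ks m" by (metis equals0I keys_eq_empty)
  obtain s where s: "lk (vfrag v) s = 1" by (cases v) auto
  have "0 < (\<Sum>v\<in>ks m. int (lk m v) * lk (vfrag v) s)"
    using v s lk_vfrag by (intro sum_pos2[of "ks m" v]) (auto simp: in_keys_iff)
  then show False using f by (simp add: fd_def lookup_sum poly_mapping_eq_iff fun_eq_iff)
qed

lemma gl_degree_fd: "ks m \<subseteq> gl_vars d n \<Longrightarrow> gl_degree n p m = cls (fd m)"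
proof -
  assume m: "ks m \<subseteq> gl_vars d n"
  interpret L: comm_group L by (rule L_comm)
  have v: "gl_var_degree n p v = cls (vfrag v)" for v by (cases v) (auto simp: gl_x_cls gl_c_cls)
  have "gl_degree n p m = (\<Otimes>\<^bsub>L\<^esub>v\<in>ks m. cls (frag_cmul (int (lk m v)) (vfrag v)))"
    unfolding gl_degree_def using m kS_vfrag
    by (intro L.finprod_cong') (auto simp: v cls_nat_pow subset_iff)
  also have "\<dots> = cls (fd m)" unfolding fd_def using m kS_vfrag by (intro cls_finprod) (auto intro!: kS_cmul)
  finally show ?thesis .
qed

definition wt :: "nat \<Rightarrow> nat set \<Rightarrow> gl_gen \<Rightarrow>\<^sub>0 int" where
  "wt j A = frag_cmul (int j) (frag_of GenC) + (\<Sum>k\<in>A. frag_of (GenX k))"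

lemma wt_kS: "A \<subseteq> {1..n} \<Longrightarrow> kS (wt j A)" unfolding wt_def by (intro kS_add kS_cmul kS_sum) auto

lemma lk_wt: "lk (wt j A) GenC = int j" "finite A \<Longrightarrow> lk (wt j A) (GenX i) = (if i \<in> A then 1 else 0)"
  by (auto simp: wt_def lookup_add lookup_sum sum.delta lookup_single when_def)

lemma wt_nonneg: "A \<subseteq> {1..n} \<Longrightarrow> nonneg (wt j A)"
proof -
  assume A: "A \<subseteq> {1..n}"
  have "finite A" using A by (rule finite_subset) simp
  then have "lk (wt j A) s \<ge> 0" for s by (cases s) (simp_all add: lk_wt)
  then show ?thesis using wt_kS[OF A] by (simp add: nonneg_def)
qed

definition interval where "interval d = gl_interval n p \<one>\<^bsub>L\<^esub> (gl_delta d n p)"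

lemma interval_carrier: "x \<in> interval d \<Longrightarrow> x \<in> carrier L" by (simp add: interval_def gl_interval_def)

end

section \<open>The interval for weights at least two\<close>

locale gl_grading2 = gl_grading +
  assumes p2: "i \<in> {1..n} \<Longrightarrow> p i \<ge> 2"
begin

text \<open>The normal form of \<delta>. By definition \<delta> is
  \<open>(2 n - d - 2) c - 2 \<Sum> x i\<close>, and \<open>- 2 x i = (p i - 2) x i - c\<close>;
  weights at least 2 make \<open>p i - 2\<close> a legal coordinate.\<close>

definition \<delta>f where
  "\<delta>f d = frag_cmul (int n - d - 2) (frag_of GenC) + (\<Sum>i\<in>{1..n}. frag_cmul (int (p i) - 2) (frag_of (GenX i)))"

lemma \<delta>f_kS [simp]: "kS (\<delta>f d)" unfolding \<delta>f_def by (intro kS_add kS_cmul kS_sum kS_simps)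

lemma lk_\<delta>f: "lk (\<delta>f d) GenC = int n - d - 2" "i \<in> {1..n} \<Longrightarrow> lk (\<delta>f d) (GenX i) = int (p i) - 2"
  by (auto simp: \<delta>f_def lookup_add lookup_sum sum.delta lookup_single when_def if_distrib cong: if_cong)

lemma nfc_\<delta>f: "nfc (\<delta>f d) = int n - d - 2"
proof -
  have "(int (p i) - 2) div int (p i) = 0" if "i \<in> {1..n}" for i using p2[OF that] by simp
  then show ?thesis by (simp add: nfc_def lk_\<delta>f)
qed

lemma delta_cls: "gl_delta d n p = cls (\<delta>f d)"
proof -
  let ?X = "\<Sum>i\<in>{1..n}. frag_of (GenX i)"
  let ?o = "frag_cmul (int n - d - 1) (frag_of GenC) - ?X"
  let ?D = "frag_cmul d (frag_of GenC) + frag_cmul 2 ?o"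
  have kX: "kS ?X" by (intro kS_sum kS_simps)
  have ko: "kS ?o" by (intro kS_diff kS_cmul kX kS_simps)
  have kD: "kS ?D" by (intro kS_add kS_cmul ko kS_simps)
  have "(\<Otimes>\<^bsub>L\<^esub>i\<in>{1..n}. gl_x n p i) = cls ?X" unfolding gl_x_cls by (rule cls_finprod) auto
  then have "gl_omega d n p = cls ?o"
    unfolding gl_omega_def using kX by (simp add: gl_c_cls cls_int_pow gl_minus_cls)
  then have "gl_delta d n p = cls ?D" unfolding gl_delta_def using ko by (simp add: gl_c_cls cls_int_pow cls_mult)
  also have "\<dots> = cls (\<delta>f d)"
  proof -
    have lX: "lk ?D (GenX i) = - 2" if "i \<in> {1..n}" for i
      using that by (simp add: lookup_add lookup_minus lookup_sum lookup_single when_def sum.delta)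
    have lC: "lk ?D GenC = d + 2 * (int n - d - 1)" by (simp add: lookup_add lookup_minus lookup_sum lookup_single when_def)
    have "nfx ?D i = nfx (\<delta>f d) i" if i: "i \<in> {1..n}" for i
      unfolding nfx_def lX[OF i] lk_\<delta>f(2)[OF i] by (simp add: mod_eq_dvd_iff)
    moreover have "(\<Sum>i\<in>{1..n}. lk ?D (GenX i) div int (p i)) = (\<Sum>i\<in>{1..n}. - 1)"
    proof (rule sum.cong[OF refl])
      fix i assume i: "i \<in> {1..n}"
      \<comment> \<open>Each of the \<open>n\<close> terms \<open>- 2 x i\<close> borrows exactly
        one \<open>c\<close>, since \<open>p i\<close> is at least 2.\<close>
      have "(- 2 :: int) div int (p i) = - 1"
        using p2[OF i] by (intro div_pos_neg_trivial[THEN trans] int_div_pos_eq[of _ _ _ "int (p i) - 2"]) auto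
      then show "lk ?D (GenX i) div int (p i) = - 1" using lX[OF i] by simp
    qed
    then have "nfc ?D = nfc (\<delta>f d)" unfolding nfc_\<delta>f by (simp add: nfc_def lC)
    ultimately show ?thesis using kD by (simp add: cls_eq)
  qed
  finally show ?thesis .
qed

lemma interval_iff: "kS f \<Longrightarrow> cls f \<in> interval d \<longleftrightarrow> nfc f \<ge> 0 \<and> nfc (\<delta>f d - f) \<ge> 0"
  by (simp add: interval_def gl_interval_def gl_le_def delta_cls cls_one gl_minus_cls pos_iff)

lemma pos_add: "\<lbrakk>kS f; kS g; nfc f \<ge> 0; nfc g \<ge> 0\<rbrakk> \<Longrightarrow> nfc (f + g) \<ge> 0"
  using gl_pos.add[of "cls f" n p "cls g"] by (simp add: pos_iff[symmetric] cls_mult)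

lemma interval_empty: "int n \<le> d + 1 \<Longrightarrow> interval d = {}"
proof (rule ccontr)
  assume n: "int n \<le> d + 1" and "interval d \<noteq> {}"
  then obtain x where x: "x \<in> interval d" by blast
  then obtain f where f: "kS f" "x = cls f" using interval_carrier L_obtain by blast
  \<comment> \<open>The sum of the two positive elements would be \<delta>, whose
    \<open>c\<close>-coordinate \<open>n - d - 2\<close> is negative here.\<close>
  then have "nfc (f + (\<delta>f d - f)) \<ge> 0" using x by (intro pos_add) (auto simp: interval_iff)
  then show False using n by (simp add: nfc_\<delta>f)
qed

text \<open>Adding the positive element \<open>f\<close> to \<open>\<delta> - (f + g)\<close> gives
  \<open>\<delta> - g\<close>. Used contrapositively: no vertex of the interval lies above a
  nonnegative degree outside it.\<close>

lemma interval_down: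
  assumes "nonneg f" "nonneg g" "cls (f + g) \<in> interval d" shows "cls g \<in> interval d"
proof -
  have "nfc (f + (\<delta>f d - (f + g))) \<ge> 0"
    using assms nonneg_nfc by (intro pos_add) (auto simp: interval_iff)
  then show ?thesis using assms nonneg_nfc by (simp add: interval_iff algebra_simps)
qed

lemma interval_zero: "int n \<ge> d + 2 \<Longrightarrow> cls 0 \<in> interval d"
  by (simp add: interval_iff nfc_\<delta>f) (simp add: nfc_def)

text \<open>The coordinates lie in a finite box: those of the \<open>x i\<close> are residues, and
  that of \<open>c\<close> is bounded because integer quotients are superadditive and add up to at
  most the coordinate of \<delta>.\<close>

lemma interval_finite: "finite (interval d)"
proof -
  let ?g = "\<lambda>x. let f = SOME f. kS f \<and> x = cls f in (\<lambda>i\<in>{1..n}. nfx f i, nfc f)"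
  have g: "?g (cls f) = (\<lambda>i\<in>{1..n}. nfx f i, nfc f)" if f: "kS f" for f
  proof -
    have "kS (SOME g. kS g \<and> cls f = cls g) \<and> cls f = cls (SOME g. kS g \<and> cls f = cls g)"
      by (rule someI[of _ f]) (use f in auto)
    then have "(\<forall>i\<in>{1..n}. nfx (SOME g. kS g \<and> cls f = cls g) i = nfx f i) \<and> nfc (SOME g. kS g \<and> cls f = cls g) = nfc f"
      using cls_eq[of "SOME g. kS g \<and> cls f = cls g" f] f by metis
    then show ?thesis by (auto simp: Let_def fun_eq_iff)
  qed
  have "?g ` interval d \<subseteq> (\<Pi>\<^sub>E i\<in>{1..n}. {0..<int (p i)}) \<times> {0..int n - d - 2}"
  proof
    fix w assume "w \<in> ?g ` interval d"
    then obtain x where x: "x \<in> interval d" "w = ?g x" by blast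
    then obtain f where f: "kS f" "x = cls f" using interval_carrier L_obtain by blast
    have nn: "nfc f \<ge> 0" "nfc (\<delta>f d - f) \<ge> 0" using x f by (auto simp: interval_iff)
    have "nfc f + nfc (\<delta>f d - f) \<le> nfc (\<delta>f d)"
    proof -
      have "lk f (GenX i) div int (p i) + lk (\<delta>f d - f) (GenX i) div int (p i) \<le> lk (\<delta>f d) (GenX i) div int (p i)"
          if "i \<in> {1..n}" for i
      proof -
        let ?a = "lk f (GenX i)" and ?b = "lk (\<delta>f d - f) (GenX i)"
        have "0 \<le> (?a mod int (p i) + ?b mod int (p i)) div int (p i)"
            using p0[OF that] by (simp add: pos_imp_zdiv_nonneg_iff)
        then have "?a div int (p i) + ?b div int (p i) \<le> (?a + ?b) div int (p i)"
          using div_add1_eq[of ?a ?b "int (p i)"] by linarith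
        then show ?thesis by (simp add: lookup_minus)
      qed
      then have "(\<Sum>i\<in>{1..n}. lk f (GenX i) div int (p i) + lk (\<delta>f d - f) (GenX i) div int (p i)) \<le> (\<Sum>i\<in>{1..n}. lk
          (\<delta>f d) (GenX i) div int (p i))"
        by (rule sum_mono)
      then show ?thesis by (simp add: nfc_def sum.distrib lookup_minus)
    qed
    then have "nfc f \<le> int n - d - 2" using nn by (simp add: nfc_\<delta>f)
    moreover have "nfx f i \<in> {0..<int (p i)}" if "i \<in> {1..n}" for i using p0[OF that] by (simp add: nfx_def)
    ultimately show "w \<in> (\<Pi>\<^sub>E i\<in>{1..n}. {0..<int (p i)}) \<times> {0..int n - d - 2}"
      using nn unfolding x(2) f(2) g[OF f(1)] by auto
  qed
  then have "finite (?g ` interval d)" by (rule finite_subset) (auto intro!: finite_PiE)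
  moreover have "inj_on ?g (interval d)"
  proof (rule inj_onI)
    fix x y assume x: "x \<in> interval d" and y: "y \<in> interval d" and eq: "?g x = ?g y"
    obtain f where f: "kS f" "x = cls f" using x interval_carrier L_obtain by blast
    obtain h where h: "kS h" "y = cls h" using y interval_carrier L_obtain by blast
    have "(\<lambda>i\<in>{1..n}. nfx f i, nfc f) = (\<lambda>i\<in>{1..n}. nfx h i, nfc h)" using eq unfolding f(2) h(2) g[OF f(1)] g[OF h(1)] .
    then have "\<forall>i\<in>{1..n}. nfx f i = nfx h i" "nfc f = nfc h" by (auto simp: fun_eq_iff restrict_def) metis
    then show "x = y" using f h by (simp add: cls_eq)
  qed
  ultimately show ?thesis by (rule finite_imageD)
qed

text \<open>Coefficients 0 and 1 are below every weight, so nothing is carried into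
  \<open>c\<close>.\<close>

lemma nfc_wt: "A \<subseteq> {1..n} \<Longrightarrow> nfc (wt j A) = int j"
proof -
  assume A: "A \<subseteq> {1..n}"
  then have fA: "finite A" by (rule finite_subset) simp
  have "lk (wt j A) (GenX i) div int (p i) = 0" if "i \<in> {1..n}" for i
    using p2[OF that] fA by (simp add: lk_wt)
  then show ?thesis by (simp add: nfc_def lk_wt)
qed

lemma nfx_wt: "A \<subseteq> {1..n} \<Longrightarrow> i \<in> {1..n} \<Longrightarrow> nfx (wt j A) i = (if i \<in> A then 1 else 0)"
proof -
  assume A: "A \<subseteq> {1..n}" and i: "i \<in> {1..n}"
  have fA: "finite A" using A by (rule finite_subset) simp
  show ?thesis using p2[OF i] fA by (simp add: nfx_def lk_wt)
qed

lemma wt_inj: "\<lbrakk>A \<subseteq> {1..n}; B \<subseteq> {1..n}; cls (wt j A) = cls (wt k B)\<rbrakk> \<Longrightarrow> j = k \<and> A = B"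
proof -
  assume A: "A \<subseteq> {1..n}" and B: "B \<subseteq> {1..n}" and eq: "cls (wt j A) = cls (wt k B)"
  have *: "\<forall>i\<in>{1..n}. nfx (wt j A) i = nfx (wt k B) i" "nfc (wt j A) = nfc (wt k B)"
    using eq wt_kS[OF A] wt_kS[OF B] by (auto simp: cls_eq)
  have "i \<in> A \<longleftrightarrow> i \<in> B" if "i \<in> {1..n}" for i
    using *(1) that nfx_wt[OF A that] nfx_wt[OF B that] by (metis zero_neq_one)
  then show ?thesis using *(2) A B nfc_wt by auto
qed

text \<open>The coefficient of \<open>x i\<close> becomes \<open>p i - 2\<close> or
  \<open>p i - 3\<close>, and it is negative only for \<open>i\<close> in \<open>A\<close> with
  \<open>p i = 2\<close>; exactly these indices borrow one \<open>c\<close>.\<close>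

lemma nfc_\<delta>f_wt:
  assumes A: "A \<subseteq> {1..n}"
  shows "nfc (\<delta>f d - wt j A) = int n - d - 2 - int j - int (card {i \<in> A. p i = 2})"
proof -
  have fA: "finite A" using A by (rule finite_subset) simp
  have "lk (\<delta>f d - wt j A) (GenX i) div int (p i) = (if i \<in> {i \<in> A. p i = 2} then - 1 else 0)" if i: "i \<in> {1..n}" for i
    using p2[OF i] fA by (auto simp: lookup_minus lk_\<delta>f(2)[OF i] lk_wt intro!: div_pos_pos_trivial)
  then have "(\<Sum>i\<in>{1..n}. lk (\<delta>f d - wt j A) (GenX i) div int (p i)) = (\<Sum>i\<in>{1..n}. if i \<in> {i \<in> A. p i = 2} then - 1 else 0)"
    by (intro sum.cong) auto
  also have "\<dots> = - int (card {i \<in> A. p i = 2})"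
    using A by (subst sum.inter_restrict[symmetric]) (auto simp: Int_absorb1 subset_iff intro!: arg_cong[where f = card])
  finally show ?thesis by (simp add: nfc_def lookup_minus lk_\<delta>f lk_wt)
qed

definition N where "N d = nat (2 * (int n - d - 2)) + card {i \<in> {1..n}. p i \<ge> 3}"

text \<open>Each index of weight 2 in \<open>A\<close> costs one \<open>c\<close>, as a unit of
  \<open>j\<close> does, but counts once instead of twice. So \<open>j\<close> plus the number of
  these indices is at most \<open>n - d - 2\<close>, and the remaining indices are among those with
  \<open>p i >= 3\<close>.\<close>

lemma wt_bound:
  assumes A: "A \<subseteq> {1..n}" and i: "cls (wt j A) \<in> interval d"
  shows "2 * j + card A \<le> N d"
proof -
  have fA: "finite A" using A by (rule finite_subset) simp
  let ?c2 = "card {i \<in> A. p i = 2}" and ?c3 = "card {i \<in> {1..n}. p i \<ge> 3}"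
  have 1: "int n - d - 2 \<ge> int j + int ?c2"
    using i wt_kS[OF A] nfc_\<delta>f_wt[OF A] by (simp add: interval_iff)
  have 2: "card A \<le> ?c2 + ?c3"
  proof -
    have "A \<subseteq> {i \<in> A. p i = 2} \<union> {i \<in> {1..n}. p i \<ge> 3}" using A p2 by force
    then have "card A \<le> card ({i \<in> A. p i = 2} \<union> {i \<in> {1..n}. p i \<ge> 3})" using fA by (intro card_mono) auto
    also have "\<dots> \<le> ?c2 + ?c3" by (rule card_Un_le)
    finally show ?thesis .
  qed
  have "int (2 * j + ?c2) \<le> 2 * (int n - d - 2)" using 1 by simp
  then have "2 * j + ?c2 \<le> nat (2 * (int n - d - 2))" by (metis nat_int nat_mono)
  then show ?thesis using 2 unfolding N_def by linarith
qed

definition top where "top d = wt (nat (int n - d - 2)) {i \<in> {1..n}. p i \<ge> 3}"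

lemma top_interval: "int n \<ge> d + 2 \<Longrightarrow> cls (top d) \<in> interval d"
proof -
  assume n: "int n \<ge> d + 2"
  have A: "{i \<in> {1..n}. p i \<ge> 3} \<subseteq> {1..n}" by auto
  have "{i \<in> {i \<in> {1..n}. p i \<ge> 3}. p i = 2} = {}" by auto
  then show ?thesis using n wt_kS[OF A] nfc_\<delta>f_wt[OF A] nfc_wt[OF A] by (simp add: top_def interval_iff)
qed

end

subsection \<open>Polynomial mappings\<close>

lemma lookup_single_mult:
  fixes f :: "('a::cancel_comm_monoid_add) \<Rightarrow>\<^sub>0 ('b::comm_semiring_1)"
  shows "Poly_Mapping.lookup (Poly_Mapping.single t c * f) k = (\<Sum>m\<in>Poly_Mapping.keys f. if t + m =
      k then c * Poly_Mapping.lookup f m else 0)"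
proof -
  have "f = (\<Sum>m\<in>Poly_Mapping.keys f. Poly_Mapping.single m (Poly_Mapping.lookup f m))"
    by (rule poly_mapping_eqI) (auto simp: lookup_sum lookup_single when_def in_keys_iff)
  then have "Poly_Mapping.single t c * f = (\<Sum>m\<in>Poly_Mapping.keys f. Poly_Mapping.single (t + m) (c *
      Poly_Mapping.lookup f m))"
    by (metis (no_types, lifting) mult_single sum.cong sum_distrib_left)
  then show ?thesis by (simp add: lookup_sum lookup_single when_def)
qed

lemma lookup_single_mult_shift:
  fixes f :: "('a::cancel_comm_monoid_add) \<Rightarrow>\<^sub>0 ('b::comm_semiring_1)"
  shows "Poly_Mapping.lookup (Poly_Mapping.single t c * f) (t + m) = c * Poly_Mapping.lookup f m"
  unfolding lookup_single_mult by (auto simp: in_keys_iff)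

lemma keys_single_mult:
  fixes f :: "('a::cancel_comm_monoid_add) \<Rightarrow>\<^sub>0 ('b::comm_semiring_1)"
  shows "Poly_Mapping.keys (Poly_Mapping.single t 1 * f) = (\<lambda>m. t + m) ` Poly_Mapping.keys f"
proof (intro equalityI subsetI)
  fix k assume "k \<in> Poly_Mapping.keys (Poly_Mapping.single t 1 * f)"
  then have "(\<Sum>m\<in>Poly_Mapping.keys f. if t + m = k then 1 * Poly_Mapping.lookup f m else 0) \<noteq> 0"
    unfolding in_keys_iff lookup_single_mult .
  then obtain m where "m \<in> Poly_Mapping.keys f" "t + m = k"
    by (rule sum.not_neutral_contains_not_neutral) (auto split: if_splits)
  then show "k \<in> (\<lambda>m. t + m) ` Poly_Mapping.keys f" by blast
next
  fix k assume "k \<in> (\<lambda>m. t + m) ` Poly_Mapping.keys f"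
  then show "k \<in> Poly_Mapping.keys (Poly_Mapping.single t 1 * f)"
    using lookup_single_mult_shift[of t 1 f] by (auto simp: in_keys_iff)
qed

lemma poly_mapping_sum_single: "f = (\<Sum>m\<in>Poly_Mapping.keys f. Poly_Mapping.single m (Poly_Mapping.lookup f m))"
  by (rule poly_mapping_eqI) (auto simp: lookup_sum lookup_single when_def in_keys_iff)

lift_definition pfilter :: "('a \<Rightarrow> bool) \<Rightarrow> ('a \<Rightarrow>\<^sub>0 'b::zero) \<Rightarrow> ('a \<Rightarrow>\<^sub>0 'b)" is "\<lambda>P f x. if P x then f x else 0"
  by (rule finite_subset) (auto split: if_splits)

lemma lookup_pfilter: "Poly_Mapping.lookup (pfilter P f) m = (if P m then Poly_Mapping.lookup f m else 0)"
  by transfer simp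

lemma keys_pfilter: "Poly_Mapping.keys (pfilter P f) = {m \<in> Poly_Mapping.keys f. P m}"
  by (auto simp: in_keys_iff lookup_pfilter split: if_splits)

lemma pfilter_zero: "pfilter P 0 = 0"
  by (rule poly_mapping_eqI) (simp add: lookup_pfilter)

lemma pfilter_add: "pfilter P (f + g) = pfilter P f + pfilter P (g :: 'a \<Rightarrow>\<^sub>0 'b::monoid_add)"
  by (rule poly_mapping_eqI) (simp add: lookup_pfilter lookup_add)

lemma pfilter_diff: "pfilter P (f - g) = pfilter P f - pfilter P (g :: 'a \<Rightarrow>\<^sub>0 'b::ab_group_add)"
  by (rule poly_mapping_eqI) (simp add: lookup_pfilter lookup_minus)

lemma pfilter_id: "(\<And>m. m \<in> Poly_Mapping.keys f \<Longrightarrow> P m) \<Longrightarrow> pfilter P f = f"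
  by (rule poly_mapping_eqI) (auto simp: lookup_pfilter in_keys_iff)

lemma pfilter_none: "(\<And>m. m \<in> Poly_Mapping.keys f \<Longrightarrow> \<not> P m) \<Longrightarrow> pfilter P f = 0"
  by (rule poly_mapping_eqI) (auto simp: lookup_pfilter in_keys_iff)

lemma pfilter_split: "pfilter P f + pfilter (\<lambda>m. \<not> P m) f = (f :: 'a \<Rightarrow>\<^sub>0 'b::monoid_add)"
  by (rule poly_mapping_eqI) (simp add: lookup_pfilter lookup_add)

text \<open>Meant for homogeneous \<open>g\<close>, where the degree of a product monomial is
  decided by the monomial of \<open>a\<close>.\<close>

lemma pfilter_mult:
  fixes a g :: "('a::monoid_add) \<Rightarrow>\<^sub>0 ('b::semiring_0)"
  assumes "\<And>m m'. \<lbrakk>m \<in> Poly_Mapping.keys a; m' \<in> Poly_Mapping.keys g\<rbrakk> \<Longrightarrow> P (m + m') \<longleftrightarrow> Q m"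
  shows "pfilter P (a * g) = pfilter Q a * g"
proof -
  have "a * g = pfilter Q a * g + pfilter (\<lambda>m. \<not> Q m) a * g"
    using pfilter_split[of Q a] by (metis distrib_right)
  then have "pfilter P (a * g) = pfilter P (pfilter Q a * g) + pfilter P (pfilter (\<lambda>m. \<not> Q m) a * g)"
    by (metis pfilter_add)
  also have "pfilter P (pfilter Q a * g) = pfilter Q a * g"
    using keys_mult[of "pfilter Q a" g] assms by (intro pfilter_id) (auto simp: keys_pfilter)
  also have "pfilter P (pfilter (\<lambda>m. \<not> Q m) a * g) = 0"
    using keys_mult[of "pfilter (\<lambda>m. \<not> Q m) a" g] assms by (intro pfilter_none) (auto simp: keys_pfilter)
  finally show ?thesis by simp
qed

subsection \<open>The polynomial ring and its ideals\<close>

locale gl_ci = gl_complete_intersection d n l p for d n and l :: "nat \<Rightarrow> 'k::field gl_poly" and p +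
  assumes p2': "i \<in> {1..n} \<Longrightarrow> p i \<ge> 2"
begin

sublocale gl_grading2 n p
  by unfold_locales (use p2' in fastforce)+

definition e where "e = nat (d + 1)"

lemma e_int: "int e = d + 1" using dim by (simp add: e_def)

lemma VarT_iff: "VarT j \<in> gl_vars d n \<longleftrightarrow> j < e"
  using e_int by (auto simp: gl_vars_def)

lemma VarX_iff: "VarX i \<in> gl_vars d n \<longleftrightarrow> i \<in> {1..n}"
  by (auto simp: gl_vars_def)

lemma vars_eq: "gl_vars d n = VarT ` {..<e} \<union> VarX ` {1..n}"
  using e_int by (auto simp: gl_vars_def)

lemma fin_vars: "finite (gl_vars d n)" by (simp add: vars_eq)

abbreviation PR where "PR \<equiv> (gl_poly_ring d n :: 'k gl_poly ring)"
definition PC :: "'k gl_poly set" where "PC = {f. \<forall>m\<in>ks f. ks m \<subseteq> gl_vars d n}"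
abbreviation kV where "kV m \<equiv> ks m \<subseteq> gl_vars d n"
abbreviation X :: "nat \<Rightarrow> 'k gl_poly" where "X i \<equiv> gl_monom_var (VarX i)"
abbreviation T :: "nat \<Rightarrow> 'k gl_poly" where "T j \<equiv> gl_monom_var (VarT j)"
abbreviation cst :: "'k \<Rightarrow> 'k gl_poly" where "cst a \<equiv> Poly_Mapping.single 0 a"

lemma PR_simps [simp]: "carrier PR = PC" "\<zero>\<^bsub>PR\<^esub> = 0" "\<one>\<^bsub>PR\<^esub> = 1" "f \<oplus>\<^bsub>PR\<^esub> g = f + g" "f \<otimes>\<^bsub>PR\<^esub> g = f * g"
  by (auto simp: gl_poly_ring_def PC_def)

lemma kV_add: "\<lbrakk>kV m; kV m'\<rbrakk> \<Longrightarrow> kV (m + m')"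
  using Poly_Mapping.keys_add[of m m'] by blast

lemma PC_simps [simp]:
  "0 \<in> PC" "1 \<in> PC" "f \<in> PC \<Longrightarrow> - f \<in> PC" "kV m \<Longrightarrow> Poly_Mapping.single m a \<in> PC" "cst a \<in> PC"
  by (auto simp: PC_def)

lemma PC_add [simp]: "\<lbrakk>f \<in> PC; g \<in> PC\<rbrakk> \<Longrightarrow> f + g \<in> PC"
  using Poly_Mapping.keys_add[of f g] unfolding PC_def by blast

lemma PC_diff [simp]: "\<lbrakk>f \<in> PC; g \<in> PC\<rbrakk> \<Longrightarrow> f - g \<in> PC"
  using PC_add[of f "- g"] by simp

lemma PC_mult [simp]: "\<lbrakk>f \<in> PC; g \<in> PC\<rbrakk> \<Longrightarrow> f * g \<in> PC"
proof -
  assume f: "f \<in> PC" and g: "g \<in> PC"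
  show ?thesis unfolding PC_def
  proof (intro CollectI ballI)
    fix m assume "m \<in> ks (f * g)"
    then obtain a b where "m = a + b" "a \<in> ks f" "b \<in> ks g" using keys_mult[of f g] by blast
    then show "kV m" using f g kV_add unfolding PC_def by blast
  qed
qed

lemma PC_sum [simp]: "(\<And>i. i \<in> A \<Longrightarrow> f i \<in> PC) \<Longrightarrow> sum f A \<in> PC"
  by (induction A rule: infinite_finite_induct) auto

lemma PC_pow [simp]: "f \<in> PC \<Longrightarrow> f ^ k \<in> PC"
  by (induction k) auto

lemma PC_var [simp]: "v \<in> gl_vars d n \<Longrightarrow> gl_monom_var v \<in> PC"
  by (auto simp: gl_monom_var_def)

lemma PC_X [simp]: "i \<in> {1..n} \<Longrightarrow> X i \<in> PC" using PC_var VarX_iff by blast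

lemma PC_pfilter [simp]: "f \<in> PC \<Longrightarrow> pfilter P f \<in> PC" by (auto simp: PC_def keys_pfilter)

lemma PR_cring: "cring PR"
proof (rule cringI)
  show "abelian_group PR"
  proof (rule abelian_groupI)
    fix x assume "x \<in> carrier PR"
    then show "\<exists>y\<in>carrier PR. y \<oplus>\<^bsub>PR\<^esub> x = \<zero>\<^bsub>PR\<^esub>" by (intro bexI[of _ "- x"]) auto
  qed auto
  show "Group.comm_monoid PR" by (rule comm_monoidI) (auto simp: mult.assoc mult.commute)
qed (auto simp: distrib_right)

lemma X_pow: "X i ^ k = Poly_Mapping.single (Poly_Mapping.single (VarX i) k) 1"
  by (induction k) (auto simp: gl_monom_var_def mult_single plus_1_eq_Suc simp flip: single_add)

lemma l_keys: "i \<in> {1..n} \<Longrightarrow> m \<in> ks (l i) \<Longrightarrow> \<exists>j<e. m = Poly_Mapping.single (VarT j) 1"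
  using linear[of i] e_int unfolding gl_linear_form_def by force

lemma PC_l [simp]: "i \<in> {1..n} \<Longrightarrow> l i \<in> PC"
  unfolding PC_def using l_keys[of i] VarT_iff by fastforce

definition g where "g i = X i ^ p i - l i"

lemma PC_g [simp]: "i \<in> {1..n} \<Longrightarrow> g i \<in> PC" by (simp add: g_def)

text \<open>The preimage in the polynomial ring of the ideal \<open>(X 1, ..., X i)\<close> of
  \<open>R\<close>; \<open>J 0\<close> is the ideal of relations (\<open>Id_J\<close>). On
  polynomials, membership can be tested monomial by monomial.\<close>

definition J :: "nat \<Rightarrow> 'k gl_poly set" where
  "J i = {f \<in> PC. \<exists>a b. (\<forall>k. a k \<in> PC) \<and> (\<forall>k. b k \<in> PC) \<and> f = (\<Sum>k\<in>{1..n}. a k * g k) + (\<Sum>k\<in>{1..i}. b k * X k)}"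

lemma J_PC: "f \<in> J i \<Longrightarrow> f \<in> PC" by (simp add: J_def)

lemma J_I: "\<lbrakk>f \<in> PC; \<And>k. a k \<in> PC; \<And>k. b k \<in> PC; f = (\<Sum>k\<in>{1..n}. a k * g k) + (\<Sum>k\<in>{1..i}. b k * X k)\<rbrakk> \<Longrightarrow> f \<in> J i"
  unfolding J_def by blast

lemma J_zero [simp]: "0 \<in> J i"
  by (auto simp: J_def intro!: exI[of _ "\<lambda>_. 0"])

lemma J_add [simp]: "\<lbrakk>f \<in> J i; f' \<in> J i\<rbrakk> \<Longrightarrow> f + f' \<in> J i"
proof -
  assume "f \<in> J i" "f' \<in> J i"
  then obtain a b a' b' where "\<forall>k. a k \<in> PC" "\<forall>k. b k \<in> PC" "f = (\<Sum>k\<in>{1..n}. a k * g k) + (\<Sum>k\<in>{1..i}. b k * X k)"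
    "\<forall>k. a' k \<in> PC" "\<forall>k. b' k \<in> PC" "f' = (\<Sum>k\<in>{1..n}. a' k * g k) + (\<Sum>k\<in>{1..i}. b' k * X k)" "f \<in> PC" "f' \<in> PC"
        by (auto simp: J_def)
  then show ?thesis unfolding J_def
    by (intro CollectI conjI exI[of _ "\<lambda>k. a k + a' k"] exI[of _ "\<lambda>k. b k + b' k"]) (auto simp: distrib_right sum.distrib)
qed

lemma J_mult [simp]: "\<lbrakk>r \<in> PC; f \<in> J i\<rbrakk> \<Longrightarrow> r * f \<in> J i"
proof -
  assume r: "r \<in> PC" and "f \<in> J i"
  then obtain a b where "\<forall>k. a k \<in> PC" "\<forall>k. b k \<in> PC"
      "f = (\<Sum>k\<in>{1..n}. a k * g k) + (\<Sum>k\<in>{1..i}. b k * X k)" and f: "f \<in> PC" by (auto simp: J_def)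
  then show ?thesis using r PC_mult[OF r f]
    by (intro J_I[where a = "\<lambda>k. r * a k" and b = "\<lambda>k. r * b k"]) (auto simp: distrib_left sum_distrib_left mult.assoc)
qed

lemma J_neg [simp]: "f \<in> J i \<Longrightarrow> - f \<in> J i"
  using J_mult[of "- 1" f i] by simp

lemma J_diff [simp]: "\<lbrakk>f \<in> J i; f' \<in> J i\<rbrakk> \<Longrightarrow> f - f' \<in> J i"
  using J_add[of f i "- f'"] by simp

lemma J_sum [simp]: "(\<And>k. k \<in> A \<Longrightarrow> f k \<in> J i) \<Longrightarrow> sum f A \<in> J i"
  by (induction A rule: infinite_finite_induct) auto

lemma J_mult_r [simp]: "\<lbrakk>r \<in> PC; f \<in> J i\<rbrakk> \<Longrightarrow> f * r \<in> J i"
  using J_mult by (metis mult.commute)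

lemma J_g [simp]: "k \<in> {1..n} \<Longrightarrow> g k \<in> J i"
  unfolding J_def
  by (intro CollectI conjI exI[of _ "\<lambda>j. if j = k then 1 else 0"] exI[of _ "\<lambda>_. 0"]) (auto simp: if_distrib[of "\<lambda>x.
      x * _"] cong: if_cong)

lemma J_X [simp]: "\<lbrakk>k \<in> {1..i}; i \<le> n\<rbrakk> \<Longrightarrow> X k \<in> J i"
  unfolding J_def
  by (intro CollectI conjI exI[of _ "\<lambda>j. if j = k then 1 else 0"] exI[of _ "\<lambda>_. 0"]) (auto simp: if_distrib[of "\<lambda>x.
      x * _"] cong: if_cong)

lemma J_minimal:
  assumes "f \<in> J i" "i \<le> n" and "0 \<in> A" "\<And>u v. \<lbrakk>u \<in> A; v \<in> A\<rbrakk> \<Longrightarrow> u + v \<in> A"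
    "\<And>a k. \<lbrakk>a \<in> PC; k \<in> {1..n}\<rbrakk> \<Longrightarrow> a * g k \<in> A" "\<And>a k. \<lbrakk>a \<in> PC; k \<in> {1..i}\<rbrakk> \<Longrightarrow> a * X k \<in> A"
  shows "f \<in> A"
proof -
  from assms(1) obtain a b where ab: "\<forall>k. a k \<in> PC" "\<forall>k. b k \<in> PC"
      "f = (\<Sum>k\<in>{1..n}. a k * g k) + (\<Sum>k\<in>{1..i}. b k * X k)" by (auto simp: J_def)
  have sm: "(\<And>k. k \<in> B \<Longrightarrow> h k \<in> A) \<Longrightarrow> sum h B \<in> A" for B :: "nat set" and h
    by (induction B rule: infinite_finite_induct) (use assms in auto)
  show ?thesis unfolding ab(3) using ab assms by (auto intro!: assms(4) sm)
qed

lemma J_mono: "\<lbrakk>i \<le> j; j \<le> n\<rbrakk> \<Longrightarrow> J i \<subseteq> J j"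
proof
  fix f assume i: "i \<le> j" "j \<le> n" and f: "f \<in> J i"
  have "X k \<in> J j" if "k \<in> {1..i}" for k using that i by (intro J_X) auto
  then show "f \<in> J j" using f i by (intro J_minimal[of f i "J j"]) (auto)
qed

lemma J_Suc: "\<lbrakk>f \<in> J (Suc i); Suc i \<le> n\<rbrakk> \<Longrightarrow> \<exists>b\<in>PC. f - X (Suc i) * b \<in> J i"
proof -
  assume "f \<in> J (Suc i)" and i: "Suc i \<le> n"
  then obtain a b where ab: "\<forall>k. a k \<in> PC" "\<forall>k. b k \<in> PC" "f = (\<Sum>k\<in>{1..n}. a k * g k) + (\<Sum>k\<in>{1..Suc i}. b k * X k)"
      "f \<in> PC" by (auto simp: J_def)
  have "f - X (Suc i) * b (Suc i) = (\<Sum>k\<in>{1..n}. a k * g k) + (\<Sum>k\<in>{1..i}. b k * X k)"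
    using ab(3) by (simp add: algebra_simps)
  moreover have "f - X (Suc i) * b (Suc i) \<in> PC" by (intro PC_diff PC_mult PC_X) (use ab(2,4) i in auto)
  ultimately have "f - X (Suc i) * b (Suc i) \<in> J i" using ab unfolding J_def by blast
  then show ?thesis using ab(2) by blast
qed

lemma J_SucI: "\<lbrakk>b \<in> PC; f - X (Suc i) * b \<in> J i; Suc i \<le> n\<rbrakk> \<Longrightarrow> f \<in> J (Suc i)"
proof -
  assume b: "b \<in> PC" and f: "f - X (Suc i) * b \<in> J i" and i: "Suc i \<le> n"
  have "f - X (Suc i) * b \<in> J (Suc i)" using f J_mono[of i "Suc i"] i by auto
  then have "(f - X (Suc i) * b) + X (Suc i) * b \<in> J (Suc i)" using b i by (intro J_add J_mult_r) auto
  then show ?thesis by simp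
qed

abbreviation Id where "Id \<equiv> gl_ideal d n l p"

lemma Id_ideal: "ideal Id PR"
proof -
  interpret PR: cring PR by (rule PR_cring)
  show ?thesis unfolding gl_ideal_def by (rule PR.genideal_ideal) (auto simp: g_def[symmetric])
qed

lemma J0_ideal: "ideal (J 0) PR"
proof -
  interpret PR: cring PR by (rule PR_cring)
  show ?thesis
  proof (rule idealI[OF PR.ring_axioms])
    show "subgroup (J 0) (add_monoid PR)"
    proof (rule PR.add.subgroupI)
      fix a assume a: "a \<in> J 0"
      then have "\<ominus>\<^bsub>PR\<^esub> a = - a" using J_PC[OF a] by (intro PR.minus_equality) auto
      then show "\<ominus>\<^bsub>PR\<^esub> a \<in> J 0" using a by simp
    next
      show "J 0 \<noteq> {}" using J_zero[of 0] by blast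
    qed (use J_PC in auto)
  qed auto
qed

lemma Id_J: "Id = J 0"
proof
  interpret PR: cring PR by (rule PR_cring)
  have img: "(\<lambda>i. gl_monom_var (VarX i) ^ p i - l i) ` {1..n} = g ` {1..n}" by (simp add: g_def)
  show "Id \<subseteq> J 0" unfolding gl_ideal_def img
    by (rule PR.genideal_minimal[OF J0_ideal]) auto
  interpret ideal Id PR by (rule Id_ideal)
  have gI: "g k \<in> Id" if "k \<in> {1..n}" for k
    unfolding gl_ideal_def img using PR.genideal_self[of "g ` {1..n}"] that by (auto simp: image_subset_iff)
  show "J 0 \<subseteq> Id"
  proof
    fix f assume f: "f \<in> J 0"
    show "f \<in> Id"
      by (rule J_minimal[OF f]) (use gI a_subgroup additive_subgroup.zero_closed[OF is_additive_subgroup]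
          a_closed[simplified] I_l_closed[simplified] in \<open>auto\<close>)
  qed
qed

subsection \<open>Homogeneous parts\<close>

text \<open>The component of degree \<open>x\<close> in the twist by \<open>z\<close>. The twist is
  an element of the free group, so multiplication by \<open>X i\<close> changes it by a
  generator.\<close>

definition pt where "pt z x f = pfilter (\<lambda>m. cls (fd m + z) = x) f"
definition hm where "hm z x f \<longleftrightarrow> f \<in> PC \<and> (\<forall>m\<in>ks f. cls (fd m + z) = x)"

lemma pt_hm: "f \<in> PC \<Longrightarrow> hm z x (pt z x f)"
  by (auto simp: hm_def pt_def keys_pfilter)

lemma hm_pt: "hm z x f \<Longrightarrow> pt z x f = f"
  by (auto simp: hm_def pt_def intro!: pfilter_id)

lemma cls_shift: "\<lbrakk>kS a; kS w; kS w'; kS z; cls w = cls w'\<rbrakk> \<Longrightarrow> cls (a + w + z) = cls (a + (z + w'))"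
proof -
  assume "kS a" "kS w" "kS w'" "kS z" "cls w = cls w'"
  then have "cls (a + z) \<otimes>\<^bsub>L\<^esub> cls w = cls (a + z) \<otimes>\<^bsub>L\<^esub> cls w'" by simp
  then show ?thesis using \<open>kS a\<close> \<open>kS w\<close> \<open>kS w'\<close> \<open>kS z\<close> by (simp add: cls_mult ac_simps)
qed

lemma pt_mult:
  assumes a: "a \<in> PC" and h: "h \<in> PC" and kz: "kS z" and w: "kS w" "\<And>m. m \<in> ks h \<Longrightarrow> cls (fd m) = cls w"
  shows "pt z x (a * h) = pt (z + w) x a * h"
  unfolding pt_def
proof (rule pfilter_mult)
  fix m m' assume m: "m \<in> ks a" "m' \<in> ks h"
  have k: "kS (fd m)" "kS (fd m')" using m a h kS_fd unfolding PC_def by blast+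
  show "cls (fd (m + m') + z) = x \<longleftrightarrow> cls (fd m + (z + w)) = x"
    using cls_shift[OF k(1,2) w(1) kz w(2)[OF m(2)]] by (simp add: fd_add)
qed

lemma fd_X: "fd (Poly_Mapping.single (VarX i) k) = frag_cmul (int k) (frag_of (GenX i))"
  by (simp add: fd_single)

lemma cls_pX: "i \<in> {1..n} \<Longrightarrow> cls (frag_cmul (int (p i)) (frag_of (GenX i))) = cls (frag_of GenC)"
proof -
  assume i: "i \<in> {1..n}"
  have "rel i \<in> K" unfolding K_eq using i by (intro generate.incl) auto
  then show ?thesis using i by (simp add: cls_eq_K rel_def)
qed

lemma g_deg: "\<lbrakk>i \<in> {1..n}; m \<in> ks (g i)\<rbrakk> \<Longrightarrow> cls (fd m) = cls (frag_of GenC)"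
proof -
  assume i: "i \<in> {1..n}" and m: "m \<in> ks (g i)"
  then have "m \<in> ks (X i ^ p i) \<or> m \<in> ks (l i)" unfolding g_def using keys_diff[of "X i ^ p i" "l i"]
    by (auto simp: in_keys_iff lookup_minus)
  then show ?thesis
  proof
    assume "m \<in> ks (X i ^ p i)"
    then have "m = Poly_Mapping.single (VarX i) (p i)" by (simp add: X_pow)
    then show ?thesis using cls_pX[OF i] by (simp add: fd_X)
  next
    assume "m \<in> ks (l i)"
    then obtain j where "m = Poly_Mapping.single (VarT j) 1" using l_keys[OF i] by blast
    then show ?thesis by (simp add: fd_single)
  qed
qed

lemma X_deg: "m \<in> ks (X i ^ k) \<Longrightarrow> fd m = frag_cmul (int k) (frag_of (GenX i))"
  by (simp add: X_pow fd_X)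

lemma pt_X: "\<lbrakk>a \<in> PC; i \<in> {1..n}; kS z\<rbrakk> \<Longrightarrow> pt z x (X i ^ k * a) = X i ^ k * pt (z + frag_cmul (int k) (frag_of (GenX i))) x a"
  using pt_mult[of a "X i ^ k" z "frag_cmul (int k) (frag_of (GenX i))" x] X_deg[of _ i k] by (simp add: mult.commute)

lemma pt_X1: "\<lbrakk>a \<in> PC; i \<in> {1..n}; kS z\<rbrakk> \<Longrightarrow> pt z x (X i * a) = X i * pt (z + frag_of (GenX i)) x a"
  using pt_X[of a i z x 1] by simp

lemma pt_diff: "pt z x (f - f') = pt z x f - pt z x (f' :: 'k gl_poly)" by (simp add: pt_def pfilter_diff)
lemma pt_add: "pt z x (f + f') = pt z x f + pt z x (f' :: 'k gl_poly)" by (simp add: pt_def pfilter_add)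

lemma pt_zero: "pt z x (0 :: 'k gl_poly) = 0" by (simp add: pt_def pfilter_zero)

lemma pt_PC [simp]: "f \<in> PC \<Longrightarrow> pt z x f \<in> PC" by (simp add: pt_def)

text \<open>The generators of \<open>J i\<close> are homogeneous, \<open>g k\<close> of degree
  \<open>c\<close> because \<open>p k x k = c\<close>, and taking components commutes with
  multiplication by a homogeneous element up to a shift of the twist.\<close>

lemma pt_J: "\<lbrakk>f \<in> J i; i \<le> n; kS z\<rbrakk> \<Longrightarrow> pt z x f \<in> J i"
proof -
  assume f: "f \<in> J i" and i: "i \<le> n" and z: "kS z"
  have "f \<in> {f. pt z x f \<in> J i}"
  proof (rule J_minimal[OF f i])
    fix a k assume a: "a \<in> PC" and k: "k \<in> {1..n}"
    have "pt z x (a * g k) = pt (z + frag_of GenC) x a * g k"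
      by (rule pt_mult) (use a k z g_deg in auto)
    then show "a * g k \<in> {f. pt z x f \<in> J i}" using a k by simp
  next
    fix a k assume a: "a \<in> PC" and k: "k \<in> {1..i}"
    then have "pt z x (a * X k) = X k * pt (z + frag_of (GenX k)) x a"
        using pt_X1[of a k z x] i z by (simp add: mult.commute)
    then show "a * X k \<in> {f. pt z x f \<in> J i}" using a k i by simp
  qed (auto simp: pt_add pt_zero)
  then show ?thesis by simp
qed

end

subsection \<open>Normal forms modulo the defining relations\<close>

text \<open>Constant polynomials act as scalars; this turns polynomials into a vector space, where
  independent and spanning sets can be compared in size.\<close>

definition kscale :: "'k::field \<Rightarrow> ('a::monoid_add \<Rightarrow>\<^sub>0 'k) \<Rightarrow> ('a \<Rightarrow>\<^sub>0 'k)" where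
  "kscale a f = Poly_Mapping.single 0 a * f"

interpretation kvs: vector_space "kscale :: 'k::field \<Rightarrow> ('a::comm_monoid_add \<Rightarrow>\<^sub>0 'k) \<Rightarrow> _"
  by unfold_locales (auto simp: kscale_def distrib_left distrib_right single_add mult_single mult.assoc[symmetric])

lemma single_sum: "Poly_Mapping.single k (sum f A) = (\<Sum>i\<in>A. Poly_Mapping.single k (f i))"
  by (induction A rule: infinite_finite_induct) (auto simp: single_add)

text \<open>With at least \<open>e = d + 1\<close> linear forms, \<open>l 1, ..., l e\<close> form a
  basis of the linear polynomials in the \<open>T j\<close>, and the \<open>T j\<close> can be
  eliminated from \<open>R\<close>.\<close>

locale gl_ci2 = gl_ci d n l p for d n and l :: "nat \<Rightarrow> 'k::field gl_poly" and p +
  assumes en: "e \<le> n"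
begin

lemma l_expand: "k \<in> {1..n} \<Longrightarrow> l k = (\<Sum>j<e. cst (lk (l k) (Poly_Mapping.single (VarT j) 1)) * T j)"
proof -
  assume k: "k \<in> {1..n}"
  have "l k = (\<Sum>m\<in>ks (l k). Poly_Mapping.single m (lk (l k) m))" by (rule poly_mapping_sum_single)
  also have "\<dots> = (\<Sum>m\<in>(\<lambda>j. Poly_Mapping.single (VarT j) 1) ` {..<e}. Poly_Mapping.single m (lk (l k) m))"
    using l_keys[OF k] by (intro sum.mono_neutral_left) (auto simp: in_keys_iff)
  also have "\<dots> = (\<Sum>j<e. Poly_Mapping.single (Poly_Mapping.single (VarT j) 1) (lk (l k) (Poly_Mapping.single (VarT j) 1)))"
    by (subst sum.reindex) (auto simp: inj_on_def dest!: injD[OF inj_single] poly_mapping_eq_iff[THEN iffD1]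
        fun_cong simp: lookup_single when_def split: if_splits)
  finally show ?thesis by (simp add: gl_monom_var_def mult_single)
qed

lemma l_inj: "inj_on l {1..e}"
proof (rule inj_onI, rule ccontr)
  fix i j assume ij: "i \<in> {1..e}" "j \<in> {1..e}" "l i = l j" "i \<noteq> j"
  \<comment> \<open>Two different indices up to \<open>e\<close> force \<open>e >= 2\<close>, so
    general position applies to the pair, with coefficients 1 and -1.\<close>
  have "card {i, j} \<le> card {1..e}" using ij by (intro card_mono) auto
  then have c: "int (card {i, j}) \<le> d + 1" using e_int by simp
  have "\<forall>k\<in>{i, j}. (if k = i then 1 else - 1 :: 'k) = 0"
  proof (rule general_position[OF _ c])
    show "{i, j} \<subseteq> {1..n}" using ij en by auto
    show "(\<Sum>k\<in>{i, j}. cst (if k = i then 1 else - 1) * l k) = 0"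
      using ij by (simp add: single_uminus)
  qed
  then show False by simp
qed

text \<open>General position makes \<open>l 1, ..., l e\<close> independent. They lie in the span of
  \<open>e\<close> variables, so by dimension they span it.\<close>

lemma T_comb: "j < e \<Longrightarrow> \<exists>c. T j = (\<Sum>k\<in>{1..e}. cst (c k) * l k)"
proof -
  assume j: "j < e"
  let ?S = "l ` {1..e}"
  have ind: "kvs.independent ?S"
  proof
    assume "kvs.dependent ?S"
    then obtain u where u: "\<exists>v\<in>?S. u v \<noteq> 0" "(\<Sum>v\<in>?S. kscale (u v) v) = 0"
      using kvs.dependent_finite[of ?S] by auto
    have "(\<Sum>k\<in>{1..e}. cst (u (l k)) * l k) = 0"
      using u(2) sum.reindex[OF l_inj, of "\<lambda>v. kscale (u v) v"] by (simp add: kscale_def)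
    then have "\<forall>k\<in>{1..e}. u (l k) = 0"
      using en e_int by (intro general_position) auto
    then show False using u(1) by auto
  qed
  have sub: "?S \<subseteq> kvs.span (T ` {..<e})"
  proof
    fix v assume "v \<in> ?S"
    then obtain k where "k \<in> {1..e}" "v = l k" by auto
    then have "v = (\<Sum>j<e. kscale (lk (l k) (Poly_Mapping.single (VarT j) 1)) (T j))"
      using l_expand[of k] en by (simp add: kscale_def)
    moreover have "(\<Sum>j<e. kscale (lk (l k) (Poly_Mapping.single (VarT j) 1)) (T j)) \<in> kvs.span (T ` {..<e})"
      by (rule kvs.span_sum, rule kvs.span_scale, rule kvs.span_base) auto
    ultimately show "v \<in> kvs.span (T ` {..<e})" by simp
  qed
  have "T j \<in> kvs.span ?S"
  proof (rule ccontr)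
    assume n: "T j \<notin> kvs.span ?S"
    then have "kvs.independent (insert (T j) ?S)" using ind by (rule kvs.independent_insertI)
    moreover have "insert (T j) ?S \<subseteq> kvs.span (T ` {..<e})" using sub j by (auto intro!: kvs.span_base)
    ultimately have "card (insert (T j) ?S) \<le> card (T ` {..<e})"
      using kvs.independent_span_bound[of "T ` {..<e}"] by blast
    also have "\<dots> \<le> e" using card_image_le[of "{..<e}" T] by simp
    finally have "card (insert (T j) ?S) \<le> e" .
    moreover have "T j \<notin> ?S" using n kvs.span_base by blast
    moreover have "card ?S = e" using card_image[OF l_inj] by simp
    ultimately show False by simp
  qed
  then obtain u where "T j = (\<Sum>v\<in>?S. kscale (u v) v)" using kvs.span_finite[of ?S] by auto
  then have "T j = (\<Sum>k\<in>{1..e}. cst (u (l k)) * l k)"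
    using sum.reindex[OF l_inj, of "\<lambda>v. kscale (u v) v"] by (simp add: kscale_def)
  then show ?thesis by (intro exI[of _ "\<lambda>k. u (l k)"])
qed

definition tc where "tc j = (SOME c. T j = (\<Sum>k\<in>{1..e}. cst (c k) * l k))"
lemma tc: "j < e \<Longrightarrow> T j = (\<Sum>k\<in>{1..e}. cst (tc j k) * l k)"
  unfolding tc_def using someI_ex[OF T_comb] by blast

definition \<theta> where "\<theta> j = (\<Sum>k\<in>{1..e}. cst (tc j k) * X k ^ p k)"
definition \<gamma> where "\<gamma> k = (\<Sum>j<e. cst (lk (l k) (Poly_Mapping.single (VarT j) 1)) * \<theta> j)"

lemma X_PC' [simp]: "k \<in> {1..e} \<Longrightarrow> X k \<in> PC" using en by (intro PC_X) auto
text \<open>Writing \<open>l k\<close> in the \<open>T j\<close> and these back in the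
  \<open>l i\<close> returns \<open>l k\<close>, so by independence the composed coefficients are
  those of the identity matrix. Applied to the powers of the \<open>X i\<close>, they leave only the
  \<open>k\<close>-th.\<close>

lemma \<gamma>_X: "k \<in> {1..e} \<Longrightarrow> \<gamma> k = X k ^ p k"
proof -
  assume k: "k \<in> {1..e}"
  define a where "a k j = lk (l k) (Poly_Mapping.single (VarT j) 1)" for k j
  have l: "l k = (\<Sum>j<e. cst (a k j) * T j)" if "k \<in> {1..n}" for k using l_expand[OF that] by (simp add: a_def)
  have "l k = (\<Sum>j<e. cst (a k j) * (\<Sum>i\<in>{1..e}. cst (tc j i) * l i))"
    using k en by (subst l) (auto intro!: sum.cong simp flip: tc)
  also have "\<dots> = (\<Sum>i\<in>{1..e}. cst (\<Sum>j<e. a k j * tc j i) * l i)"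
    unfolding sum_distrib_left by (subst sum.swap) (auto intro!: sum.cong simp: sum_distrib_right single_sum
        mult_single mult.assoc[symmetric])
  finally have eq: "l k = (\<Sum>i\<in>{1..e}. cst (\<Sum>j<e. a k j * tc j i) * l i)" .
  let ?u = "\<lambda>i. (\<Sum>j<e. a k j * tc j i) - (if i = k then 1 else 0)"
  have "(\<Sum>i\<in>{1..e}. cst (?u i) * l i) = (\<Sum>i\<in>{1..e}. cst (\<Sum>j<e. a k j * tc j i) * l i) - (\<Sum>i\<in>{1..e}. cst (if i =
      k then 1 else 0) * l i)"
    by (simp add: single_diff left_diff_distrib sum_subtractf)
  also have "(\<Sum>i\<in>{1..e}. cst (if i = k then 1 else 0) * l i) = (\<Sum>i\<in>{1..e}. if i = k then l k else 0)"
    by (intro sum.cong) auto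
  also have "\<dots> = l k" using k by simp
  finally have "(\<Sum>i\<in>{1..e}. cst (?u i) * l i) = 0" using eq by simp
  then have u: "\<forall>i\<in>{1..e}. ?u i = 0" using en e_int by (intro general_position) auto
  have "\<gamma> k = (\<Sum>j<e. cst (a k j) * (\<Sum>i\<in>{1..e}. cst (tc j i) * X i ^ p i))"
    by (simp add: \<gamma>_def \<theta>_def a_def)
  also have "\<dots> = (\<Sum>i\<in>{1..e}. cst (\<Sum>j<e. a k j * tc j i) * X i ^ p i)"
    unfolding sum_distrib_left by (subst sum.swap) (auto intro!: sum.cong simp: sum_distrib_right single_sum
        mult_single mult.assoc[symmetric])
  also have "\<dots> = (\<Sum>i\<in>{1..e}. if i = k then X k ^ p k else 0)"
    using u by (intro sum.cong) auto
  also have "\<dots> = X k ^ p k" using k by simp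
  finally show ?thesis .
qed

text \<open>
  \<open>R\<close> is free over the polynomial ring in \<open>X\<^sub>1, \<dots>, X\<^sub>e\<close>, with basis the monomials in the
  remaining \<open>X\<^sub>k\<close> with exponents below \<open>p\<^sub>k\<close>. The normal form replaces \<open>T\<^sub>j\<close> by the combination
  \<open>\<theta> j\<close> of the \<open>X\<^sub>k\<close> to the power \<open>p\<^sub>k\<close>, \<open>k \<le> e\<close>, and, for \<open>k > e\<close>, \<open>X\<^sub>k\<close> to the power \<open>p\<^sub>k\<close> by \<open>\<gamma> k\<close>.
\<close>

primrec \<psi> :: "gl_var \<Rightarrow> nat \<Rightarrow> 'k gl_poly" where
  "\<psi> (VarT j) a = \<theta> j ^ a"
| "\<psi> (VarX k) a = (if k \<le> e then X k ^ a else \<gamma> k ^ (a div p k) * X k ^ (a mod p k))"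

abbreviation V where "V \<equiv> gl_vars d n"

definition nm :: "(gl_var \<Rightarrow>\<^sub>0 nat) \<Rightarrow> 'k gl_poly" where "nm m = (\<Prod>v\<in>V. \<psi> v (lk m v))"

definition NF :: "'k gl_poly \<Rightarrow> 'k gl_poly" where "NF f = (\<Sum>m\<in>ks f. cst (lk f m) * nm m)"

lemma NF_superset: "\<lbrakk>finite A; ks f \<subseteq> A\<rbrakk> \<Longrightarrow> NF f = (\<Sum>m\<in>A. cst (lk f m) * nm m)"
  unfolding NF_def by (rule sum.mono_neutral_left) (auto simp: in_keys_iff)

lemma NF_add: "NF (f + f') = NF f + NF f'"
proof -
  let ?A = "ks f \<union> ks f'"
  have "NF (f + f') = (\<Sum>m\<in>?A. cst (lk (f + f') m) * nm m)"
    using Poly_Mapping.keys_add[of f f'] by (intro NF_superset) auto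
  then show ?thesis using NF_superset[of ?A f] NF_superset[of ?A f']
    by (simp add: lookup_add single_add distrib_right sum.distrib)
qed

lemma NF_zero [simp]: "NF 0 = 0" by (simp add: NF_def)

lemma NF_neg: "NF (- f) = - NF f"
  using NF_add[of f "- f"] by (simp add: eq_neg_iff_add_eq_0 add.commute)

lemma NF_diff: "NF (f - f') = NF f - NF f'" using NF_add[of f "- f'"] by (simp add: NF_neg)

lemma NF_sum: "NF (sum f A) = (\<Sum>i\<in>A. NF (f i))"
  by (induction A rule: infinite_finite_induct) (auto simp: NF_add)

lemma NF_single: "NF (Poly_Mapping.single m a) = cst a * nm m"
  by (cases "a = 0") (auto simp: NF_def)

lemma nm_shift:
  assumes v: "v \<in> V" and c: "\<And>b. \<psi> v (a + b) = \<phi> * \<psi> v b"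
  shows "nm (Poly_Mapping.single v a + m) = \<phi> * nm m"
proof -
  have "nm (Poly_Mapping.single v a + m) = \<psi> v (a + lk m v) * (\<Prod>w\<in>V - {v}. \<psi> w (lk (Poly_Mapping.single v a + m) w))"
    unfolding nm_def using v fin_vars by (subst prod.remove[of _ v]) (auto simp: lookup_add)
  also have "(\<Prod>w\<in>V - {v}. \<psi> w (lk (Poly_Mapping.single v a + m) w)) = (\<Prod>w\<in>V - {v}. \<psi> w (lk m w))"
    by (intro prod.cong) (auto simp: lookup_add lookup_single when_def)
  also have "\<psi> v (a + lk m v) * \<dots> = \<phi> * (\<psi> v (lk m v) * (\<Prod>w\<in>V - {v}. \<psi> w (lk m w)))" by (simp add: c mult.assoc)
  also have "\<psi> v (lk m v) * (\<Prod>w\<in>V - {v}. \<psi> w (lk m w)) = nm m"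
    unfolding nm_def using v fin_vars by (subst (2) prod.remove[of _ v]) auto
  finally show ?thesis .
qed

text \<open>\<open>NF\<close> is not multiplicative, since exponents of \<open>X k\<close> with
  \<open>k > e\<close> are reduced. It respects multiplication by \<open>T j\<close>, by
  \<open>X k\<close> with \<open>k <= e\<close> and by \<open>X k ^ p k\<close>, which suffices to
  kill all multiples of the \<open>g k\<close>.\<close>

lemma NF_mult_mono:
  assumes "\<And>m. nm (t + m) = \<phi> * nm m"
  shows "NF (Poly_Mapping.single t c * f) = cst c * \<phi> * NF f"
proof -
  have "Poly_Mapping.single t c * f = (\<Sum>m\<in>ks f. Poly_Mapping.single (t + m) (c * lk f m))"
    using poly_mapping_sum_single[of f] by (metis (no_types, lifting) mult_single sum.cong sum_distrib_left)
  then have "NF (Poly_Mapping.single t c * f) = (\<Sum>m\<in>ks f. cst (c * lk f m) * (\<phi> * nm m))"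
    by (simp add: NF_sum NF_single assms)
  also have "\<dots> = (\<Sum>m\<in>ks f. cst c * \<phi> * (cst (lk f m) * nm m))"
    by (intro sum.cong) (auto simp: mult_single[of 0 c 0, simplified, symmetric] ac_simps)
  finally show ?thesis by (simp add: NF_def sum_distrib_left)
qed

lemma NF_T: "j < e \<Longrightarrow> NF (cst c * T j * f) = cst c * \<theta> j * NF f"
proof -
  assume j: "j < e"
  have "nm (Poly_Mapping.single (VarT j) 1 + m) = \<theta> j * nm m" for m
    by (rule nm_shift) (use j VarT_iff in \<open>auto simp: plus_1_eq_Suc\<close>)
  from NF_mult_mono[OF this, of c f] show ?thesis by (simp add: gl_monom_var_def mult_single)
qed

lemma NF_X: "k \<in> {1..e} \<Longrightarrow> NF (X k * f) = X k * NF f"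
proof -
  assume k: "k \<in> {1..e}"
  have "nm (Poly_Mapping.single (VarX k) 1 + m) = X k * nm m" for m
    by (rule nm_shift) (use k VarX_iff en in \<open>auto simp: plus_1_eq_Suc\<close>)
  from NF_mult_mono[OF this, of 1 f] show ?thesis by (simp add: gl_monom_var_def)
qed

lemma NF_Xp: "k \<in> {1..n} \<Longrightarrow> NF (X k ^ p k * f) = \<gamma> k * NF f"
proof -
  assume k: "k \<in> {1..n}"
  have pk: "p k > 0" using p2'[OF k] by simp
  have "\<psi> (VarX k) (p k + b) = \<gamma> k * \<psi> (VarX k) b" for b
  proof (cases "k \<le> e")
    case True
    then show ?thesis using \<gamma>_X[of k] k by (simp add: power_add)
  next
    case False
    then show ?thesis using pk by (simp add: power_add mult.assoc mult.left_commute)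
  qed
  from NF_mult_mono[OF nm_shift[OF _ this], of 1 f] show ?thesis using VarX_iff k by (simp add: X_pow)
qed

lemma NF_l: "k \<in> {1..n} \<Longrightarrow> NF (l k * f) = \<gamma> k * NF f"
proof -
  assume k: "k \<in> {1..n}"
  have "l k * f = (\<Sum>j<e. cst (lk (l k) (Poly_Mapping.single (VarT j) 1)) * T j * f)"
    by (subst l_expand[OF k]) (simp add: sum_distrib_right)
  then show ?thesis by (simp add: NF_sum NF_T \<gamma>_def sum_distrib_right)
qed

lemma NF_g: "k \<in> {1..n} \<Longrightarrow> NF (g k * f) = 0"
  by (simp add: g_def left_diff_distrib NF_diff NF_Xp NF_l)

section \<open>Congruence modulo the relations and the regular sequence\<close>

definition cg where "cg f f' \<longleftrightarrow> f \<in> PC \<and> f' \<in> PC \<and> f - f' \<in> J 0"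

lemma cg_refl: "f \<in> PC \<Longrightarrow> cg f f" by (simp add: cg_def)
lemma cg_sym: "cg f f' \<Longrightarrow> cg f' f" using J_neg[of "f - f'" 0] by (simp add: cg_def)
lemma cg_trans: "cg f f' \<Longrightarrow> cg f' f'' \<Longrightarrow> cg f f''"
  using J_add[of "f - f'" 0 "f' - f''"] by (simp add: cg_def)
lemma cg_add: "\<lbrakk>cg a b; cg a' b'\<rbrakk> \<Longrightarrow> cg (a + a') (b + b')"
  using J_add[of "a - b" 0 "a' - b'"] by (simp add: cg_def algebra_simps)
lemma cg_mult: "\<lbrakk>cg a b; cg a' b'\<rbrakk> \<Longrightarrow> cg (a * a') (b * b')"
proof -
  assume "cg a b" "cg a' b'"
  then have "(a - b) * a' + b * (a' - b') \<in> J 0" by (intro J_add J_mult J_mult_r) (auto simp: cg_def)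
  then show ?thesis using \<open>cg a b\<close> \<open>cg a' b'\<close> by (simp add: cg_def algebra_simps)
qed
lemma cg_pow: "cg a b \<Longrightarrow> cg (a ^ k) (b ^ k)"
  by (induction k) (auto intro: cg_mult cg_refl)
lemma cg_sum: "(\<And>i. i \<in> A \<Longrightarrow> cg (f i) (h i)) \<Longrightarrow> cg (sum f A) (sum h A)"
  by (induction A rule: infinite_finite_induct) (auto intro: cg_add cg_refl)
lemma cg_prod: "(\<And>i. i \<in> A \<Longrightarrow> cg (f i) (h i)) \<Longrightarrow> cg (prod f A) (prod h A)"
  by (induction A rule: infinite_finite_induct) (auto intro: cg_mult cg_refl)

lemma cg_l: "k \<in> {1..n} \<Longrightarrow> cg (l k) (X k ^ p k)"
  by (rule cg_sym) (simp add: cg_def g_def[symmetric])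

lemma cg_T: "j < e \<Longrightarrow> cg (T j) (\<theta> j)"
proof -
  assume j: "j < e"
  show ?thesis unfolding tc[OF j] \<theta>_def using en by (intro cg_sum cg_mult cg_refl cg_l) auto
qed

lemma cg_\<gamma>: "k \<in> {1..n} \<Longrightarrow> cg (X k ^ p k) (\<gamma> k)"
proof -
  assume k: "k \<in> {1..n}"
  have "cg (l k) (\<gamma> k)" unfolding \<gamma>_def by (subst l_expand[OF k]) (intro cg_sum cg_mult cg_refl cg_T, auto)
  then show ?thesis using cg_l[OF k] cg_sym cg_trans by blast
qed

lemma cg_\<psi>: "v \<in> V \<Longrightarrow> cg (gl_monom_var v ^ a) (\<psi> v a)"
proof (cases v)
  case (VarT j)
  assume "v \<in> V"
  then show ?thesis using VarT VarT_iff cg_T cg_pow by simp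
next
  case (VarX k)
  assume "v \<in> V"
  then have k: "k \<in> {1..n}" using VarX VarX_iff by simp
  show ?thesis
  proof (cases "k \<le> e")
    case True
    then show ?thesis using VarX k by (simp add: cg_refl)
  next
    case False
    have "X k ^ a = (X k ^ p k) ^ (a div p k) * X k ^ (a mod p k)" by (metis mult_div_mod_eq power_add power_mult)
    moreover have "cg ((X k ^ p k) ^ (a div p k) * X k ^ (a mod p k)) (\<gamma> k ^ (a div p k) * X k ^ (a mod p k))"
      using k by (intro cg_mult cg_pow cg_\<gamma> cg_refl) auto
    ultimately show ?thesis using False VarX by simp
  qed
qed

lemma monom_prod: "kV m \<Longrightarrow> Poly_Mapping.single m 1 = (\<Prod>v\<in>V. gl_monom_var v ^ lk m v :: 'k gl_poly)"
proof -
  assume m: "kV m"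
  have pw: "(gl_monom_var v :: 'k gl_poly) ^ a = Poly_Mapping.single (Poly_Mapping.single v a) 1" for v a
    by (induction a) (auto simp: gl_monom_var_def mult_single plus_1_eq_Suc simp flip: single_add)
  have "(\<Prod>v\<in>A. Poly_Mapping.single (Poly_Mapping.single v (lk m v)) (1 :: 'k)) =
      Poly_Mapping.single (\<Sum>v\<in>A. Poly_Mapping.single v (lk m v)) 1" if "finite A" for A
    using that by (induction A rule: finite_induct) (auto simp: mult_single)
  moreover have "(\<Sum>v\<in>V. Poly_Mapping.single v (lk m v)) = m"
    using fin_vars m by (intro poly_mapping_eqI) (auto simp: lookup_sum lookup_single when_def in_keys_iff subset_iff)
  ultimately show ?thesis using fin_vars by (simp add: pw)
qed

lemma cg_nm: "kV m \<Longrightarrow> cg (Poly_Mapping.single m 1) (nm m)"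
  unfolding monom_prod nm_def by (intro cg_prod cg_\<psi>)

text \<open>Each variable power is congruent to what replaces it, so \<open>f\<close> and
  \<open>NF f\<close> agree in \<open>R\<close>. Together with \<open>NF_g\<close> this makes the
  relations the exact kernel of \<open>NF\<close> on the polynomial ring.\<close>

lemma cg_NF: "f \<in> PC \<Longrightarrow> cg f (NF f)"
proof -
  assume f: "f \<in> PC"
  have "f = (\<Sum>m\<in>ks f. cst (lk f m) * Poly_Mapping.single m 1)"
    using poly_mapping_sum_single[of f] by (simp add: mult_single)
  moreover have "cg (\<Sum>m\<in>ks f. cst (lk f m) * Poly_Mapping.single m 1) (NF f)"
    unfolding NF_def by (rule cg_sum) (intro cg_mult cg_refl cg_nm, use f in \<open>auto simp: PC_def\<close>)
  ultimately show ?thesis by simp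
qed

definition hasX :: "nat \<Rightarrow> (gl_var \<Rightarrow>\<^sub>0 nat) \<Rightarrow> bool" where "hasX i m \<longleftrightarrow> (\<exists>k\<in>{1..i}. lk m (VarX k) \<noteq> 0)"

lemma X_mult_keys: "m \<in> ks (X k ^ a * f) \<longleftrightarrow> (\<exists>m'\<in>ks f. m = Poly_Mapping.single (VarX k) a + m')"
  using keys_single_mult[of "Poly_Mapping.single (VarX k) a" f] by (auto simp: X_pow)

lemma X_mult_keys1: "m \<in> ks (X k * f) \<longleftrightarrow> (\<exists>m'\<in>ks f. m = Poly_Mapping.single (VarX k) 1 + m')"
  using X_mult_keys[of m k 1 f] by simp

lemma hasX_shift: "k \<in> {1..i} \<Longrightarrow> hasX i (Poly_Mapping.single (VarX k) 1 + m)"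
  unfolding hasX_def by (rule bexI[of _ k]) (simp_all add: lookup_add plus_1_eq_Suc)

lemma hasX_J: "\<lbrakk>h \<in> PC; \<And>m. m \<in> ks h \<Longrightarrow> hasX i m; i \<le> n\<rbrakk> \<Longrightarrow> h \<in> J i"
proof -
  assume h: "h \<in> PC" "\<And>m. m \<in> ks h \<Longrightarrow> hasX i m" and i: "i \<le> n"
  have "Poly_Mapping.single m (lk h m) \<in> J i" if m: "m \<in> ks h" for m
  proof -
    obtain k where k: "k \<in> {1..i}" "lk m (VarX k) \<noteq> 0" using h(2)[OF m] by (auto simp: hasX_def)
    let ?s = "Poly_Mapping.single (VarX k) (1 :: nat)"
    have e: "?s + (m - ?s) = m"
      using k(2) by (intro poly_mapping_eqI) (auto simp: lookup_add lookup_minus lookup_single when_def)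
    have "kV (m - ?s)"
    proof
      fix v assume "v \<in> ks (m - ?s)"
      then have "v \<in> ks m" by (auto simp: in_keys_iff lookup_minus)
      then show "v \<in> V" using h(1) m by (auto simp: PC_def)
    qed
    then have "X k * Poly_Mapping.single (m - ?s) (lk h m) \<in> J i" using k(1) i by (intro J_mult_r) auto
    moreover have "X k * Poly_Mapping.single (m - ?s) (lk h m) = Poly_Mapping.single m (lk h m)"
      unfolding gl_monom_var_def mult_single e by simp
    ultimately show ?thesis by simp
  qed
  then show ?thesis using poly_mapping_sum_single[of h] J_sum[of "ks h" "\<lambda>m. Poly_Mapping.single m (lk h m)" i] by simp
qed

text \<open>\<open>NF\<close> commutes with \<open>X k\<close> for \<open>k <= e\<close>, so it
  carries \<open>J i\<close> into the monomial ideal of the first \<open>i\<close> variables;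
  conversely \<open>f\<close> differs from \<open>NF f\<close> by relations. For
  \<open>i = 0\<close> this says that \<open>NF\<close> detects zero in \<open>R\<close>.\<close>

lemma J_NF: "\<lbrakk>f \<in> PC; i \<le> e\<rbrakk> \<Longrightarrow> f \<in> J i \<longleftrightarrow> (\<forall>m\<in>ks (NF f). hasX i m)"
proof
  assume f: "f \<in> PC" and i: "i \<le> e"
  have i': "i \<le> n" using i en by simp
  { assume fJ: "f \<in> J i"
    have "f \<in> {f. \<forall>m\<in>ks (NF f). hasX i m}"
    proof (rule J_minimal[OF fJ i'])
      fix u v assume "u \<in> {f. \<forall>m\<in>ks (NF f). hasX i m}" "v \<in> {f. \<forall>m\<in>ks (NF f). hasX i m}"
      then show "u + v \<in> {f. \<forall>m\<in>ks (NF f). hasX i m}"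
        using Poly_Mapping.keys_add[of "NF u" "NF v"] by (auto simp: NF_add)
    next
      fix a k assume "a \<in> PC" "k \<in> {1..n}"
      then show "a * g k \<in> {f. \<forall>m\<in>ks (NF f). hasX i m}" using NF_g[of k a] by (simp add: mult.commute)
    next
      fix a k assume a: "a \<in> PC" and k: "k \<in> {1..i}"
      then have "NF (a * X k) = X k * NF a" using NF_X[of k a] i by (simp add: mult.commute)
      then show "a * X k \<in> {f. \<forall>m\<in>ks (NF f). hasX i m}"
        using hasX_shift[OF k] by (auto simp: X_mult_keys1)
    qed simp
    then show "\<forall>m\<in>ks (NF f). hasX i m" by simp }
  assume h: "\<forall>m\<in>ks (NF f). hasX i m"
  have "cg f (NF f)" by (rule cg_NF[OF f])
  then have "NF f \<in> J i" "f - NF f \<in> J i" using h hasX_J i' J_mono[of 0 i] by (auto simp: cg_def)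
  then have "(f - NF f) + NF f \<in> J i" by (intro J_add)
  then show "f \<in> J i" by simp
qed

text \<open>On normal forms the multiplication raises the exponent of a variable outside the first
  \<open>i\<close>, which does not affect divisibility by one of those.\<close>

lemma X_regular: "\<lbrakk>Suc i \<le> e; f \<in> PC; X (Suc i) * f \<in> J i\<rbrakk> \<Longrightarrow> f \<in> J i"
proof -
  assume i: "Suc i \<le> e" and f: "f \<in> PC" and X: "X (Suc i) * f \<in> J i"
  have Xp: "X (Suc i) * f \<in> PC" using f i by simp
  have "\<forall>m\<in>ks (NF (X (Suc i) * f)). hasX i m" using J_NF[OF Xp] X i by simp
  then have "\<forall>m\<in>ks (X (Suc i) * NF f). hasX i m" using NF_X[of "Suc i" f] i by simp
  then have h: "hasX i (Poly_Mapping.single (VarX (Suc i)) 1 + m)" if "m \<in> ks (NF f)" for m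
    using that X_mult_keys1 by blast
  have "hasX i m" if "m \<in> ks (NF f)" for m
    using h[OF that] by (auto simp: hasX_def lookup_add lookup_single when_def split: if_splits)
  then show ?thesis using J_NF[OF f, of i] i by simp
qed

subsection \<open>The monomial ideals\<close>

text \<open>
  For \<open>i \<ge> e\<close> the linear forms \<open>l\<^sub>1, \<dots>, l\<^sub>e\<close> lie in \<open>J i\<close>, hence all \<open>T\<^sub>j\<close> do, and \<open>J i\<close> is
  the span of the following monomials.
\<close>

definition mon :: "nat \<Rightarrow> (gl_var \<Rightarrow>\<^sub>0 nat) \<Rightarrow> bool" where
  "mon i m \<longleftrightarrow> (\<exists>j<e. lk m (VarT j) \<noteq> 0) \<or> hasX i m \<or> (\<exists>k\<in>{1..n}. lk m (VarX k) \<ge> p k)"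

lemma mon_up: "mon i m' \<Longrightarrow> mon i (m + m')"
  unfolding mon_def hasX_def lookup_add by (meson add_is_0 trans_le_add2)

lemma l_J: "\<lbrakk>k \<in> {1..n}; e \<le> i; i \<le> n\<rbrakk> \<Longrightarrow> l k \<in> J i \<and> (\<forall>j<e. T j \<in> J i)"
proof -
  assume k: "k \<in> {1..n}" and i: "e \<le> i" "i \<le> n"
  have lJ: "l j \<in> J i" if j: "j \<in> {1..e}" for j
  proof -
    have "X j \<in> J i" using j i by (intro J_X) auto
    then have "X j ^ (p j - 1) * X j \<in> J i" using j by (intro J_mult) auto
    moreover have "X j ^ (p j - 1) * X j = X j ^ p j" using p2'[of j] j en by (intro power_minus_mult) auto
    ultimately have "X j ^ p j - g j \<in> J i" using j en by (intro J_diff) auto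
    then show ?thesis by (simp add: g_def)
  qed
  have TJ: "T j \<in> J i" if "j < e" for j unfolding tc[OF that] using lJ by (intro J_sum J_mult) auto
  then show ?thesis by (subst l_expand[OF k]) (auto intro!: J_sum J_mult)
qed

lemma J_mon:
  assumes f: "f \<in> PC" and i: "e \<le> i" "i \<le> n"
  shows "f \<in> J i \<longleftrightarrow> (\<forall>m\<in>ks f. mon i m)"
proof
  { assume fJ: "f \<in> J i"
    have "f \<in> {f. \<forall>m\<in>ks f. mon i m}"
    proof (rule J_minimal[OF fJ i(2)])
      fix u v :: "'k gl_poly" assume "u \<in> {f. \<forall>m\<in>ks f. mon i m}" "v \<in> {f. \<forall>m\<in>ks f. mon i m}"
      then show "u + v \<in> {f. \<forall>m\<in>ks f. mon i m}" using Poly_Mapping.keys_add[of u v] by auto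
    next
      fix a k assume a: "a \<in> PC" and k: "k \<in> {1..n}"
      have "mon i m" if "m \<in> ks (g k)" for m
      proof -
        have "m \<in> ks (X k ^ p k) \<or> m \<in> ks (l k)" using that by (auto simp: g_def in_keys_iff lookup_minus)
        then show ?thesis
        proof
          assume "m \<in> ks (X k ^ p k)"
          then have "p k \<le> lk m (VarX k)" by (simp add: X_pow)
          then show ?thesis using k unfolding mon_def by blast
        next
          assume "m \<in> ks (l k)"
          then show ?thesis using l_keys[OF k] by (force simp: mon_def)
        qed
      qed
      then show "a * g k \<in> {f. \<forall>m\<in>ks f. mon i m}" using keys_mult[of a "g k"] mon_up by blast
    next
      fix a k assume a: "a \<in> PC" and k: "k \<in> {1..i}"
      have "mon i m" if "m \<in> ks (X k)" for m using that k by (force simp: gl_monom_var_def mon_def hasX_def)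
      then show "a * X k \<in> {f. \<forall>m\<in>ks f. mon i m}" using keys_mult[of a "X k"] mon_up by blast
    qed simp
    then show "\<forall>m\<in>ks f. mon i m" by simp }
  assume h: "\<forall>m\<in>ks f. mon i m"
  \<comment> \<open>A monomial divisible by a power of a variable that lies in \<open>J i\<close> is
    a multiple of that power.\<close>
  have step: "Poly_Mapping.single m c \<in> J i" if m: "kV m" and v: "gl_monom_var v ^ a \<in> J i" "lk m v \<ge> a" for m v a c
  proof -
    let ?s = "Poly_Mapping.single v a"
    have e: "?s + (m - ?s) = m" using v(2) by (intro poly_mapping_eqI) (auto simp: lookup_add lookup_minus
        lookup_single when_def)
    have "kV (m - ?s)" using m by (auto simp: in_keys_iff lookup_minus subset_iff)
    then have "gl_monom_var v ^ a * Poly_Mapping.single (m - ?s) c \<in> J i" using v(1) by (intro J_mult_r) auto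
    moreover have "(gl_monom_var v :: 'k gl_poly) ^ a = Poly_Mapping.single ?s 1"
      by (induction a) (auto simp: gl_monom_var_def mult_single plus_1_eq_Suc simp flip: single_add)
    ultimately show ?thesis by (simp add: mult_single e)
  qed
  have "Poly_Mapping.single m (lk f m) \<in> J i" if m: "m \<in> ks f" for m
  proof -
    have kV: "kV m" using f m by (auto simp: PC_def)
    consider j where "j < e" "lk m (VarT j) \<noteq> 0" | k where "k \<in> {1..i}" "lk m (VarX k) \<noteq> 0"
      | k where "k \<in> {1..n}" "lk m (VarX k) \<ge> p k" using h m unfolding mon_def hasX_def by blast
    then show ?thesis
    proof cases
      case 1
      \<comment> \<open>\<open>l_J\<close> asks for the index of some linear form; one exists
        because \<open>0 < e\<close> and \<open>e \<le> n\<close>.\<close>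
      then have "n \<ge> 1" using en by simp
      then have "T j \<in> J i" using 1 l_J[of 1 i] i by auto
      then show ?thesis using step[OF kV, of "VarT j" 1] 1 by simp
    next
      case 2
      then show ?thesis using step[OF kV, of "VarX k" 1] J_X[of k i] i by simp
    next
      case 3
      have "g k + l k \<in> J i" using 3 l_J[of k i] i by (intro J_add) auto
      then show ?thesis using step[OF kV, of "VarX k" "p k"] 3 by (simp add: g_def)
    qed
  qed
  then show "f \<in> J i" using poly_mapping_sum_single[of f] J_sum[of "ks f" "\<lambda>m. Poly_Mapping.single m (lk f m)" i] by simp
qed

text \<open>Every variable lies in the ideal, so the quotient is the field; its twists are the
  simple modules.\<close>

lemma J_n: "f \<in> PC \<Longrightarrow> f \<in> J n \<longleftrightarrow> lk f 0 = 0"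
proof -
  assume f: "f \<in> PC"
  have "mon n m \<longleftrightarrow> m \<noteq> 0" if m: "kV m" for m
  proof
    assume "mon n m"
    then show "m \<noteq> 0" using p2' by (force simp: mon_def hasX_def)
  next
    assume "m \<noteq> 0"
    then obtain v where v: "v \<in> ks m" by (metis equals0I keys_eq_empty)
    then have "v \<in> V" using m by auto
    then show "mon n m" using v VarT_iff VarX_iff by (cases v) (auto simp: mon_def hasX_def in_keys_iff)
  qed
  then have "f \<in> J n \<longleftrightarrow> (\<forall>m\<in>ks f. m \<noteq> 0)" using J_mon[OF f en order_refl] f by (auto simp: PC_def)
  then show ?thesis by (auto simp: in_keys_iff)
qed

text \<open>The kernel of \<open>X (Suc i)\<close> modulo \<open>J i\<close>. A monomial outside the
  ideal enters it under this multiplication only by reaching exponent \<open>p (Suc i)\<close>, so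
  it is divisible by the power one below.\<close>

lemma colon_X:
  assumes i: "e \<le> i" "Suc i \<le> n" and f: "f \<in> PC"
  shows "X (Suc i) * f \<in> J i \<longleftrightarrow> (\<exists>s\<in>PC. f - X (Suc i) ^ (p (Suc i) - 1) * s \<in> J i)"
proof
  let ?x = "VarX (Suc i)" and ?q = "p (Suc i)"
  have x: "Suc i \<in> {1..n}" using i by auto
  have q: "?q \<ge> 2" by (rule p2'[OF x])
  { assume "X (Suc i) * f \<in> J i"
    then have mm: "mon i (Poly_Mapping.single ?x 1 + m)" if "m \<in> ks f" for m
      using J_mon[of "X (Suc i) * f" i] that f i x by (auto simp: X_mult_keys1)
    let ?P = "\<lambda>m. mon i m"
    have f1: "pfilter ?P f \<in> J i" using J_mon[of "pfilter ?P f" i] f i by (auto simp: keys_pfilter)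
    define f2 where "f2 = pfilter (\<lambda>m. \<not> ?P m) f"
    let ?s = "Poly_Mapping.single ?x (?q - 1)"
    have ge: "lk m ?x \<ge> ?q - 1" if "m \<in> ks f2" for m
    proof -
      have "mon i (Poly_Mapping.single ?x 1 + m)" "\<not> mon i m" using that mm by (auto simp: f2_def keys_pfilter)
      then show ?thesis by (force simp: mon_def hasX_def lookup_add lookup_single when_def split: if_splits)
    qed
    \<comment> \<open>The part of \<open>f\<close> outside the monomial ideal, divided by the power
      of the variable; \<open>ge\<close> makes the subtraction of exponents exact.\<close>
    define s where "s = (\<Sum>m\<in>ks f2. Poly_Mapping.single (m - ?s) (lk f2 m))"
    have kV2: "kV m" if "m \<in> ks f2" for m using that f by (auto simp: f2_def keys_pfilter PC_def)
    have sPC: "s \<in> PC" unfolding s_def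
    proof (intro PC_sum PC_simps)
      fix m assume "m \<in> ks f2"
      then show "kV (m - ?s)" using kV2 by (auto simp: in_keys_iff lookup_minus subset_iff)
    qed
    have "X (Suc i) ^ (?q - 1) * s = (\<Sum>m\<in>ks f2. Poly_Mapping.single (?s + (m - ?s)) (lk f2 m))"
      by (simp add: X_pow s_def sum_distrib_left mult_single)
    also have "\<dots> = (\<Sum>m\<in>ks f2. Poly_Mapping.single m (lk f2 m))"
    proof (rule sum.cong[OF refl])
      fix m assume "m \<in> ks f2"
      then have "?s + (m - ?s) = m" using ge by (intro poly_mapping_eqI) (auto simp: lookup_add lookup_minus
          lookup_single when_def)
      then show "Poly_Mapping.single (?s + (m - ?s)) (lk f2 m) = Poly_Mapping.single m (lk f2 m)" by simp
    qed
    also have "\<dots> = f2" by (rule poly_mapping_sum_single[symmetric])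
    finally have "f - X (Suc i) ^ (?q - 1) * s = pfilter ?P f"
        using pfilter_split[of ?P f] by (simp add: f2_def algebra_simps)
    then show "\<exists>s\<in>PC. f - X (Suc i) ^ (p (Suc i) - 1) * s \<in> J i" using f1 sPC by (intro bexI[of _ s]) simp_all }
  assume "\<exists>s\<in>PC. f - X (Suc i) ^ (p (Suc i) - 1) * s \<in> J i"
  then obtain s where s: "s \<in> PC" "f - X (Suc i) ^ (?q - 1) * s \<in> J i" by blast
  have "X (Suc i) * (f - X (Suc i) ^ (?q - 1) * s) \<in> J i" using s x by (intro J_mult) auto
  moreover have "g (Suc i) + l (Suc i) \<in> J i" using x l_J[OF x] i by (intro J_add) auto
  then have "X (Suc i) ^ ?q * s \<in> J i" using s by (intro J_mult_r) (auto simp: g_def)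
  moreover have "X (Suc i) ^ ?q = X (Suc i) * X (Suc i) ^ (?q - 1)" using q by (simp add: power_eq_if)
  ultimately have "X (Suc i) * (f - X (Suc i) ^ (?q - 1) * s) + X (Suc i) * X (Suc i) ^ (?q - 1) * s \<in> J i"
      by (intro J_add) auto
  then show "X (Suc i) * f \<in> J i" by (simp add: algebra_simps)
qed

text \<open>The annihilator of the generator of the kernel in \<open>colon_X\<close>: exponent
  \<open>p (Suc i) - 1 + a\<close> reaches the bound exactly if \<open>a > 0\<close>. Relative to
  \<open>z\<close> this copy of the quotient by \<open>J (Suc i)\<close> is twisted by
  \<open>p x = c\<close>.\<close>

lemma colon_Xp:
  assumes i: "e \<le> i" "Suc i \<le> n" and f: "f \<in> PC"
  shows "X (Suc i) ^ (p (Suc i) - 1) * f \<in> J i \<longleftrightarrow> f \<in> J (Suc i)"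
proof -
  have x: "Suc i \<in> {1..n}" using i by auto
  have q: "p (Suc i) \<ge> 2" by (rule p2'[OF x])
  have "mon i (Poly_Mapping.single (VarX (Suc i)) (p (Suc i) - 1) + m) \<longleftrightarrow> mon (Suc i) m" for m
  proof
    assume "mon i (Poly_Mapping.single (VarX (Suc i)) (p (Suc i) - 1) + m)"
    then show "mon (Suc i) m" using q x by (force simp: mon_def hasX_def lookup_add lookup_single when_def split: if_splits)
  next
    assume "mon (Suc i) m"
    then consider "lk m (VarX (Suc i)) \<noteq> 0" | "mon i m" by (force simp: mon_def hasX_def le_Suc_eq)
    then show "mon i (Poly_Mapping.single (VarX (Suc i)) (p (Suc i) - 1) + m)"
    proof cases
      case 1
      then have "p (Suc i) \<le> lk (Poly_Mapping.single (VarX (Suc i)) (p (Suc i) - 1) + m) (VarX (Suc i))"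
          using q by (simp add: lookup_add)
      then show ?thesis using x unfolding mon_def by blast
    next
      case 2
      then show ?thesis by (rule mon_up)
    qed
  qed
  then have "(\<forall>m\<in>ks (X (Suc i) ^ (p (Suc i) - 1) * f). mon i m) \<longleftrightarrow> (\<forall>m\<in>ks f. mon (Suc i) m)"
    unfolding Ball_def X_mult_keys by metis
  then show ?thesis using J_mon[of "X (Suc i) ^ (p (Suc i) - 1) * f" i] J_mon[of f "Suc i"] f i x by simp
qed

end

subsection \<open>Twists of the ring as column modules\<close>

locale gl_ci3 = gl_ci2 d n l p for d n and l :: "nat \<Rightarrow> 'k::field gl_poly" and p +
  assumes dn: "int n \<ge> d + 2"
begin

abbreviation R where "R \<equiv> gl_ring d n l p"
abbreviation I where "I \<equiv> interval d"

definition q :: "'k gl_poly \<Rightarrow> 'k gl_poly set" where "q f = Id +>\<^bsub>PR\<^esub> f"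
definition H where "H x y = gl_component d n l p (gl_minus n p x y)"
definition c where "c \<alpha> = q (cst \<alpha>)"

text \<open>The component of \<open>R\<close> of degree \<open>x - z\<close>.\<close>

definition Cz where "Cz z x = q ` {f. hm z x f}"

lemma R_cring: "cring R"
  unfolding gl_ring_def by (rule ideal.quotient_is_cring[OF Id_ideal PR_cring])

lemma q_hom: "q \<in> ring_hom PR R"
  unfolding q_def gl_ring_def by (rule ideal.rcos_ring_hom[OF Id_ideal])

lemma q_add: "\<lbrakk>f \<in> PC; h \<in> PC\<rbrakk> \<Longrightarrow> q f \<oplus>\<^bsub>R\<^esub> q h = q (f + h)"
  using ring_hom_add[OF q_hom, of f h] by simp
lemma q_mult: "\<lbrakk>f \<in> PC; h \<in> PC\<rbrakk> \<Longrightarrow> q f \<otimes>\<^bsub>R\<^esub> q h = q (f * h)"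
  using ring_hom_mult[OF q_hom, of f h] by simp
lemma q_one: "\<one>\<^bsub>R\<^esub> = q 1" using ring_hom_one[OF q_hom] by simp
lemma q_carrier [simp]: "f \<in> PC \<Longrightarrow> q f \<in> carrier R" using ring_hom_closed[OF q_hom, of f] by simp

lemma R_carrier: "carrier R = q ` PC"
  unfolding gl_ring_def FactRing_def A_RCOSETS_def RCOSETS_def a_r_coset_def q_def
  by (auto simp: PC_def gl_poly_ring_def)

lemma q_zero: "\<zero>\<^bsub>R\<^esub> = q 0"
proof -
  interpret R: cring R by (rule R_cring)
  have "q 0 \<oplus>\<^bsub>R\<^esub> q 0 = q 0" using q_add[of 0 0] by simp
  then show ?thesis using R.add.r_cancel_one[of "q 0" "q 0"] by simp
qed

lemma q_neg: "f \<in> PC \<Longrightarrow> \<ominus>\<^bsub>R\<^esub> q f = q (- f)"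
proof -
  assume f: "f \<in> PC"
  interpret R: cring R by (rule R_cring)
  show ?thesis by (rule R.minus_equality) (use f q_add[of "- f" f] in \<open>auto simp: q_zero\<close>)
qed

lemma q_diff: "\<lbrakk>f \<in> PC; h \<in> PC\<rbrakk> \<Longrightarrow> q f \<ominus>\<^bsub>R\<^esub> q h = q (f - h)"
  using q_add[of f "- h"] q_neg by (simp add: a_minus_def)

lemma q_eq: "\<lbrakk>f \<in> PC; h \<in> PC\<rbrakk> \<Longrightarrow> q f = q h \<longleftrightarrow> f - h \<in> J 0"
proof -
  assume f: "f \<in> PC" and h: "h \<in> PC"
  interpret R: cring R by (rule R_cring)
  interpret PR: cring PR by (rule PR_cring)
  interpret ideal Id PR by (rule Id_ideal)
  have z: "\<zero>\<^bsub>R\<^esub> = Id" by (simp add: gl_ring_def FactRing_def)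
  have "q f = q h \<longleftrightarrow> q (f - h) = \<zero>\<^bsub>R\<^esub>"
  proof
    assume "q f = q h"
    then show "q (f - h) = \<zero>\<^bsub>R\<^esub>" using q_diff[OF f h] R.r_neg[of "q h"] h by (simp add: a_minus_def)
  next
    assume 0: "q (f - h) = \<zero>\<^bsub>R\<^esub>"
    have "q f = q (f - h) \<oplus>\<^bsub>R\<^esub> q h" using q_add[of "f - h" h] f h by simp
    then show "q f = q h" using 0 h by simp
  qed
  also have "\<dots> \<longleftrightarrow> Id +>\<^bsub>PR\<^esub> (f - h) = Id" using z by (simp add: q_def)
  also have "\<dots> \<longleftrightarrow> f - h \<in> Id"
    using PR.a_coset_join1[of Id "f - h"] PR.a_coset_join2[of "f - h" Id] a_subgroup f h by auto
  finally show ?thesis by (simp add: Id_J)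
qed

lemma hm_PC: "hm z x f \<Longrightarrow> f \<in> PC" by (simp add: hm_def)

lemma hm_zero: "hm z x 0" by (simp add: hm_def)
lemma hm_add: "\<lbrakk>hm z x f; hm z x h\<rbrakk> \<Longrightarrow> hm z x (f + h)"
  using Poly_Mapping.keys_add[of f h] by (auto simp: hm_def)
lemma hm_neg: "hm z x f \<Longrightarrow> hm z x (- f)"
  by (auto simp: hm_def)

lemma kS_fd': "f \<in> PC \<Longrightarrow> m \<in> ks f \<Longrightarrow> kS (fd m)"
  using kS_fd unfolding PC_def by blast

lemma hm_cong: "\<lbrakk>kS z; kS z'; cls z = cls z'\<rbrakk> \<Longrightarrow> hm z x f \<longleftrightarrow> hm z' x f"
proof -
  assume z: "kS z" "kS z'" "cls z = cls z'"
  have "cls (fd m + z) = cls (fd m + z')" if "f \<in> PC" "m \<in> ks f" for m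
    using cls_mult[OF kS_fd'[OF that] z(1)] cls_mult[OF kS_fd'[OF that] z(2)] z(3) by simp
  then show ?thesis by (auto simp: hm_def)
qed

lemma hm_mult:
  assumes "kS y" "kS z" "hm y x f" "hm z (cls y) h"
  shows "hm z x (f * h)"
  unfolding hm_def
proof (intro conjI ballI)
  show "f * h \<in> PC" using assms hm_PC by simp
  fix m assume "m \<in> ks (f * h)"
  then obtain a b where ab: "m = a + b" "a \<in> ks f" "b \<in> ks h" using keys_mult[of f h] by blast
  have k: "kS (fd a)" "kS (fd b)" using ab assms hm_PC kS_fd' by blast+
  have "cls (fd m + z) = cls (fd a) \<otimes>\<^bsub>L\<^esub> cls (fd b + z)" using ab(1) k assms(2) by (simp add: fd_add cls_mult add.assoc)
  also have "cls (fd b + z) = cls y" using assms(4) ab by (simp add: hm_def)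
  also have "cls (fd a) \<otimes>\<^bsub>L\<^esub> cls y = x" using assms(1,3) ab k by (simp add: hm_def cls_mult)
  finally show "cls (fd m + z) = x" .
qed

lemma hm_X: "\<lbrakk>k \<in> {1..n}; kS z; hm (z + frag_cmul (int a) (frag_of (GenX k))) x f\<rbrakk> \<Longrightarrow> hm z x (X k ^ a * f)"
proof -
  assume k: "k \<in> {1..n}" and z: "kS z" and f: "hm (z + frag_cmul (int a) (frag_of (GenX k))) x f"
  show ?thesis unfolding hm_def
  proof (intro conjI ballI)
    show "X k ^ a * f \<in> PC" using hm_PC[OF f] k by simp
    fix m assume "m \<in> ks (X k ^ a * f)"
    then obtain m' where m': "m' \<in> ks f" "m = Poly_Mapping.single (VarX k) a + m'" using X_mult_keys by blast
    have eq: "fd m + z = fd m' + (z + frag_cmul (int a) (frag_of (GenX k)))" unfolding m'(2) fd_add fd_X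
        by (simp only: ac_simps)
    show "cls (fd m + z) = x" unfolding eq using f m'(1) unfolding hm_def by blast
  qed
qed

lemma I_carrier: "x \<in> I \<Longrightarrow> \<exists>f. nonneg f \<and> x = cls f"
proof -
  assume x: "x \<in> I"
  then obtain f where f: "kS f" "x = cls f" using interval_carrier L_obtain by blast
  then have "x \<in> gl_pos n p" using x pos_iff interval_iff by blast
  then show ?thesis by (rule pos_nonneg)
qed

text \<open>With a lift \<open>z\<close> of the vertex, an equation of degrees in the grading group
  becomes the condition \<open>hm\<close>, in which twists are added instead of vertices
  subtracted.\<close>

lemma H_Cz: "\<lbrakk>x \<in> I; kS z\<rbrakk> \<Longrightarrow> H x (cls z) = Cz z x"
proof -
  assume x: "x \<in> I" and z: "kS z"
  obtain f where f: "kS f" "x = cls f" using x interval_carrier L_obtain by blast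
  have "gl_degree n p m = gl_minus n p x (cls z) \<longleftrightarrow> cls (fd m + z) = x" if "kV m" for m
    using f z that kS_fd[OF that] by (simp add: gl_degree_fd gl_minus_cls cls_eq_K algebra_simps)
  then have "{f \<in> PC. \<forall>m\<in>ks f. gl_degree n p m = gl_minus n p x (cls z)} = {f. hm z x f}"
    unfolding hm_def PC_def by (intro Collect_cong) blast
  then show ?thesis by (simp add: H_def gl_component_def Cz_def q_def)
qed

lemma Cz_add: "\<lbrakk>a \<in> Cz z x; b \<in> Cz z x\<rbrakk> \<Longrightarrow> a \<oplus>\<^bsub>R\<^esub> b \<in> Cz z x"
  using hm_add hm_PC by (auto simp: Cz_def q_add)
lemma Cz_neg: "a \<in> Cz z x \<Longrightarrow> \<ominus>\<^bsub>R\<^esub> a \<in> Cz z x"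
  using hm_neg hm_PC by (auto simp: Cz_def q_neg)
lemma Cz_zero: "\<zero>\<^bsub>R\<^esub> \<in> Cz z x"
  using hm_zero by (auto simp: Cz_def q_zero)
lemma Cz_sub: "Cz z x \<subseteq> carrier R"
  using hm_PC by (auto simp: Cz_def)
lemma Cz_mult: "\<lbrakk>kS y; kS z; a \<in> Cz y x; b \<in> Cz z (cls y)\<rbrakk> \<Longrightarrow> a \<otimes>\<^bsub>R\<^esub> b \<in> Cz z x"
  using hm_mult hm_PC unfolding Cz_def by (auto simp: q_mult)

text \<open>A nonconstant monomial has positive rational degree. This gives directedness of
  \<open>A\<close> and leaves only constants on the diagonal.\<close>

lemma hm_dir:
  assumes z: "kS z" and f: "hm z x f" and m: "m \<in> ks f" "m \<noteq> 0"
  shows "ldeg (cls z) < ldeg x"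
proof -
  have kV: "kV m" using f m by (auto simp: hm_def PC_def)
  have x: "x = cls (fd m + z)" using f m by (simp add: hm_def)
  have "degq (fd m) > 0" using degq_pos[OF nonneg_fd[OF kV]] fd_eq_zero m by blast
  then show ?thesis unfolding x using z kS_fd[OF kV] by (simp add: ldeg_cls degq_add)
qed

lemma hm_const:
  assumes z: "kS z" and f: "hm z (cls z) f" shows "f = cst (lk f 0)"
proof -
  have "m = 0" if "m \<in> ks f" for m using hm_dir[OF z f that] by blast
  then show ?thesis by (intro poly_mapping_eqI) (auto simp: lookup_single when_def in_keys_iff)
qed

sublocale GM: graded_matrix R I H ldeg c
proof (intro graded_matrix.intro R_cring graded_matrix_axioms.intro)
  interpret R: cring R by (rule R_cring)
  show "finite I" by (rule interval_finite)
  fix x y assume x: "x \<in> I" and y: "y \<in> I"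
  obtain y' where y': "kS y'" "y = cls y'" using y interval_carrier L_obtain by blast
  have HC: "H x y = Cz y' x" using H_Cz[OF x y'(1)] y' by simp
  show "H x y \<subseteq> carrier R" using HC Cz_sub by simp
  show "\<zero>\<^bsub>R\<^esub> \<in> H x y" using HC Cz_zero by simp
  show "a \<oplus>\<^bsub>R\<^esub> b \<in> H x y" if "a \<in> H x y" "b \<in> H x y" for a b using that HC Cz_add by simp
  show "\<ominus>\<^bsub>R\<^esub> a \<in> H x y" if "a \<in> H x y" for a using that HC Cz_neg by simp
  show "a \<otimes>\<^bsub>R\<^esub> b \<in> H x z" if z: "z \<in> I" and ab: "a \<in> H x y" "b \<in> H y z" for z a b
  proof -
    obtain z' where z': "kS z'" "z = cls z'" using z interval_carrier L_obtain by blast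
    show ?thesis using Cz_mult[OF y'(1) z'(1), of a x b] ab HC H_Cz[OF x z'(1)] H_Cz[OF y z'(1)] y' z' by simp
  qed
  show "ldeg y < ldeg x" if xy: "x \<noteq> y" and a: "a \<in> H x y" "a \<noteq> \<zero>\<^bsub>R\<^esub>" for a
  proof -
    obtain f where f: "hm y' x f" "a = q f" using a HC by (auto simp: Cz_def)
    then have "f \<noteq> 0" using a q_zero by auto
    then obtain m where m: "m \<in> ks f" by (metis equals0I keys_eq_empty)
    have "m \<noteq> 0" using f m xy y' by (auto simp: hm_def)
    then show ?thesis using hm_dir[OF y'(1) f(1) m] y' by simp
  qed
next
  fix x assume x: "x \<in> I"
  obtain x' where x': "kS x'" "x = cls x'" using x interval_carrier L_obtain by blast
  show "H x x = range c"
  proof (intro equalityI subsetI)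
    fix a assume "a \<in> H x x"
    then obtain f where "hm x' (cls x') f" "a = q f" using H_Cz[OF x x'(1)] x' by (auto simp: Cz_def)
    then have "a = c (lk f 0)" using hm_const[OF x'(1)] by (metis c_def)
    then show "a \<in> range c" by blast
  next
    fix a assume "a \<in> range c"
    then obtain \<alpha> where a: "a = q (cst \<alpha>)" by (auto simp: c_def)
    have "hm x' x (cst \<alpha>)" using x' by (auto simp: hm_def)
    then show "a \<in> H x x" using H_Cz[OF x x'(1)] x' a by (auto simp: Cz_def)
  qed
next
  show "c (\<alpha> + \<beta>) = c \<alpha> \<oplus>\<^bsub>R\<^esub> c \<beta>" for \<alpha> \<beta> by (simp add: c_def q_add single_add)
  show "c (\<alpha> * \<beta>) = c \<alpha> \<otimes>\<^bsub>R\<^esub> c \<beta>" for \<alpha> \<beta> by (simp add: c_def q_mult mult_single)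
  show "c 1 = \<one>\<^bsub>R\<^esub>" by (simp add: c_def q_one)
  \<comment> \<open>\<open>R\<close> is nonzero because 1 is not even in \<open>J n\<close>, whose
    members have no constant term.\<close>
  have "1 \<notin> J 0" using J_n[of 1] J_mono[of 0 n] by auto
  then show "\<one>\<^bsub>R\<^esub> \<noteq> \<zero>\<^bsub>R\<^esub>" using q_eq[of 1 0] by (simp add: q_one q_zero)
qed

lemma A_eq: "GM.A = cm_canonical_algebra d n l p"
  unfolding GM.A_def by (simp add: cm_canonical_algebra_def Let_def interval_def H_def[abs_def])

lemma q_J0: "q ` J 0 = {\<zero>\<^bsub>R\<^esub>}"
proof -
  have "q f = \<zero>\<^bsub>R\<^esub>" if "f \<in> J 0" for f using q_eq[of f 0] that J_PC[OF that] q_zero by simp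
  then have "q ` J 0 \<subseteq> {\<zero>\<^bsub>R\<^esub>}" by blast
  moreover have "\<zero>\<^bsub>R\<^esub> \<in> q ` J 0" unfolding q_zero using J_zero by (rule imageI)
  ultimately show ?thesis by blast
qed

lemma Cz_colC: "kS z \<Longrightarrow> GM.colC (Cz z)"
  unfolding GM.colC_def
proof (intro ballI conjI)
  assume z: "kS z"
  fix x assume x: "x \<in> I"
  show "Cz z x \<subseteq> carrier R" "\<zero>\<^bsub>R\<^esub> \<in> Cz z x" by (rule Cz_sub, rule Cz_zero)
  show "a \<oplus>\<^bsub>R\<^esub> b \<in> Cz z x" if "a \<in> Cz z x" "b \<in> Cz z x" for a b using that by (rule Cz_add)
  show "\<ominus>\<^bsub>R\<^esub> a \<in> Cz z x" if "a \<in> Cz z x" for a using that by (rule Cz_neg)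
  show "h \<otimes>\<^bsub>R\<^esub> a \<in> Cz z x" if w: "w \<in> I" and h: "h \<in> H x w" and a: "a \<in> Cz z w" for w h a
  proof -
    obtain w' where w': "kS w'" "w = cls w'" using w interval_carrier L_obtain by blast
    show ?thesis using Cz_mult[OF w'(1) z, of h x a] H_Cz[OF x w'(1)] h a w' by simp
  qed
qed

text \<open>A monomial in the entry at \<open>x\<close> would have degree \<open>x - z\<close> and
  put the vertex \<open>x\<close> above \<open>z\<close>, against \<open>interval_down\<close>. This
  truncates the resolutions to the interval.\<close>

lemma Cz_outside: "\<lbrakk>nonneg z; cls z \<notin> I; x \<in> I\<rbrakk> \<Longrightarrow> Cz z x = {\<zero>\<^bsub>R\<^esub>}"
proof -
  assume z: "nonneg z" "cls z \<notin> I" and x: "x \<in> I"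
  have "f = 0" if f: "hm z x f" for f
  proof (rule ccontr)
    assume "f \<noteq> 0"
    then obtain m where m: "m \<in> ks f" by (metis equals0I keys_eq_empty)
    then have "kV m" "cls (fd m + z) = x" using f by (auto simp: hm_def PC_def)
    then show False using interval_down[OF nonneg_fd z(1)] x z(2) by blast
  qed
  then show ?thesis using hm_zero[of z x] by (auto simp: Cz_def q_zero)
qed

lemma col_cong: "(\<And>x. x \<in> I \<Longrightarrow> C x = C' x) \<Longrightarrow> GM.col C = GM.col C' \<and> GM.colsub C J' = GM.colsub C' J'"
  by (auto simp: GM.col_def GM.colsub_def cong: PiE_cong)

text \<open>A column at a vertex embeds into \<open>A\<close> as a matrix with only that column
  nonzero, so \<open>'m\<close> is large enough for it; outside the interval the column module is
  zero.\<close>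

lemma col_embed:
  fixes \<iota> :: "(gl_deg \<Rightarrow> gl_deg \<Rightarrow> 'k gl_poly set) \<Rightarrow> 'm"
  assumes \<iota>: "inj_on \<iota> (carrier GM.A)" and z: "nonneg z"
  shows "\<exists>\<iota>' :: _ \<Rightarrow> 'm. inj_on \<iota>' (carrier (GM.col (Cz z)))"
proof (cases "cls z \<in> I")
  case True
  have C: "GM.col (Cz z) = GM.col (\<lambda>x. H x (cls z))" using col_cong[of "Cz z" "\<lambda>x. H x (cls z)"] H_Cz z by simp
  have "inj_on (\<lambda>u. \<iota> (GM.mat (cls z) u)) (carrier (GM.col (\<lambda>x. H x (cls z))))"
  proof (rule inj_onI)
    fix u v assume u: "u \<in> carrier (GM.col (\<lambda>x. H x (cls z)))" and v: "v \<in> carrier (GM.col (\<lambda>x. H x (cls z)))"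
      and "\<iota> (GM.mat (cls z) u) = \<iota> (GM.mat (cls z) v)"
    then have "GM.mat (cls z) u = GM.mat (cls z) v" using \<iota> GM.mat_A[OF True u] GM.mat_A[OF True v] by (meson inj_onD)
    then show "u = v" using GM.mat_g0[OF True u] GM.mat_g0[OF True v] by metis
  qed
  then show ?thesis unfolding C by blast
next
  case False
  have "u = v" if "u \<in> carrier (GM.col (Cz z))" "v \<in> carrier (GM.col (Cz z))" for u v
  proof (rule GM.col_eqI[OF that])
    fix x assume x: "x \<in> I"
    have "u x \<in> Cz z x" "v x \<in> Cz z x" using that x unfolding GM.col_simps by (auto intro: PiE_mem)
    then show "u x = v x" using Cz_outside[OF z False x] by simp
  qed
  \<comment> \<open>The carrier has at most one element, so every map is injective on it.\<close>
  then show ?thesis by (intro exI[of _ undefined]) (auto simp: inj_on_def)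
qed

text \<open>
  The degrees of the tops of the \<open>h\<close>-th term of the resolution of \<open>R / J i\<close> twisted by \<open>z\<close>.
\<close>

definition Zs :: "nat \<Rightarrow> (gl_gen \<Rightarrow>\<^sub>0 int) \<Rightarrow> nat \<Rightarrow> gl_deg set" where
  "Zs i z h = {cls (z + wt j B) | j B. B \<subseteq> {1..i} \<and> 2 * j + card B = h \<and> (i \<le> e \<longrightarrow> j = 0)}"

lemma ZsI: "\<lbrakk>x = cls (z + wt j B); B \<subseteq> {1..i}; 2 * j + card B = h; i \<le> e \<longrightarrow> j = 0\<rbrakk> \<Longrightarrow> x \<in> Zs i z h"
  unfolding Zs_def by blast

lemma ZsE:
  assumes "x \<in> Zs i z h"
  obtains j B where "x = cls (z + wt j B)" "B \<subseteq> {1..i}" "2 * j + card B = h" "i \<le> e \<longrightarrow> j = 0"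
  using assms unfolding Zs_def by blast

lemma Zs_0: "Zs i z 0 = {cls z}"
proof -
  have w: "wt 0 {} = 0" by (simp add: wt_def)
  have "x = cls z" if x: "x \<in> Zs i z 0" for x
  proof -
    obtain j B where B: "x = cls (z + wt j B)" "B \<subseteq> {1..i}" "2 * j + card B = 0" using x by (rule ZsE)
    then have "B = {}" "j = 0" using finite_subset[of B "{1..i}"] by auto
    then show ?thesis using B(1) w by simp
  qed
  moreover have "cls z \<in> Zs i z 0" by (rule ZsI[where j = 0 and B = "{}"]) (simp_all add: w)
  ultimately show ?thesis by blast
qed

lemma Zs_base: "Zs 0 z (Suc k) = {}"
  by (auto simp: Zs_def)

lemma wt_insert: "\<lbrakk>finite B; i \<notin> B\<rbrakk> \<Longrightarrow> wt j (insert i B) = frag_of (GenX i) + wt j B"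
  by (simp add: wt_def algebra_simps)

lemma wt_Suc: "wt (Suc j) B = frag_of GenC + wt j B"
  by (simp add: wt_def frag_cmul_distrib algebra_simps)

text \<open>Mirrors the two cones: for \<open>j = 0\<close> either \<open>B\<close> avoids
  \<open>Suc i\<close> or one \<open>x\<close> is split off at the cost of one degree, and for
  \<open>j > 0\<close> one \<open>c\<close> is split off at the cost of two.\<close>

lemma Zs_split:
  assumes x: "x \<in> Zs (Suc i) z (Suc k)"
  shows "x \<in> Zs i z (Suc k) \<or> x \<in> Zs i (z + frag_of (GenX (Suc i))) k \<or> (e < Suc i \<and> k > 0 \<and>
      x \<in> Zs (Suc i) (z + frag_of GenC) (k - 1))"
proof -
  obtain j B where jB: "x = cls (z + wt j B)" "B \<subseteq> {1..Suc i}" "2 * j + card B = Suc k" "Suc i \<le> e \<longrightarrow> j = 0"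
    using x by (rule ZsE)
  have fB: "finite B" using jB(2) finite_subset by blast
  show ?thesis
  proof (cases j)
    case 0
    show ?thesis
    proof (cases "Suc i \<in> B")
      case True
      let ?B = "B - {Suc i}"
      have B: "B = insert (Suc i) ?B" using True by auto
      have "card B = Suc (card ?B)" by (rule card.remove[OF fB True])
      moreover have "wt j B = frag_of (GenX (Suc i)) + wt j ?B" using wt_insert[of ?B "Suc i" j] fB B by simp
      moreover have "?B \<subseteq> {1..i}" using jB(2) by (auto simp: le_Suc_eq)
      ultimately have "x \<in> Zs i (z + frag_of (GenX (Suc i))) k"
        using jB 0 by (intro ZsI[of _ _ j ?B]) (auto simp: add.assoc)
      then show ?thesis by simp
    next
      case False
      then have "B \<subseteq> {1..i}" using jB(2) by (auto simp: le_Suc_eq subset_iff)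
      then have "x \<in> Zs i z (Suc k)" using jB 0 by (intro ZsI[of _ _ j B]) auto
      then show ?thesis by simp
    qed
  next
    case (Suc j')
    then have "e < Suc i" "k > 0" using jB by auto
    moreover have "x \<in> Zs (Suc i) (z + frag_of GenC) (k - 1)"
      using jB Suc by (intro ZsI[of _ _ j' B]) (auto simp: wt_Suc add.assoc)
    ultimately show ?thesis by simp
  qed
qed

lemma Zs_sub1: "Zs i z k \<subseteq> Zs (Suc i) z k"
proof
  fix x assume "x \<in> Zs i z k"
  then obtain j B where jB: "x = cls (z + wt j B)" "B \<subseteq> {1..i}" "2 * j + card B = k" "i \<le> e \<longrightarrow> j = 0" by (rule ZsE)
  then show "x \<in> Zs (Suc i) z k" by (intro ZsI[of _ _ j B]) auto
qed

lemma Zs_sub2: "Zs i (z + frag_of (GenX (Suc i))) k \<subseteq> Zs (Suc i) z (Suc k)"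
proof
  fix x assume "x \<in> Zs i (z + frag_of (GenX (Suc i))) k"
  then obtain j B where jB: "x = cls (z + frag_of (GenX (Suc i)) + wt j B)" "B \<subseteq> {1..i}" "2 * j + card B = k"
      "i \<le> e \<longrightarrow> j = 0" by (rule ZsE)
  have fB: "finite B" "Suc i \<notin> B" using jB(2) finite_subset by auto
  then show "x \<in> Zs (Suc i) z (Suc k)" using jB
    by (intro ZsI[of _ _ j "insert (Suc i) B"]) (auto simp: wt_insert add.assoc)
qed

lemma Zs_sub3: "\<lbrakk>e < Suc i; k > 0\<rbrakk> \<Longrightarrow> Zs (Suc i) (z + frag_of GenC) (k - 1) \<subseteq> Zs (Suc i) z (Suc k)"
proof
  fix x assume i: "e < Suc i" "k > 0" and "x \<in> Zs (Suc i) (z + frag_of GenC) (k - 1)"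
  then obtain j B where jB: "x = cls (z + frag_of GenC + wt j B)" "B \<subseteq> {1..Suc i}" "2 * j + card B = k - 1" by (elim ZsE)
  then show "x \<in> Zs (Suc i) z (Suc k)" using i
    by (intro ZsI[of _ _ "Suc j" B]) (auto simp: wt_Suc add.assoc)
qed

lemma Zs_Suc1: "Suc i \<le> e \<Longrightarrow> Zs (Suc i) z (Suc k) = Zs i z (Suc k) \<union> Zs i (z + frag_of (GenX (Suc i))) k"
  using Zs_split[of _ i z k] Zs_sub1 Zs_sub2 by fastforce

text \<open>The tops for the image of multiplication by \<open>X (Suc i)\<close>, that is for the
  quotient by the colon ideal of \<open>J i\<close> and \<open>X (Suc i)\<close>, twisted by
  \<open>z\<close> plus the degree of this variable. It lies between the two cones.\<close>

definition Zm where
  "Zm i z k = Zs i (z + frag_of (GenX (Suc i))) k \<union> (if k = 0 then {} else Zs (Suc i) (z + frag_of GenC) (k - 1))"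

lemma Zs_Suc2: "e < Suc i \<Longrightarrow> Zs (Suc i) z (Suc k) = Zs i z (Suc k) \<union> Zm i z k"
  using Zs_split[of _ i z k] Zs_sub1[of i z "Suc k"] Zs_sub2[of i z k] Zs_sub3[of i k z] unfolding Zm_def by auto

lemma nonneg_gens: "nonneg (frag_of GenC)" "i \<in> {1..n} \<Longrightarrow> nonneg (frag_of (GenX i))"
  by (auto simp: nonneg_def)

text \<open>The ideals of \<open>R\<close>, pulled back to the polynomial ring. Colon ideals have to
  be covered besides the \<open>J i\<close>.\<close>

definition pid where
  "pid P \<longleftrightarrow> P \<subseteq> PC \<and> J 0 \<subseteq> P \<and> (\<forall>f\<in>P. \<forall>h\<in>P. f + h \<in> P) \<and> (\<forall>r\<in>PC. \<forall>f\<in>P. r * f \<in> P)"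

lemma pid_J: "i \<le> n \<Longrightarrow> pid (J i)"
  using J_PC J_mono[of 0 i] by (auto simp: pid_def)

lemma pid_colon: "\<lbrakk>i \<le> n; k \<in> {1..n}\<rbrakk> \<Longrightarrow> pid {f \<in> PC. X k * f \<in> J i}"
  unfolding pid_def
proof (intro conjI ballI)
  assume i: "i \<le> n" and k: "k \<in> {1..n}"
  show "J 0 \<subseteq> {f \<in> PC. X k * f \<in> J i}" using J_PC J_mono[of 0 i] i k by auto
  fix r f assume r: "r \<in> PC" and f: "f \<in> {f \<in> PC. X k * f \<in> J i}"
  then have "X k * (r * f) \<in> J i" using J_mult[of r "X k * f" i] by (simp add: ac_simps)
  then show "r * f \<in> {f \<in> PC. X k * f \<in> J i}" using r f by simp
qed (auto simp: distrib_left)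

lemma q_pid: "\<lbrakk>pid P; f \<in> PC\<rbrakk> \<Longrightarrow> q f \<in> q ` P \<longleftrightarrow> f \<in> P"
proof
  assume P: "pid P" and f: "f \<in> PC" and "q f \<in> q ` P"
  then obtain h where h: "h \<in> P" "q f = q h" by blast
  have "h \<in> PC" using P h(1) by (auto simp: pid_def)
  then have "f - h \<in> P" using q_eq[OF f, of h] P h(2) unfolding pid_def by blast
  then have "(f - h) + h \<in> P" using P h(1) unfolding pid_def by blast
  then show "f \<in> P" by simp
qed auto

lemma pid_idl: "pid P \<Longrightarrow> GM.idl (q ` P)"
  unfolding GM.idl_def
proof (intro conjI ballI)
  assume P: "pid P"
  then have sub: "P \<subseteq> PC" by (simp add: pid_def)
  show "q ` P \<subseteq> carrier R" using sub by auto
  show "\<zero>\<^bsub>R\<^esub> \<in> q ` P" using P J_zero unfolding pid_def q_zero by blast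
  show "a \<oplus>\<^bsub>R\<^esub> b \<in> q ` P" if ab: "a \<in> q ` P" "b \<in> q ` P" for a b
  proof -
    obtain f h where fh: "f \<in> P" "a = q f" "h \<in> P" "b = q h" using ab by blast
    then have "a \<oplus>\<^bsub>R\<^esub> b = q (f + h)" "f + h \<in> P" using sub P q_add[of f h] by (auto simp: pid_def)
    then show ?thesis by blast
  qed
  show "r \<otimes>\<^bsub>R\<^esub> a \<in> q ` P" if r: "r \<in> carrier R" and a: "a \<in> q ` P" for r a
  proof -
    obtain f h where fh: "f \<in> P" "a = q f" "h \<in> PC" "r = q h" using a r R_carrier by blast
    then have "r \<otimes>\<^bsub>R\<^esub> a = q (h * f)" "h * f \<in> P" using sub P q_mult[of h f] by (auto simp: pid_def)
    then show ?thesis by blast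
  qed
qed

text \<open>\<open>col_cone\<close> for multiplication by \<open>X k ^ a\<close>, with hypotheses on
  polynomials. The twist \<open>w\<close> is fixed only up to the relations of the grading group, so
  that \<open>p k x k\<close> can be replaced by \<open>c\<close>.\<close>

lemma cone_step:
  fixes \<iota> :: "(gl_deg \<Rightarrow> gl_deg \<Rightarrow> 'k gl_poly set) \<Rightarrow> 'm"
    and \<Phi> \<Phi>' \<Phi>'' :: "nat \<Rightarrow> (gl_deg \<Rightarrow> gl_deg \<Rightarrow> 'k gl_poly set, 'm) module \<Rightarrow> bool"
  assumes inf: "infinite (UNIV :: 'm set)" and \<iota>: "inj_on \<iota> (carrier GM.A)"
    and z: "nonneg z" and w: "nonneg w" "cls w = cls (z + frag_cmul (int a) (frag_of (GenX k)))" and k: "k \<in> {1..n}"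
    and P: "pid P1" "pid P3" and i: "i \<le> n"
    and j1: "\<And>f. f \<in> PC \<Longrightarrow> X k ^ a * f \<in> J i \<longleftrightarrow> f \<in> P1"
    and j3: "\<And>f. f \<in> PC \<Longrightarrow> f \<in> P3 \<longleftrightarrow> (\<exists>s\<in>PC. f - X k ^ a * s \<in> J i)"
    and r1: "GM.rs h \<Phi> (Cz w) (q ` P1)" and r2: "GM.rs (Suc h) \<Phi>' (Cz z) (q ` J i)"
    and cb: "\<And>k. comb GM.A (\<Phi>' (Suc k)) (\<Phi> k) (\<Phi>'' (Suc k))" and 0: "\<And>P. \<Phi>' 0 P \<Longrightarrow> \<Phi>'' 0 P"
  shows "GM.rs (Suc h) \<Phi>'' (Cz z) (q ` P3)"
proof -
  let ?w = "z + frag_cmul (int a) (frag_of (GenX k))"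
  have kS: "kS z" "kS w" "kS ?w" using z w k by (auto simp: nonneg_def)
  obtain \<iota>1 :: "_ \<Rightarrow> 'm" where e1: "inj_on \<iota>1 (carrier (GM.col (Cz w)))" using col_embed[OF \<iota> w(1)] by blast
  obtain \<iota>2 :: "_ \<Rightarrow> 'm" where e2: "inj_on \<iota>2 (carrier (GM.col (Cz z)))" using col_embed[OF \<iota> z] by blast
  have X: "X k ^ a \<in> PC" using k by simp
  have hw: "hm w x f \<longleftrightarrow> hm ?w x f" for x f by (rule hm_cong[OF kS(2,3) w(2)])
  show ?thesis
  proof (rule GM.col_cone[OF inf e1 e2 Cz_colC[OF kS(2)] Cz_colC[OF kS(1)] pid_idl[OF P(1)] pid_idl[OF pid_J[OF i]]
      pid_idl[OF P(2)] q_carrier[OF X] _ _ _ r1 r2 cb 0])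
    fix x b assume "b \<in> Cz w x"
    then obtain f where f: "hm ?w x f" "b = q f" "f \<in> PC" using hw hm_PC unfolding Cz_def by blast
    then have eq: "q (X k ^ a) \<otimes>\<^bsub>R\<^esub> b = q (X k ^ a * f)" using q_mult[OF X] by simp
    show "q (X k ^ a) \<otimes>\<^bsub>R\<^esub> b \<in> Cz z x" unfolding eq Cz_def using hm_X[OF k kS(1) f(1)] by blast
    show "q (X k ^ a) \<otimes>\<^bsub>R\<^esub> b \<in> q ` J i \<longleftrightarrow> b \<in> q ` P1"
      unfolding eq unfolding f(2) using q_pid[OF pid_J[OF i], of "X k ^ a * f"] q_pid[OF P(1) f(3)] j1[OF f(3)] X
          f(3) by simp
  next
    fix x v assume "v \<in> Cz z x"
    then obtain f where f: "hm z x f" "v = q f" "f \<in> PC" using hm_PC unfolding Cz_def by blast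
    have eq: "v \<ominus>\<^bsub>R\<^esub> q (X k ^ a) \<otimes>\<^bsub>R\<^esub> q s \<in> q ` J i \<longleftrightarrow> f - X k ^ a * s \<in> J i" if s: "s \<in> PC" for s
      using s X f q_mult[OF X s] q_diff[of f "X k ^ a * s"] q_pid[OF pid_J[OF i], of "f - X k ^ a * s"] by simp
    \<comment> \<open>The homogeneous component of \<open>s\<close> serves as well, since both
      \<open>f\<close> and the ideal are homogeneous.\<close>
    have hom: "\<exists>s. hm ?w x s \<and> f - X k ^ a * s \<in> J i" if s: "s \<in> PC" "f - X k ^ a * s \<in> J i" for s
    proof -
      have "pt z x (f - X k ^ a * s) = f - X k ^ a * pt ?w x s"
        unfolding pt_diff using hm_pt[OF f(1)] pt_X[OF s(1) k kS(1)] by simp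
      then show ?thesis using pt_J[OF s(2) i kS(1), of x] pt_hm[OF s(1)] by metis
    qed
    have "v \<in> q ` P3 \<longleftrightarrow> (\<exists>s\<in>PC. f - X k ^ a * s \<in> J i)" unfolding f(2) using q_pid[OF P(2) f(3)] j3[OF f(3)] by simp
    also have "\<dots> \<longleftrightarrow> (\<exists>s. hm ?w x s \<and> f - X k ^ a * s \<in> J i)" using hom hm_PC by blast
    also have "\<dots> \<longleftrightarrow> (\<exists>b\<in>Cz w x. v \<ominus>\<^bsub>R\<^esub> q (X k ^ a) \<otimes>\<^bsub>R\<^esub> b \<in> q ` J i)"
      unfolding Cz_def using eq hm_PC hw by blast
    finally show "v \<in> q ` P3 \<longleftrightarrow> (\<exists>b\<in>Cz w x. v \<ominus>\<^bsub>R\<^esub> q (X k ^ a) \<otimes>\<^bsub>R\<^esub> b \<in> q ` J i)" .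
  qed
qed

lemma rs_0: "GM.rs 0 \<Phi> C P"
  unfolding GM.rs_def coded_def by simp

lemma nonneg_add: "\<lbrakk>nonneg z; nonneg w\<rbrakk> \<Longrightarrow> nonneg (z + w)"
  using Poly_Mapping.keys_add[of z w] by (auto simp: nonneg_def lookup_add)

lemma J_Suc_iff: "\<lbrakk>Suc i \<le> n; f \<in> PC\<rbrakk> \<Longrightarrow> f \<in> J (Suc i) \<longleftrightarrow> (\<exists>s\<in>PC. f - X (Suc i) ^ 1 * s \<in> J i)"
  using J_Suc[of f i] J_SucI[of _ f i] by auto

text \<open>
  The exact sequences are
  \<open>0 \<rightarrow> V\<^sub>i (z + x\<^sub>i\<^sub>+\<^sub>1) \<rightarrow> V\<^sub>i (z) \<rightarrow> V\<^sub>i\<^sub>+\<^sub>1 (z) \<rightarrow> 0\<close> if \<open>i < e\<close> and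
  \<open>0 \<rightarrow> V\<^sub>i\<^sub>+\<^sub>1 (z + c) \<rightarrow> V\<^sub>i (z + x\<^sub>i\<^sub>+\<^sub>1) \<rightarrow> V\<^sub>i (z) \<rightarrow> V\<^sub>i\<^sub>+\<^sub>1 (z) \<rightarrow> 0\<close> otherwise. The second one is not
  recursive in \<open>i\<close> alone, but shifts \<open>V\<^sub>i\<^sub>+\<^sub>1\<close> by two homological degrees.
\<close>

lemma rs_main:
  fixes \<iota> :: "(gl_deg \<Rightarrow> gl_deg \<Rightarrow> 'k gl_poly set) \<Rightarrow> 'm"
  assumes inf: "infinite (UNIV :: 'm set)" and \<iota>: "inj_on \<iota> (carrier GM.A)" and i: "i \<le> n" and z: "nonneg z"
  shows "GM.rs h (\<lambda>k P. GM.topsP (Zs i z k) (P :: (gl_deg \<Rightarrow> gl_deg \<Rightarrow> 'k gl_poly set, 'm) module)) (Cz z) (q ` J i)"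
  using i z
proof (induction i arbitrary: z h)
  case 0
  have z: "kS z" using 0 by (simp add: nonneg_def)
  show ?case unfolding GM.rs_def
  proof (intro allI impI)
    fix Q :: "(gl_deg \<Rightarrow> gl_deg \<Rightarrow> 'k gl_poly set, 'm) module" and \<kappa>
    assume c: "coded GM.A (GM.col (Cz z)) (GM.colsub (Cz z) (q ` J 0)) Q \<kappa>"
    show "res GM.A h (\<lambda>k P. GM.topsP (Zs 0 z k) P) Q"
    proof (cases "cls z \<in> I")
      case True
      have "coded GM.A (GM.col (\<lambda>x. H x (cls z))) (GM.colsub (\<lambda>x. H x (cls z)) {\<zero>\<^bsub>R\<^esub>}) Q \<kappa>"
        using c col_cong[of "Cz z" "\<lambda>x. H x (cls z)"] H_Cz z by (simp add: q_J0)
      then have "projective_module GM.A Q \<and> GM.topsP {cls z} Q" by (rule GM.col_unit[OF True])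
      then have P: "projective_module GM.A Q" "GM.topsP (Zs 0 z 0) Q" by (simp_all only: Zs_0)
      show ?thesis by (rule res_projective, rule P(1), rule P(2), rule GM.topsP_zero) (simp_all add: Zs_base)
    next
      case False
      have "left_module GM.A Q \<and> carrier Q = {\<zero>\<^bsub>Q\<^esub>}"
        by (rule GM.col_zero[OF Cz_colC[OF z] Cz_outside[OF 0(2) False] c])
      moreover have "Zs 0 z k \<inter> I = {}" for k using False by (cases k) (auto simp: Zs_0 Zs_base)
      ultimately show ?thesis by (metis (no_types, lifting) res_zero_module GM.topsP_zero)
    qed
  qed
next
  case (Suc i)
  let ?x = "frag_of (GenX (Suc i))"
  have i: "Suc i \<in> {1..n}" "i \<le> n" "Suc i \<le> n" using Suc.prems by auto
  note IH = Suc.IH[OF i(2)]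
  have zx: "nonneg (z + ?x)" if "nonneg z" for z using that i nonneg_gens by (intro nonneg_add) auto
  have zc: "nonneg (z + frag_of GenC)" if "nonneg z" for z using that nonneg_gens by (intro nonneg_add) auto
  show ?case
  proof (cases "Suc i \<le> e")
    case True
    show ?thesis
    proof (cases h)
      case (Suc h')
      have reg: "X (Suc i) ^ 1 * f \<in> J i \<longleftrightarrow> f \<in> J i" if "f \<in> PC" for f
      proof
        assume "X (Suc i) ^ 1 * f \<in> J i"
        then show "f \<in> J i" by (intro X_regular[OF True that]) (simp only: power_one_right)
      next
        assume "f \<in> J i"
        then show "X (Suc i) ^ 1 * f \<in> J i" by (rule J_mult[OF PC_pow[OF PC_X[OF i(1)]]])
      qed
      show ?thesis unfolding Suc
        by (rule cone_step[OF inf \<iota> Suc.prems(2) zx[OF Suc.prems(2)] _ i(1) pid_J[OF i(2)] pid_J[OF i(3)] i(2) reg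
            J_Suc_iff[OF i(3)]
            IH[OF zx[OF Suc.prems(2)]] IH[OF Suc.prems(2)]])
          (auto simp: Zs_Suc1[OF True] Zs_0 intro: GM.comb_tops)
    qed (simp add: rs_0)
  next
    case False
    then have ei: "e < Suc i" "e \<le> i" by auto
    let ?JQ = "{f \<in> PC. X (Suc i) * f \<in> J i}"
    have P: "pid ?JQ" by (rule pid_colon[OF i(2,1)])
    have "p (Suc i) \<ge> 1" using p2'[OF i(1)] by linarith
    then have pS: "frag_cmul (int (p (Suc i) - 1)) ?x + ?x = frag_cmul (int (p (Suc i))) ?x"
      by (metis (no_types) frag_cmul_distrib frag_cmul_one le_add_diff_inverse2 of_nat_1 of_nat_add)
    show ?thesis using Suc.prems(2)
    \<comment> \<open>Strong induction, because the recursion lowers the number of terms by two and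
      moves \<open>z\<close> to \<open>z + c\<close>.\<close>
    proof (induction h arbitrary: z rule: less_induct)
      case (less h)
      note z = less.prems
      have kS: "kS z" using z by (simp add: nonneg_def)
      have c: "cls (z + frag_of GenC) = cls (z + ?x + frag_cmul (int (p (Suc i) - 1)) ?x)"
      proof -
        have eq: "z + ?x + frag_cmul (int (p (Suc i) - 1)) ?x = z + frag_cmul (int (p (Suc i))) ?x"
          using pS by (simp only: ac_simps)
        have "kS (frag_cmul (int (p (Suc i))) ?x)" "kS (frag_of GenC)" using i by auto
        then show ?thesis unfolding eq using kS cls_pX[OF i(1)] cls_mult by metis
      qed
      show ?case
      proof (cases h)
        case (Suc h')
        \<comment> \<open>First cone: the cokernel of \<open>X (Suc i) ^ (p (Suc i) - 1)\<close> is
          the quotient by the colon ideal \<open>?JQ\<close>. On this quotient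
          \<open>X (Suc i)\<close> is injective, and the second cone is that of
          \<open>X (Suc i)\<close>.\<close>
        have r1: "GM.rs h' (\<lambda>k P. GM.topsP (Zm i z k) (P :: (gl_deg \<Rightarrow> gl_deg \<Rightarrow> 'k gl_poly set, 'm) module)) (Cz (z
            + ?x)) (q ` ?JQ)"
        proof (cases h')
          case (Suc h'')
          have j3: "f \<in> ?JQ \<longleftrightarrow> (\<exists>s\<in>PC. f - X (Suc i) ^ (p (Suc i) - 1) * s \<in> J i)" if "f \<in> PC" for f
            using colon_X[OF ei(2) i(3) that] that by simp
          have h'': "h'' < h" using Suc \<open>h = Suc h'\<close> by simp
          show ?thesis unfolding Suc
            by (rule cone_step[OF inf \<iota> zx[OF z] zc[OF z] c i(1) pid_J[OF i(3)] P i(2) colon_Xp[OF ei(2) i(3)] j3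
                less.IH[OF h'' zc[OF z]] IH[OF zx[OF z]]])
              (auto simp: Zm_def intro: GM.comb_tops)
        qed (simp add: rs_0)
        have j1: "X (Suc i) ^ 1 * f \<in> J i \<longleftrightarrow> f \<in> ?JQ" if "f \<in> PC" for f using that by simp
        show ?thesis unfolding Suc
          by (rule cone_step[OF inf \<iota> z zx[OF z] _ i(1) P pid_J[OF i(3)] i(2) j1 J_Suc_iff[OF i(3)] r1 IH[OF z]])
            (auto simp: Zs_Suc2[OF ei(1)] Zs_0 intro: GM.comb_tops)
      qed (simp add: rs_0)
    qed
  qed
qed

section \<open>Simple modules and the global dimension\<close>

lemma simple_res:
  fixes \<iota> :: "(gl_deg \<Rightarrow> gl_deg \<Rightarrow> 'k gl_poly set) \<Rightarrow> 'm"
  assumes inf: "infinite (UNIV :: 'm set)" and \<iota>: "inj_on \<iota> (carrier GM.A)" and z: "nonneg z" and zI: "cls z \<in> I"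
  obtains Q :: "(gl_deg \<Rightarrow> gl_deg \<Rightarrow> 'k gl_poly set, 'm) module" and v0 where
    "\<And>h. res GM.A h (\<lambda>k. GM.topsP (Zs n z k)) Q" "GM.D.conc (cls z) Q" "v0 \<in> carrier Q" "v0 \<noteq> \<zero>\<^bsub>Q\<^esub>"
    "\<forall>v\<in>carrier Q. \<exists>\<alpha>. v = GM.s (cls z) \<alpha> \<odot>\<^bsub>Q\<^esub> v0"
proof -
  have kS: "kS z" using z by (simp add: nonneg_def)
  have J: "GM.idl (q ` J n)" by (rule pid_idl[OF pid_J]) simp
  obtain \<iota>' :: "_ \<Rightarrow> 'm" where "inj_on \<iota>' (carrier (GM.col (Cz z)))" using col_embed[OF \<iota> z] by blast
  then obtain Q :: "(gl_deg \<Rightarrow> gl_deg \<Rightarrow> 'k gl_poly set, 'm) module" and \<kappa>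
    where c: "coded GM.A (GM.col (Cz z)) (GM.colsub (Cz z) (q ` J n)) Q \<kappa>"
    using ex_coded[OF GM.col_left_module[OF Cz_colC[OF kS]] GM.colsub_lsub[OF Cz_colC[OF kS] J]] by blast
  have r: "res GM.A h (\<lambda>k. GM.topsP (Zs n z k)) Q" for h
    using rs_main[OF inf \<iota> order_refl z, of h] c unfolding GM.rs_def by blast
  have c': "coded GM.A (GM.col (\<lambda>x. H x (cls z))) (GM.colsub (\<lambda>x. H x (cls z)) (q ` J n)) Q \<kappa>"
    using c col_cong[of "Cz z" "\<lambda>x. H x (cls z)"] H_Cz kS by simp
  have J1: "H x (cls z) \<subseteq> q ` J n" if x: "x \<in> I" "x \<noteq> cls z" for x
  proof
    fix a assume "a \<in> H x (cls z)"
    then obtain f where f: "hm z x f" "a = q f" using H_Cz[OF x(1) kS] by (auto simp: Cz_def)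
    have "0 \<notin> ks f"
    proof
      assume "0 \<in> ks f"
      then have "cls (fd 0 + z) = x" using f(1) unfolding hm_def by blast
      then show False using x(2) by simp
    qed
    then have "f \<in> J n" using J_n[OF hm_PC[OF f(1)]] by (simp add: in_keys_iff)
    then show "a \<in> q ` J n" using f(2) by blast
  qed
  have J2: "a = \<zero>\<^bsub>R\<^esub>" if a: "a \<in> H (cls z) (cls z)" "a \<in> q ` J n" for a
  proof -
    obtain f where f: "hm z (cls z) f" "a = q f" using a H_Cz[OF zI kS] by (auto simp: Cz_def)
    have "f \<in> J n" using q_pid[OF pid_J[OF order_refl] hm_PC[OF f(1)]] a(2) f(2) by blast
    then have "lk f 0 = 0" using J_n[OF hm_PC[OF f(1)]] by blast
    then have "f = 0" using hm_const[OF kS f(1)] by simp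
    then show ?thesis using f(2) q_zero by simp
  qed
  have "GM.D.conc (cls z) Q \<and> (\<exists>v0\<in>carrier Q. v0 \<noteq> \<zero>\<^bsub>Q\<^esub> \<and> (\<forall>v\<in>carrier Q. \<exists>\<alpha>. v = GM.s (cls z) \<alpha> \<odot>\<^bsub>Q\<^esub> v0))"
    by (rule GM.col_simple[OF zI J _ _ c']) (rule J1 J2, assumption, assumption)+
  then obtain v0 where "GM.D.conc (cls z) Q" "v0 \<in> carrier Q" "v0 \<noteq> \<zero>\<^bsub>Q\<^esub>" "\<forall>v\<in>carrier Q. \<exists>\<alpha>. v = GM.s (cls z) \<alpha> \<odot>\<^bsub>Q\<^esub> v0"
    by blast
  then show thesis by (rule that[OF r])
qed

text \<open>Twisting by a nonnegative \<open>z\<close> only moves vertices upwards, so by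
  \<open>interval_down\<close> the count of \<open>wt_bound\<close> for \<open>z = 0\<close>
  applies.\<close>

lemma Zs_bound: "\<lbrakk>nonneg z; k > N d\<rbrakk> \<Longrightarrow> Zs n z k \<inter> I = {}"
proof -
  assume z: "nonneg z" and k: "k > N d"
  have False if x: "x \<in> Zs n z k" "x \<in> I" for x
  proof -
    obtain j B where B: "x = cls (z + wt j B)" "B \<subseteq> {1..n}" "2 * j + card B = k" using x(1) by (elim ZsE)
    have "cls (wt j B) \<in> I" using interval_down[OF z wt_nonneg[OF B(2)]] x(2) B(1) by blast
    then show False using wt_bound[OF B(2)] B(3) k by fastforce
  qed
  then show ?thesis by blast
qed

lemma all_res:
  fixes \<iota> :: "(gl_deg \<Rightarrow> gl_deg \<Rightarrow> 'k gl_poly set) \<Rightarrow> 'm" and M :: "(gl_deg \<Rightarrow> gl_deg \<Rightarrow> 'k gl_poly set, 'm) module"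
  assumes inf: "infinite (UNIV :: 'm set)" and \<iota>: "inj_on \<iota> (carrier GM.A)" and M: "left_module GM.A M"
  shows "res GM.A (N d + 2) (pdc (N d)) M"
proof (rule GM.D.filtration[OF inf _ M])
  fix x and M :: "(gl_deg \<Rightarrow> gl_deg \<Rightarrow> 'k gl_poly set, 'm) module" assume x: "x \<in> I" and M: "GM.D.conc x M"
  obtain z where z: "nonneg z" "x = cls z" using I_carrier[OF x] by blast
  have zI: "cls z \<in> I" using x z(2) by simp
  obtain Q :: "(gl_deg \<Rightarrow> gl_deg \<Rightarrow> 'k gl_poly set, 'm) module" and v0
    where Q: "\<And>h. res GM.A h (\<lambda>k. GM.topsP (Zs n z k)) Q" "GM.D.conc (cls z) Q" "v0 \<in> carrier Q" "v0 \<noteq> \<zero>\<^bsub>Q\<^esub>"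
    "\<forall>v\<in>carrier Q. \<exists>\<alpha>. v = GM.s (cls z) \<alpha> \<odot>\<^bsub>Q\<^esub> v0"
    using simple_res[OF inf \<iota> z(1) zI] by blast
  have "res GM.A (N d + 2) (pdc (N d)) Q"
  proof (rule res_mono[OF Q(1)])
    fix k and P :: "(gl_deg \<Rightarrow> gl_deg \<Rightarrow> 'k gl_poly set, 'm) module"
    assume P: "projective_module GM.A P" "GM.topsP (Zs n z k) P"
    show "pdc (N d) k P" unfolding pdc_def
      using GM.topsP_empty[OF projective_left_module[OF P(1)] P(2) Zs_bound[OF z(1)]] by blast
  qed
  then show "res GM.A (N d + 2) (pdc (N d)) M"
    using GM.D.conc_res[OF inf zI Q(2,3,4,5)] M z(2) by blast
qed

text \<open>Coordinates 0 and 1 are legal for weights at least 2, so \<open>j\<close> and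
  \<open>B\<close> can be read off the vertex, and with them the homological degree.\<close>

lemma top_Zs: "cls (top d) \<in> Zs n 0 k \<longleftrightarrow> k = N d"
proof
  have A: "{i \<in> {1..n}. p i \<ge> 3} \<subseteq> {1..n}" by auto
  show "k = N d" if x: "cls (top d) \<in> Zs n 0 k"
  proof -
    obtain j B where B: "cls (top d) = cls (0 + wt j B)" "B \<subseteq> {1..n}" "2 * j + card B = k" using x by (elim ZsE)
    then have "nat (int n - d - 2) = j \<and> {i \<in> {1..n}. p i \<ge> 3} = B" unfolding top_def by (intro wt_inj[OF A]) simp_all
    then show ?thesis using B(3) dn by (auto simp: N_def nat_mult_distrib)
  qed
  show "cls (top d) \<in> Zs n 0 k" if "k = N d"
    by (rule ZsI[of _ _ "nat (int n - d - 2)" "{i \<in> {1..n}. p i \<ge> 3}"])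
      (use A that dn e_int in \<open>auto simp: N_def top_def nat_mult_distrib\<close>)
qed

lemma global_dimension_A:
  assumes "module_universe TYPE('m) GM.A"
  shows "global_dimension TYPE('m) GM.A = enat (N d)"
proof (rule antisym)
  obtain \<iota> :: "(gl_deg \<Rightarrow> gl_deg \<Rightarrow> 'k gl_poly set) \<Rightarrow> 'm" where inf: "infinite (UNIV :: 'm set)" and \<iota>: "inj_on \<iota>
      (carrier GM.A)"
    using assms unfolding module_universe_def by blast
  show "global_dimension TYPE('m) GM.A \<le> enat (N d)"
    unfolding global_dimension_def
  proof (rule SUP_least)
    fix M :: "(gl_deg \<Rightarrow> gl_deg \<Rightarrow> 'k gl_poly set, 'm) module" assume "M \<in> {M. left_module GM.A M}"
    then have "\<exists>Q D. projective_resolution GM.A M (N d) Q D"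
      using res_pdc_projective_resolution[OF all_res[OF inf \<iota>]] by blast
    then show "projective_dimension GM.A M \<le> enat (N d)"
      unfolding projective_dimension_def by (intro INF_lower) simp
  qed
  have z: "nonneg (0 :: gl_gen \<Rightarrow>\<^sub>0 int)" by (simp add: nonneg_def)
  obtain Q :: "(gl_deg \<Rightarrow> gl_deg \<Rightarrow> 'k gl_poly set, 'm) module" and v0
    where Q: "\<And>h. res GM.A h (\<lambda>k. GM.topsP (Zs n 0 k)) Q" "GM.D.conc (cls 0) Q"
    by (rule simple_res[OF inf \<iota> z interval_zero[OF dn]]) (rule that, assumption+)
  let ?t = "cls (top d)"
  have t: "?t \<in> I" by (rule top_interval[OF dn])
  \<comment> \<open>One equivalence serves the degree \<open>N d\<close> and both of its neighbours
    in \<open>resolution_length_ge\<close>.\<close>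
  have tops: "notop (GM.e ?t) (GM.D.B ?t) P \<longleftrightarrow> k \<noteq> N d" if "GM.topsP (Zs n 0 k) P"
    for k and P :: "(gl_deg \<Rightarrow> gl_deg \<Rightarrow> 'k gl_poly set, 'm) module"
    using that t top_Zs unfolding GM.topsP_def by blast
  have "enat (N d) \<le> projective_dimension GM.A Q"
    unfolding projective_dimension_def
  proof (rule INF_greatest)
    fix m assume "m \<in> {m. \<exists>P D. projective_resolution GM.A Q m P D}"
    then obtain P D where P: "projective_resolution GM.A Q m P D" by blast
    have "N d \<le> m"
      by (rule resolution_length_ge[OF Q(1) P GM.D.B_sub[of ?t] GM.D.e_closed[OF t] GM.D.e_idem[OF t] GM.D.B_left[OF t]])
        (use tops in auto)
    then show "enat (N d) \<le> enat m" by simp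
  qed
  also have "\<dots> \<le> global_dimension TYPE('m) GM.A"
    unfolding global_dimension_def using res_left_module[OF Q(1)] by (intro SUP_upper) simp
  finally show "enat (N d) \<le> global_dimension TYPE('m) GM.A" .
qed

lemma A_nonzero: "carrier GM.A \<noteq> {\<zero>\<^bsub>GM.A\<^esub>}"
proof
  assume 0: "carrier GM.A = {\<zero>\<^bsub>GM.A\<^esub>}"
  have "\<one>\<^bsub>GM.A\<^esub> (cls 0) (cls 0) = \<zero>\<^bsub>GM.A\<^esub> (cls 0) (cls 0)" using 0 GM.D.one_closed by simp
  then show False using interval_zero[OF dn] GM.nontrivial by simp
qed

end

theorem theorem0p3:
  fixes d :: int and n :: nat
    and l :: "nat \<Rightarrow> 'k::field gl_poly" and p :: "nat \<Rightarrow> nat"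
  assumes "gl_complete_intersection d n l p"
    and "\<And>i. i \<in> {1..n} \<Longrightarrow> p i \<ge> 2"
  shows "(carrier (cm_canonical_algebra d n l p) = {\<zero>\<^bsub>cm_canonical_algebra d n l p\<^esub>}
            \<longleftrightarrow> int n \<le> d + 1) \<and>
         (int n \<ge> d + 2 \<longrightarrow> module_universe TYPE('m) (cm_canonical_algebra d n l p) \<longrightarrow>
           global_dimension TYPE('m) (cm_canonical_algebra d n l p)
             = enat (nat (2 * (int n - d - 2)) + card {i \<in> {1..n}. p i \<ge> 3}))"
proof (cases "int n \<ge> d + 2")
  case True
  have ci: "gl_ci d n l p" by (intro gl_ci.intro gl_ci_axioms.intro assms)
  interpret gl_ci3 d n l p
    by (intro gl_ci3.intro gl_ci2.intro ci gl_ci2_axioms.intro gl_ci3_axioms.intro True)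
      (use True in \<open>simp add: gl_ci.e_def[OF ci]\<close>)
  show ?thesis using True A_nonzero global_dimension_A[where ?'m = 'm] unfolding A_eq N_def by auto
next
  case False
  interpret gl_ci d n l p by (intro gl_ci.intro gl_ci_axioms.intro assms)
  \<comment> \<open>An empty index set leaves a single matrix, everywhere \<open>undefined\<close>,
    which is also the zero.\<close>
  have "gl_interval n p \<one>\<^bsub>L\<^esub> (gl_delta d n p) = {}"
    using interval_empty[of d] False by (simp add: interval_def)
  then show ?thesis using False by (simp add: cm_canonical_algebra_def Let_def restrict_def)
qed

end
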